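(* Suppose Assumption A2 (given in the context) holds, and let $\Pi_h:L^2(\Omega)\to V_h$ be the interpolation operator defined in the context. There is a constant $C$ (independent of $v$, $h$, $T$ and the position of $\Omega$ relative to the mesh) such that for every $T\in\mathcal T_h$, $m\in\{0,1\}$ and $v\in H^{k+1}(\Omega)$ $$\|v-\Pi_hv\|_{H^m(T)}\le C h^{k+1-m}\|v^E\|_{H^{k+1}(B_{\delta,T})},$$ where $B_{\delta,T}$ is a suitable ball containing $\mathcal T_h(T)\cup\mathcal T_h(S_h(T))$ with radius $\delta\sim h$ (for $T\in\mathcal T_h^L$ the set $\mathcal T_h(S_h(T))$ is omitted), $\mathcal T_h(T')$ is the set of elements of $\mathcal T_h$ that share a node with $T'$, and on $T$ the function $v$ is identified with its extension $v^E$.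
   Context: Mesh and spaces. $\mathcal T_{h,0}$, $h\in(0,h_0]$, is a family of quasiuniform (in particular shape regular) meshes of closed simplices with mesh parameter $h$ on a closed polygonal domain $\Omega_0\subset\mathbb R^d$, and $V_{h,0}=\{v\in C^0(\Omega_0): v|_T\in\mathbb P_k(T)\ \forall T\in\mathcal T_{h,0}\}$, where $\mathbb P_k$ denotes polynomials of degree at most $k$, $k\ge1$. $\Omega\subset\Omega_0$ is a given closed domain, $\mathcal T_h=\{T\in\mathcal T_{h,0}:T\cap\Omega\ne\emptyset\}$, $\Omega_h=\bigcup_{T\in\mathcal T_h}T$, and $V_h=V_{h,0}|_{\Omega_h}$. $\{\varphi_i\}_{i\in I}$ is the standard (nodal) finite element basis of $V_h$, and for $T\in\mathcal T_h$ with $T\subset\mathrm{supp}(\varphi_i)$, $\varphi_{i,T}^*$ are the element degrees of freedom (dual to the element basis); by conformity the value on $V_h$ does not depend on $T$, and one also writes $\varphi_i^*$. For $p\in\mathbb P_k(\mathbb R^d)$, $\varphi_{i,T}^*(p)$ means $\varphi_{i,T}^*(p|_T)$. For a polynomial $p$ on an element, $p^e\in\mathbb P_k(\mathbb R^d)$ is its canonical extension. Large and small elements. For a fixed $\gamma\in(0,1]$, $\mathcal T_h^L=\{T\in\mathcal T_h:|T\cap\Omega|\ge\gamma|T|\}$ and $\mathcal T_h^S=\mathcal T_h\setminus\mathcal T_h^L$. $S_h:\mathcal T_h^S\to\mathcal T_h^L$ is a given map. $I^S\subset I$ is the set of indices $i$ such that $\mathrm{supp}(\varphi_i)$ contains no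 element of $\mathcal T_h^L$, and $I^L=I\setminus I^S$. For $i\in I^S$, $T_i\subset\mathrm{supp}(\varphi_i)$ is a chosen element (necessarily in $\mathcal T_h^S$); for $i\in I^L$, $T_i\in\mathcal T_h^L$ is a chosen large element in $\mathrm{supp}(\varphi_i)$. Assumption A2: for each $T\in\mathcal T_h^S$ there is a path of face-neighboring elements of $\mathcal T_h$ (consecutive elements share a face) starting in $T$, ending in $S_h(T)$, of uniformly bounded length. Interpolation. $E:H^s(\Omega)\ni v\mapsto v^E\in H^s(\mathbb R^d)$ is a universal (Stein) extension operator, $\|v^E\|_{H^s(\mathbb R^d)}\le C\|v\|_{H^s(\Omega)}$, $s\ge0$ ($\Omega$ is assumed regular enough for it to exist). $P_T:L^2(T)\to\mathbb P_k(T)$ is the $L^2$ projection. $\pi_hv=\sum_{i\in I}\varphi_i^*(P_{T_i'}(v^E|_{T_i'}))\varphi_i$ for $v\in L^2(\Omega)$, where $T_i'\in\mathcal T_h$ is a chosen element in the support of $\varphi_i$. The operator $\widetilde\Pi_h:V_h\to V_h$ is $$\widetilde\Pi_hv=\sum_{i\in I^S}\varphi_{i,T_i}^*\big((v|_{S_h(T_i)})^e\big)\varphi_i+\sum_{i\in I^L}\varphi_{i,T_i}^*(v)\varphi_i,$$ and $\Pi_hv=\widetilde\Pi_h\pi_hv$ for $v\in L^2(\Omega)$. *)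

theory Defs
  imports "HOL-Analysis.Analysis"
begin

section \<open>Multi-indices, polynomials, test functions\<close>

text \<open>A multi-index on the ambient space is a function supported on the standard basis.\<close>

definition mi_order :: "('a::euclidean_space \<Rightarrow> nat) \<Rightarrow> nat" where
  "mi_order \<alpha> = (\<Sum>b\<in>Basis. \<alpha> b)"

definition multi_indices :: "nat \<Rightarrow> ('a::euclidean_space \<Rightarrow> nat) set" where
  "multi_indices m = {\<alpha>. (\<forall>b. b \<notin> Basis \<longrightarrow> \<alpha> b = 0) \<and> mi_order \<alpha> \<le> m}"

definition poly_space :: "nat \<Rightarrow> ('a::euclidean_space \<Rightarrow> real) set" where
  "poly_space k = {p. \<exists>c. \<forall>x. p x = (\<Sum>\<alpha>\<in>multi_indices k. c \<alpha> * (\<Prod>b\<in>Basis. (x \<bullet> b) ^ \<alpha> b))}"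

definition partial_deriv :: "'a::euclidean_space \<Rightarrow> ('a \<Rightarrow> real) \<Rightarrow> 'a \<Rightarrow> real" where
  "partial_deriv b f x = frechet_derivative f (at x) b"

primrec C_diff :: "nat \<Rightarrow> ('a::euclidean_space \<Rightarrow> real) \<Rightarrow> bool" where
  "C_diff 0 f \<longleftrightarrow> continuous_on UNIV f"
| "C_diff (Suc n) f \<longleftrightarrow> f differentiable_on UNIV \<and> (\<forall>b\<in>Basis. C_diff n (partial_deriv b f))"

definition test_functions :: "'a::euclidean_space set \<Rightarrow> ('a \<Rightarrow> real) set" where
  "test_functions U = {\<phi>. (\<forall>n. C_diff n \<phi>) \<and>
     compact (closure {x. \<phi> x \<noteq> 0}) \<and> closure {x. \<phi> x \<noteq> 0} \<subseteq> U}"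

text \<open>The enumeration of the basis only fixes the order of differentiation; on smooth functions,
  to which \<open>multi_deriv\<close> is applied, the order is immaterial.\<close>

definition basis_list :: "'a::euclidean_space list" where
  "basis_list = (SOME bs. distinct bs \<and> set bs = Basis)"

definition multi_deriv :: "('a::euclidean_space \<Rightarrow> nat) \<Rightarrow> ('a \<Rightarrow> real) \<Rightarrow> 'a \<Rightarrow> real" where
  "multi_deriv \<alpha> f = fold (\<lambda>b. partial_deriv b ^^ \<alpha> b) basis_list f"


section \<open>Sobolev spaces on open sets\<close>

text \<open>Elements are functions, not classes modulo null sets. For a closed domain or closed simplex
  \<open>S\<close>, the space \<open>H\<^sup>m(S)\<close> is \<open>sobolev_space m (interior S)\<close>.\<close>

definition L2_space :: "'a::euclidean_space set \<Rightarrow> ('a \<Rightarrow> real) set" where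
  "L2_space U = {f. set_borel_measurable lebesgue U f \<and> set_integrable lebesgue U (\<lambda>x. (f x)\<^sup>2)}"

definition locally_integrable :: "'a::euclidean_space set \<Rightarrow> ('a \<Rightarrow> real) \<Rightarrow> bool" where
  "locally_integrable U f \<longleftrightarrow> (\<forall>K. compact K \<and> K \<subseteq> U \<longrightarrow> set_integrable lebesgue K f)"

definition is_weak_deriv ::
    "('a::euclidean_space \<Rightarrow> nat) \<Rightarrow> 'a set \<Rightarrow> ('a \<Rightarrow> real) \<Rightarrow> ('a \<Rightarrow> real) \<Rightarrow> bool" where
  "is_weak_deriv \<alpha> U f g \<longleftrightarrow> locally_integrable U f \<and> locally_integrable U g \<and>
     (\<forall>\<phi>\<in>test_functions U.
        (LINT x:U|lebesgue. f x * multi_deriv \<alpha> \<phi> x) =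
        (-1) ^ mi_order \<alpha> * (LINT x:U|lebesgue. g x * \<phi> x))"

definition weak_deriv :: "('a::euclidean_space \<Rightarrow> nat) \<Rightarrow> 'a set \<Rightarrow> ('a \<Rightarrow> real) \<Rightarrow> 'a \<Rightarrow> real" where
  "weak_deriv \<alpha> U f = (SOME g. is_weak_deriv \<alpha> U f g)"

definition sobolev_space :: "nat \<Rightarrow> 'a::euclidean_space set \<Rightarrow> ('a \<Rightarrow> real) set" where
  "sobolev_space m U = {f \<in> L2_space U.
     \<forall>\<alpha>\<in>multi_indices m. \<exists>g\<in>L2_space U. is_weak_deriv \<alpha> U f g}"

text \<open>Meaningful for members of \<open>sobolev_space m U\<close> only.\<close>

definition sobolev_norm :: "nat \<Rightarrow> 'a::euclidean_space set \<Rightarrow> ('a \<Rightarrow> real) \<Rightarrow> real" where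
  "sobolev_norm m U f = sqrt (\<Sum>\<alpha>\<in>multi_indices m. LINT x:U|lebesgue. (weak_deriv \<alpha> U f x)\<^sup>2)"

text \<open>\<open>H\<^sup>s\<close> for real \<open>s \<ge> 0\<close>, with the Sobolev--Slobodeckij norm for fractional \<open>s\<close>. For integer
  \<open>s\<close> these are the space and the norm above, as the two lemmas confirm.\<close>

definition slobodeckij_sq :: "real \<Rightarrow> 'a::euclidean_space set \<Rightarrow> ('a \<Rightarrow> real) \<Rightarrow> ennreal" where
  "slobodeckij_sq \<sigma> U g = (\<integral>\<^sup>+x\<in>U. (\<integral>\<^sup>+y\<in>U.
      ennreal ((g x - g y)\<^sup>2 / norm (x - y) powr (real DIM('a) + 2 * \<sigma>)) \<partial>lebesgue) \<partial>lebesgue)"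

definition Hs_space :: "real \<Rightarrow> 'a::euclidean_space set \<Rightarrow> ('a \<Rightarrow> real) set" where
  "Hs_space s U = {f \<in> sobolev_space (nat \<lfloor>s\<rfloor>) U. frac s > 0 \<longrightarrow>
     (\<forall>\<alpha>\<in>multi_indices (nat \<lfloor>s\<rfloor>). mi_order \<alpha> = nat \<lfloor>s\<rfloor> \<longrightarrow>
        slobodeckij_sq (frac s) U (weak_deriv \<alpha> U f) < \<infinity>)}"

definition Hs_norm :: "real \<Rightarrow> 'a::euclidean_space set \<Rightarrow> ('a \<Rightarrow> real) \<Rightarrow> real" where
  "Hs_norm s U f = sqrt ((sobolev_norm (nat \<lfloor>s\<rfloor>) U f)\<^sup>2 +
     (if frac s > 0
      then \<Sum>\<alpha>\<in>{\<alpha>\<in>multi_indices (nat \<lfloor>s\<rfloor>). mi_order \<alpha> = nat \<lfloor>s\<rfloor>}.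
             enn2real (slobodeckij_sq (frac s) U (weak_deriv \<alpha> U f))
      else 0))"

lemma Hs_space_of_nat: "Hs_space (real m) U = sobolev_space m U"
  by (simp add: Hs_space_def)

lemma Hs_norm_of_nat: "Hs_norm (real m) U f = sobolev_norm m U f"
proof -
  have "0 \<le> (LINT x:U|lebesgue. (weak_deriv \<alpha> U f x)\<^sup>2)" for \<alpha>
    unfolding set_lebesgue_integral_def by (rule integral_nonneg_AE) auto
  then have "0 \<le> sobolev_norm m U f"
    unfolding sobolev_norm_def by (intro real_sqrt_ge_zero sum_nonneg) auto
  then show ?thesis
    by (simp add: Hs_norm_def)
qed


section \<open>Domains, extension operators and meshes\<close>

definition closed_domain :: "'a::euclidean_space set \<Rightarrow> bool" where
  "closed_domain S \<longleftrightarrow> S \<noteq> {} \<and> S = closure (interior S) \<and> connected (interior S)"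

text \<open>One linear operator, defined on \<open>L\<^sup>2\<close>, is bounded on the whole scale \<open>H\<^sup>s\<close>, \<open>s \<ge> 0\<close>.
  The existence of such an operator is the regularity assumed of \<open>\<Omega>\<close>.\<close>

definition universal_extension ::
    "'a::euclidean_space set \<Rightarrow> (('a \<Rightarrow> real) \<Rightarrow> 'a \<Rightarrow> real) \<Rightarrow> bool" where
  "universal_extension \<Omega> E \<longleftrightarrow>
     (\<forall>v\<in>L2_space (interior \<Omega>). AE x in lebesgue. x \<in> interior \<Omega> \<longrightarrow> E v x = v x) \<and>
     (\<forall>v\<in>L2_space (interior \<Omega>). \<forall>w\<in>L2_space (interior \<Omega>). \<forall>a b.
        AE x in lebesgue. E (\<lambda>y. a * v y + b * w y) x = a * E v x + b * E w x) \<and>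
     (\<forall>s\<ge>0. \<exists>C. \<forall>v\<in>Hs_space s (interior \<Omega>).
        E v \<in> Hs_space s UNIV \<and> Hs_norm s UNIV (E v) \<le> C * Hs_norm s (interior \<Omega>) v)"

definition inradius :: "'a::euclidean_space set \<Rightarrow> real" where
  "inradius T = Sup {r. \<exists>x. cball x r \<subseteq> T}"

text \<open>Conforming meshes of \<open>\<Omega>\<^sub>0\<close> (a triangulation is finite, and any two of its simplices meet in a
  common face), consisting of nondegenerate closed simplices. The parameter \<open>h\<close> bounds the
  diameters; the constants \<open>\<kappa>\<close> (shape regularity) and \<open>q\<close> (quasiuniformity) do not depend on it.\<close>

definition quasiuniform_meshes ::
    "'a::euclidean_space set \<Rightarrow> real \<Rightarrow> (real \<Rightarrow> 'a set set) \<Rightarrow> bool" where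
  "quasiuniform_meshes \<Omega>\<^sub>0 h\<^sub>0 \<T>\<^sub>0 \<longleftrightarrow>
     (\<forall>h\<in>{0<..h\<^sub>0}. triangulation (\<T>\<^sub>0 h) \<and> (\<forall>T\<in>\<T>\<^sub>0 h. int DIM('a) simplex T) \<and> \<Union>(\<T>\<^sub>0 h) = \<Omega>\<^sub>0) \<and>
     (\<exists>\<kappa> q. \<forall>h\<in>{0<..h\<^sub>0}. \<forall>T\<in>\<T>\<^sub>0 h.
        diameter T \<le> h \<and> h \<le> q * diameter T \<and> diameter T \<le> \<kappa> * inradius T)"

definition active_mesh :: "'a::euclidean_space set set \<Rightarrow> 'a set \<Rightarrow> 'a set set" where
  "active_mesh \<T> \<Omega> = {T\<in>\<T>. T \<inter> \<Omega> \<noteq> {}}"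

definition large_elements :: "real \<Rightarrow> 'a::euclidean_space set set \<Rightarrow> 'a set \<Rightarrow> 'a set set" where
  "large_elements \<gamma> \<T> \<Omega> =
     {T\<in>active_mesh \<T> \<Omega>. measure lebesgue (T \<inter> \<Omega>) \<ge> \<gamma> * measure lebesgue T}"

definition small_elements :: "real \<Rightarrow> 'a::euclidean_space set set \<Rightarrow> 'a set \<Rightarrow> 'a set set" where
  "small_elements \<gamma> \<T> \<Omega> = active_mesh \<T> \<Omega> - large_elements \<gamma> \<T> \<Omega>"

definition face_neighbors :: "'a::euclidean_space set \<Rightarrow> 'a set \<Rightarrow> bool" where
  "face_neighbors T T' \<longleftrightarrow> T \<noteq> T' \<and> (\<exists>F. F facet_of T \<and> F facet_of T')"

text \<open>Each small element is joined to its image under \<open>S\<close> by a face-to-face path of at most \<open>N\<close>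
  elements.\<close>

definition path_assumption ::
    "nat \<Rightarrow> real \<Rightarrow> 'a::euclidean_space set set \<Rightarrow> 'a set \<Rightarrow> ('a set \<Rightarrow> 'a set) \<Rightarrow> bool" where
  "path_assumption N \<gamma> \<T> \<Omega> S \<longleftrightarrow>
     (\<forall>T\<in>small_elements \<gamma> \<T> \<Omega>. \<exists>Ts. Ts \<noteq> [] \<and> set Ts \<subseteq> active_mesh \<T> \<Omega> \<and>
        hd Ts = T \<and> last Ts = S T \<and> length Ts \<le> N \<and> successively face_neighbors Ts)"


section \<open>Lagrange finite elements\<close>

definition lagrange_nodes :: "nat \<Rightarrow> 'a::euclidean_space set \<Rightarrow> 'a set" where
  "lagrange_nodes k T = {(\<Sum>v\<in>{v. v extreme_point_of T}. (real (m v) / real k) *\<^sub>R v) |m.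
     (\<Sum>v\<in>{v. v extreme_point_of T}. m v) = k}"

definition fe_space0 :: "nat \<Rightarrow> 'a::euclidean_space set set \<Rightarrow> ('a \<Rightarrow> real) set" where
  "fe_space0 k \<T> = {v. continuous_on (\<Union>\<T>) v \<and> (\<forall>T\<in>\<T>. \<exists>p\<in>poly_space k. \<forall>x\<in>T. v x = p x)}"

text \<open>The restriction of \<open>fe_space0 k \<T>\<close> to \<open>\<Union>(active_mesh \<T> \<Omega>)\<close>; a function on that set is
  represented by its extension by zero. This makes \<open>fe_basis\<close> below unique as a total function.\<close>

definition fe_space :: "nat \<Rightarrow> 'a::euclidean_space set set \<Rightarrow> 'a set \<Rightarrow> ('a \<Rightarrow> real) set" where
  "fe_space k \<T> \<Omega> = (\<lambda>v x. if x \<in> \<Union>(active_mesh \<T> \<Omega>) then v x else 0) ` fe_space0 k \<T>"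

text \<open>The nodes themselves serve as the index set of the nodal basis.\<close>

definition fe_nodes :: "nat \<Rightarrow> 'a::euclidean_space set set \<Rightarrow> 'a set \<Rightarrow> 'a set" where
  "fe_nodes k \<T> \<Omega> = (\<Union>T\<in>active_mesh \<T> \<Omega>. lagrange_nodes k T)"

definition fe_basis :: "nat \<Rightarrow> 'a::euclidean_space set set \<Rightarrow> 'a set \<Rightarrow> 'a \<Rightarrow> 'a \<Rightarrow> real" where
  "fe_basis k \<T> \<Omega> i = (THE \<phi>. \<phi> \<in> fe_space k \<T> \<Omega> \<and>
     (\<forall>j\<in>fe_nodes k \<T> \<Omega>. \<phi> j = (if j = i then 1 else 0)))"

definition fe_supp :: "nat \<Rightarrow> 'a::euclidean_space set set \<Rightarrow> 'a set \<Rightarrow> 'a \<Rightarrow> 'a set" where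
  "fe_supp k \<T> \<Omega> i = closure {x. fe_basis k \<T> \<Omega> i x \<noteq> 0}"

text \<open>The functional on \<open>\<P>\<^sub>k(T)\<close> dual to the element basis: the coefficient of the basis function
  with index \<open>i\<close> in the expansion of \<open>f\<close> on \<open>T\<close>.\<close>

definition elem_dof ::
    "nat \<Rightarrow> 'a::euclidean_space set set \<Rightarrow> 'a set \<Rightarrow> 'a \<Rightarrow> 'a set \<Rightarrow> ('a \<Rightarrow> real) \<Rightarrow> real" where
  "elem_dof k \<T> \<Omega> i T f = (THE c. \<exists>a. a i = c \<and>
     (\<forall>x\<in>T. f x = (\<Sum>j\<in>lagrange_nodes k T. a j * fe_basis k \<T> \<Omega> j x)))"

definition poly_ext :: "nat \<Rightarrow> 'a::euclidean_space set \<Rightarrow> ('a \<Rightarrow> real) \<Rightarrow> 'a \<Rightarrow> real" where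
  "poly_ext k T f = (THE p. p \<in> poly_space k \<and> (\<forall>x\<in>T. p x = f x))"

definition L2_proj :: "nat \<Rightarrow> 'a::euclidean_space set \<Rightarrow> ('a \<Rightarrow> real) \<Rightarrow> 'a \<Rightarrow> real" where
  "L2_proj k T w = (THE p. p \<in> poly_space k \<and>
     (\<forall>r\<in>poly_space k. (LINT x:T|lebesgue. (w x - p x) * r x) = 0))"

definition small_nodes :: "nat \<Rightarrow> real \<Rightarrow> 'a::euclidean_space set set \<Rightarrow> 'a set \<Rightarrow> 'a set" where
  "small_nodes k \<gamma> \<T> \<Omega> =
     {i\<in>fe_nodes k \<T> \<Omega>. \<not> (\<exists>T\<in>large_elements \<gamma> \<T> \<Omega>. T \<subseteq> fe_supp k \<T> \<Omega> i)}"

definition large_nodes :: "nat \<Rightarrow> real \<Rightarrow> 'a::euclidean_space set set \<Rightarrow> 'a set \<Rightarrow> 'a set" where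
  "large_nodes k \<gamma> \<T> \<Omega> = fe_nodes k \<T> \<Omega> - small_nodes k \<gamma> \<T> \<Omega>"

definition node_patch ::
    "nat \<Rightarrow> 'a::euclidean_space set set \<Rightarrow> 'a set \<Rightarrow> 'a set \<Rightarrow> 'a set set" where
  "node_patch k \<T> \<Omega> T =
     {T'\<in>active_mesh \<T> \<Omega>. lagrange_nodes k T' \<inter> lagrange_nodes k T \<noteq> {}}"


section \<open>The interpolation operator\<close>

text \<open>\<open>elem\<close> is the choice of \<open>T\<^sub>i\<close> and \<open>elem'\<close> the choice of \<open>T\<^sub>i'\<close>.\<close>

definition valid_choices ::
    "nat \<Rightarrow> real \<Rightarrow> 'a::euclidean_space set set \<Rightarrow> 'a set \<Rightarrow>
     ('a \<Rightarrow> 'a set) \<Rightarrow> ('a \<Rightarrow> 'a set) \<Rightarrow> bool" where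
  "valid_choices k \<gamma> \<T> \<Omega> elem elem' \<longleftrightarrow>
     (\<forall>i\<in>small_nodes k \<gamma> \<T> \<Omega>. elem i \<in> active_mesh \<T> \<Omega> \<and> elem i \<subseteq> fe_supp k \<T> \<Omega> i) \<and>
     (\<forall>i\<in>large_nodes k \<gamma> \<T> \<Omega>. elem i \<in> large_elements \<gamma> \<T> \<Omega> \<and> elem i \<subseteq> fe_supp k \<T> \<Omega> i) \<and>
     (\<forall>i\<in>fe_nodes k \<T> \<Omega>. elem' i \<in> active_mesh \<T> \<Omega> \<and> elem' i \<subseteq> fe_supp k \<T> \<Omega> i)"

definition pi_interp ::
    "nat \<Rightarrow> 'a::euclidean_space set set \<Rightarrow> 'a set \<Rightarrow> (('a \<Rightarrow> real) \<Rightarrow> 'a \<Rightarrow> real) \<Rightarrow>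
     ('a \<Rightarrow> 'a set) \<Rightarrow> ('a \<Rightarrow> real) \<Rightarrow> 'a \<Rightarrow> real" where
  "pi_interp k \<T> \<Omega> E elem' v = (\<lambda>x. \<Sum>i\<in>fe_nodes k \<T> \<Omega>.
     elem_dof k \<T> \<Omega> i (elem' i) (L2_proj k (elem' i) (E v)) * fe_basis k \<T> \<Omega> i x)"

definition Pi_tilde ::
    "nat \<Rightarrow> real \<Rightarrow> 'a::euclidean_space set set \<Rightarrow> 'a set \<Rightarrow> ('a set \<Rightarrow> 'a set) \<Rightarrow>
     ('a \<Rightarrow> 'a set) \<Rightarrow> ('a \<Rightarrow> real) \<Rightarrow> 'a \<Rightarrow> real" where
  "Pi_tilde k \<gamma> \<T> \<Omega> S elem v = (\<lambda>x.
     (\<Sum>i\<in>small_nodes k \<gamma> \<T> \<Omega>.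
        elem_dof k \<T> \<Omega> i (elem i) (poly_ext k (S (elem i)) v) * fe_basis k \<T> \<Omega> i x) +
     (\<Sum>i\<in>large_nodes k \<gamma> \<T> \<Omega>.
        elem_dof k \<T> \<Omega> i (elem i) v * fe_basis k \<T> \<Omega> i x))"

definition Pi_interp ::
    "nat \<Rightarrow> real \<Rightarrow> 'a::euclidean_space set set \<Rightarrow> 'a set \<Rightarrow> (('a \<Rightarrow> real) \<Rightarrow> 'a \<Rightarrow> real) \<Rightarrow>
     ('a set \<Rightarrow> 'a set) \<Rightarrow> ('a \<Rightarrow> 'a set) \<Rightarrow> ('a \<Rightarrow> 'a set) \<Rightarrow>
     ('a \<Rightarrow> real) \<Rightarrow> 'a \<Rightarrow> real" where
  "Pi_interp k \<gamma> \<T> \<Omega> E S elem elem' v =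
     Pi_tilde k \<gamma> \<T> \<Omega> S elem (pi_interp k \<T> \<Omega> E elem' v)"

end

theory Submission
  imports Defs
begin

text \<open>Let \<open>w\<close> be the extension of \<open>v\<close>. All elements that enter the definition of the interpolant on \<open>T\<close> lie in
  a ball \<open>B\<close> of radius \<open>(N + 10) h\<close> about a point of \<open>T\<close>. By the Bramble--Hilbert lemma there is a polynomial \<open>p\<close> of
  degree at most \<open>k\<close> with \<open>\<parallel>w - p\<parallel> \<le> C h\<^sup>k\<^sup>+\<^sup>1 \<parallel>w\<parallel>\<close> on \<open>B\<close>, and likewise for the gradients with one power of \<open>h\<close>
  less. The interpolation operator reproduces \<open>p\<close>, and each nodal value of the interpolant of \<open>w - p\<close> is at most
  \<open>C h\<^sup>-\<^sup>d\<^sup>/\<^sup>2\<close> times the \<open>L\<^sup>2\<close> norm of \<open>w - p\<close> on \<open>B\<close>: the \<open>L\<^sup>2\<close> projections are contractions, and on polynomials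
  of fixed degree the values and derivatives at distance \<open>O(h)\<close> of a ball of radius proportional to \<open>h\<close> are
  controlled by the \<open>L\<^sup>2\<close> norm on that ball.

  The Bramble--Hilbert lemma is obtained from the top degree downwards by subtracting polynomials, which only needs
  the Poincare inequality \<open>\<parallel>u - c\<parallel> \<le> C \<delta> \<parallel>\<nabla>u\<parallel>\<close> on a ball for functions with a weak gradient. No mollification
  is involved: pairing \<open>u\<close> with a translated test function and using the mean value theorem and \<open>L\<^sup>2\<close> duality gives
  \<open>\<parallel>u(\<cdot> + t) - u\<parallel> \<le> |t| \<parallel>\<nabla>u\<parallel>\<close>; integrating the square over \<open>t\<close> yields a point \<open>x\<close> such that \<open>c = u(x)\<close> will do.\<close>


section \<open>Square-integrable functions\<close>

text \<open>No reference simplex occurs. Estimates for polynomials are moved to the unit ball by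
  translation and dilation, so an element enters only through its diameter and an inscribed ball of
  radius \<open>\<rho> * h\<close>; and a Lagrange function, written in barycentric coordinates, is
  bounded on its simplex by \<open>k ^ k\<close> whatever the shape. The constants therefore depend
  on the dimension, \<open>k\<close>, \<open>N\<close>, \<open>\<rho>\<close> and, because the norm
  for \<open>m = 1\<close> contains the L2 part, on \<open>h\<^sub>0\<close>. The finite element
  basis, the degrees of freedom, the canonical extension and the projection are definite
  descriptions, and weak derivatives are picked by \<open>SOME\<close>. Each has to be identified
  before it can be estimated: by unisolvence of the Lagrange nodes, by orthogonality, and by
  approximation with test functions respectively. Weak derivatives are tested with mixed derivatives
  in the fixed order of \<open>basis_list\<close>. Symmetry of second derivatives turns a weak
  derivative of higher order into an iterated first order one, so that the Bramble--Hilbert argument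
  sees first order derivatives only.\<close>

definition sqint :: "'a::euclidean_space set \<Rightarrow> ('a \<Rightarrow> real) \<Rightarrow> real" where
  "sqint U f = (LINT x:U|lebesgue. (f x)\<^sup>2)"

lemma sqint_nonneg: "0 \<le> sqint U f"
  unfolding sqint_def set_lebesgue_integral_def by (rule integral_nonneg_AE) auto

lemma L2_spaceD:
  assumes "f \<in> L2_space U"
  shows "(\<lambda>x. indicator U x * f x) \<in> borel_measurable lebesgue"
    and "set_integrable lebesgue U (\<lambda>x. (f x)\<^sup>2)"
  using assms by (auto simp: L2_space_def set_borel_measurable_def)

lemma L2_mult_integrable:
  assumes "f \<in> L2_space U" "g \<in> L2_space U"
  shows "set_integrable lebesgue U (\<lambda>x. f x * g x)"
proof -
  have m: "(\<lambda>x. indicator U x *\<^sub>R (f x * g x)) \<in> borel_measurable lebesgue"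
  proof -
    have "(\<lambda>x. (indicator U x * f x) * (indicator U x * g x)) \<in> borel_measurable lebesgue"
      using L2_spaceD(1)[OF assms(1)] L2_spaceD(1)[OF assms(2)] by (rule borel_measurable_times)
    also have "(\<lambda>x. (indicator U x * f x) * (indicator U x * g x)) = (\<lambda>x. indicator U x *\<^sub>R (f x * g x))"
      by (auto simp: indicator_def)
    finally show ?thesis .
  qed
  have "integrable lebesgue (\<lambda>x. indicator U x *\<^sub>R ((f x)\<^sup>2 + (g x)\<^sup>2))"
    using set_integral_add(1)[OF L2_spaceD(2)[OF assms(1)] L2_spaceD(2)[OF assms(2)]]
    by (simp add: set_integrable_def)
  then show ?thesis unfolding set_integrable_def
  proof (rule Bochner_Integration.integrable_bound[OF _ m], intro AE_I2)
    fix x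
    have "\<bar>f x * g x\<bar> \<le> (f x)\<^sup>2 + (g x)\<^sup>2"
      using sum_squares_bound[of "\<bar>f x\<bar>" "\<bar>g x\<bar>"] mult_nonneg_nonneg[of "\<bar>f x\<bar>" "\<bar>g x\<bar>"]
      unfolding abs_mult power2_abs by linarith
    then show "norm (indicator U x *\<^sub>R (f x * g x)) \<le> norm (indicator U x *\<^sub>R ((f x)\<^sup>2 + (g x)\<^sup>2))"
      by (auto simp: indicator_def)
  qed
qed

text \<open>The expansion comes along with membership because it is the quadratic form in
  \<open>a\<close> and \<open>b\<close> from which Cauchy--Schwarz and the parallelogram estimate
  below are read off.\<close>

lemma L2_space_lincomb:
  assumes "f \<in> L2_space U" "g \<in> L2_space U"
  shows "(\<lambda>x. a * f x + b * g x) \<in> L2_space U"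
    and "sqint U (\<lambda>x. a * f x + b * g x) =
      a\<^sup>2 * sqint U f + 2 * a * b * (LINT x:U|lebesgue. f x * g x) + b\<^sup>2 * sqint U g"
proof -
  note m1 = L2_spaceD(1)[OF assms(1)] and m2 = L2_spaceD(1)[OF assms(2)]
  have "(\<lambda>x. a * (indicator U x * f x) + b * (indicator U x * g x)) \<in> borel_measurable lebesgue"
    by (intro borel_measurable_add borel_measurable_times m1 m2 borel_measurable_const)
  also have "(\<lambda>x. a * (indicator U x * f x) + b * (indicator U x * g x)) = 
     (\<lambda>x. indicator U x *\<^sub>R (a * f x + b * g x))"
    by (auto simp: indicator_def)
  finally have m: "set_borel_measurable lebesgue U (\<lambda>x. a * f x + b * g x)"
    by (simp add: set_borel_measurable_def)
  have eq: "(\<lambda>x. (a * f x + b * g x)\<^sup>2) = (\<lambda>x. (a\<^sup>2 * (f x)\<^sup>2 + 2 * a * b * (f x * g x)) + b\<^sup>2 * (g x)\<^sup>2)"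
    by (auto simp: power2_eq_square algebra_simps)
  note i1 = L2_spaceD(2)[OF assms(1)] and i2 = L2_spaceD(2)[OF assms(2)] and i3 = L2_mult_integrable[OF assms]
  have j1: "set_integrable lebesgue U (\<lambda>x. a\<^sup>2 * (f x)\<^sup>2)" 
    and j2: "set_integrable lebesgue U (\<lambda>x. 2 * a * b * (f x * g x))"
    and j3: "set_integrable lebesgue U (\<lambda>x. b\<^sup>2 * (g x)\<^sup>2)"
    using i1 i2 i3 by auto
  have j12: "set_integrable lebesgue U (\<lambda>x. a\<^sup>2 * (f x)\<^sup>2 + 2 * a * b * (f x * g x))"
    by (rule set_integral_add(1)[OF j1 j2])
  show "(\<lambda>x. a * f x + b * g x) \<in> L2_space U"
    unfolding L2_space_def eq[symmetric] using m set_integral_add(1)[OF j12 j3] by (auto simp: eq)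
  show "sqint U (\<lambda>x. a * f x + b * g x) =
      a\<^sup>2 * sqint U f + 2 * a * b * (LINT x:U|lebesgue. f x * g x) + b\<^sup>2 * sqint U g"
    unfolding sqint_def eq set_integral_add(2)[OF j12 j3] set_integral_add(2)[OF j1 j2] by simp
qed

lemma L2_space_add: "f \<in> L2_space U \<Longrightarrow> g \<in> L2_space U \<Longrightarrow> (\<lambda>x. f x + g x) \<in> L2_space U"
  using L2_space_lincomb(1)[of f U g 1 1] by simp

lemma L2_space_diff: "f \<in> L2_space U \<Longrightarrow> g \<in> L2_space U \<Longrightarrow> (\<lambda>x. f x - g x) \<in> L2_space U"
  using L2_space_lincomb(1)[of f U g 1 "-1"] by simp

lemma L2_space_cmult: "f \<in> L2_space U \<Longrightarrow> (\<lambda>x. a * f x) \<in> L2_space U"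
  using L2_space_lincomb(1)[of f U f a 0] by simp

lemma L2_space_zero: "(\<lambda>x. 0) \<in> L2_space U"
  by (simp add: L2_space_def set_borel_measurable_def set_integrable_def)

lemma L2_space_sum: "(\<And>i. i \<in> I \<Longrightarrow> f i \<in> L2_space U) \<Longrightarrow> (\<lambda>x. \<Sum>i\<in>I. f i x) \<in> L2_space U"
  by (induction I rule: infinite_finite_induct) (auto intro: L2_space_add L2_space_zero)

text \<open>A nonnegative quadratic form has nonpositive discriminant. The case of vanishing
  \<open>?D\<close> is separate, since there the form is linear in \<open>b\<close> and its
  coefficient has to be zero.\<close>

lemma L2_Cauchy_Schwarz:
  assumes "f \<in> L2_space U" "g \<in> L2_space U"
  shows "(LINT x:U|lebesgue. f x * g x)\<^sup>2 \<le> sqint U f * sqint U g"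
proof -
  let ?A = "sqint U f" and ?B = "LINT x:U|lebesgue. f x * g x" and ?D = "sqint U g"
  have nn: "0 \<le> a\<^sup>2 * ?A + 2 * a * b * ?B + b\<^sup>2 * ?D" for a b
    using sqint_nonneg[of U "\<lambda>x. a * f x + b * g x"] L2_space_lincomb(2)[OF assms] by simp
  show ?thesis
  proof (cases "?D = 0")
    case True
    have "?B = 0"
    proof (rule ccontr)
      assume B: "?B \<noteq> 0"
      \<comment> \<open>With \<open>?D = 0\<close> this choice of \<open>b\<close> gives the form
        the value \<open>-1\<close>.\<close>
      have "0 \<le> 1\<^sup>2 * ?A + 2 * 1 * (-(?A + 1) / (2 * ?B)) * ?B + (-(?A + 1) / (2 * ?B))\<^sup>2 * ?D"
        by (rule nn)
      then show False using True B by (simp add: field_simps)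
    qed
    then show ?thesis using True by simp
  next
    case False
    then have D: "?D > 0" using sqint_nonneg[of U g] by linarith
    \<comment> \<open>The minimiser \<open>a = ?D\<close>, \<open>b = - ?B\<close>, scaled so that
      no division occurs.\<close>
    have "0 \<le> ?D\<^sup>2 * ?A + 2 * ?D * (-?B) * ?B + (-?B)\<^sup>2 * ?D" by (rule nn)
    also have "\<dots> = ?D * (?A * ?D - ?B\<^sup>2)" by (simp add: power2_eq_square algebra_simps)
    finally show ?thesis using D by (simp add: zero_le_mult_iff)
  qed
qed

text \<open>The parallelogram identity with the square of the sum discarded.\<close>

lemma sqint_diff_le:
  assumes "f \<in> L2_space U" "g \<in> L2_space U"
  shows "sqint U (\<lambda>x. f x - g x) \<le> 2 * sqint U f + 2 * sqint U g"
  using L2_space_lincomb(2)[OF assms, of 1 1] L2_space_lincomb(2)[OF assms, of 1 "-1"]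
    sqint_nonneg[of U "\<lambda>x. 1 * f x + 1 * g x"] by simp

lemma L2_space_subset:
  assumes "f \<in> L2_space U" "V \<subseteq> U" "V \<in> sets lebesgue"
  shows "f \<in> L2_space V" "sqint V f \<le> sqint U f"
proof -
  have i: "set_integrable lebesgue V (\<lambda>x. (f x)\<^sup>2)"
    by (rule set_integrable_subset[OF L2_spaceD(2)[OF assms(1)] assms(3,2)])
  have "(\<lambda>x. indicator V x * (indicator U x * f x)) \<in> borel_measurable lebesgue"
    by (intro borel_measurable_times borel_measurable_indicator assms L2_spaceD(1))
  also have "(\<lambda>x. indicator V x * (indicator U x * f x)) = (\<lambda>x. indicator V x *\<^sub>R f x)"
    using assms(2) by (intro ext) (auto simp: indicator_def)
  finally show "f \<in> L2_space V" using i by (simp add: L2_space_def set_borel_measurable_def)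
  show "sqint V f \<le> sqint U f"
    unfolding sqint_def set_lebesgue_integral_def
    by (rule integral_mono)
       (use i L2_spaceD(2)[OF assms(1)] assms(2) in \<open>auto simp: set_integrable_def indicator_def\<close>)
qed

text \<open>Measurability of \<open>g\<close> is inherited from \<open>f\<close> because Lebesgue
  measure is complete. This makes the change of representatives below free of side
  conditions.\<close>

lemma L2_space_AE_cong:
  assumes "f \<in> L2_space U" "AE x in lebesgue. x \<in> U \<longrightarrow> g x = f x"
  shows "g \<in> L2_space U" "sqint U g = sqint U f"
proof -
  have m: "(\<lambda>x. indicator U x *\<^sub>R g x) \<in> borel_measurable lebesgue"
    by (rule borel_measurable_AE[OF L2_spaceD(1)[OF assms(1)]])
       (use assms(2) in \<open>eventually_elim, auto simp: indicator_def\<close>)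
  have ae: "AE x in lebesgue. indicator U x *\<^sub>R (g x)\<^sup>2 = indicator U x *\<^sub>R (f x)\<^sup>2"
    using assms(2) by eventually_elim (auto simp: indicator_def)
  have m2: "(\<lambda>x. indicator U x *\<^sub>R (g x)\<^sup>2) \<in> borel_measurable lebesgue"
    by (rule borel_measurable_AE[of "\<lambda>x. indicator U x *\<^sub>R (f x)\<^sup>2"])
       (use L2_spaceD(2)[OF assms(1)] ae in \<open>auto simp: set_integrable_def\<close>)
  have m3: "(\<lambda>x. indicator U x *\<^sub>R (f x)\<^sup>2) \<in> borel_measurable lebesgue"
    using L2_spaceD(2)[OF assms(1)] by (auto simp: set_integrable_def)
  have "set_integrable lebesgue U (\<lambda>x. (g x)\<^sup>2)"
    using L2_spaceD(2)[OF assms(1)] ae m2 m3 unfolding set_integrable_def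
    by (subst integrable_cong_AE[of _ _ "\<lambda>x. indicator U x *\<^sub>R (f x)\<^sup>2"]) auto
  then show "g \<in> L2_space U" using m by (simp add: L2_space_def set_borel_measurable_def)
  show "sqint U g = sqint U f"
    unfolding sqint_def set_lebesgue_integral_def using m2 m3 ae by (intro integral_cong_AE) auto
qed

lemma L2_space_cong_on:
  assumes "f \<in> L2_space U" "\<And>x. x \<in> U \<Longrightarrow> g x = f x"
  shows "g \<in> L2_space U" "sqint U g = sqint U f"
  using L2_space_AE_cong[of f U g] assms by auto

lemma bounded_imp_L2_space:
  assumes "f \<in> borel_measurable lebesgue" "U \<in> lmeasurable" "\<And>x. x \<in> U \<Longrightarrow> \<bar>f x\<bar> \<le> M"
  shows "f \<in> L2_space U" "sqint U f \<le> M\<^sup>2 * measure lebesgue U"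
proof -
  have U: "U \<in> sets lebesgue" using assms(2) by auto
  have m: "(\<lambda>x. indicator U x *\<^sub>R (f x)\<^sup>2) \<in> borel_measurable lebesgue"
    by (intro borel_measurable_scaleR borel_measurable_indicator borel_measurable_power assms U)
  have iM: "integrable lebesgue (\<lambda>x. indicator U x *\<^sub>R M\<^sup>2)"
    using assms(2) by (auto intro!: integrable_scaleR_left integrable_real_indicator simp: fmeasurable_def)
  have le: "(f x)\<^sup>2 \<le> M\<^sup>2" if "x \<in> U" for x
    using power_mono[OF assms(3)[OF that] abs_ge_zero, of 2] by simp
  have i: "integrable lebesgue (\<lambda>x. indicator U x *\<^sub>R (f x)\<^sup>2)"
    by (rule Bochner_Integration.integrable_bound[OF iM m]) (use le in \<open>auto simp: indicator_def\<close>)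
  have "(\<lambda>x. indicator U x *\<^sub>R f x) \<in> borel_measurable lebesgue"
    by (intro borel_measurable_scaleR borel_measurable_indicator assms U)
  with i show "f \<in> L2_space U" by (simp add: L2_space_def set_borel_measurable_def set_integrable_def)
  have "sqint U f \<le> (LINT x|lebesgue. indicator U x *\<^sub>R M\<^sup>2)"
    unfolding sqint_def set_lebesgue_integral_def
    by (rule integral_mono[OF i iM]) (use le in \<open>auto simp: indicator_def\<close>)
  also have "\<dots> = M\<^sup>2 * measure lebesgue U" using assms(2) by simp
  finally show "sqint U f \<le> M\<^sup>2 * measure lebesgue U" .
qed

lemma continuous_imp_measurable_lebesgue:
  fixes f :: "'a::euclidean_space \<Rightarrow> real"
  assumes "continuous_on UNIV f"
  shows "f \<in> borel_measurable lebesgue"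
  using borel_measurable_continuous_onI[OF assms] by (simp add: measurable_completion)

lemma continuous_imp_L2_space:
  fixes f :: "'a::euclidean_space \<Rightarrow> real"
  assumes "continuous_on UNIV f" "bounded U" "U \<in> sets lebesgue"
  shows "f \<in> L2_space U"
proof -
  have "compact (f ` closure U)"
    using assms(1,2) by (intro compact_continuous_image) (auto intro: continuous_on_subset)
  then obtain M where M: "\<And>x. x \<in> U \<Longrightarrow> \<bar>f x\<bar> \<le> M"
    using closure_subset[of U] by (auto dest!: compact_imp_bounded simp: bounded_iff) blast
  have "U \<in> lmeasurable" using assms bounded_set_imp_lmeasurable by blast
  then show ?thesis
    using bounded_imp_L2_space(1)[OF continuous_imp_measurable_lebesgue[OF assms(1)] _ M] by blast
qed

text \<open>The product with the constant 1, which is square-integrable on a bounded set.\<close>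

lemma L2_set_integrable:
  assumes "f \<in> L2_space U" "bounded U" "U \<in> sets lebesgue"
  shows "set_integrable lebesgue U f"
  using L2_mult_integrable[OF assms(1) continuous_imp_L2_space[of "\<lambda>_. 1", OF _ assms(2,3)]] by simp

lemma L2_imp_locally_integrable:
  assumes "f \<in> L2_space U"
  shows "locally_integrable U f"
  unfolding locally_integrable_def
proof safe
  fix K assume "compact K" "K \<subseteq> U"
  moreover have "K \<in> sets lebesgue" using \<open>compact K\<close> by (simp add: borel_compact)
  ultimately show "set_integrable lebesgue K f"
    by (intro L2_set_integrable L2_space_subset(1)[OF assms]) (auto simp: compact_imp_bounded)
qed


section \<open>Smooth functions and test functions\<close>

text \<open>The functions \<open>t \<mapsto> exp (-1/t) / t ^ n\<close>, extended by zero to \<open>t \<le> 0\<close>, span a space that is closed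
  under differentiation, which makes smoothness of everything below a formality.\<close>

definition bump :: "nat \<Rightarrow> real \<Rightarrow> real" where
  "bump n t = (if t > 0 then exp (- inverse t) / t ^ n else 0)"

text \<open>Away from 0 this is the quotient rule, transferred to the piecewise function by
  locality. At 0 the left difference quotient vanishes and the right one is handled by the decay of
  the exponential.\<close>

lemma bump_deriv: "(bump n has_real_derivative (bump (n + 2) t - real n * bump (n + 1) t)) (at t)"
proof (cases t "0 :: real" rule: linorder_cases)
  case less
  have "((\<lambda>_. 0) has_real_derivative 0) (at t)" by simp
  then show ?thesis
    by (rule DERIV_cong_ev[THEN iffD1, rotated -1, OF _ refl])
       (use less in \<open>auto simp: bump_def intro!: eventually_mono[OF eventually_nhds_in_open[of "{..<0}"]]\<close>)
next
  case greater
  have "((\<lambda>t. exp (- inverse t) / t ^ n) has_real_derivative (bump (n + 2) t - real n * bump (n + 1) t)) (at t)"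
  proof -
    have "real n * t ^ (n - 1) = real n * t ^ n / t" using greater by (cases n) auto
    with DERIV_pow[of n t UNIV] have "((\<lambda>t. t ^ n) has_real_derivative real n * t ^ n / t) (at t)"
      by (simp only: One_nat_def)
    moreover have "((\<lambda>t. exp (- inverse t)) has_real_derivative exp (- inverse t) / t\<^sup>2) (at t)"
      using greater by (auto intro!: derivative_eq_intros simp: field_simps power2_eq_square)
    ultimately have "((\<lambda>t. exp (- inverse t) / t ^ n) has_real_derivative
       (exp (- inverse t) / t\<^sup>2 * t ^ n - exp (- inverse t) * (real n * t ^ n / t)) / (t ^ n * t ^ n)) (at t)"
      using greater by (intro DERIV_divide) auto
    also have "(exp (- inverse t) / t\<^sup>2 * t ^ n - exp (- inverse t) * (real n * t ^ n / t)) / (t ^ n * t ^ n) =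
       bump (n + 2) t - real n * bump (n + 1) t"
      using greater by (simp add: bump_def field_simps power_add power2_eq_square)
    finally show ?thesis .
  qed
  then show ?thesis
    by (rule DERIV_cong_ev[THEN iffD1, rotated -1, OF _ refl])
       (use greater in \<open>auto simp: bump_def intro!: eventually_mono[OF eventually_nhds_in_open[of "{0<..}"]]\<close>)
next
  case equal
  \<comment> \<open>Under \<open>s = inverse h\<close> this is the difference quotient of
    \<open>bump n\<close> at 0 from the right.\<close>
  have "((\<lambda>s::real. s ^ (n + 1) / exp s) \<longlongrightarrow> 0) at_top"
    by (rule tendsto_power_div_exp_0)
  then have "((\<lambda>h::real. (inverse h) ^ (n + 1) / exp (inverse h)) \<longlongrightarrow> 0) (at_right 0)"
    by (rule filterlim_compose[OF _ filterlim_inverse_at_top_right])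
  then have r: "((\<lambda>h. bump n h / h) \<longlongrightarrow> 0) (at_right 0)"
  proof (rule Lim_transform_eventually)
    show "\<forall>\<^sub>F h in at_right (0::real). (inverse h) ^ (n + 1) / exp (inverse h) = bump n h / h"
      by (rule eventually_mono[OF eventually_at_right_less])
         (auto simp: bump_def field_simps exp_minus)
  qed
  have l: "((\<lambda>h. bump n h / h) \<longlongrightarrow> 0) (at_left 0)"
    by (rule Lim_transform_eventually[OF tendsto_const])
       (auto simp: bump_def eventually_at_filter)
  from l r have "((\<lambda>h. bump n h / h) \<longlongrightarrow> 0) (at 0)"
    by (simp add: filterlim_split_at)
  then show ?thesis unfolding equal by (simp add: DERIV_def bump_def)
qed

lemma bump_0_bounds: "0 \<le> bump 0 t" "bump 0 t \<le> 1"
  by (auto simp: bump_def)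

text \<open>\<open>C_diff\<close> is defined by recursion on the order, which makes closure
  properties tedious to establish for concrete functions. A syntactic class that is closed under
  partial derivatives gives all orders at once; it contains the polynomials and the cut-off
  functions built from \<open>bump\<close>.\<close>

inductive smooth :: "('a::euclidean_space \<Rightarrow> real) \<Rightarrow> bool" where
  linear: "bounded_linear f \<Longrightarrow> smooth f"
| const: "smooth (\<lambda>x. c)"
| add: "smooth f \<Longrightarrow> smooth g \<Longrightarrow> smooth (\<lambda>x. f x + g x)"
| mult: "smooth f \<Longrightarrow> smooth g \<Longrightarrow> smooth (\<lambda>x. f x * g x)"
| bump: "smooth f \<Longrightarrow> smooth (\<lambda>x. bump n (f x))"

lemma partial_derivI: "(f has_derivative f') (at x) \<Longrightarrow> partial_deriv b f x = f' b"
  unfolding partial_deriv_def using frechet_derivative_at by metis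

lemma smooth_cmult: "smooth f \<Longrightarrow> smooth (\<lambda>x. c * f x)"
  by (intro smooth.mult smooth.const)

lemma smooth_diff: "smooth f \<Longrightarrow> smooth g \<Longrightarrow> smooth (\<lambda>x. f x - g x)"
  using smooth.add[OF _ smooth_cmult[of g "-1"]] by simp

lemma smooth_sum: "(\<And>i. i \<in> I \<Longrightarrow> smooth (f i)) \<Longrightarrow> smooth (\<lambda>x. \<Sum>i\<in>I. f i x)"
  by (induction I rule: infinite_finite_induct) (auto intro: smooth.add smooth.const)

lemma smooth_prod: "(\<And>i. i \<in> I \<Longrightarrow> smooth (f i)) \<Longrightarrow> smooth (\<lambda>x. \<Prod>i\<in>I. f i x)"
  by (induction I rule: infinite_finite_induct) (auto intro: smooth.mult smooth.const)

lemma smooth_power: "smooth f \<Longrightarrow> smooth (\<lambda>x. f x ^ n)"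
  by (induction n) (auto intro: smooth.mult smooth.const)

lemma smooth_inner: "smooth (\<lambda>x. x \<bullet> b)"
  by (intro smooth.linear bounded_linear_inner_left)

text \<open>Differentiability and closure are proved together, since the formulas for the derivative
  of a sum, product or composition need the former. In the last case \<open>bump_deriv\<close> keeps
  the derivative of \<open>bump n\<close> within the family.\<close>

lemma smooth_deriv:
  assumes "smooth f"
  shows "(\<forall>x. f differentiable (at x)) \<and> (\<forall>b. smooth (partial_deriv b f))"
  using assms
proof induction
  case (linear f)
  then have "(f has_derivative f) (at x)" for x by (rule bounded_linear_imp_has_derivative)
  moreover from this have "partial_deriv b f = (\<lambda>x. f b)" for b
    by (intro ext partial_derivI)
  ultimately show ?case by (auto simp: differentiable_def smooth.const)
next
  case (const c)
  have "partial_deriv b (\<lambda>x. c) = (\<lambda>x. 0)" for b :: 'a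
    by (rule ext) (rule partial_derivI[OF has_derivative_const])
  then show ?case by (auto intro: smooth.const)
next
  case (add f g)
  then have d: "(f has_derivative frechet_derivative f (at x)) (at x)"
    "(g has_derivative frechet_derivative g (at x)) (at x)" for x
    by (auto simp: frechet_derivative_works)
  have "partial_deriv b (\<lambda>x. f x + g x) = (\<lambda>x. partial_deriv b f x + partial_deriv b g x)" for b
    using partial_derivI[OF has_derivative_add[OF d]] by (auto simp: partial_deriv_def)
  then show ?case using add by (auto intro: smooth.add)
next
  case (mult f g)
  then have d: "(f has_derivative frechet_derivative f (at x)) (at x)"
    "(g has_derivative frechet_derivative g (at x)) (at x)" for x
    by (auto simp: frechet_derivative_works)
  have "partial_deriv b (\<lambda>x. f x * g x) = (\<lambda>x. f x * partial_deriv b g x + partial_deriv b f x * g x)" for b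
    using partial_derivI[OF has_derivative_mult[OF d]] by (auto simp: partial_deriv_def)
  then show ?case using mult by (auto intro!: smooth.add smooth.mult)
next
  case (bump f n)
  let ?D = "\<lambda>t. bump (n + 2) t - real n * bump (n + 1) t"
  from bump have "(f has_derivative frechet_derivative f (at x)) (at x)" for x
    by (auto simp: frechet_derivative_works)
  then have d: "((\<lambda>x. bump n (f x)) has_derivative (\<lambda>h. frechet_derivative f (at x) h * ?D (f x))) (at x)" for x
    using has_derivative_compose[OF _ bump_deriv[unfolded has_field_derivative_def], of f _ x UNIV]
    by (simp add: mult.commute)
  have "partial_deriv b (\<lambda>x. bump n (f x)) = (\<lambda>x. partial_deriv b f x * ?D (f x))" for b
    using partial_derivI[OF d] by (auto simp: partial_deriv_def)
  then show ?case using bump d 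
    by (auto intro!: smooth.mult smooth_diff smooth_cmult smooth.bump simp: differentiable_def simp del: of_nat_Suc)
qed

lemma smooth_C_diff: "smooth f \<Longrightarrow> C_diff n f"
proof (induction n arbitrary: f)
  case 0
  then show ?case using smooth_deriv[OF 0]
    by (auto intro!: differentiable_imp_continuous_on simp: differentiable_on_def)
next
  case (Suc n)
  then show ?case using smooth_deriv[OF Suc.prems] by (auto simp: differentiable_on_def)
qed

lemma smooth_continuous: "smooth f \<Longrightarrow> continuous_on UNIV f"
  using smooth_C_diff[of f 0] by simp

section \<open>Test functions\<close>

lemma test_functionsI:
  assumes "smooth \<phi>" "compact K" "K \<subseteq> U" "\<And>x. x \<notin> K \<Longrightarrow> \<phi> x = 0"
  shows "\<phi> \<in> test_functions U"
proof -
  have "closure {x. \<phi> x \<noteq> 0} \<subseteq> K"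
    using assms by (intro closure_minimal) (auto simp: compact_imp_closed)
  moreover from this have "compact (closure {x. \<phi> x \<noteq> 0})"
    using compact_Int_closed[OF assms(2), of "closure {x. \<phi> x \<noteq> 0}"] by (simp add: Int_absorb1)
  ultimately show ?thesis using assms smooth_C_diff by (auto simp: test_functions_def)
qed

lemma test_functions_zero: "\<phi> \<in> test_functions U \<Longrightarrow> x \<notin> U \<Longrightarrow> \<phi> x = 0"
  using closure_subset[of "{x. \<phi> x \<noteq> 0}"] by (auto simp: test_functions_def)

lemma test_functions_mono: "\<phi> \<in> test_functions V \<Longrightarrow> V \<subseteq> U \<Longrightarrow> \<phi> \<in> test_functions U"
  by (auto simp: test_functions_def)

lemma test_functions_C_diff: "\<phi> \<in> test_functions U \<Longrightarrow> C_diff n \<phi>"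
  by (auto simp: test_functions_def)

lemma test_functions_continuous: "\<phi> \<in> test_functions U \<Longrightarrow> continuous_on UNIV \<phi>"
  using test_functions_C_diff[of \<phi> U 0] by simp

lemma test_functions_bounded:
  assumes "\<phi> \<in> test_functions U"
  obtains B where "\<And>x. \<bar>\<phi> x\<bar> \<le> B"
proof -
  let ?S = "closure {x. \<phi> x \<noteq> 0}"
  have "compact (\<phi> ` ?S)"
    using assms continuous_on_subset[OF test_functions_continuous[OF assms]]
    by (intro compact_continuous_image) (auto simp: test_functions_def)
  then obtain B where B: "\<And>x. x \<in> ?S \<Longrightarrow> \<bar>\<phi> x\<bar> \<le> B"
    by (auto dest!: compact_imp_bounded simp: bounded_iff) blast
  show ?thesis
  proof (rule that[of "max B 0"])
    show "\<bar>\<phi> x\<bar> \<le> max B 0" for x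
      using B[of x] closure_subset[of "{x. \<phi> x \<noteq> 0}"] by (cases "\<phi> x = 0") auto
  qed
qed

section \<open>Approximation by test functions and uniqueness of weak derivatives\<close>

lemma set_integral_supported:
  fixes f :: "'a::euclidean_space \<Rightarrow> real"
  assumes "V \<subseteq> U" "\<And>x. x \<notin> V \<Longrightarrow> f x = 0"
  shows "(LINT x:U|lebesgue. f x) = (LINT x:V|lebesgue. f x)"
  unfolding set_lebesgue_integral_def
  by (rule Bochner_Integration.integral_cong) (use assms in \<open>auto simp: indicator_def\<close>)

text \<open>Smooth cut-offs with compact support in \<open>V\<close>, values in [0,1] and pointwise
  limit 1 on \<open>V\<close>. The notion is abstracted from balls because it passes to
  intersections by multiplication; the translation estimate lives on the intersection of a ball with
  its translate.\<close>

definition bump_approx :: "'a::euclidean_space set \<Rightarrow> bool" where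
  "bump_approx V \<longleftrightarrow> (\<exists>\<eta> K. \<forall>n. smooth (\<eta> n) \<and> compact (K n) \<and> K n \<subseteq> V \<and> (\<forall>x. x \<notin> K n \<longrightarrow> \<eta> n x = 0) \<and>
     (\<forall>x. 0 \<le> \<eta> n x \<and> \<eta> n x \<le> 1) \<and> (\<forall>x\<in>V. (\<lambda>n. \<eta> n x) \<longlonglongrightarrow> (1::real)))"

lemma bump_approx_Int:
  assumes "bump_approx V" "bump_approx W"
  shows "bump_approx (V \<inter> W)"
proof -
  from assms(1)[unfolded bump_approx_def] obtain \<eta> K where 1: "\<And>n. smooth (\<eta> n)" "\<And>n. compact (K n)" "\<And>n. K n \<subseteq> V" 
    "\<And>x n. x \<notin> K n \<Longrightarrow> \<eta> n x = 0" "\<And>x n. 0 \<le> \<eta> n x \<and> \<eta> n x \<le> 1"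
    "\<And>x. x \<in> V \<Longrightarrow> (\<lambda>n. \<eta> n x) \<longlonglongrightarrow> (1::real)" by blast
  from assms(2)[unfolded bump_approx_def] obtain \<eta>' K' where 2: "\<And>n. smooth (\<eta>' n)" "\<And>n. compact (K' n)" "\<And>n. K' n \<subseteq> W" 
    "\<And>x n. x \<notin> K' n \<Longrightarrow> \<eta>' n x = 0" "\<And>x n. 0 \<le> \<eta>' n x \<and> \<eta>' n x \<le> 1"
    "\<And>x. x \<in> W \<Longrightarrow> (\<lambda>n. \<eta>' n x) \<longlonglongrightarrow> (1::real)" by blast
  have "(\<lambda>n. \<eta> n x * \<eta>' n x) \<longlonglongrightarrow> 1" if "x \<in> V \<inter> W" for x
    using tendsto_mult[OF 1(6) 2(6), of x x] that by simp
  moreover have "K n \<inter> K' n \<subseteq> V \<inter> W" "compact (K n \<inter> K' n)" for n 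
    using 1(3)[of n] 2(3)[of n] by (auto intro: compact_Int 1(2) 2(2))
  moreover have "\<eta> n x * \<eta>' n x \<le> 1" for n x using 1(5) 2(5) by (meson mult_le_one)
  ultimately show ?thesis using 1 2 unfolding bump_approx_def
    by (intro exI[of _ "\<lambda>n x. \<eta> n x * \<eta>' n x"] exI[of _ "\<lambda>n. K n \<inter> K' n"]) (auto intro: smooth.mult)
qed

lemma bump_0_at_top: "(bump 0 \<longlongrightarrow> 1) at_top"
proof -
  have "((\<lambda>t::real. exp (- inverse t)) \<longlongrightarrow> exp (- 0)) at_top"
    by (intro tendsto_exp tendsto_minus tendsto_inverse_0_at_top filterlim_ident)
  then have "((\<lambda>t::real. exp (- inverse t)) \<longlongrightarrow> 1) at_top" by simp
  then show ?thesis
    by (rule Lim_transform_eventually) (auto intro!: eventually_mono[OF eventually_gt_at_top[of 0]] simp: bump_def)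
qed

text \<open>\<open>bump 0\<close> is applied to a polynomial that is positive exactly inside the
  sphere of radius \<open>s n\<close>. The factor \<open>Suc n\<close> drives its argument to
  infinity at each point of the ball, where \<open>bump 0\<close> tends to 1.\<close>

lemma bump_approx_ball:
  assumes "r > 0"
  shows "bump_approx (ball z r)"
proof -
  \<comment> \<open>Strictly below \<open>r\<close>, so that the support is compact in the open
    ball, and tending to \<open>r\<close>, so that the ball is exhausted.\<close>
  define s where "s n = r * (1 - inverse (real (Suc n)))" for n
  define P where "P n x = (s n)\<^sup>2 - (dist z x)\<^sup>2" for n and x
  define \<eta> where "\<eta> n x = bump 0 (real (Suc n) * P n x)" for n x
  have "(\<lambda>n. 1 - inverse (real (Suc n))) \<longlonglongrightarrow> 1 - 0"
    by (intro tendsto_diff tendsto_const LIMSEQ_inverse_real_of_nat)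
  from tendsto_mult[OF tendsto_const[of r] this] have s: "s \<longlonglongrightarrow> r" unfolding s_def by simp
  have s0: "0 \<le> s n" "s n < r" for n
    using assms by (auto simp: s_def field_simps)
  have sub: "cball z (s n) \<subseteq> ball z r" for n using s0(2)[of n] by auto
  have sm: "smooth (\<eta> n)" for n
  proof -
    \<comment> \<open>The squared distance in coordinates is visibly a polynomial, which is what
      \<open>smooth\<close> requires.\<close>
    have P: "P n = (\<lambda>x. (s n)\<^sup>2 - (\<Sum>b\<in>Basis. (x \<bullet> b - z \<bullet> b)\<^sup>2))"
      by (rule ext) (simp add: P_def euclidean_dist_l2[of z] L2_set_def sum_nonneg dist_real_def power2_commute)
    show ?thesis unfolding \<eta>_def[abs_def] P
      by (intro smooth.bump smooth_cmult smooth_diff smooth.const smooth_sum smooth_power smooth_inner)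
  qed
  have zero: "\<eta> n x = 0" if "x \<notin> cball z (s n)" for n x
  proof -
    have "(s n)\<^sup>2 \<le> (dist z x)\<^sup>2" using that s0 by (intro power_mono) auto
    then show ?thesis by (simp add: \<eta>_def P_def bump_def not_less mult_nonneg_nonpos)
  qed
  have lim: "(\<lambda>n. \<eta> n x) \<longlonglongrightarrow> 1" if "x \<in> ball z r" for x
  proof -
    have "(\<lambda>n. P n x) \<longlonglongrightarrow> r\<^sup>2 - (dist z x)\<^sup>2"
      unfolding P_def using s by (intro tendsto_intros)
    moreover have "0 < r\<^sup>2 - (dist z x)\<^sup>2"
      using that by (simp add: power_strict_mono)
    ultimately have "filterlim (\<lambda>n. P n x * real (Suc n)) at_top sequentially"
      by (intro filterlim_tendsto_pos_mult_at_top filterlim_compose[OF filterlim_real_sequentially filterlim_Suc])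
    from filterlim_compose[OF bump_0_at_top this] show ?thesis by (simp add: \<eta>_def mult.commute)
  qed
  show ?thesis
    unfolding bump_approx_def
    by (intro exI[of _ \<eta>] exI[of _ "\<lambda>n. cball z (s n)"])
       (use sm zero lim sub bump_0_bounds in \<open>auto simp: \<eta>_def\<close>)
qed

lemma smooth_real_polynomial_function: "real_polynomial_function p \<Longrightarrow> smooth p"
  by (induction rule: real_polynomial_function.induct) (auto intro: smooth.intros)

text \<open>A measurable function is an a.e. limit of continuous ones; these are truncated,
  approximated uniformly by polynomials on the compact closure of \<open>V\<close>, and multiplied
  by cut-offs. The uniform error is at most 1, which gives the bound \<open>M + 1\<close> needed for
  dominated convergence.\<close>

lemma bounded_measurable_test_approx:
  fixes f :: "'a::euclidean_space \<Rightarrow> real"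
  assumes V: "bump_approx V" "bounded V" and f: "f \<in> borel_measurable lebesgue" "\<And>x. \<bar>f x\<bar> \<le> M"
  obtains \<phi> where "\<And>n. \<phi> n \<in> test_functions V" "\<And>n x. \<bar>\<phi> n x\<bar> \<le> M + 1"
    "AE x in lebesgue. x \<in> V \<longrightarrow> (\<lambda>n. \<phi> n x) \<longlonglongrightarrow> f x"
proof -
  have "f measurable_on UNIV"
    using f(1) by (intro lebesgue_measurable_imp_measurable_on_real) auto
  then obtain N g where N: "negligible N" and g: "\<And>n. continuous_on UNIV (g n)"
    and lim: "\<And>x. x \<notin> N \<Longrightarrow> (\<lambda>n. g n x) \<longlonglongrightarrow> f x"
    unfolding measurable_on_def by auto
  \<comment> \<open>Truncation at \<open>M\<close> makes the sequence uniformly bounded and leaves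
    the limit alone, since \<open>f\<close> itself is bounded by \<open>M\<close>.\<close>
  define G where "G n x = max (- M) (min M (g n x))" for n x
  have M: "0 \<le> M" using f(2)[of undefined] by linarith
  have G: "continuous_on UNIV (G n)" "\<bar>G n x\<bar> \<le> M" for n x
    using M by (auto simp: G_def intro!: continuous_intros g)
  have limG: "(\<lambda>n. G n x) \<longlonglongrightarrow> f x" if "x \<notin> N" for x
  proof -
    have "(\<lambda>n. G n x) \<longlonglongrightarrow> max (- M) (min M (f x))"
      unfolding G_def by (intro tendsto_max tendsto_min tendsto_const lim that)
    then show ?thesis using f(2)[of x] by (simp add: abs_le_iff)
  qed
  \<comment> \<open>Stone--Weierstrass turns continuous functions into smooth ones here; this is
    what replaces mollification.\<close>
  have "\<exists>p. real_polynomial_function p \<and> (\<forall>x\<in>closure V. \<bar>G n x - p x\<bar> < inverse (real (Suc n)))" for n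
    using Stone_Weierstrass_real_polynomial_function[of "closure V" "G n" "inverse (real (Suc n))"]
      V(2) continuous_on_subset[OF G(1)] by (metis compact_closure inverse_positive_iff_positive of_nat_0_less_iff subset_UNIV zero_less_Suc)
  then obtain p where p: "\<And>n. real_polynomial_function (p n)" 
    "\<And>n x. x \<in> V \<Longrightarrow> \<bar>G n x - p n x\<bar> < inverse (real (Suc n))"
    using closure_subset[of V] by (metis subsetD)
  from V(1)[unfolded bump_approx_def] obtain \<eta> K where 1: "\<And>n. smooth (\<eta> n)" "\<And>n. compact (K n)" "\<And>n. K n \<subseteq> V" 
    "\<And>x n. x \<notin> K n \<Longrightarrow> \<eta> n x = 0" "\<And>x n. 0 \<le> \<eta> n x \<and> \<eta> n x \<le> 1"
    "\<And>x. x \<in> V \<Longrightarrow> (\<lambda>n. \<eta> n x) \<longlonglongrightarrow> (1::real)" by blast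
  show ?thesis
  proof (rule that[of "\<lambda>n x. \<eta> n x * p n x"])
    show "(\<lambda>x. \<eta> n x * p n x) \<in> test_functions V" for n
      by (rule test_functionsI[OF _ 1(2,3)[of n]])
         (rule smooth.mult[OF 1(1) smooth_real_polynomial_function[OF p(1)]], simp add: 1(4))
    show "\<bar>\<eta> n x * p n x\<bar> \<le> M + 1" for n x
    proof (cases "x \<in> V")
      case True
      have "inverse (real (Suc n)) \<le> 1" by (simp add: field_simps)
      with p(2)[OF True, of n] G(2)[of n x] have "\<bar>p n x\<bar> \<le> M + 1" by linarith
      then have "\<bar>\<eta> n x\<bar> * \<bar>p n x\<bar> \<le> 1 * (M + 1)"
        using 1(5)[of n x] by (intro mult_mono) auto
      then show ?thesis by (simp add: abs_mult)
    next
      case False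
      then show ?thesis using 1(3,4) M by (metis abs_zero add_nonneg_nonneg mult_zero_left subsetD zero_le_one)
    qed
    have "(\<lambda>n. \<eta> n x * p n x) \<longlonglongrightarrow> f x" if "x \<in> V" "x \<notin> N" for x
    proof -
      have "(\<lambda>n. G n x - p n x) \<longlonglongrightarrow> 0"
        by (rule Lim_null_comparison[OF _ LIMSEQ_inverse_real_of_nat])
           (use less_imp_le[OF p(2)[OF that(1)]] in simp)
      from tendsto_diff[OF limG[OF that(2)] this] have "(\<lambda>n. p n x) \<longlonglongrightarrow> f x" by simp
      from tendsto_mult[OF 1(6)[OF that(1)] this] show ?thesis by simp
    qed
    moreover have "AE x in lebesgue. x \<notin> N"
      using N by (intro AE_not_in) (simp add: negligible_iff_null_sets)
    ultimately show "AE x in lebesgue. x \<in> V \<longrightarrow> (\<lambda>n. \<eta> n x * p n x) \<longlonglongrightarrow> f x"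
      by (auto elim: eventually_mono)
  qed
qed

lemma set_integral_dominated_convergence:
  fixes f :: "'a \<Rightarrow> real"
  assumes "\<And>n. set_borel_measurable M U (s n)" "set_borel_measurable M U f" "set_integrable M U w"
    "AE x in M. x \<in> U \<longrightarrow> (\<lambda>n. s n x) \<longlonglongrightarrow> f x" "\<And>n x. x \<in> U \<Longrightarrow> \<bar>s n x\<bar> \<le> w x"
  shows "(\<lambda>n. LINT x:U|M. s n x) \<longlonglongrightarrow> (LINT x:U|M. f x)"
  unfolding set_lebesgue_integral_def
proof (rule integral_dominated_convergence[where w = "\<lambda>x. indicator U x *\<^sub>R w x"])
  show "AE x in M. (\<lambda>n. indicator U x *\<^sub>R s n x) \<longlonglongrightarrow> indicator U x *\<^sub>R f x"
    using assms(4) by eventually_elim (auto simp: indicator_def)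
qed (use assms in \<open>auto simp: set_borel_measurable_def set_integrable_def indicator_def\<close>)

lemma lebesgue_set_measurable:
  fixes f :: "'a::euclidean_space \<Rightarrow> real"
  assumes "f \<in> borel_measurable lebesgue" "U \<in> sets lebesgue"
  shows "set_borel_measurable lebesgue U f"
  unfolding set_borel_measurable_def
  by (intro borel_measurable_scaleR borel_measurable_indicator assms)

lemma set_borel_measurable_mult:
  fixes f :: "'a::euclidean_space \<Rightarrow> real"
  assumes "set_borel_measurable lebesgue U f" "set_borel_measurable lebesgue U g"
  shows "set_borel_measurable lebesgue U (\<lambda>x. f x * g x)"
proof -
  have "(\<lambda>x. (indicator U x *\<^sub>R f x) * (indicator U x *\<^sub>R g x)) \<in> borel_measurable lebesgue"
    using assms unfolding set_borel_measurable_def by (intro borel_measurable_times)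
  also have "(\<lambda>x. (indicator U x *\<^sub>R f x) * (indicator U x *\<^sub>R g x)) = (\<lambda>x. indicator U x *\<^sub>R (f x * g x))"
    by (auto simp: indicator_def)
  finally show ?thesis by (simp add: set_borel_measurable_def)
qed

lemma test_functions_mult_integrable:
  fixes f :: "'a::euclidean_space \<Rightarrow> real"
  assumes "set_integrable lebesgue V f" "\<phi> \<in> test_functions U" "V \<in> sets lebesgue"
  shows "set_integrable lebesgue V (\<lambda>x. f x * \<phi> x)"
proof -
  obtain B where B: "\<And>x. \<bar>\<phi> x\<bar> \<le> B" using test_functions_bounded[OF assms(2)] by blast
  have "set_integrable lebesgue V (\<lambda>x. f x * B)" using assms(1) by simp
  then show ?thesis unfolding set_integrable_def
  proof (rule Bochner_Integration.integrable_bound)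
    have "set_borel_measurable lebesgue V f" 
      using assms(1) by (auto simp: set_integrable_def set_borel_measurable_def)
    from set_borel_measurable_mult[OF this lebesgue_set_measurable[OF continuous_imp_measurable_lebesgue[OF test_functions_continuous[OF assms(2)]] assms(3)]]
    show "(\<lambda>x. indicator V x *\<^sub>R (f x * \<phi> x)) \<in> borel_measurable lebesgue"
      by (simp add: set_borel_measurable_def)
    have "\<bar>f x\<bar> * \<bar>\<phi> x\<bar> \<le> \<bar>f x\<bar> * \<bar>B\<bar>" for x 
      using B[of x] by (intro mult_left_mono) auto
    then show "AE x in lebesgue. norm (indicator V x *\<^sub>R (f x * \<phi> x)) \<le> norm (indicator V x *\<^sub>R (f x * B))"
      by (auto simp: indicator_def abs_mult)
  qed
qed

text \<open>The truncations of \<open>h\<close> are limits of test functions bounded by a constant, so they may be used for \<open>\<phi>\<close>.\<close>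

lemma L2_dual_bound:
  fixes h :: "'a::euclidean_space \<Rightarrow> real"
  assumes V: "bump_approx V" "bounded V" "V \<in> sets lebesgue" and h: "h \<in> L2_space V" and M: "0 \<le> M"
    and *: "\<And>\<phi>. \<phi> \<in> test_functions V \<Longrightarrow> (LINT x:V|lebesgue. h x * \<phi> x)\<^sup>2 \<le> M * sqint V \<phi>"
  shows "sqint V h \<le> M"
proof -
  define H where "H K x = max (- K) (min K (indicator V x * h x))" for K x
  have Hm: "H K \<in> borel_measurable lebesgue" for K
    unfolding H_def[abs_def] by (intro borel_measurable_max borel_measurable_min borel_measurable_const L2_spaceD(1)[OF h])
  have VL: "V \<in> lmeasurable" using V bounded_set_imp_lmeasurable by blast
  note hm = L2_space_def[THEN equalityD1, THEN subsetD, OF h, simplified, THEN conjunct1]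
  have hi: "set_integrable lebesgue V h" by (rule L2_set_integrable[OF h V(2,3)])
  \<comment> \<open>For a fixed truncation level the hypothesis passes to the limit along bounded
    test functions, on both sides by dominated convergence.\<close>
  have bd: "sqint V (H K) \<le> M" if K: "0 \<le> K" for K
  proof -
    have HK: "\<bar>H K x\<bar> \<le> K" for x using K by (auto simp: H_def)
    obtain \<phi> where \<phi>: "\<And>n. \<phi> n \<in> test_functions V" "\<And>n x. \<bar>\<phi> n x\<bar> \<le> K + 1"
      "AE x in lebesgue. x \<in> V \<longrightarrow> (\<lambda>n. \<phi> n x) \<longlonglongrightarrow> H K x"
      using bounded_measurable_test_approx[OF V(1,2) Hm HK] by blast
    have \<phi>m: "set_borel_measurable lebesgue V (\<phi> n)" for n
      using \<phi>(1) by (intro lebesgue_set_measurable V continuous_imp_measurable_lebesgue test_functions_continuous)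
    have Hm': "set_borel_measurable lebesgue V (H K)" by (intro lebesgue_set_measurable V Hm)
    have l1: "(\<lambda>n. LINT x:V|lebesgue. h x * \<phi> n x) \<longlonglongrightarrow> (LINT x:V|lebesgue. h x * H K x)"
    proof (rule set_integral_dominated_convergence)
      show "set_integrable lebesgue V (\<lambda>x. \<bar>h x\<bar> * (K + 1))"
        using set_integrable_abs[OF hi] by simp
      show "AE x in lebesgue. x \<in> V \<longrightarrow> (\<lambda>n. h x * \<phi> n x) \<longlonglongrightarrow> h x * H K x"
        using \<phi>(3) by eventually_elim (auto intro: tendsto_intros)
    qed (auto intro!: set_borel_measurable_mult hm \<phi>m Hm' mult_left_mono \<phi>(2) simp: abs_mult)
    have l2: "(\<lambda>n. sqint V (\<phi> n)) \<longlonglongrightarrow> sqint V (H K)"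
      unfolding sqint_def
    proof (rule set_integral_dominated_convergence)
      show "set_integrable lebesgue V (\<lambda>x. (K + 1)\<^sup>2)"
        using VL unfolding set_integrable_def fmeasurable_def 
        by (intro integrable_scaleR_left integrable_real_indicator) auto
      show "AE x in lebesgue. x \<in> V \<longrightarrow> (\<lambda>n. (\<phi> n x)\<^sup>2) \<longlonglongrightarrow> (H K x)\<^sup>2"
        using \<phi>(3) by eventually_elim (auto intro: tendsto_intros)
      show "\<bar>(\<phi> n x)\<^sup>2\<bar> \<le> (K + 1)\<^sup>2" for n x using power_mono[OF \<phi>(2)[of n x], of 2] by simp
    qed (auto simp: power2_eq_square intro!: set_borel_measurable_mult \<phi>m Hm')
    let ?A = "LINT x:V|lebesgue. h x * H K x" and ?B = "sqint V (H K)"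
    have AB: "?A\<^sup>2 \<le> M * ?B"
      by (rule LIMSEQ_le[OF tendsto_power[OF l1] tendsto_mult[OF tendsto_const l2]]) (use *[OF \<phi>(1)] in auto)
    \<comment> \<open>Truncation keeps the sign and does not increase the modulus, so
      \<open>(H K)\<^sup>2 \<le> h * H K\<close> pointwise. Together with \<open>AB\<close> this
      gives \<open>?A\<^sup>2 \<le> M * ?A\<close>, and hence the bound on both \<open>?A\<close>
      and \<open>?B\<close>.\<close>
    have "?B \<le> ?A" unfolding sqint_def
    proof (rule set_integral_mono)
      have HL: "H K \<in> L2_space V" by (rule bounded_imp_L2_space(1)[OF Hm VL HK])
      then show "set_integrable lebesgue V (\<lambda>x. (H K x)\<^sup>2)" by (rule L2_spaceD)
      show "set_integrable lebesgue V (\<lambda>x. h x * H K x)" by (rule L2_mult_integrable[OF h HL])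
      show "(H K x)\<^sup>2 \<le> h x * H K x" if "x \<in> V" for x
        using that K by (auto simp: H_def power2_eq_square max_def min_def mult_le_cancel_right)
    qed
    with M AB have "?A\<^sup>2 \<le> M * ?A" by (meson mult_left_mono order_trans)
    then have "?A * (?A - M) \<le> 0" by (simp add: power2_eq_square algebra_simps)
    with M have "?A \<le> M" by (auto simp: mult_le_0_iff)
    with \<open>?B \<le> ?A\<close> show ?thesis by simp
  qed
  \<comment> \<open>At each point the truncation is eventually inactive, and the squares are
    dominated by that of \<open>h\<close>.\<close>
  have "(\<lambda>n. sqint V (H (real n))) \<longlonglongrightarrow> sqint V h"
    unfolding sqint_def
  proof (rule set_integral_dominated_convergence)
    show "set_integrable lebesgue V (\<lambda>x. (h x)\<^sup>2)" using h by (rule L2_spaceD)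
    show "AE x in lebesgue. x \<in> V \<longrightarrow> (\<lambda>n. (H (real n) x)\<^sup>2) \<longlonglongrightarrow> (h x)\<^sup>2"
    proof (intro AE_I2 impI tendsto_power)
      fix x assume "x \<in> V"
      obtain m where "\<bar>h x\<bar> \<le> real m" using real_arch_simple by blast
      then have "H (real n) x = h x" if "n \<ge> m" for n
        using that \<open>x \<in> V\<close> by (auto simp: H_def max_def min_def)
      then have "\<forall>\<^sub>F n in sequentially. h x = H (real n) x"
        by (auto simp: eventually_sequentially intro!: exI[of _ m])
      then show "(\<lambda>n. H (real n) x) \<longlonglongrightarrow> h x" by (rule Lim_transform_eventually[OF tendsto_const])
    qed
    show "\<bar>(H (real n) x)\<^sup>2\<bar> \<le> (h x)\<^sup>2" if "x \<in> V" for n x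
      using that by (auto simp: H_def abs_le_square_iff[symmetric])
  qed (unfold power2_eq_square, (intro set_borel_measurable_mult hm lebesgue_set_measurable V Hm)+)
  then show ?thesis by (rule LIMSEQ_le_const2) (use bd in auto)
qed

text \<open>The fundamental lemma of the calculus of variations for integrable \<open>g\<close>.
  Testing with \<open>g\<close> itself is impossible outside L2, so its truncation \<open>H\<close>
  at 1 is used: it is bounded, and \<open>g * H\<close> is nonnegative and vanishes only where
  \<open>g\<close> does.\<close>

lemma integral_test_functions_zero_imp_AE_zero:
  fixes g :: "'a::euclidean_space \<Rightarrow> real"
  assumes V: "bump_approx V" "bounded V" "V \<in> sets lebesgue" and g: "set_integrable lebesgue V g"
    and *: "\<And>\<phi>. \<phi> \<in> test_functions V \<Longrightarrow> (LINT x:V|lebesgue. g x * \<phi> x) = 0"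
  shows "AE x in lebesgue. x \<in> V \<longrightarrow> g x = 0"
proof -
  define H where "H x = max (- 1) (min 1 (indicator V x *\<^sub>R g x))" for x
  have Hm: "H \<in> borel_measurable lebesgue" 
    using g unfolding H_def[abs_def] set_integrable_def
    by (intro borel_measurable_max borel_measurable_min borel_measurable_const borel_measurable_integrable)
  have H1: "\<bar>H x\<bar> \<le> 1" for x by (auto simp: H_def)
  obtain \<phi> where \<phi>: "\<And>n. \<phi> n \<in> test_functions V" "\<And>n x. \<bar>\<phi> n x\<bar> \<le> 1 + 1"
    "AE x in lebesgue. x \<in> V \<longrightarrow> (\<lambda>n. \<phi> n x) \<longlonglongrightarrow> H x"
    using bounded_measurable_test_approx[OF V(1,2) Hm H1] by blast
  have gm: "set_borel_measurable lebesgue V g" 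
    using g by (auto simp: set_integrable_def set_borel_measurable_def)
  have \<phi>m: "set_borel_measurable lebesgue V (\<phi> n)" for n
    using \<phi>(1) by (intro lebesgue_set_measurable V continuous_imp_measurable_lebesgue test_functions_continuous)
  have Hm': "set_borel_measurable lebesgue V H" by (intro lebesgue_set_measurable V Hm)
  have "(\<lambda>n. LINT x:V|lebesgue. g x * \<phi> n x) \<longlonglongrightarrow> (LINT x:V|lebesgue. g x * H x)"
  proof (rule set_integral_dominated_convergence)
    show "set_integrable lebesgue V (\<lambda>x. \<bar>g x\<bar> * (1 + 1))"
      using set_integrable_abs[OF g] by simp
    show "AE x in lebesgue. x \<in> V \<longrightarrow> (\<lambda>n. g x * \<phi> n x) \<longlonglongrightarrow> g x * H x"
      using \<phi>(3) by eventually_elim (auto intro: tendsto_intros)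
    show "\<bar>g x * \<phi> n x\<bar> \<le> \<bar>g x\<bar> * (1 + 1)" for n x
      unfolding abs_mult by (rule mult_left_mono[OF \<phi>(2)]) simp
  qed (intro set_borel_measurable_mult gm \<phi>m Hm')+
  then have 0: "(LINT x:V|lebesgue. g x * H x) = 0"
    using *[OF \<phi>(1)] by (simp add: LIMSEQ_const_iff)
  have gH: "set_integrable lebesgue V (\<lambda>x. g x * H x)"
    unfolding set_integrable_def
  proof (rule Bochner_Integration.integrable_bound[OF g[unfolded set_integrable_def]])
    show "(\<lambda>x. indicator V x *\<^sub>R (g x * H x)) \<in> borel_measurable lebesgue"
      using set_borel_measurable_mult[OF gm Hm'] by (simp add: set_borel_measurable_def)
    have "\<bar>g x * H x\<bar> \<le> \<bar>g x\<bar>" for x 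
      using mult_left_mono[OF H1[of x], of "\<bar>g x\<bar>"] by (simp add: abs_mult)
    then show "AE x in lebesgue. norm (indicator V x *\<^sub>R (g x * H x)) \<le> norm (indicator V x *\<^sub>R g x)"
      by (auto simp: indicator_def)
  qed
  have nn: "0 \<le> indicator V x *\<^sub>R (g x * H x)" for x
    by (auto simp: indicator_def H_def max_def min_def mult_nonpos_nonpos)
  have "AE x in lebesgue. indicator V x *\<^sub>R (g x * H x) = 0"
    using integral_nonneg_eq_0_iff_AE[OF gH[unfolded set_integrable_def]] nn 0
    by (simp add: set_lebesgue_integral_def)
  then show ?thesis
    by eventually_elim (auto simp: indicator_def H_def max_def min_def split: if_splits)
qed

text \<open>Lindelof reduces the cover to countably many balls, so the exceptional sets remain null.
  The closed balls lie in \<open>U\<close> because local integrability is a statement about compact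
  subsets.\<close>

lemma AE_open_if_AE_ball:
  fixes U :: "'a::euclidean_space set"
  assumes "open U" "\<And>z r. r > 0 \<Longrightarrow> cball z r \<subseteq> U \<Longrightarrow> AE x in lebesgue. x \<in> ball z r \<longrightarrow> P x"
  shows "AE x in lebesgue. x \<in> U \<longrightarrow> P x"
proof -
  define F where "F = {ball z r | z r. r > 0 \<and> cball z r \<subseteq> U}"
  have "open S" if "S \<in> F" for S using that unfolding F_def by blast
  then obtain F' where F': "F' \<subseteq> F" "countable F'" "\<Union>F' = \<Union>F" using Lindelof by metis
  have "U \<subseteq> \<Union>F"
  proof
    fix x assume "x \<in> U"
    then obtain e where "e > 0" "cball x e \<subseteq> U" using assms(1) open_contains_cball by blast
    then have "ball x e \<in> F" "x \<in> ball x e" unfolding F_def by (blast, simp)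
    then show "x \<in> \<Union>F" by blast
  qed
  have "AE x in lebesgue. \<forall>S\<in>F'. x \<in> S \<longrightarrow> P x"
    unfolding AE_ball_countable[OF F'(2)]
  proof
    fix S assume "S \<in> F'"
    then obtain z r where "S = ball z r" "r > 0" "cball z r \<subseteq> U" using F'(1) unfolding F_def by blast
    then show "AE x in lebesgue. x \<in> S \<longrightarrow> P x" using assms(2) by simp
  qed
  then show ?thesis by (rule eventually_mono) (use \<open>U \<subseteq> \<Union>F\<close> F'(3) in blast)
qed

text \<open>On a ball compactly contained in \<open>U\<close> the difference is integrable and
  orthogonal to all test functions. This is what makes the arbitrary choice in
  \<open>weak_deriv\<close> harmless.\<close>

lemma is_weak_deriv_unique:
  assumes "open U" "is_weak_deriv \<alpha> U f g" "is_weak_deriv \<alpha> U f g'"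
  shows "AE x in lebesgue. x \<in> U \<longrightarrow> g x = g' x"
proof -
  have "AE x in lebesgue. x \<in> U \<longrightarrow> g x - g' x = 0"
  proof (rule AE_open_if_AE_ball[OF assms(1)])
    fix z :: 'a and r :: real assume r: "r > 0" "cball z r \<subseteq> U"
    have i: "set_integrable lebesgue (ball z r) g" "set_integrable lebesgue (ball z r) g'"
      using assms(2,3) r unfolding is_weak_deriv_def locally_integrable_def
      by (auto intro: set_integrable_subset[of lebesgue "cball z r" _ "ball z r"])
    have i': "set_integrable lebesgue (ball z r) (\<lambda>x. g x - g' x)" by (rule set_integral_diff(1)[OF i])
    have "ball z r \<in> sets lebesgue" by auto
    then show "AE x in lebesgue. x \<in> ball z r \<longrightarrow> g x - g' x = 0"
    proof (rule integral_test_functions_zero_imp_AE_zero[OF bump_approx_ball[OF r(1)] bounded_ball _ i'])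
      fix \<phi> assume \<phi>: "\<phi> \<in> test_functions (ball z r)"
      have sub: "ball z r \<subseteq> U" using r by auto
      have \<phi>U: "\<phi> \<in> test_functions U" by (rule test_functions_mono[OF \<phi> sub])
      have "(LINT x:U|lebesgue. g x * \<phi> x) = (LINT x:U|lebesgue. g' x * \<phi> x)"
      proof -
        have "(-1) ^ mi_order \<alpha> * (LINT x:U|lebesgue. g x * \<phi> x) = (-1) ^ mi_order \<alpha> * (LINT x:U|lebesgue. g' x * \<phi> x)"
          using assms(2,3) \<phi>U unfolding is_weak_deriv_def by auto
        then show ?thesis by simp
      qed
      then have eq: "(LINT x:ball z r|lebesgue. g x * \<phi> x) = (LINT x:ball z r|lebesgue. g' x * \<phi> x)"
        using set_integral_supported[OF sub, of "\<lambda>x. g x * \<phi> x"] set_integral_supported[OF sub, of "\<lambda>x. g' x * \<phi> x"]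
          test_functions_zero[OF \<phi>] by simp
      have "set_integrable lebesgue (ball z r) (\<lambda>x. k x * \<phi> x)" if "set_integrable lebesgue (ball z r) k" for k
        by (rule test_functions_mult_integrable[OF that \<phi>]) auto
      from set_integral_diff(2)[OF this[OF i(1)] this[OF i(2)]] eq
      show "(LINT x:ball z r|lebesgue. (g x - g' x) * \<phi> x) = 0" by (simp add: left_diff_distrib)
    qed
  qed
  then show ?thesis by simp
qed


section \<open>The Poincare inequality for weak gradients\<close>

lemma lebesgue_affine_scaleR:
  fixes t :: "'a::euclidean_space"
  assumes "c \<noteq> 0"
  shows "lebesgue = density (distr lebesgue lebesgue (\<lambda>x. t + c *\<^sub>R x)) (\<lambda>_. ennreal (\<bar>c\<bar> ^ DIM('a)))"
    and "(\<lambda>x. t + c *\<^sub>R x) \<in> lebesgue \<rightarrow>\<^sub>M lebesgue"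
proof -
  have eq: "(\<lambda>x. t + (\<Sum>j\<in>Basis. (c * (x \<bullet> j)) *\<^sub>R j)) = (\<lambda>x. t + c *\<^sub>R x)"
    unfolding scaleR_scaleR[symmetric] scaleR_sum_right[symmetric] euclidean_representation ..
  show "lebesgue = density (distr lebesgue lebesgue (\<lambda>x. t + c *\<^sub>R x)) (\<lambda>_. ennreal (\<bar>c\<bar> ^ DIM('a)))"
    using lebesgue_affine_euclidean[of "\<lambda>_. c" t] assms unfolding eq by simp
  show "(\<lambda>x. t + c *\<^sub>R x) \<in> lebesgue \<rightarrow>\<^sub>M lebesgue"
    using lebesgue_affine_measurable[of "\<lambda>_. c" t] assms unfolding eq by simp
qed

lemma borel_measurable_lebesgue_affine:
  fixes f :: "'a::euclidean_space \<Rightarrow> real"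
  assumes "f \<in> borel_measurable lebesgue" "c \<noteq> 0"
  shows "(\<lambda>x. f (t + c *\<^sub>R x)) \<in> borel_measurable lebesgue"
  using measurable_compose[OF lebesgue_affine_scaleR(2)[OF assms(2)] assms(1)] .

lemma integral_lebesgue_affine:
  fixes f :: "'a::euclidean_space \<Rightarrow> real"
  assumes "f \<in> borel_measurable lebesgue" "c \<noteq> 0"
  shows "(LINT x|lebesgue. f x) = \<bar>c\<bar> ^ DIM('a) * (LINT x|lebesgue. f (t + c *\<^sub>R x))"
proof -
  let ?T = "\<lambda>x. t + c *\<^sub>R x"
  have "(LINT x|lebesgue. f x) = (LINT x|density (distr lebesgue lebesgue ?T) (\<lambda>_. ennreal (\<bar>c\<bar> ^ DIM('a))). f x)"
    using lebesgue_affine_scaleR(1)[OF assms(2), of t] by simp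
  also have "\<dots> = (LINT x|distr lebesgue lebesgue ?T. \<bar>c\<bar> ^ DIM('a) *\<^sub>R f x)"
    using assms(1) by (intro integral_density) auto
  also have "\<dots> = (LINT x|lebesgue. \<bar>c\<bar> ^ DIM('a) *\<^sub>R f (?T x))"
    using assms(1) by (intro integral_distr lebesgue_affine_scaleR assms) auto
  finally show ?thesis by simp
qed

lemma integral_lebesgue_translate:
  fixes f :: "'a::euclidean_space \<Rightarrow> real"
  assumes "f \<in> borel_measurable lebesgue"
  shows "(LINT x|lebesgue. f (x + t)) = (LINT x|lebesgue. f x)"
  using integral_lebesgue_affine[OF assms, of 1 t] by (simp add: add.commute)

lemma integrable_lebesgue_affine:
  fixes f :: "'a::euclidean_space \<Rightarrow> real"
  assumes "integrable lebesgue f" "c \<noteq> 0"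
  shows "integrable lebesgue (\<lambda>x. f (t + c *\<^sub>R x))"
proof -
  let ?T = "\<lambda>x. t + c *\<^sub>R x"
  have fm: "f \<in> borel_measurable lebesgue" using assms(1) by auto
  have "integrable (density (distr lebesgue lebesgue ?T) (\<lambda>_. ennreal (\<bar>c\<bar> ^ DIM('a)))) f"
    using assms(1) lebesgue_affine_scaleR(1)[OF assms(2), of t] by simp
  then have "integrable (distr lebesgue lebesgue ?T) (\<lambda>x. \<bar>c\<bar> ^ DIM('a) *\<^sub>R f x)"
    using fm by (subst (asm) integrable_density) auto
  then have "integrable (distr lebesgue lebesgue ?T) f" using assms(2) by auto
  then show ?thesis
    using fm lebesgue_affine_scaleR(2)[OF assms(2)] by (subst (asm) integrable_distr_eq) auto
qed

section \<open>Differentiation and translation of test functions\<close>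

lemma C_diff_imp_has_derivative:
  assumes "C_diff (Suc n) \<phi>"
  shows "(\<phi> has_derivative (\<lambda>t. \<Sum>b\<in>Basis. (t \<bullet> b) * partial_deriv b \<phi> x)) (at x)"
proof -
  have d: "(\<phi> has_derivative frechet_derivative \<phi> (at x)) (at x)"
    using assms by (auto simp: frechet_derivative_works[symmetric] differentiable_on_def)
  then interpret linear "frechet_derivative \<phi> (at x)" by (rule has_derivative_linear)
  have "frechet_derivative \<phi> (at x) t = (\<Sum>b\<in>Basis. (t \<bullet> b) * partial_deriv b \<phi> x)" for t
  proof -
    have "frechet_derivative \<phi> (at x) t = frechet_derivative \<phi> (at x) (\<Sum>b\<in>Basis. (t \<bullet> b) *\<^sub>R b)"
      by (simp add: euclidean_representation)
    also have "\<dots> = (\<Sum>b\<in>Basis. (t \<bullet> b) * partial_deriv b \<phi> x)"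
      by (simp add: sum scale partial_deriv_def)
    finally show ?thesis .
  qed
  with d show ?thesis by (metis (no_types, lifting) ext)
qed

lemma C_diff_antimono: "C_diff (Suc n) \<phi> \<Longrightarrow> C_diff n \<phi>"
proof (induction n arbitrary: \<phi>)
  case 0
  then show ?case by (auto intro: differentiable_imp_continuous_on)
next
  case (Suc n)
  then show ?case by (metis C_diff.simps(2))
qed

lemma partial_deriv_shift:
  assumes "C_diff (Suc n) \<phi>"
  shows "partial_deriv b (\<lambda>x. \<phi> (x - c)) = (\<lambda>x. partial_deriv b \<phi> (x - c))"
proof
  fix x
  have d: "(\<phi> has_derivative frechet_derivative \<phi> (at (x - c))) (at (x - c))"
    using assms by (auto simp: frechet_derivative_works[symmetric] differentiable_on_def)
  have "((\<lambda>x. \<phi> (x - c)) has_derivative (\<lambda>h. frechet_derivative \<phi> (at (x - c)) h)) (at x)"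
    by (rule has_derivative_compose[where f = "\<lambda>x. x - c" and g = \<phi>, OF _ d])
      (auto intro!: derivative_eq_intros)
  then show "partial_deriv b (\<lambda>x. \<phi> (x - c)) x = partial_deriv b \<phi> (x - c)"
    using partial_derivI partial_deriv_def by metis
qed

lemma C_diff_shift: "C_diff n \<phi> \<Longrightarrow> C_diff n (\<lambda>x. \<phi> (x - c))"
proof (induction n arbitrary: \<phi>)
  case 0
  then have "continuous_on UNIV (\<phi> \<circ> (\<lambda>x. x - c))"
    by (intro continuous_on_compose) (auto intro!: continuous_intros intro: continuous_on_subset)
  then show ?case by (simp add: o_def)
next
  case (Suc n)
  have "\<phi> differentiable (at x)" for x using Suc.prems by (auto simp: differentiable_on_def)
  then have "(\<lambda>x. \<phi> (x - c)) differentiable (at x)" for x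
    using differentiable_compose[of \<phi> "\<lambda>x. x - c" x UNIV] by simp
  then show ?case
    using Suc partial_deriv_shift[OF Suc.prems] by (auto simp: differentiable_on_def)
qed

lemma test_functions_shift:
  assumes "\<phi> \<in> test_functions U" "\<And>x. x \<in> U \<Longrightarrow> x + c \<in> W"
  shows "(\<lambda>x. \<phi> (x - c)) \<in> test_functions W"
proof -
  have "{x. \<phi> (x - c) \<noteq> 0} = (+) c ` {x. \<phi> x \<noteq> 0}"
    by (auto simp: image_iff) (metis add.commute diff_add_cancel)
  then have cl: "closure {x. \<phi> (x - c) \<noteq> 0} = (+) c ` closure {x. \<phi> x \<noteq> 0}"
    by (simp add: closure_translation)
  have "compact ((+) c ` closure {x. \<phi> x \<noteq> 0})"
    using assms(1) by (intro compact_translation) (simp add: test_functions_def)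
  moreover have "(+) c ` closure {x. \<phi> x \<noteq> 0} \<subseteq> W"
    using assms by (auto simp: test_functions_def add.commute)
  ultimately show ?thesis
    using C_diff_shift[of _ \<phi> c] assms(1) unfolding test_functions_def mem_Collect_eq cl by blast
qed

lemma partial_deriv_test_functions:
  assumes "\<phi> \<in> test_functions U" "b \<in> Basis"
  shows "partial_deriv b \<phi> \<in> test_functions U"
proof -
  let ?S = "closure {x. \<phi> x \<noteq> 0}"
  have "partial_deriv b \<phi> x = 0" if "x \<notin> ?S" for x
  proof -
    have "((\<lambda>x. 0) has_derivative (\<lambda>h. 0)) (at x)" by simp
    then have "(\<phi> has_derivative (\<lambda>h. 0)) (at x)"
      by (rule has_derivative_transform_within_open[of _ _ _ _ "- ?S"])
         (use that closure_subset[of "{x. \<phi> x \<noteq> 0}"] in auto)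
    from partial_derivI[OF this] show ?thesis .
  qed
  then have sub: "closure {x. partial_deriv b \<phi> x \<noteq> 0} \<subseteq> ?S"
    by (intro closure_minimal) auto
  have "compact ?S" "?S \<subseteq> U" using assms by (auto simp: test_functions_def)
  with sub have "compact (closure {x. partial_deriv b \<phi> x \<noteq> 0})"
    using compact_Int_closed[of ?S "closure {x. partial_deriv b \<phi> x \<noteq> 0}"] by (simp add: Int_absorb1)
  moreover have "C_diff n (partial_deriv b \<phi>)" for n
    using test_functions_C_diff[OF assms(1), of "Suc n"] assms(2) by simp
  ultimately show ?thesis using sub \<open>?S \<subseteq> U\<close> by (auto simp: test_functions_def)
qed

text \<open>The distributional derivative in direction \<open>b\<close>, without the local integrability of \<^const>\<open>is_weak_deriv\<close>.\<close>

definition weak_partial :: "'a::euclidean_space set \<Rightarrow> 'a \<Rightarrow> ('a \<Rightarrow> real) \<Rightarrow> ('a \<Rightarrow> real) \<Rightarrow> bool" where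
  "weak_partial U b u g \<longleftrightarrow> (\<forall>\<phi>\<in>test_functions U.
     (LINT x:U|lebesgue. u x * partial_deriv b \<phi> x) = - (LINT x:U|lebesgue. g x * \<phi> x))"

text \<open>Differentiation under the integral sign with all regularity on \<open>\<phi>\<close>:
  the difference quotients of \<open>\<phi>\<close> along \<open>t\<close> are bounded by a
  Lipschitz constant, so a multiple of \<open>\<bar>u\<bar>\<close> dominates. \<open>u\<close> need
  only be integrable.\<close>

lemma has_real_derivative_integral_shift:
  fixes u \<phi> :: "'a::euclidean_space \<Rightarrow> real"
  assumes u: "set_integrable lebesgue B u" and B: "B \<in> sets lebesgue" and \<phi>: "\<phi> \<in> test_functions U"
  shows "((\<lambda>s. LINT x:B|lebesgue. u x * \<phi> (x - s *\<^sub>R t)) has_real_derivative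
     - (LINT x:B|lebesgue. u x * (\<Sum>b\<in>Basis. (t \<bullet> b) * partial_deriv b \<phi> (x - s *\<^sub>R t)))) (at s)"
proof -
  define D where "D y = (\<Sum>b\<in>Basis. (t \<bullet> b) * partial_deriv b \<phi> y)" for y
  have "\<exists>M. \<forall>y. \<bar>partial_deriv b \<phi> y\<bar> \<le> M" if "b \<in> Basis" for b
    using test_functions_bounded[OF partial_deriv_test_functions[OF \<phi> that]] by metis
  then obtain M where M: "\<And>b y. b \<in> Basis \<Longrightarrow> \<bar>partial_deriv b \<phi> y\<bar> \<le> M b" by metis
  \<comment> \<open>The Lipschitz constant of \<open>\<phi>\<close> along the direction
    \<open>t\<close>; finite because each partial derivative is again a test function and hence
    bounded.\<close>
  define L where "L = (\<Sum>b\<in>Basis. \<bar>t \<bullet> b\<bar> * M b)"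
  have L: "\<bar>D y\<bar> \<le> L" for y
    unfolding D_def L_def by (rule order_trans[OF sum_abs]) (auto simp: abs_mult intro!: sum_mono mult_left_mono M)
  have deriv: "((\<lambda>r. \<phi> (x - r *\<^sub>R t)) has_real_derivative - D (x - r *\<^sub>R t)) (at r)" for x r
  proof -
    have "((\<lambda>r. x - r *\<^sub>R t) has_derivative (\<lambda>h. - h *\<^sub>R t)) (at r)"
      by (auto intro!: derivative_eq_intros)
    from has_derivative_compose[OF this C_diff_imp_has_derivative[OF test_functions_C_diff[OF \<phi>, of "Suc 0"]]]
    show ?thesis
      unfolding has_field_derivative_def D_def
      by (rule has_derivative_eq_rhs) (simp add: sum_distrib_left sum_negf[symmetric] fun_eq_iff mult_ac)
  qed
  have lip: "\<bar>\<phi> (x - r' *\<^sub>R t) - \<phi> (x - r *\<^sub>R t)\<bar> \<le> L * \<bar>r' - r\<bar>" for x r r'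
    using field_differentiable_bound[of UNIV "\<lambda>r. \<phi> (x - r *\<^sub>R t)" "\<lambda>r. - D (x - r *\<^sub>R t)" L r' r]
      deriv L by (simp add: has_field_derivative_at_within)
  have test: "(\<lambda>x. \<phi> (x - s *\<^sub>R t)) \<in> test_functions UNIV" for s
    by (rule test_functions_shift[OF \<phi>]) simp
  have contD: "continuous_on UNIV (\<lambda>x. D (x - s *\<^sub>R t))" for s
    unfolding D_def
    by (intro continuous_intros test_functions_continuous[of _ UNIV] test_functions_shift[OF partial_deriv_test_functions[OF \<phi>]]) auto
  have int: "set_integrable lebesgue B (\<lambda>x. u x * \<phi> (x - s *\<^sub>R t))" for s
    by (rule test_functions_mult_integrable[OF u test B])
  have um: "set_borel_measurable lebesgue B u" using u by (auto simp: set_integrable_def set_borel_measurable_def)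
  have phm: "(\<lambda>x. \<phi> (x - s *\<^sub>R t)) \<in> borel_measurable lebesgue" for s
    by (intro continuous_imp_measurable_lebesgue test_functions_continuous[OF test])
  show ?thesis
    unfolding DERIV_def D_def[symmetric] tendsto_at_iff_sequentially
  proof (intro allI impI)
    fix X :: "nat \<Rightarrow> real" assume X: "\<forall>i. X i \<in> UNIV - {0}" "X \<longlonglongrightarrow> 0"
    have eq: "((\<lambda>h. ((LINT x:B|lebesgue. u x * \<phi> (x - (s + h) *\<^sub>R t)) - (LINT x:B|lebesgue. u x * \<phi> (x - s *\<^sub>R t))) / h) \<circ> X) =
        (\<lambda>n. LINT x:B|lebesgue. u x * ((\<phi> (x - (s + X n) *\<^sub>R t) - \<phi> (x - s *\<^sub>R t)) / X n))"
    proof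
      fix n
      have "((LINT x:B|lebesgue. u x * \<phi> (x - (s + X n) *\<^sub>R t)) - (LINT x:B|lebesgue. u x * \<phi> (x - s *\<^sub>R t))) / X n =
        (LINT x:B|lebesgue. u x * \<phi> (x - (s + X n) *\<^sub>R t) - u x * \<phi> (x - s *\<^sub>R t)) / X n"
        by (subst set_integral_diff(2)[OF int int]) simp
      also have "\<dots> = (LINT x:B|lebesgue. u x * ((\<phi> (x - (s + X n) *\<^sub>R t) - \<phi> (x - s *\<^sub>R t)) / X n))"
        by (subst set_integral_divide_zero[symmetric]) (simp add: algebra_simps diff_divide_distrib)
      finally show "((\<lambda>h. ((LINT x:B|lebesgue. u x * \<phi> (x - (s + h) *\<^sub>R t)) - (LINT x:B|lebesgue. u x * \<phi> (x - s *\<^sub>R t))) / h) \<circ> X) n =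
        (LINT x:B|lebesgue. u x * ((\<phi> (x - (s + X n) *\<^sub>R t) - \<phi> (x - s *\<^sub>R t)) / X n))" by simp
    qed
    have eq2: "- (LINT x:B|lebesgue. u x * D (x - s *\<^sub>R t)) = (LINT x:B|lebesgue. u x * (- D (x - s *\<^sub>R t)))"
      by (simp add: set_lebesgue_integral_def)
    show "((\<lambda>h. ((LINT x:B|lebesgue. u x * \<phi> (x - (s + h) *\<^sub>R t)) - (LINT x:B|lebesgue. u x * \<phi> (x - s *\<^sub>R t))) / h) \<circ> X)
       \<longlonglongrightarrow> - (LINT x:B|lebesgue. u x * D (x - s *\<^sub>R t))"
      unfolding eq eq2
    proof (rule set_integral_dominated_convergence)
      show "set_borel_measurable lebesgue B (\<lambda>x. u x * ((\<phi> (x - (s + X n) *\<^sub>R t) - \<phi> (x - s *\<^sub>R t)) / X n))" for n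
        by (intro set_borel_measurable_mult um lebesgue_set_measurable B borel_measurable_divide borel_measurable_diff phm) auto
      show "set_borel_measurable lebesgue B (\<lambda>x. u x * - D (x - s *\<^sub>R t))"
        by (intro set_borel_measurable_mult um lebesgue_set_measurable B continuous_imp_measurable_lebesgue continuous_on_minus contD)
      show "set_integrable lebesgue B (\<lambda>x. \<bar>u x\<bar> * L)"
        using set_integrable_abs[OF u] by simp
      show "\<bar>u x * ((\<phi> (x - (s + X n) *\<^sub>R t) - \<phi> (x - s *\<^sub>R t)) / X n)\<bar> \<le> \<bar>u x\<bar> * L" for n x
      proof -
        have "X n \<noteq> 0" using X(1) by auto
        then have "\<bar>(\<phi> (x - (s + X n) *\<^sub>R t) - \<phi> (x - s *\<^sub>R t)) / X n\<bar> \<le> L"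
          using lip[of x "s + X n" s] by (simp add: divide_le_eq)
        then show ?thesis unfolding abs_mult by (rule mult_left_mono) simp
      qed
      show "AE x in lebesgue. x \<in> B \<longrightarrow> (\<lambda>n. u x * ((\<phi> (x - (s + X n) *\<^sub>R t) - \<phi> (x - s *\<^sub>R t)) / X n)) \<longlonglongrightarrow> u x * - D (x - s *\<^sub>R t)"
      proof (intro AE_I2 impI tendsto_mult tendsto_const)
        fix x
        show "(\<lambda>n. (\<phi> (x - (s + X n) *\<^sub>R t) - \<phi> (x - s *\<^sub>R t)) / X n) \<longlonglongrightarrow> - D (x - s *\<^sub>R t)"
          using deriv[of x s] X unfolding DERIV_def tendsto_at_iff_sequentially by (auto simp: o_def)
      qed
    qed
  qed
qed

lemma set_integral_sum:
  fixes f :: "'b \<Rightarrow> 'a::euclidean_space \<Rightarrow> real"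
  assumes "\<And>i. i \<in> I \<Longrightarrow> set_integrable lebesgue U (f i)"
  shows "set_integrable lebesgue U (\<lambda>x. \<Sum>i\<in>I. f i x)"
    and "(LINT x:U|lebesgue. \<Sum>i\<in>I. f i x) = (\<Sum>i\<in>I. LINT x:U|lebesgue. f i x)"
  using Bochner_Integration.integrable_sum[of I lebesgue "\<lambda>i x. indicator U x *\<^sub>R f i x"]
    Bochner_Integration.integral_sum[of I lebesgue "\<lambda>i x. indicator U x *\<^sub>R f i x"] assms
  unfolding set_integrable_def set_lebesgue_integral_def scaleR_sum_right by blast+

text \<open>\<open>?V\<close> consists of the points \<open>x\<close> with both \<open>x\<close> and
  \<open>x + t\<close> in the ball. For a test function \<open>\<phi>\<close> on \<open>?V\<close>
  the pairing of the difference with \<open>\<phi>\<close> equals \<open>F 1 - F 0\<close>, where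
  \<open>F s\<close> pairs \<open>u\<close> with \<open>\<phi>\<close> translated by
  \<open>s *\<^sub>R t\<close>. The derivative of \<open>F\<close> moves onto the weak gradient, and
  Cauchy--Schwarz with \<open>L2_dual_bound\<close> turns the estimate of the pairing into one of
  the norm.\<close>

lemma weak_partial_translation_bound:
  fixes u :: "'a::euclidean_space \<Rightarrow> real"
  assumes u: "u \<in> L2_space (ball z \<delta>)" and G: "\<And>b. b \<in> Basis \<Longrightarrow> G b \<in> L2_space (ball z \<delta>)"
    and w: "\<And>b. b \<in> Basis \<Longrightarrow> weak_partial (ball z \<delta>) b u (G b)" and \<delta>: "\<delta> > 0"
  shows "(\<lambda>x. u (x + t) - u x) \<in> L2_space (ball z \<delta> \<inter> ball (z - t) \<delta>)"
    and "sqint (ball z \<delta> \<inter> ball (z - t) \<delta>) (\<lambda>x. u (x + t) - u x) \<le> (norm t)\<^sup>2 * (\<Sum>b\<in>Basis. sqint (ball z \<delta>) (G b))"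
proof -
  let ?B = "ball z \<delta>" and ?V = "ball z \<delta> \<inter> ball (z - t) \<delta>"
  have inV: "x \<in> ?V \<longleftrightarrow> x \<in> ?B \<and> x + t \<in> ?B" for x
    by (simp add: dist_norm algebra_simps)
  have BL: "?B \<in> sets lebesgue" "?V \<in> sets lebesgue" by auto
  define v where "v x = indicator ?B x * u x" for x
  have vm: "v \<in> borel_measurable lebesgue" unfolding v_def[abs_def] by (rule L2_spaceD(1)[OF u])
  have vm': "(\<lambda>x. v (x + t)) \<in> borel_measurable lebesgue" 
    using borel_measurable_lebesgue_affine[OF vm, of 1 t] by (simp add: add.commute)
  have "integrable lebesgue (\<lambda>x. (v x)\<^sup>2)"
    using L2_spaceD(2)[OF u] unfolding set_integrable_def
    by (rule Bochner_Integration.integrable_cong[THEN iffD1, rotated -1]) (auto simp: v_def indicator_def)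
  then have vt: "integrable lebesgue (\<lambda>x. (v (x + t))\<^sup>2)"
    using integrable_lebesgue_affine[of "\<lambda>x. (v x)\<^sup>2" 1 t] by (simp add: add.commute)
  have "(\<lambda>x. v (x + t)) \<in> L2_space ?V"
    unfolding L2_space_def using lebesgue_set_measurable[OF vm' BL(2)] integrable_mult_indicator[OF BL(2) vt]
    by (simp add: set_integrable_def)
  then have ut: "(\<lambda>x. u (x + t)) \<in> L2_space ?V"
  proof (rule L2_space_cong_on(1))
    fix x assume "x \<in> ?V"
    then have "x + t \<in> ?B" using inV by blast
    then show "u (x + t) = v (x + t)" by (simp add: v_def)
  qed
  have uV: "u \<in> L2_space ?V" by (rule L2_space_subset(1)[OF u]) (use BL in auto)
  show hL: "(\<lambda>x. u (x + t) - u x) \<in> L2_space ?V"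
    by (rule L2_space_diff[OF ut uV])
  define \<Gamma> where "\<Gamma> x = (\<Sum>b\<in>Basis. (t \<bullet> b) * G b x)" for x
  have \<Gamma>L: "\<Gamma> \<in> L2_space ?B" unfolding \<Gamma>_def by (intro L2_space_sum L2_space_cmult G)
  \<comment> \<open>\<open>\<Gamma>\<close> is the weak derivative in direction \<open>t\<close>;
    the estimate is Cauchy--Schwarz in the coordinates, pointwise.\<close>
  have \<Gamma>: "sqint ?B \<Gamma> \<le> (norm t)\<^sup>2 * (\<Sum>b\<in>Basis. sqint ?B (G b))"
  proof -
    have "sqint ?B \<Gamma> \<le> (LINT x:?B|lebesgue. (norm t)\<^sup>2 * (\<Sum>b\<in>Basis. (G b x)\<^sup>2))"
      unfolding sqint_def
    proof (rule set_integral_mono[OF L2_spaceD(2)[OF \<Gamma>L]])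
      show "set_integrable lebesgue ?B (\<lambda>x. (norm t)\<^sup>2 * (\<Sum>b\<in>Basis. (G b x)\<^sup>2))"
      proof (rule set_integrable_mult_right)
        show "set_integrable lebesgue ?B (\<lambda>x. \<Sum>b\<in>Basis. (G b x)\<^sup>2)"
          by (rule set_integral_sum(1)[OF L2_spaceD(2)[OF G]])
      qed
      fix x
      have "(norm t)\<^sup>2 = (\<Sum>b\<in>Basis. (t \<bullet> b)\<^sup>2)"
        by (simp add: norm_eq_sqrt_inner euclidean_inner[of t t] power2_eq_square sum_nonneg)
      then show "(\<Gamma> x)\<^sup>2 \<le> (norm t)\<^sup>2 * (\<Sum>b\<in>Basis. (G b x)\<^sup>2)"
        unfolding \<Gamma>_def using Cauchy_Schwarz_ineq_sum[of "\<lambda>b. t \<bullet> b" "\<lambda>b. G b x" Basis] by simp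
    qed
    also have "\<dots> = (norm t)\<^sup>2 * (\<Sum>b\<in>Basis. sqint ?B (G b))"
      unfolding sqint_def by (simp add: set_integral_sum(2)[OF L2_spaceD(2)[OF G]])
    finally show ?thesis .
  qed
  show "sqint ?V (\<lambda>x. u (x + t) - u x) \<le> (norm t)\<^sup>2 * (\<Sum>b\<in>Basis. sqint ?B (G b))"
  proof (rule L2_dual_bound[OF _ _ BL(2) hL])
    show "bump_approx ?V" by (intro bump_approx_Int bump_approx_ball \<delta>)
    show "0 \<le> (norm t)\<^sup>2 * (\<Sum>b\<in>Basis. sqint ?B (G b))"
      by (intro mult_nonneg_nonneg sum_nonneg sqint_nonneg) auto
    fix \<phi> assume \<phi>: "\<phi> \<in> test_functions ?V"
    \<comment> \<open>Convexity of the ball: the whole segment from \<open>x\<close> to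
      \<open>x + t\<close> stays in it, so every intermediate translate is an admissible test
      function on the ball.\<close>
    have shift: "(\<lambda>x. \<phi> (x - s *\<^sub>R t)) \<in> test_functions ?B" if "0 \<le> s" "s \<le> 1" for s
    proof (rule test_functions_shift[OF \<phi>])
      fix x assume "x \<in> ?V"
      then have "(1 - s) *\<^sub>R x + s *\<^sub>R (x + t) \<in> ?B"
        using that unfolding inV by (intro convexD[OF convex_ball]) auto
      then show "x + s *\<^sub>R t \<in> ?B" by (simp add: algebra_simps)
    qed
    have ui: "set_integrable lebesgue ?B u" by (rule L2_set_integrable[OF u]) auto
    define F where "F s = (LINT x:?B|lebesgue. u x * \<phi> (x - s *\<^sub>R t))" for s
    have F: "(F has_real_derivative (LINT x:?B|lebesgue. \<Gamma> x * \<phi> (x - s *\<^sub>R t))) (at s)" if s: "0 \<le> s" "s \<le> 1" for s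
    proof -
      have ip: "set_integrable lebesgue ?B (\<lambda>x. u x * partial_deriv b \<phi> (x - s *\<^sub>R t))" if "b \<in> Basis" for b
        by (rule test_functions_mult_integrable[OF ui test_functions_shift[OF partial_deriv_test_functions[OF \<phi> that], where W=UNIV]]) auto
      have iG: "set_integrable lebesgue ?B (\<lambda>x. G b x * \<phi> (x - s *\<^sub>R t))" if "b \<in> Basis" for b
        by (rule test_functions_mult_integrable[OF _ shift[OF s]]) (auto intro!: L2_set_integrable G that)
      have "- (LINT x:?B|lebesgue. u x * (\<Sum>b\<in>Basis. (t \<bullet> b) * partial_deriv b \<phi> (x - s *\<^sub>R t))) =
        - (\<Sum>b\<in>Basis. (t \<bullet> b) * (LINT x:?B|lebesgue. u x * partial_deriv b \<phi> (x - s *\<^sub>R t)))"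
      proof -
        have "(\<lambda>x. u x * (\<Sum>b\<in>Basis. (t \<bullet> b) * partial_deriv b \<phi> (x - s *\<^sub>R t))) =
          (\<lambda>x. \<Sum>b\<in>Basis. (t \<bullet> b) * (u x * partial_deriv b \<phi> (x - s *\<^sub>R t)))"
          by (simp add: sum_distrib_left mult.left_commute)
        then show ?thesis using ip by (simp add: set_integral_sum(2))
      qed
      also have "\<dots> = (\<Sum>b\<in>Basis. (t \<bullet> b) * (LINT x:?B|lebesgue. G b x * \<phi> (x - s *\<^sub>R t)))"
      proof -
        have "(LINT x:?B|lebesgue. u x * partial_deriv b \<phi> (x - s *\<^sub>R t)) = - (LINT x:?B|lebesgue. G b x * \<phi> (x - s *\<^sub>R t))"
          if "b \<in> Basis" for b
          using w[OF that] shift[OF s] partial_deriv_shift[OF test_functions_C_diff[OF \<phi>, of "Suc 0"]]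
          unfolding weak_partial_def by metis
        then show ?thesis by (simp add: sum_negf[symmetric])
      qed
      also have "\<dots> = (LINT x:?B|lebesgue. \<Gamma> x * \<phi> (x - s *\<^sub>R t))"
      proof -
        have "(\<lambda>x. \<Gamma> x * \<phi> (x - s *\<^sub>R t)) = (\<lambda>x. \<Sum>b\<in>Basis. (t \<bullet> b) * (G b x * \<phi> (x - s *\<^sub>R t)))"
          by (simp add: \<Gamma>_def sum_distrib_right mult.assoc)
        then show ?thesis using iG by (simp add: set_integral_sum(2))
      qed
      finally show ?thesis
        using has_real_derivative_integral_shift[OF ui BL(1) \<phi>, of t s] unfolding F_def[abs_def] by simp
    qed
    \<comment> \<open>The mean value theorem stands in for integration over \<open>s\<close>, so no
      second integration variable has to be justified.\<close>
    obtain \<xi> where \<xi>: "0 < \<xi>" "\<xi> < 1" "F 1 - F 0 = (1 - 0) * (LINT x:?B|lebesgue. \<Gamma> x * \<phi> (x - \<xi> *\<^sub>R t))"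
      using MVT2[of 0 1 F "\<lambda>s. LINT x:?B|lebesgue. \<Gamma> x * \<phi> (x - s *\<^sub>R t)"] F by auto
    have \<phi>c: "continuous_on UNIV \<phi>" by (rule test_functions_continuous[OF \<phi>])
    have \<phi>m: "\<phi> \<in> borel_measurable lebesgue" by (rule continuous_imp_measurable_lebesgue[OF \<phi>c])
    have \<phi>m': "(\<lambda>x. \<phi> (x - c)) \<in> borel_measurable lebesgue" for c
      using borel_measurable_lebesgue_affine[OF \<phi>m, of 1 "- c"] by (simp add: add.commute)
    \<comment> \<open>Translation invariance makes the bound independent of the intermediate point
      \<open>\<xi>\<close>.\<close>
    have sq: "sqint ?B (\<lambda>x. \<phi> (x - \<xi> *\<^sub>R t)) = sqint ?V \<phi>"
    proof -
      have "sqint ?B (\<lambda>x. \<phi> (x - \<xi> *\<^sub>R t)) = sqint UNIV (\<lambda>x. \<phi> (x - \<xi> *\<^sub>R t))"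
        unfolding sqint_def 
        by (rule set_integral_supported[symmetric]) (use test_functions_zero[OF shift, of \<xi>] \<xi> in auto)
      also have "\<dots> = sqint UNIV \<phi>"
        unfolding sqint_def set_lebesgue_integral_def
        using integral_lebesgue_translate[of "\<lambda>x. (\<phi> x)\<^sup>2" "- \<xi> *\<^sub>R t"] \<phi>m by simp
      also have "\<dots> = sqint ?V \<phi>"
        unfolding sqint_def 
        by (rule set_integral_supported) (use test_functions_zero[OF \<phi>] in auto)
      finally show ?thesis .
    qed
    have F1: "F 1 = (LINT x:?V|lebesgue. u (x + t) * \<phi> x)"
    proof -
      have "F 1 = (LINT x|lebesgue. v x * \<phi> (x - t))"
        unfolding F_def set_lebesgue_integral_def v_def by (simp add: mult.assoc)
      also have "\<dots> = (LINT x|lebesgue. v (x + t) * \<phi> x)"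
        using integral_lebesgue_translate[of "\<lambda>x. v x * \<phi> (x - t)" t] vm \<phi>m' by simp
      also have "\<dots> = (LINT x:UNIV|lebesgue. v (x + t) * \<phi> x)" by (simp add: set_lebesgue_integral_def)
      also have "\<dots> = (LINT x:?V|lebesgue. v (x + t) * \<phi> x)"
        by (rule set_integral_supported) (use test_functions_zero[OF \<phi>] in auto)
      also have "\<dots> = (LINT x:?V|lebesgue. u (x + t) * \<phi> x)"
        unfolding set_lebesgue_integral_def
      proof (intro Bochner_Integration.integral_cong refl)
        fix x show "indicator ?V x *\<^sub>R (v (x + t) * \<phi> x) = indicator ?V x *\<^sub>R (u (x + t) * \<phi> x)"
          using inV[of x] by (cases "x \<in> ?V") (auto simp: v_def indicator_def)
      qed
      finally show ?thesis .
    qed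
    have F0: "F 0 = (LINT x:?V|lebesgue. u x * \<phi> x)"
    proof -
      have "F 0 = (LINT x:?B|lebesgue. u x * \<phi> x)" unfolding F_def by simp
      also have "\<dots> = (LINT x:?V|lebesgue. u x * \<phi> x)"
        by (rule set_integral_supported) (use test_functions_zero[OF \<phi>] in auto)
      finally show ?thesis .
    qed
    have \<phi>L: "\<phi> \<in> L2_space ?V" by (rule continuous_imp_L2_space[OF \<phi>c]) auto
    have "(LINT x:?V|lebesgue. (u (x + t) - u x) * \<phi> x) = F 1 - F 0"
      unfolding F1 F0 left_diff_distrib
      by (rule set_integral_diff(2)) (intro L2_mult_integrable ut uV \<phi>L)+
    also have "\<dots> = (LINT x:?B|lebesgue. \<Gamma> x * \<phi> (x - \<xi> *\<^sub>R t))" using \<xi> by simp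
    also have "(\<dots>)\<^sup>2 \<le> sqint ?B \<Gamma> * sqint ?V \<phi>"
      unfolding sq[symmetric]
      by (rule L2_Cauchy_Schwarz[OF \<Gamma>L continuous_imp_L2_space[OF test_functions_continuous[OF shift]]]) (use \<xi> in auto)
    also have "\<dots> \<le> (norm t)\<^sup>2 * (\<Sum>b\<in>Basis. sqint ?B (G b)) * sqint ?V \<phi>"
      by (rule mult_right_mono[OF \<Gamma> sqint_nonneg])
    finally show "(LINT x:?V|lebesgue. (u (x + t) - u x) * \<phi> x)\<^sup>2 \<le> (norm t)\<^sup>2 * (\<Sum>b\<in>Basis. sqint ?B (G b)) * sqint ?V \<phi>" .
  qed (auto intro: bounded_Int)
qed

text \<open>The double integral below is taken over \<open>lborel\<close>, for which the interchange
  of integrals is available; this is the passage from Lebesgue measure.\<close>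

lemma nn_integral_sqint:
  assumes "f \<in> L2_space U"
  shows "(\<integral>\<^sup>+x. indicator U x * ennreal ((f x)\<^sup>2) \<partial>lborel) = ennreal (sqint U f)"
proof -
  have "(\<integral>\<^sup>+x. indicator U x * ennreal ((f x)\<^sup>2) \<partial>lborel) = (\<integral>\<^sup>+x. indicator U x * ennreal ((f x)\<^sup>2) \<partial>lebesgue)"
    by (simp add: nn_integral_completion)
  also have "\<dots> = (\<integral>\<^sup>+x. ennreal (indicator U x *\<^sub>R (f x)\<^sup>2) \<partial>lebesgue)"
    by (intro nn_integral_cong) (auto simp: indicator_def)
  also have "\<dots> = ennreal (LINT x|lebesgue. indicator U x *\<^sub>R (f x)\<^sup>2)"
    using L2_spaceD(2)[OF assms] unfolding set_integrable_def by (intro nn_integral_eq_integral) auto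
  finally show ?thesis by (simp add: sqint_def set_lebesgue_integral_def)
qed

text \<open>\<open>J x\<close> is the squared norm of \<open>u - u x\<close>. After the substitution
  \<open>y = x + t\<close> its integral over the ball is a double integral in \<open>x\<close> and
  \<open>t\<close>, and the translation estimate bounds it by \<open>c\<close> times the volume of
  the ball. So \<open>J\<close> is at most \<open>c\<close> somewhere. Borel measurability of
  \<open>u\<close> gives the joint measurability that interchanging the integrals requires.\<close>

lemma poincare_ball_borel:
  fixes u :: "'a::euclidean_space \<Rightarrow> real"
  assumes u[measurable]: "u \<in> borel_measurable borel" and uL: "u \<in> L2_space (ball z \<delta>)"
    and G: "\<And>b. b \<in> Basis \<Longrightarrow> G b \<in> L2_space (ball z \<delta>)"
    and w: "\<And>b. b \<in> Basis \<Longrightarrow> weak_partial (ball z \<delta>) b u (G b)" and \<delta>: "\<delta> > 0"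
  shows "\<exists>c. sqint (ball z \<delta>) (\<lambda>x. u x - c) \<le> 4 * 2 ^ DIM('a) * \<delta>\<^sup>2 * (\<Sum>b\<in>Basis. sqint (ball z \<delta>) (G b))"
proof -
  let ?B = "ball z \<delta>"
  define K where "K = (\<Sum>b\<in>Basis. sqint ?B (G b))"
  have K: "0 \<le> K" unfolding K_def by (intro sum_nonneg sqint_nonneg)
  define J where "J x = (\<integral>\<^sup>+y. indicator ?B y * ennreal ((u y - u x)\<^sup>2) \<partial>lborel)" for x
  define i where "i = (indicator ?B :: 'a \<Rightarrow> ennreal)"
  have [measurable]: "i \<in> borel_measurable borel" unfolding i_def by (intro borel_measurable_indicator borel_open open_ball)
  have Jm: "J \<in> borel_measurable lborel" unfolding J_def[abs_def] i_def[symmetric] by measurable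
  \<comment> \<open>Two points of the ball differ by less than \<open>2 * \<delta>\<close>, so
    longer translations contribute nothing; for the others \<open>norm t\<close> is replaced by
    \<open>2 * \<delta>\<close>.\<close>
  have inner: "(\<integral>\<^sup>+x. indicator ?B x * (indicator ?B (x + t) * ennreal ((u (x + t) - u x)\<^sup>2)) \<partial>lborel)
     \<le> indicator (ball 0 (2 * \<delta>)) t * ennreal (4 * \<delta>\<^sup>2 * K)" for t
  proof (cases "t \<in> ball 0 (2 * \<delta>)")
    case True
    let ?V = "ball z \<delta> \<inter> ball (z - t) \<delta>"
    have ind: "indicator ?B x * (indicator ?B (x + t) * a) = indicator ?V x * (a::ennreal)" for x a
      by (auto simp: indicator_def dist_norm algebra_simps)
    have "(norm t)\<^sup>2 \<le> (2 * \<delta>)\<^sup>2" using True by (intro power_mono) auto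
    then have le: "(norm t)\<^sup>2 * K \<le> 4 * \<delta>\<^sup>2 * K" using K by (intro mult_right_mono) (auto simp: power2_eq_square)
    have "(\<integral>\<^sup>+x. indicator ?B x * (indicator ?B (x + t) * ennreal ((u (x + t) - u x)\<^sup>2)) \<partial>lborel) = ennreal (sqint ?V (\<lambda>x. u (x + t) - u x))"
      unfolding ind by (rule nn_integral_sqint[OF weak_partial_translation_bound(1)[OF uL G w \<delta>]])
    also have "\<dots> \<le> ennreal (4 * \<delta>\<^sup>2 * K)"
      using weak_partial_translation_bound(2)[OF uL G w \<delta>, of t] le unfolding K_def[symmetric]
      by (intro ennreal_leI) simp
    finally show ?thesis using True by simp
  next
    case False
    have "\<not> (x \<in> ?B \<and> x + t \<in> ?B)" for x
      using False norm_triangle_ineq4[of "x + t - z" "x - z"] by (auto simp: dist_norm norm_minus_commute)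
    then have eq0: "indicator ?B x * (indicator ?B (x + t) * a) = (0::ennreal)" for x a
      by (auto simp: indicator_def)
    show ?thesis unfolding eq0 by simp
  qed
  have "(\<integral>\<^sup>+x. indicator ?B x * J x \<partial>lborel) =
    (\<integral>\<^sup>+x. (\<integral>\<^sup>+t. indicator ?B x * (indicator ?B (x + t) * ennreal ((u (x + t) - u x)\<^sup>2)) \<partial>lborel) \<partial>lborel)"
  proof (intro nn_integral_cong)
    fix x :: 'a
    have [measurable]: "(\<lambda>y. indicator ?B y * ennreal ((u y - u x)\<^sup>2)) \<in> borel_measurable borel"
      unfolding i_def[symmetric] by measurable
    have "J x = (\<integral>\<^sup>+y. indicator ?B y * ennreal ((u y - u x)\<^sup>2) \<partial>(distr lborel borel ((+) x)))"
      unfolding J_def lborel_distr_plus ..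
    also have "\<dots> = (\<integral>\<^sup>+t. indicator ?B (x + t) * ennreal ((u (x + t) - u x)\<^sup>2) \<partial>lborel)"
      by (subst nn_integral_distr) auto
    finally show "indicator ?B x * J x = (\<integral>\<^sup>+t. indicator ?B x * (indicator ?B (x + t) * ennreal ((u (x + t) - u x)\<^sup>2)) \<partial>lborel)"
      by (simp add: nn_integral_cmult)
  qed
  also have "\<dots> = (\<integral>\<^sup>+t. (\<integral>\<^sup>+x. indicator ?B x * (indicator ?B (x + t) * ennreal ((u (x + t) - u x)\<^sup>2)) \<partial>lborel) \<partial>lborel)"
    unfolding i_def[symmetric] by (rule lborel_pair.Fubini'[symmetric]) measurable
  also have "\<dots> \<le> (\<integral>\<^sup>+t. indicator (ball (0::'a) (2 * \<delta>)) t * ennreal (4 * \<delta>\<^sup>2 * K) \<partial>lborel)"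
  proof (rule nn_integral_mono)
    fix t :: 'a
    show "(\<integral>\<^sup>+x. indicator ?B x * (indicator ?B (x + t) * ennreal ((u (x + t) - u x)\<^sup>2)) \<partial>lborel)
      \<le> indicator (ball 0 (2 * \<delta>)) t * ennreal (4 * \<delta>\<^sup>2 * K)"
      using inner[of t] by simp
  qed
  also have "\<dots> = emeasure lborel (ball (0::'a) (2 * \<delta>)) * ennreal (4 * \<delta>\<^sup>2 * K)"
    by (subst nn_integral_multc) (auto intro!: borel_measurable_indicator)
  \<comment> \<open>The factor \<open>2 ^ DIM('a)\<close> in the Poincare constant is this ratio of
    volumes.\<close>
  also have "emeasure lborel (ball (0::'a) (2 * \<delta>)) = ennreal (2 ^ DIM('a)) * emeasure lborel ?B"
    using \<delta> by (simp add: emeasure_ball power_mult_distrib ennreal_mult[symmetric] mult_ac)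
  finally have main: "(\<integral>\<^sup>+x. indicator ?B x * J x \<partial>lborel) \<le> ennreal (4 * 2 ^ DIM('a) * \<delta>\<^sup>2 * K) * emeasure lborel ?B"
    using K by (simp add: ennreal_mult mult_ac)
  define c where "c = 4 * 2 ^ DIM('a) * \<delta>\<^sup>2 * K"
  have eqc: "(\<integral>\<^sup>+x. indicator ?B x * ennreal c \<partial>lborel) = emeasure lborel ?B * ennreal c"
    by (subst nn_integral_multc) (auto intro!: borel_measurable_indicator)
  \<comment> \<open>If \<open>J\<close> exceeded \<open>c\<close> on the whole ball, its integral
    would be strictly larger than \<open>c\<close> times the volume, which is finite and
    positive.\<close>
  have "\<exists>x\<in>?B. J x \<le> ennreal c"
  proof (rule ccontr)
    assume n: "\<not> (\<exists>x\<in>?B. J x \<le> ennreal c)"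
    have "(\<integral>\<^sup>+x. indicator ?B x * ennreal c \<partial>lborel) < (\<integral>\<^sup>+x. indicator ?B x * J x \<partial>lborel)"
    proof (rule nn_integral_less)
      show "(\<integral>\<^sup>+x. indicator ?B x * ennreal c \<partial>lborel) \<noteq> \<infinity>"
        using emeasure_lborel_ball_finite[of z \<delta>] by (simp add: eqc ennreal_mult_eq_top_iff)
      show "AE x in lborel. indicator ?B x * ennreal c \<le> indicator ?B x * J x"
        using n by (auto simp: indicator_def not_le intro!: AE_I2 less_imp_le)
      show "\<not> (AE x in lborel. indicator ?B x * J x \<le> indicator ?B x * ennreal c)"
      proof
        assume "AE x in lborel. indicator ?B x * J x \<le> indicator ?B x * ennreal c"
        then have "AE x in lborel. x \<notin> ?B"
          by eventually_elim (use n in auto)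
        then have "emeasure lborel ?B = 0"
          by (subst (asm) AE_iff_measurable[of ?B]) auto
        then show False using content_ball_gt_0_iff[of z \<delta>] \<delta> by (simp add: measure_def)
      qed
    qed (use Jm in \<open>unfold i_def[symmetric], measurable\<close>)
    also have "\<dots> \<le> ennreal c * emeasure lborel ?B" using main unfolding c_def .
    finally show False unfolding eqc by (simp add: mult.commute)
  qed
  then obtain x where x: "x \<in> ?B" "J x \<le> ennreal c" by blast
  have L: "(\<lambda>y. u y - u x) \<in> L2_space ?B"
    by (rule L2_space_diff[OF uL continuous_imp_L2_space]) auto
  have "ennreal (sqint ?B (\<lambda>y. u y - u x)) \<le> ennreal c"
    using nn_integral_sqint[OF L] x(2) by (simp add: J_def)
  moreover have "0 \<le> c" using K by (simp add: c_def)
  ultimately show ?thesis unfolding c_def K_def by (auto intro!: exI[of _ "u x"])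
qed

lemma set_integral_AE_cong:
  fixes f g :: "'a::euclidean_space \<Rightarrow> real"
  assumes "set_borel_measurable lebesgue U f" "AE x in lebesgue. x \<in> U \<longrightarrow> f x = g x"
  shows "(LINT x:U|lebesgue. f x) = (LINT x:U|lebesgue. g x)"
proof -
  have ae: "AE x in lebesgue. indicator U x *\<^sub>R f x = indicator U x *\<^sub>R g x"
    using assms(2) by eventually_elim (auto simp: indicator_def)
  have "(\<lambda>x. indicator U x *\<^sub>R g x) \<in> borel_measurable lebesgue"
    by (rule borel_measurable_AE[OF assms(1)[unfolded set_borel_measurable_def] ae])
  then show ?thesis
    unfolding set_lebesgue_integral_def using assms(1) ae
    by (intro integral_cong_AE) (auto simp: set_borel_measurable_def)
qed

text \<open>\<open>u\<close> is replaced by a Borel representative; neither the norms nor the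
  pairings with test functions notice a change on a null set.\<close>

lemma poincare_ball:
  fixes u :: "'a::euclidean_space \<Rightarrow> real"
  assumes uL: "u \<in> L2_space (ball z \<delta>)" and G: "\<And>b. b \<in> Basis \<Longrightarrow> G b \<in> L2_space (ball z \<delta>)"
    and w: "\<And>b. b \<in> Basis \<Longrightarrow> weak_partial (ball z \<delta>) b u (G b)" and \<delta>: "\<delta> > 0"
  shows "\<exists>c. sqint (ball z \<delta>) (\<lambda>x. u x - c) \<le> 4 * 2 ^ DIM('a) * \<delta>\<^sup>2 * (\<Sum>b\<in>Basis. sqint (ball z \<delta>) (G b))"
proof -
  let ?B = "ball z \<delta>"
  obtain v where v: "v \<in> borel_measurable borel" "AE x in lborel. indicator ?B x * u x = v x"
    using completion_ex_borel_measurable_real[OF L2_spaceD(1)[OF uL]] by auto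
  have "AE x in lebesgue. indicator ?B x * u x = v x" using v(2) by (rule AE_completion)
  then have ae: "AE x in lebesgue. x \<in> ?B \<longrightarrow> v x = u x" by eventually_elim auto
  have vL: "v \<in> L2_space ?B" by (rule L2_space_AE_cong(1)[OF uL ae])
  have "weak_partial ?B b v (G b)" if b: "b \<in> Basis" for b
    unfolding weak_partial_def
  proof
    fix \<phi> assume \<phi>: "\<phi> \<in> test_functions ?B"
    have "(LINT x:?B|lebesgue. v x * partial_deriv b \<phi> x) = (LINT x:?B|lebesgue. u x * partial_deriv b \<phi> x)"
    proof (rule set_integral_AE_cong)
      show "set_borel_measurable lebesgue ?B (\<lambda>x. v x * partial_deriv b \<phi> x)"
        using vL test_functions_continuous[OF partial_deriv_test_functions[OF \<phi> b]]
        by (intro set_borel_measurable_mult[OF _ lebesgue_set_measurable] continuous_imp_measurable_lebesgue) (auto simp: L2_space_def)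
      show "AE x in lebesgue. x \<in> ?B \<longrightarrow> v x * partial_deriv b \<phi> x = u x * partial_deriv b \<phi> x"
        using ae by eventually_elim auto
    qed
    then show "(LINT x:?B|lebesgue. v x * partial_deriv b \<phi> x) = - (LINT x:?B|lebesgue. G b x * \<phi> x)"
      using w[OF b] \<phi> by (simp add: weak_partial_def)
  qed
  from poincare_ball_borel[OF v(1) vL G this \<delta>] obtain c where
    c: "sqint ?B (\<lambda>x. v x - c) \<le> 4 * 2 ^ DIM('a) * \<delta>\<^sup>2 * (\<Sum>b\<in>Basis. sqint ?B (G b))" by blast
  have "sqint ?B (\<lambda>x. u x - c) = sqint ?B (\<lambda>x. v x - c)"
  proof (rule L2_space_AE_cong(2))
    show "(\<lambda>x. v x - c) \<in> L2_space ?B"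
      by (rule L2_space_diff[OF vL continuous_imp_L2_space]) auto
    show "AE x in lebesgue. x \<in> ?B \<longrightarrow> u x - c = v x - c" using ae by eventually_elim auto
  qed
  with c show ?thesis by (intro exI[of _ c]) simp
qed


section \<open>Iterated weak derivatives\<close>

lemma has_real_derivative_line:
  assumes "f differentiable (at (y + s *\<^sub>R a))"
  shows "((\<lambda>s. f (y + s *\<^sub>R a)) has_real_derivative partial_deriv a f (y + s *\<^sub>R a)) (at s)"
proof -
  have d: "(f has_derivative frechet_derivative f (at (y + s *\<^sub>R a))) (at (y + s *\<^sub>R a))"
    using assms by (simp add: frechet_derivative_works)
  then interpret linear "frechet_derivative f (at (y + s *\<^sub>R a))" by (rule has_derivative_linear)
  have "((\<lambda>s. y + s *\<^sub>R a) has_derivative (\<lambda>h. h *\<^sub>R a)) (at s)"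
    by (auto intro!: derivative_eq_intros)
  from has_derivative_compose[OF this d] show ?thesis
    unfolding has_field_derivative_def
    by (rule has_derivative_eq_rhs) (simp add: scale partial_deriv_def fun_eq_iff mult.commute)
qed

lemma C_diff_differentiable: "C_diff (Suc n) f \<Longrightarrow> f differentiable (at x)"
  by (auto simp: differentiable_on_def)

text \<open>Two mean value theorems: along \<open>a\<close>, applied to the increment in direction
  \<open>b\<close>, and along \<open>b\<close>, applied to the resulting increment of
  \<open>partial_deriv a f\<close>.\<close>

lemma second_difference_eq:
  fixes f :: "'a::euclidean_space \<Rightarrow> real"
  assumes f: "C_diff (Suc (Suc 0)) f" and ab: "a \<in> Basis" "b \<in> Basis" and h: "h > 0"
  shows "\<exists>p. dist x p \<le> 2 * h \<and>
    f (x + h *\<^sub>R a + h *\<^sub>R b) - f (x + h *\<^sub>R a) - f (x + h *\<^sub>R b) + f x = h\<^sup>2 * partial_deriv b (partial_deriv a f) p"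
proof -
  have fa: "C_diff (Suc 0) (partial_deriv a f)" using f ab by simp
  have "\<exists>\<xi>>0. \<xi> < h \<and> (f ((x + h *\<^sub>R b) + h *\<^sub>R a) - f (x + h *\<^sub>R a)) - (f ((x + h *\<^sub>R b) + 0 *\<^sub>R a) - f (x + 0 *\<^sub>R a)) =
     (h - 0) * (partial_deriv a f ((x + h *\<^sub>R b) + \<xi> *\<^sub>R a) - partial_deriv a f (x + \<xi> *\<^sub>R a))"
    by (rule MVT2[OF h]) (auto intro!: DERIV_diff has_real_derivative_line C_diff_differentiable[OF f])
  then obtain \<xi> where \<xi>: "0 < \<xi>" "\<xi> < h" 
    "f (x + h *\<^sub>R a + h *\<^sub>R b) - f (x + h *\<^sub>R a) - f (x + h *\<^sub>R b) + f x = 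
     h * (partial_deriv a f ((x + \<xi> *\<^sub>R a) + h *\<^sub>R b) - partial_deriv a f ((x + \<xi> *\<^sub>R a) + 0 *\<^sub>R b))"
    by (auto simp: algebra_simps)
  have "\<exists>\<zeta>>0. \<zeta> < h \<and> partial_deriv a f ((x + \<xi> *\<^sub>R a) + h *\<^sub>R b) - partial_deriv a f ((x + \<xi> *\<^sub>R a) + 0 *\<^sub>R b) =
     (h - 0) * partial_deriv b (partial_deriv a f) ((x + \<xi> *\<^sub>R a) + \<zeta> *\<^sub>R b)"
    by (rule MVT2[OF h]) (auto intro!: has_real_derivative_line C_diff_differentiable[OF fa])
  then obtain \<zeta> where \<zeta>: "0 < \<zeta>" "\<zeta> < h" 
    "partial_deriv a f ((x + \<xi> *\<^sub>R a) + h *\<^sub>R b) - partial_deriv a f ((x + \<xi> *\<^sub>R a) + 0 *\<^sub>R b) =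
     h * partial_deriv b (partial_deriv a f) ((x + \<xi> *\<^sub>R a) + \<zeta> *\<^sub>R b)" by auto
  have "dist x ((x + \<xi> *\<^sub>R a) + \<zeta> *\<^sub>R b) = norm (\<xi> *\<^sub>R a + \<zeta> *\<^sub>R b)" 
    by (simp add: dist_norm norm_minus_commute algebra_simps)
  also have "\<dots> \<le> 2 * h" using norm_triangle_ineq[of "\<xi> *\<^sub>R a" "\<zeta> *\<^sub>R b"] \<xi> \<zeta> ab by simp
  finally show ?thesis using \<xi>(3) \<zeta>(3) by (auto simp: power2_eq_square)
qed

text \<open>The second difference is symmetric in \<open>a\<close> and \<open>b\<close>. So the two
  mixed derivatives agree at points \<open>p n\<close> and \<open>q n\<close> near \<open>x\<close>,
  and both sequences tend to \<open>x\<close>, where the mixed derivatives are continuous.\<close>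

lemma partial_deriv_commute:
  fixes f :: "'a::euclidean_space \<Rightarrow> real"
  assumes f: "C_diff (Suc (Suc 0)) f" and ab: "a \<in> Basis" "b \<in> Basis"
  shows "partial_deriv a (partial_deriv b f) = partial_deriv b (partial_deriv a f)"
proof
  fix x
  have "\<exists>p q. dist x p \<le> 2 * inverse (real (Suc n)) \<and> dist x q \<le> 2 * inverse (real (Suc n)) \<and>
     partial_deriv b (partial_deriv a f) p = partial_deriv a (partial_deriv b f) q" for n
  proof -
    let ?h = "inverse (real (Suc n))"
    have h: "?h > 0" by simp
    obtain p where p: "dist x p \<le> 2 * ?h" "f (x + ?h *\<^sub>R a + ?h *\<^sub>R b) - f (x + ?h *\<^sub>R a) - f (x + ?h *\<^sub>R b) + f x = ?h\<^sup>2 * partial_deriv b (partial_deriv a f) p"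
      using second_difference_eq[OF f ab h, of x] by blast
    obtain q where q: "dist x q \<le> 2 * ?h" "f (x + ?h *\<^sub>R b + ?h *\<^sub>R a) - f (x + ?h *\<^sub>R b) - f (x + ?h *\<^sub>R a) + f x = ?h\<^sup>2 * partial_deriv a (partial_deriv b f) q"
      using second_difference_eq[OF f ab(2,1) h, of x] by blast
    have "?h\<^sup>2 * partial_deriv b (partial_deriv a f) p = ?h\<^sup>2 * partial_deriv a (partial_deriv b f) q"
      unfolding p(2)[symmetric] q(2)[symmetric] by (simp add: algebra_simps)
    then show ?thesis using p(1) q(1) h by (auto simp: mult_cancel_left)
  qed
  then obtain p q where pq: "\<And>n. dist x (p n) \<le> 2 * inverse (real (Suc n))" "\<And>n. dist x (q n) \<le> 2 * inverse (real (Suc n))"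
    "\<And>n. partial_deriv b (partial_deriv a f) (p n) = partial_deriv a (partial_deriv b f) (q n)" by metis
  have lim: "r \<longlonglongrightarrow> x" if "\<And>n. dist x (r n) \<le> 2 * inverse (real (Suc n))" for r
  proof -
    have "(\<lambda>n. 2 * inverse (real (Suc n))) \<longlonglongrightarrow> 2 * 0"
      by (intro tendsto_mult tendsto_const LIMSEQ_inverse_real_of_nat)
    then have z: "(\<lambda>n. 2 * inverse (real (Suc n))) \<longlonglongrightarrow> 0" by simp
    show ?thesis
      by (rule metric_tendsto_imp_tendsto[OF z]) (use that in \<open>auto simp: dist_commute\<close>)
  qed
  have c: "isCont (partial_deriv b (partial_deriv a f)) x" "isCont (partial_deriv a (partial_deriv b f)) x"
    using f ab by (auto simp: continuous_on_eq_continuous_at)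
  have "(\<lambda>n. partial_deriv b (partial_deriv a f) (p n)) \<longlonglongrightarrow> partial_deriv b (partial_deriv a f) x"
    by (rule isCont_tendsto_compose[OF c(1) lim[OF pq(1)]])
  moreover have "(\<lambda>n. partial_deriv a (partial_deriv b f) (q n)) \<longlonglongrightarrow> partial_deriv a (partial_deriv b f) x"
    by (rule isCont_tendsto_compose[OF c(2) lim[OF pq(2)]])
  ultimately show "partial_deriv a (partial_deriv b f) x = partial_deriv b (partial_deriv a f) x"
    unfolding pq(3) by (rule LIMSEQ_unique[symmetric])
qed

lemma C_diff_funpow_partial:
  assumes "\<And>n. C_diff n f" "c \<in> Basis"
  shows "C_diff n ((partial_deriv c ^^ k) f)"
  using assms
proof (induction k arbitrary: n)
  case (Suc k)
  then have "C_diff (Suc n) ((partial_deriv c ^^ k) f)" by blast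
  then show ?case using Suc.prems(2) by simp
qed simp

lemma partial_deriv_funpow_commute:
  assumes "\<And>n. C_diff n f" "b \<in> Basis" "c \<in> Basis"
  shows "partial_deriv b ((partial_deriv c ^^ k) f) = (partial_deriv c ^^ k) (partial_deriv b f)"
proof (induction k)
  case (Suc k)
  show ?case
    using partial_deriv_commute[OF C_diff_funpow_partial[OF assms(1,3)] assms(2,3)] Suc by simp
qed simp

text \<open>The additional derivative is to be the one applied before all others, as the weak
  formulation needs it on the test function. It has to commute with the directions that precede
  \<open>b\<close> in the list.\<close>

lemma fold_partial_deriv_Suc:
  assumes "\<And>n. C_diff n f" "set bs \<subseteq> Basis" "distinct bs" "b \<in> set bs"
  shows "fold (\<lambda>c. partial_deriv c ^^ (\<alpha>(b := Suc (\<alpha> b))) c) bs f = fold (\<lambda>c. partial_deriv c ^^ \<alpha> c) bs (partial_deriv b f)"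
  using assms
proof (induction bs arbitrary: f)
  case (Cons c cs)
  show ?case
  proof (cases "c = b")
    case True
    have "fold (\<lambda>c. partial_deriv c ^^ (\<alpha>(b := Suc (\<alpha> b))) c) cs g = fold (\<lambda>c. partial_deriv c ^^ \<alpha> c) cs g" for g :: "'a \<Rightarrow> real"
      by (rule fold_cong) (use Cons.prems True in auto)
    then show ?thesis using True by (simp add: funpow_swap1)
  next
    case False
    have "fold (\<lambda>c. partial_deriv c ^^ (\<alpha>(b := Suc (\<alpha> b))) c) (c # cs) f = 
      fold (\<lambda>c. partial_deriv c ^^ (\<alpha>(b := Suc (\<alpha> b))) c) cs ((partial_deriv c ^^ \<alpha> c) f)"
      using False by simp
    also have "\<dots> = fold (\<lambda>c. partial_deriv c ^^ \<alpha> c) cs (partial_deriv b ((partial_deriv c ^^ \<alpha> c) f))"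
      by (rule Cons.IH) (use Cons.prems(2-) False C_diff_funpow_partial[OF Cons.prems(1)] in auto)
    also have "partial_deriv b ((partial_deriv c ^^ \<alpha> c) f) = (partial_deriv c ^^ \<alpha> c) (partial_deriv b f)"
      by (rule partial_deriv_funpow_commute) (use Cons.prems False in auto)
    finally show ?thesis by simp
  qed
qed simp

section \<open>Weak derivatives of higher order as iterated first order ones\<close>

lemma basis_list: "distinct (basis_list :: 'a::euclidean_space list)" "set (basis_list :: 'a list) = Basis"
proof -
  have "\<exists>bs. distinct bs \<and> set bs = (Basis :: 'a set)"
    using finite_distinct_list[OF finite_Basis] by blast
  from someI_ex[OF this] show "distinct (basis_list :: 'a list)" "set (basis_list :: 'a list) = Basis"
    by (simp_all add: basis_list_def)
qed

lemma multi_deriv_Suc: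
  assumes "\<And>n. C_diff n f" "b \<in> Basis"
  shows "multi_deriv (\<alpha>(b := Suc (\<alpha> b))) f = multi_deriv \<alpha> (partial_deriv b f)"
  unfolding multi_deriv_def using assms basis_list by (intro fold_partial_deriv_Suc) auto

lemma multi_deriv_0: "multi_deriv (\<lambda>_. 0) f = f"
proof -
  have "fold (\<lambda>b. partial_deriv b ^^ 0) bs f = f" for bs :: "'a list" by (induction bs) auto
  then show ?thesis by (simp add: multi_deriv_def)
qed

lemma mi_order_Suc: "b \<in> Basis \<Longrightarrow> mi_order (\<alpha>(b := Suc (\<alpha> b))) = Suc (mi_order \<alpha>)"
  unfolding mi_order_def by (subst (1 2) sum.remove[of Basis b]) (auto intro: sum.cong)

lemma mi_order_0: "mi_order (\<lambda>_. 0) = 0"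
  by (simp add: mi_order_def)

text \<open>Testing \<open>g\<close> with \<open>partial_deriv b \<phi>\<close> and
  \<open>g'\<close> with \<open>\<phi>\<close> produces the same integral of \<open>w\<close>; the
  orders differ by one, which leaves one minus sign.\<close>

lemma is_weak_deriv_imp_weak_partial:
  assumes "is_weak_deriv \<alpha> U w g" "is_weak_deriv (\<alpha>(b := Suc (\<alpha> b))) U w g'" "b \<in> Basis"
  shows "weak_partial U b g g'"
  unfolding weak_partial_def
proof
  fix \<phi> assume \<phi>: "\<phi> \<in> test_functions U"
  have "(-1) ^ mi_order \<alpha> * (LINT x:U|lebesgue. g x * partial_deriv b \<phi> x) = (LINT x:U|lebesgue. w x * multi_deriv \<alpha> (partial_deriv b \<phi>) x)"
    using assms(1) partial_deriv_test_functions[OF \<phi> assms(3)] by (simp add: is_weak_deriv_def)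
  also have "\<dots> = (LINT x:U|lebesgue. w x * multi_deriv (\<alpha>(b := Suc (\<alpha> b))) \<phi> x)"
    by (simp add: multi_deriv_Suc[OF test_functions_C_diff[OF \<phi>] assms(3)])
  also have "\<dots> = (-1) ^ mi_order (\<alpha>(b := Suc (\<alpha> b))) * (LINT x:U|lebesgue. g' x * \<phi> x)"
    using assms(2) \<phi> by (simp only: is_weak_deriv_def)
  also have "\<dots> = (-1) ^ mi_order \<alpha> * - (LINT x:U|lebesgue. g' x * \<phi> x)"
    by (simp only: mi_order_Suc[OF assms(3)]) simp
  finally show "(LINT x:U|lebesgue. g x * partial_deriv b \<phi> x) = - (LINT x:U|lebesgue. g' x * \<phi> x)"
    by (simp only: mult_cancel_left) simp
qed

text \<open>A test function on \<open>V\<close> is one on \<open>U\<close>, and both it and its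
  derivative vanish outside \<open>V\<close>, so the integrals over \<open>U\<close> and
  \<open>V\<close> coincide.\<close>

lemma is_weak_deriv_subset:
  assumes "is_weak_deriv \<alpha> U f g" "V \<subseteq> U"
  shows "is_weak_deriv \<alpha> V f g"
proof -
  have "(LINT x:V|lebesgue. f x * multi_deriv \<alpha> \<phi> x) = (-1) ^ mi_order \<alpha> * (LINT x:V|lebesgue. g x * \<phi> x)"
    if \<phi>: "\<phi> \<in> test_functions V" for \<phi>
  proof -
    have md: "multi_deriv \<alpha> \<phi> \<in> test_functions V"
    proof -
      have "fold (\<lambda>b. partial_deriv b ^^ \<alpha> b) bs \<psi> \<in> test_functions V" if "set bs \<subseteq> Basis" "\<psi> \<in> test_functions V" for bs \<psi>
        using that
      proof (induction bs arbitrary: \<psi>)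
        case (Cons b bs)
        have "(partial_deriv b ^^ k) \<psi> \<in> test_functions V" for k
          by (induction k) (use Cons.prems partial_deriv_test_functions in auto)
        then show ?case using Cons by simp
      qed simp
      then show ?thesis unfolding multi_deriv_def using \<phi> basis_list(2)[where 'a = 'a] by blast
    qed
    have "(LINT x:V|lebesgue. f x * multi_deriv \<alpha> \<phi> x) = (LINT x:U|lebesgue. f x * multi_deriv \<alpha> \<phi> x)"
      by (rule set_integral_supported[OF assms(2), symmetric]) (use test_functions_zero[OF md] in auto)
    moreover have "(LINT x:V|lebesgue. g x * \<phi> x) = (LINT x:U|lebesgue. g x * \<phi> x)"
      by (rule set_integral_supported[OF assms(2), symmetric]) (use test_functions_zero[OF \<phi>] in auto)
    ultimately show ?thesis using assms test_functions_mono[OF \<phi> assms(2)] by (simp add: is_weak_deriv_def)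
  qed
  then show ?thesis using assms unfolding is_weak_deriv_def locally_integrable_def by blast
qed

text \<open>The choice in \<open>weak_deriv\<close> ranges over all locally integrable weak
  derivatives, so square integrability of the chosen one has to be transferred from the witness in
  \<open>sobolev_space\<close>, by uniqueness up to null sets.\<close>

lemma sobolev_space_weak_deriv:
  assumes "open U" "f \<in> sobolev_space m U" "\<alpha> \<in> multi_indices m"
  shows "is_weak_deriv \<alpha> U f (weak_deriv \<alpha> U f)" "weak_deriv \<alpha> U f \<in> L2_space U"
proof -
  obtain g where g: "g \<in> L2_space U" "is_weak_deriv \<alpha> U f g"
    using assms(2,3) by (auto simp: sobolev_space_def)
  then show w: "is_weak_deriv \<alpha> U f (weak_deriv \<alpha> U f)"
    unfolding weak_deriv_def by (metis someI)
  show "weak_deriv \<alpha> U f \<in> L2_space U"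
    by (rule L2_space_AE_cong(1)[OF g(1) is_weak_deriv_unique[OF assms(1) w g(2)]])
qed

lemma sobolev_space_subset:
  assumes "f \<in> sobolev_space m U" "V \<subseteq> U" "open V"
  shows "f \<in> sobolev_space m V"
proof -
  have V: "V \<in> sets lebesgue" using assms(3) by simp
  show ?thesis using assms L2_space_subset(1)[OF _ assms(2) V] is_weak_deriv_subset[OF _ assms(2)]
    unfolding sobolev_space_def by blast
qed

section \<open>The weak gradient of a smooth function\<close>

lemma C_diff_add: "C_diff n f \<Longrightarrow> C_diff n g \<Longrightarrow> C_diff n (\<lambda>x. f x + g x)"
proof (induction n arbitrary: f g)
  case (Suc n)
  have d: "(f has_derivative frechet_derivative f (at x)) (at x)" "(g has_derivative frechet_derivative g (at x)) (at x)" for x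
    using Suc.prems by (auto simp: frechet_derivative_works[symmetric] differentiable_on_def)
  have "partial_deriv b (\<lambda>x. f x + g x) = (\<lambda>x. partial_deriv b f x + partial_deriv b g x)" for b
    using partial_derivI[OF has_derivative_add[OF d]] by (auto simp: partial_deriv_def)
  then show ?case using Suc by (auto simp: differentiable_on_def)
qed (auto intro: continuous_intros)

lemma partial_deriv_mult:
  assumes "f differentiable (at x)" "g differentiable (at x)"
  shows "partial_deriv b (\<lambda>x. f x * g x) x = f x * partial_deriv b g x + partial_deriv b f x * g x"
proof -
  have d: "(f has_derivative frechet_derivative f (at x)) (at x)" "(g has_derivative frechet_derivative g (at x)) (at x)"
    using assms by (auto simp: frechet_derivative_works[symmetric])
  show ?thesis
    using partial_derivI[OF has_derivative_mult[OF d]] by (auto simp: partial_deriv_def)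
qed

lemma C_diff_mult: "C_diff n f \<Longrightarrow> C_diff n g \<Longrightarrow> C_diff n (\<lambda>x. f x * g x)"
proof (induction n arbitrary: f g)
  case (Suc n)
  have d: "f differentiable (at x)" "g differentiable (at x)" for x
    using Suc.prems by (auto simp: differentiable_on_def)
  have "partial_deriv b (\<lambda>x. f x * g x) = (\<lambda>x. f x * partial_deriv b g x + partial_deriv b f x * g x)" for b
    using partial_deriv_mult[OF d] by auto
  moreover have "C_diff n f" "C_diff n g" using Suc.prems C_diff_antimono by blast+
  ultimately show ?case using Suc d by (auto simp: differentiable_on_def intro!: C_diff_add)
qed (auto intro: continuous_intros)

text \<open>The integral of a translate does not depend on the translation, and its derivative at 0
  is minus the integral of the partial derivative.\<close>

lemma integral_partial_deriv_test_function:
  assumes \<phi>: "\<phi> \<in> test_functions U" and b: "b \<in> Basis"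
  shows "(LINT x:U|lebesgue. partial_deriv b \<phi> x) = 0"
proof -
  have "bounded (closure {x. \<phi> x \<noteq> 0})" using \<phi> by (auto simp: test_functions_def compact_imp_bounded)
  then obtain R where R: "\<And>x. x \<in> closure {x. \<phi> x \<noteq> 0} \<Longrightarrow> norm x \<le> R" by (auto simp: bounded_iff)
  \<comment> \<open>The larger ball leaves room for translations by less than 1, so that
    \<open>F\<close> is constant near 0.\<close>
  let ?W = "ball (0::'a) (\<bar>R\<bar> + 1)" and ?B = "ball (0::'a) (\<bar>R\<bar> + 2)"
  have \<phi>W: "\<phi> \<in> test_functions ?W"
    using \<phi> R by (force simp: test_functions_def)
  have \<phi>B: "\<phi> \<in> test_functions ?B" by (rule test_functions_mono[OF \<phi>W]) auto
  have shift: "(\<lambda>x. \<phi> (x - s *\<^sub>R b)) \<in> test_functions ?B" if "\<bar>s\<bar> < 1" for s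
  proof (rule test_functions_shift[OF \<phi>W])
    fix x assume "x \<in> ?W" then show "x + s *\<^sub>R b \<in> ?B"
      using norm_triangle_ineq[of x "s *\<^sub>R b"] that b by auto
  qed
  have i: "set_integrable lebesgue ?B (\<lambda>x. 1 :: real)"
    by (rule L2_set_integrable[OF continuous_imp_L2_space]) auto
  define F where "F s = (LINT x:?B|lebesgue. 1 * \<phi> (x - s *\<^sub>R b))" for s
  have F: "(F has_real_derivative - (LINT x:?B|lebesgue. 1 * (\<Sum>c\<in>Basis. (b \<bullet> c) * partial_deriv c \<phi> (x - 0 *\<^sub>R b)))) (at 0)"
    unfolding F_def[abs_def] by (rule has_real_derivative_integral_shift[OF i _ \<phi>]) auto
  have \<phi>m: "\<phi> \<in> borel_measurable lebesgue" by (rule continuous_imp_measurable_lebesgue[OF test_functions_continuous[OF \<phi>]])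
  have Fc: "F s = (LINT x|lebesgue. \<phi> x)" if "\<bar>s\<bar> < 1" for s
  proof -
    have "F s = (LINT x:UNIV|lebesgue. \<phi> (x - s *\<^sub>R b))"
      unfolding F_def mult_1 by (rule set_integral_supported[symmetric]) (use test_functions_zero[OF shift[OF that]] in auto)
    then show ?thesis using integral_lebesgue_translate[OF \<phi>m, of "- s *\<^sub>R b"] by (simp add: set_lebesgue_integral_def)
  qed
  have "(F has_real_derivative 0) (at 0)"
  proof (rule DERIV_cong_ev[THEN iffD1, rotated -1, OF _ refl])
    show "((\<lambda>s. LINT x|lebesgue. \<phi> x) has_real_derivative 0) (at 0)" by simp
    show "\<forall>\<^sub>F s in nhds 0. (LINT x|lebesgue. \<phi> x) = F s"
      by (rule eventually_mono[OF eventually_nhds_in_open[of "ball 0 1"]]) (auto simp: Fc)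
  qed auto
  from DERIV_unique[OF F this] have "(LINT x:?B|lebesgue. (\<Sum>c\<in>Basis. (b \<bullet> c) * partial_deriv c \<phi> x)) = 0" by simp
  also have "(\<lambda>x. \<Sum>c\<in>Basis. (b \<bullet> c) * partial_deriv c \<phi> x) = partial_deriv b \<phi>"
    using b by (auto simp: inner_Basis if_distrib[of "\<lambda>r. r * _"] cong: if_cong)
  finally have 0: "(LINT x:?B|lebesgue. partial_deriv b \<phi> x) = 0" .
  have "(LINT x:?B|lebesgue. partial_deriv b \<phi> x) = (LINT x:UNIV|lebesgue. partial_deriv b \<phi> x)"
    by (rule set_integral_supported[symmetric])
       (use test_functions_zero[OF partial_deriv_test_functions[OF \<phi>B b]] in auto)
  also have "\<dots> = (LINT x:U|lebesgue. partial_deriv b \<phi> x)"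
    by (rule set_integral_supported) (use test_functions_zero[OF partial_deriv_test_functions[OF \<phi> b]] in auto)
  finally show ?thesis using 0 by simp
qed

text \<open>Integration by parts: the product \<open>p * \<phi>\<close> is a test function, so the
  integral of its partial derivative vanishes, and the product rule splits it.\<close>

lemma weak_partial_smooth:
  assumes p: "smooth p" and b: "b \<in> Basis" and U: "bounded U" "U \<in> sets lebesgue"
  shows "weak_partial U b p (partial_deriv b p)"
  unfolding weak_partial_def
proof
  fix \<phi> assume \<phi>: "\<phi> \<in> test_functions U"
  have sub: "closure {x. p x * \<phi> x \<noteq> 0} \<subseteq> closure {x. \<phi> x \<noteq> 0}" by (rule closure_mono) auto
  have t: "(\<lambda>x. p x * \<phi> x) \<in> test_functions U"
    using \<phi> sub compact_Int_closed[of "closure {x. \<phi> x \<noteq> 0}" "closure {x. p x * \<phi> x \<noteq> 0}"] smooth_C_diff[OF p]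
    by (auto simp: test_functions_def Int_absorb1 intro: C_diff_mult)
  have pb: "smooth (partial_deriv b p)" using smooth_deriv[OF p] by blast
  have i: "set_integrable lebesgue U q" if "smooth q" for q
    by (rule L2_set_integrable[OF continuous_imp_L2_space[OF smooth_continuous[OF that] U] U])
  have "partial_deriv b (\<lambda>x. p x * \<phi> x) = (\<lambda>x. p x * partial_deriv b \<phi> x + partial_deriv b p x * \<phi> x)"
    using partial_deriv_mult[of p _ \<phi>] smooth_deriv[OF p] C_diff_differentiable[OF test_functions_C_diff[OF \<phi>]] by auto
  then have "0 = (LINT x:U|lebesgue. p x * partial_deriv b \<phi> x + partial_deriv b p x * \<phi> x)"
    using integral_partial_deriv_test_function[OF t b] by simp
  also have "\<dots> = (LINT x:U|lebesgue. p x * partial_deriv b \<phi> x) + (LINT x:U|lebesgue. partial_deriv b p x * \<phi> x)"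
    by (intro set_integral_add(2) test_functions_mult_integrable[OF i] partial_deriv_test_functions[OF \<phi> b] p pb \<phi> U)
       (use \<phi> partial_deriv_test_functions[OF \<phi> b] U in auto)
  finally show "(LINT x:U|lebesgue. p x * partial_deriv b \<phi> x) = - (LINT x:U|lebesgue. partial_deriv b p x * \<phi> x)" by simp
qed

lemma weak_partial_diff:
  assumes "weak_partial U b u g" "weak_partial U b u' g'" "b \<in> Basis" "bounded U" "U \<in> sets lebesgue"
    "u \<in> L2_space U" "g \<in> L2_space U" "u' \<in> L2_space U" "g' \<in> L2_space U"
  shows "weak_partial U b (\<lambda>x. u x - u' x) (\<lambda>x. g x - g' x)"
  unfolding weak_partial_def
proof
  fix \<phi> assume \<phi>: "\<phi> \<in> test_functions U"
  note d\<phi> = partial_deriv_test_functions[OF \<phi> assms(3)]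
  have i: "set_integrable lebesgue U (\<lambda>x. q x * \<psi> x)" if "q \<in> L2_space U" "\<psi> \<in> test_functions U" for q \<psi>
    by (rule test_functions_mult_integrable[OF L2_set_integrable[OF that(1) assms(4,5)] that(2) assms(5)])
  show "(LINT x:U|lebesgue. (u x - u' x) * partial_deriv b \<phi> x) = - (LINT x:U|lebesgue. (g x - g' x) * \<phi> x)"
    unfolding left_diff_distrib set_integral_diff(2)[OF i[OF assms(6) d\<phi>] i[OF assms(8) d\<phi>]]
      set_integral_diff(2)[OF i[OF assms(7) \<phi>] i[OF assms(9) \<phi>]]
    using assms(1,2) \<phi> unfolding weak_partial_def by simp
qed


section \<open>The Bramble--Hilbert lemma\<close>

definition mi_exact :: "nat \<Rightarrow> ('a::euclidean_space \<Rightarrow> nat) set" where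
  "mi_exact n = {\<alpha>. (\<forall>b. b \<notin> Basis \<longrightarrow> \<alpha> b = 0) \<and> mi_order \<alpha> = n}"

text \<open>Division by the factorials makes differentiation lower the exponent without creating a
  factor.\<close>

definition mon :: "('a::euclidean_space \<Rightarrow> nat) \<Rightarrow> 'a \<Rightarrow> real" where
  "mon \<alpha> x = (\<Prod>b\<in>Basis. (x \<bullet> b) ^ \<alpha> b / fact (\<alpha> b))"

text \<open>The derivative of order \<open>\<beta>\<close> of the polynomial with coefficients
  \<open>c\<close> on the index set \<open>A\<close>, by formula. All derivatives of one polynomial
  share the same \<open>c\<close>, which lets the coefficients be prescribed order by order. The
  filter makes the truncated subtraction a true one.\<close>

definition poly_jet :: "('a::euclidean_space \<Rightarrow> nat) set \<Rightarrow> (('a \<Rightarrow> nat) \<Rightarrow> real) \<Rightarrow> ('a \<Rightarrow> nat) \<Rightarrow> 'a \<Rightarrow> real" where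
  "poly_jet A c \<beta> x = (\<Sum>\<alpha>\<in>{\<alpha>\<in>A. \<forall>b. \<beta> b \<le> \<alpha> b}. c \<alpha> * mon (\<lambda>b. \<alpha> b - \<beta> b) x)"

lemma finite_multi_indices: "finite (multi_indices n :: ('a::euclidean_space \<Rightarrow> nat) set)"
proof (rule finite_subset)
  show "(multi_indices n :: ('a \<Rightarrow> nat) set) \<subseteq> {f. \<forall>x. (x \<in> Basis \<longrightarrow> f x \<in> {..n}) \<and> (x \<notin> Basis \<longrightarrow> f x = 0)}"
  proof clarify
    fix \<alpha> :: "'a \<Rightarrow> nat" and x assume a: "\<alpha> \<in> multi_indices n"
    have "\<alpha> x \<le> mi_order \<alpha>" if "x \<in> Basis"
      unfolding mi_order_def using that by (intro member_le_sum) auto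
    then show "(x \<in> Basis \<longrightarrow> \<alpha> x \<in> {..n}) \<and> (x \<notin> Basis \<longrightarrow> \<alpha> x = 0)"
      using a by (auto simp: multi_indices_def)
  qed
  show "finite {f. \<forall>x. (x \<in> (Basis :: 'a set) \<longrightarrow> f x \<in> {..n}) \<and> (x \<notin> Basis \<longrightarrow> f x = 0)}"
    by (intro finite_set_of_finite_funs) auto
qed

lemma mi_exact_subset: "m \<le> n \<Longrightarrow> mi_exact m \<subseteq> multi_indices n"
  by (auto simp: mi_exact_def multi_indices_def)

lemma finite_mi_exact: "finite (mi_exact n)"
  by (rule finite_subset[OF mi_exact_subset[OF order_refl] finite_multi_indices])

lemma mi_exact_Suc: "\<alpha> \<in> mi_exact n \<Longrightarrow> b \<in> Basis \<Longrightarrow> \<alpha>(b := Suc (\<alpha> b)) \<in> mi_exact (Suc n)"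
  by (auto simp: mi_exact_def mi_order_Suc)

lemma multi_indices_Suc: "\<alpha> \<in> multi_indices n \<Longrightarrow> b \<in> Basis \<Longrightarrow> \<alpha>(b := Suc (\<alpha> b)) \<in> multi_indices (Suc n)"
  by (auto simp: multi_indices_def mi_order_Suc)

lemma smooth_mon: "smooth (mon \<alpha>)"
  unfolding mon_def[abs_def] divide_inverse
  by (intro smooth_prod smooth.mult smooth_power smooth_inner smooth.const)

lemma smooth_poly_jet: "smooth (poly_jet A c \<beta>)"
  unfolding poly_jet_def[abs_def] by (intro smooth_sum smooth_cmult smooth_mon)

lemma partial_deriv_line:
  assumes "f differentiable (at x)" "((\<lambda>s. f (x + s *\<^sub>R b)) has_real_derivative d) (at 0)"
  shows "partial_deriv b f x = d"
  using has_real_derivative_line[of f x 0 b] assms by (simp add: DERIV_unique)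

lemma partial_deriv_mon:
  assumes b: "b \<in> Basis"
  shows "partial_deriv b (mon \<alpha>) x = (if \<alpha> b = 0 then 0 else mon (\<alpha>(b := \<alpha> b - 1)) x)"
proof (rule partial_deriv_line)
  show "mon \<alpha> differentiable (at x)" using smooth_deriv[OF smooth_mon] by blast
  define R where "R = (\<Prod>c\<in>Basis - {b}. (x \<bullet> c) ^ \<alpha> c / fact (\<alpha> c))"
  have line: "mon \<alpha> (x + s *\<^sub>R b) = (x \<bullet> b + s) ^ \<alpha> b / fact (\<alpha> b) * R" for s
  proof -
    have "mon \<alpha> (x + s *\<^sub>R b) = ((x + s *\<^sub>R b) \<bullet> b) ^ \<alpha> b / fact (\<alpha> b) * (\<Prod>c\<in>Basis - {b}. ((x + s *\<^sub>R b) \<bullet> c) ^ \<alpha> c / fact (\<alpha> c))"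
      unfolding mon_def using b by (subst prod.remove[of Basis b]) auto
    also have "(\<Prod>c\<in>Basis - {b}. ((x + s *\<^sub>R b) \<bullet> c) ^ \<alpha> c / fact (\<alpha> c)) = R"
      unfolding R_def using b by (intro prod.cong) (auto simp: inner_add_left inner_Basis)
    finally show ?thesis using b by (simp add: inner_add_left)
  qed
  show "((\<lambda>s. mon \<alpha> (x + s *\<^sub>R b)) has_real_derivative (if \<alpha> b = 0 then 0 else mon (\<alpha>(b := \<alpha> b - 1)) x)) (at 0)"
  proof (cases "\<alpha> b")
    case 0
    then show ?thesis unfolding line by simp
  next
    case (Suc n)
    have "mon (\<alpha>(b := n)) x = (x \<bullet> b) ^ n / fact n * (\<Prod>c\<in>Basis - {b}. (x \<bullet> c) ^ (\<alpha>(b := n)) c / fact ((\<alpha>(b := n)) c))"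
      unfolding mon_def using b by (subst prod.remove[of Basis b]) auto
    also have "(\<Prod>c\<in>Basis - {b}. (x \<bullet> c) ^ (\<alpha>(b := n)) c / fact ((\<alpha>(b := n)) c)) = R"
      unfolding R_def by (intro prod.cong) auto
    finally have m: "mon (\<alpha>(b := n)) x = (x \<bullet> b) ^ n / fact n * R" .
    have "((\<lambda>s. (x \<bullet> b + s) ^ Suc n / fact (Suc n) * R) has_real_derivative 
        (real (Suc n) * (x \<bullet> b + 0) ^ n / fact (Suc n) * R)) (at 0)"
      by (auto intro!: derivative_eq_intros simp del: of_nat_Suc fact_Suc power_Suc)
    also have "real (Suc n) * (x \<bullet> b + 0) ^ n / fact (Suc n) * R = (x \<bullet> b) ^ n / fact n * R"
      by (simp add: field_simps del: of_nat_Suc) 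
    finally show ?thesis unfolding line using Suc m by simp
  qed
qed

lemma partial_deriv_sum_cmult:
  assumes "\<And>i. i \<in> I \<Longrightarrow> smooth (f i)"
  shows "partial_deriv b (\<lambda>x. \<Sum>i\<in>I. c i * f i x) x = (\<Sum>i\<in>I. c i * partial_deriv b (f i) x)"
proof (rule partial_deriv_line)
  show "(\<lambda>x. \<Sum>i\<in>I. c i * f i x) differentiable (at x)"
    using smooth_deriv[OF smooth_sum[of I "\<lambda>i x. c i * f i x"]] assms smooth_cmult by blast
  have "((\<lambda>s. f i (x + s *\<^sub>R b)) has_real_derivative partial_deriv b (f i) x) (at 0)" if "i \<in> I" for i
    using has_real_derivative_line[of "f i" x 0 b] smooth_deriv[OF assms[OF that]] by simp
  then show "((\<lambda>s. \<Sum>i\<in>I. c i * f i (x + s *\<^sub>R b)) has_real_derivative (\<Sum>i\<in>I. c i * partial_deriv b (f i) x)) (at 0)"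
    by (intro DERIV_sum DERIV_cmult)
qed

text \<open>Exactly the terms with \<open>\<alpha> b = \<beta> b\<close> are killed, and these are
  the ones that the index set for the raised \<open>\<beta>\<close> drops.\<close>

lemma partial_deriv_poly_jet:
  assumes b: "b \<in> Basis" and A: "finite A"
  shows "partial_deriv b (poly_jet A c \<beta>) = poly_jet A c (\<beta>(b := Suc (\<beta> b)))"
proof
  fix x
  let ?M = "{\<alpha>\<in>A. \<forall>b. \<beta> b \<le> \<alpha> b}" and ?M' = "{\<alpha>\<in>A. \<forall>a. (\<beta>(b := Suc (\<beta> b))) a \<le> \<alpha> a}"
  have "partial_deriv b (poly_jet A c \<beta>) x = (\<Sum>\<alpha>\<in>?M. c \<alpha> * partial_deriv b (mon (\<lambda>b. \<alpha> b - \<beta> b)) x)"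
    unfolding poly_jet_def[abs_def] by (intro partial_deriv_sum_cmult smooth_mon)
  also have "\<dots> = (\<Sum>\<alpha>\<in>?M'. c \<alpha> * partial_deriv b (mon (\<lambda>b. \<alpha> b - \<beta> b)) x)"
  proof (rule sum.mono_neutral_right)
    show "finite ?M" using A by simp
    show "?M' \<subseteq> ?M"
    proof clarify
      fix \<alpha> a assume *: "\<forall>a. (\<beta>(b := Suc (\<beta> b))) a \<le> \<alpha> a"
      show "\<beta> a \<le> \<alpha> a" using *[rule_format, of a] by (auto split: if_splits)
    qed
    show "\<forall>\<alpha>\<in>?M - ?M'. c \<alpha> * partial_deriv b (mon (\<lambda>b. \<alpha> b - \<beta> b)) x = 0"
    proof
      fix \<alpha> assume "\<alpha> \<in> ?M - ?M'"
      then obtain a where a: "\<And>a. \<beta> a \<le> \<alpha> a" "\<not> (\<beta>(b := Suc (\<beta> b))) a \<le> \<alpha> a" by auto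
      then have "a = b" by (auto split: if_splits)
      then have "\<alpha> b - \<beta> b = 0" using a by auto
      then show "c \<alpha> * partial_deriv b (mon (\<lambda>b. \<alpha> b - \<beta> b)) x = 0" by (simp add: partial_deriv_mon[OF b])
    qed
  qed
  also have "\<dots> = poly_jet A c (\<beta>(b := Suc (\<beta> b))) x"
    unfolding poly_jet_def
  proof (intro sum.cong refl arg_cong2[where f = times])
    fix \<alpha> assume "\<alpha> \<in> ?M'"
    then have "Suc (\<beta> b) \<le> \<alpha> b" by (auto dest: spec[of _ b])
    moreover have "(\<lambda>c. \<alpha> c - \<beta> c)(b := \<alpha> b - \<beta> b - 1) = (\<lambda>c. \<alpha> c - (\<beta>(b := Suc (\<beta> b))) c)" by auto
    ultimately show "partial_deriv b (mon (\<lambda>b. \<alpha> b - \<beta> b)) x = mon (\<lambda>c. \<alpha> c - (\<beta>(b := Suc (\<beta> b))) c) x"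
      by (simp add: partial_deriv_mon[OF b])
  qed
  finally show "partial_deriv b (poly_jet A c \<beta>) x = poly_jet A c (\<beta>(b := Suc (\<beta> b))) x" .
qed

lemma poly_jet_Un:
  assumes "finite A" "finite B" "A \<inter> B = {}"
  shows "poly_jet (A \<union> B) c \<beta> x = poly_jet A c \<beta> x + poly_jet B c \<beta> x"
proof -
  have "{\<alpha>\<in>A \<union> B. \<forall>b. \<beta> b \<le> \<alpha> b} = {\<alpha>\<in>A. \<forall>b. \<beta> b \<le> \<alpha> b} \<union> {\<alpha>\<in>B. \<forall>b. \<beta> b \<le> \<alpha> b}" by auto
  then show ?thesis unfolding poly_jet_def using assms by (simp, subst sum.union_disjoint) auto
qed

lemma poly_jet_cong: "(\<And>\<alpha>. \<alpha> \<in> A \<Longrightarrow> c \<alpha> = c' \<alpha>) \<Longrightarrow> poly_jet A c \<beta> x = poly_jet A c' \<beta> x"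
  unfolding poly_jet_def by (intro sum.cong) auto

lemma mi_le_exact_imp_eq:
  assumes "\<alpha> \<in> mi_exact n" "\<beta> \<in> mi_exact n" "\<And>b. \<beta> b \<le> \<alpha> b"
  shows "\<alpha> = \<beta>"
proof
  fix b
  have "(\<Sum>b\<in>Basis. \<alpha> b - \<beta> b) = 0"
    using assms by (subst sum_subtractf_nat) (auto simp: mi_exact_def mi_order_def)
  then show "\<alpha> b = \<beta> b"
    using assms by (cases "b \<in> Basis") (auto simp: mi_exact_def intro: antisym)
qed

text \<open>At top order the derivatives of a homogeneous polynomial are its coefficients. Hence
  constants attached freely to the derivatives of order \<open>n\<close> are always realised by one
  polynomial.\<close>

lemma poly_jet_exact:
  assumes "\<beta> \<in> mi_exact n"
  shows "poly_jet (mi_exact n) c \<beta> x = c \<beta>"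
proof -
  have "{\<alpha>\<in>mi_exact n. \<forall>b. \<beta> b \<le> \<alpha> b} = {\<beta>}"
    using assms mi_le_exact_imp_eq[OF _ assms] by auto
  then show ?thesis by (simp add: poly_jet_def mon_def)
qed

lemma poly_jet_order_less:
  assumes "\<And>\<alpha>. \<alpha> \<in> A \<Longrightarrow> mi_order \<alpha> < mi_order \<beta>"
  shows "poly_jet A c \<beta> x = 0"
proof -
  have "{\<alpha>\<in>A. \<forall>b. \<beta> b \<le> \<alpha> b} = {}"
  proof -
    have "\<not> (\<forall>b. \<beta> b \<le> \<alpha> b)" if "\<alpha> \<in> A" for \<alpha>
      using assms[OF that] sum_mono[of Basis \<beta> \<alpha>] by (auto simp: mi_order_def not_less[symmetric])
    then show ?thesis by auto
  qed
  then show ?thesis unfolding poly_jet_def by (simp only: sum.empty)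
qed

text \<open>\<open>D \<alpha>\<close> plays the role of the weak derivative of order \<open>\<alpha>\<close> of a function \<open>D 0\<close>. Only first order weak
  derivatives occur, so that subtracting the jet of a polynomial stays within the notion.\<close>

definition jet :: "nat \<Rightarrow> 'a::euclidean_space set \<Rightarrow> (('a \<Rightarrow> nat) \<Rightarrow> 'a \<Rightarrow> real) \<Rightarrow> bool" where
  "jet n U D \<longleftrightarrow> (\<forall>m\<le>n. \<forall>\<alpha>\<in>mi_exact m. D \<alpha> \<in> L2_space U) \<and>
     (\<forall>m<n. \<forall>\<alpha>\<in>mi_exact m. \<forall>b\<in>Basis. weak_partial U b (D \<alpha>) (D (\<alpha>(b := Suc (\<alpha> b)))))"

definition mi_less :: "nat \<Rightarrow> ('a::euclidean_space \<Rightarrow> nat) set" where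
  "mi_less n = (\<Union>m<n. mi_exact m)"

lemma finite_mi_less: "finite (mi_less n)"
  by (simp add: mi_less_def finite_mi_exact)

text \<open>The induction is over all jets, because the hypothesis is applied to \<open>D'\<close>
  and not to \<open>D\<close>: subtracting a homogeneous polynomial of degree \<open>n\<close> makes
  the derivatives of order \<open>n\<close> small by Poincare, and the hypothesis then treats the
  lower orders, whose bound involves order \<open>n\<close> only.\<close>

theorem jet_bramble_hilbert:
  "\<exists>C\<ge>0. \<forall>z \<delta>. \<forall>D :: ('a::euclidean_space \<Rightarrow> nat) \<Rightarrow> 'a \<Rightarrow> real. \<delta> > 0 \<longrightarrow> jet n (ball z \<delta>) D \<longrightarrow>
     (\<exists>c. \<forall>m<n. \<forall>\<beta>\<in>mi_exact m. sqint (ball z \<delta>) (\<lambda>x. D \<beta> x - poly_jet (mi_less n) c \<beta> x)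
        \<le> C * \<delta> ^ (2 * (n - m)) * (\<Sum>\<alpha>\<in>mi_exact n. sqint (ball z \<delta>) (D \<alpha>)))"
proof (induction n)
  case 0
  show ?case by (intro exI[of _ 0]) auto
next
  case (Suc n)
  then obtain C where C: "C \<ge> 0" and IH: "\<And>z \<delta>. \<And>D :: ('a \<Rightarrow> nat) \<Rightarrow> 'a \<Rightarrow> real. \<delta> > 0 \<Longrightarrow> jet n (ball z \<delta>) D \<Longrightarrow>
     \<exists>c. \<forall>m<n. \<forall>\<beta>\<in>mi_exact m. sqint (ball z \<delta>) (\<lambda>x. D \<beta> x - poly_jet (mi_less n) c \<beta> x)
        \<le> C * \<delta> ^ (2 * (n - m)) * (\<Sum>\<alpha>\<in>mi_exact n. sqint (ball z \<delta>) (D \<alpha>))" by blast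
  \<comment> \<open>The Poincare constant times the dimension, since each of the
    \<open>DIM('a)\<close> terms of the gradient is estimated by the full sum
    \<open>\<Sigma>\<close>.\<close>
  define K where "K = real DIM('a) * (4 * 2 ^ DIM('a))"
  define N where "N = real (card (mi_exact n :: ('a \<Rightarrow> nat) set))"
  have K: "0 \<le> K" by (simp add: K_def)
  show ?case
  proof (intro exI[of _ "C * N * K + K"] conjI allI impI)
    show "0 \<le> C * N * K + K" using C K by (simp add: N_def)
    fix z :: 'a and \<delta> :: real and D :: "('a \<Rightarrow> nat) \<Rightarrow> 'a \<Rightarrow> real"
    assume \<delta>: "\<delta> > 0" and j: "jet (Suc n) (ball z \<delta>) D"
    let ?B = "ball z \<delta>"
    have BL: "?B \<in> sets lebesgue" "bounded ?B" by auto
    define \<Sigma> where "\<Sigma> = (\<Sum>\<alpha>\<in>mi_exact (Suc n). sqint ?B (D \<alpha>))"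
    have \<Sigma>0: "0 \<le> \<Sigma>" unfolding \<Sigma>_def by (intro sum_nonneg sqint_nonneg)
    have DL: "D \<alpha> \<in> L2_space ?B" if "\<alpha> \<in> mi_exact m" "m \<le> Suc n" for \<alpha> m
      using j that by (auto simp: jet_def)
    have Dw: "weak_partial ?B b (D \<alpha>) (D (\<alpha>(b := Suc (\<alpha> b))))" if "\<alpha> \<in> mi_exact m" "m < Suc n" "b \<in> Basis" for \<alpha> m b
      using j that by (auto simp: jet_def)
    have "\<exists>c. sqint ?B (\<lambda>x. D \<alpha> x - c) \<le> K * \<delta>\<^sup>2 * \<Sigma>" if \<alpha>: "\<alpha> \<in> mi_exact n" for \<alpha>
    proof -
      have "\<exists>c. sqint ?B (\<lambda>x. D \<alpha> x - c) \<le> 4 * 2 ^ DIM('a) * \<delta>\<^sup>2 * (\<Sum>b\<in>Basis. sqint ?B (D (\<alpha>(b := Suc (\<alpha> b)))))"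
        by (rule poincare_ball[OF DL[OF \<alpha>] DL[OF mi_exact_Suc[OF \<alpha>]] Dw[OF \<alpha>] \<delta>]) auto
      then obtain c where c: "sqint ?B (\<lambda>x. D \<alpha> x - c) \<le> 4 * 2 ^ DIM('a) * \<delta>\<^sup>2 * (\<Sum>b\<in>Basis. sqint ?B (D (\<alpha>(b := Suc (\<alpha> b)))))" ..
      also have "(\<Sum>b\<in>Basis. sqint ?B (D (\<alpha>(b := Suc (\<alpha> b))))) \<le> (\<Sum>b\<in>(Basis::'a set). \<Sigma>)"
        unfolding \<Sigma>_def by (intro sum_mono member_le_sum mi_exact_Suc[OF \<alpha>] sqint_nonneg finite_mi_exact) auto
      also have "4 * 2 ^ DIM('a) * \<delta>\<^sup>2 * (\<Sum>b\<in>(Basis::'a set). \<Sigma>) = K * \<delta>\<^sup>2 * \<Sigma>"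
        by (simp add: K_def)
      finally show ?thesis by (auto simp: mult_left_mono)
    qed
    then obtain c0 where c0: "\<And>\<alpha>. \<alpha> \<in> mi_exact n \<Longrightarrow> sqint ?B (\<lambda>x. D \<alpha> x - c0 \<alpha>) \<le> K * \<delta>\<^sup>2 * \<Sigma>" by metis
    \<comment> \<open>The polynomial whose derivatives of order \<open>n\<close> are the Poincare
      constants \<open>c0\<close>.\<close>
    define T where "T = poly_jet (mi_exact n :: ('a \<Rightarrow> nat) set) c0"
    define D' where "D' \<beta> x = D \<beta> x - T \<beta> x" for \<beta> x
    have TL: "T \<beta> \<in> L2_space ?B" for \<beta>
      unfolding T_def by (rule continuous_imp_L2_space[OF smooth_continuous[OF smooth_poly_jet] BL(2,1)])
    have j': "jet n ?B D'"
      unfolding jet_def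
    proof (intro conjI allI impI ballI)
      fix m \<alpha> assume "m \<le> n" "\<alpha> \<in> (mi_exact m :: ('a \<Rightarrow> nat) set)"
      then show "D' \<alpha> \<in> L2_space ?B" unfolding D'_def by (intro L2_space_diff TL DL[of \<alpha> m]) auto
    next
      fix m \<alpha> b assume m: "m < n" and \<alpha>: "\<alpha> \<in> (mi_exact m :: ('a \<Rightarrow> nat) set)" and b: "b \<in> (Basis :: 'a set)"
      have "weak_partial ?B b (T \<alpha>) (partial_deriv b (T \<alpha>))"
        unfolding T_def by (rule weak_partial_smooth[OF smooth_poly_jet b BL(2,1)])
      then have "weak_partial ?B b (T \<alpha>) (T (\<alpha>(b := Suc (\<alpha> b))))"
        by (simp add: T_def partial_deriv_poly_jet[OF b finite_mi_exact])
      then show "weak_partial ?B b (D' \<alpha>) (D' (\<alpha>(b := Suc (\<alpha> b))))"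
        unfolding D'_def using m
        by (intro weak_partial_diff Dw[OF \<alpha>] b BL DL[OF \<alpha>] DL[OF mi_exact_Suc[OF \<alpha> b]] TL) auto
    qed
    from IH[OF \<delta> j'] obtain c1 where c1: "\<And>m \<beta>. m < n \<Longrightarrow> \<beta> \<in> mi_exact m \<Longrightarrow> sqint ?B (\<lambda>x. D' \<beta> x - poly_jet (mi_less n) c1 \<beta> x)
        \<le> C * \<delta> ^ (2 * (n - m)) * (\<Sum>\<alpha>\<in>mi_exact n. sqint ?B (D' \<alpha>))" by blast
    \<comment> \<open>The index sets of \<open>T\<close> and of the polynomial from the induction
      hypothesis are disjoint, so their coefficients combine into one family.\<close>
    define c where "c \<alpha> = (if mi_order \<alpha> = n then c0 \<alpha> else c1 \<alpha>)" for \<alpha>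
    have split: "poly_jet (mi_less (Suc n)) c \<beta> x = poly_jet (mi_less n) c1 \<beta> x + T \<beta> x" for \<beta> x
    proof -
      have "mi_less (Suc n) = mi_less n \<union> (mi_exact n :: ('a \<Rightarrow> nat) set)"
        unfolding mi_less_def lessThan_Suc by auto
      moreover have "mi_less n \<inter> (mi_exact n :: ('a \<Rightarrow> nat) set) = {}"
        by (auto simp: mi_less_def mi_exact_def)
      ultimately have "poly_jet (mi_less (Suc n)) c \<beta> x = poly_jet (mi_less n) c \<beta> x + poly_jet (mi_exact n) c \<beta> x"
        by (simp add: poly_jet_Un finite_mi_less finite_mi_exact)
      also have "poly_jet (mi_less n) c \<beta> x = poly_jet (mi_less n) c1 \<beta> x"
        by (rule poly_jet_cong) (auto simp: c_def mi_less_def mi_exact_def)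
      also have "poly_jet (mi_exact n) c \<beta> x = T \<beta> x"
        unfolding T_def by (rule poly_jet_cong) (auto simp: c_def mi_exact_def)
      finally show ?thesis .
    qed
    have D'n: "sqint ?B (D' \<alpha>) \<le> K * \<delta>\<^sup>2 * \<Sigma>" if "\<alpha> \<in> mi_exact n" for \<alpha>
      using c0[OF that] poly_jet_exact[OF that] by (simp add: D'_def[abs_def] T_def)
    have D'sum: "(\<Sum>\<alpha>\<in>mi_exact n. sqint ?B (D' \<alpha>)) \<le> N * (K * \<delta>\<^sup>2 * \<Sigma>)"
      using sum_bounded_above[of "mi_exact n" "\<lambda>\<alpha>. sqint ?B (D' \<alpha>)", OF D'n] by (simp add: N_def)
    show "\<exists>c. \<forall>m<Suc n. \<forall>\<beta>\<in>mi_exact m. sqint ?B (\<lambda>x. D \<beta> x - poly_jet (mi_less (Suc n)) c \<beta> x)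
        \<le> (C * N * K + K) * \<delta> ^ (2 * (Suc n - m)) * (\<Sum>\<alpha>\<in>mi_exact (Suc n). sqint ?B (D \<alpha>))"
    proof (intro exI[of _ c] allI impI ballI)
      fix m and \<beta> :: "'a \<Rightarrow> nat" assume m: "m < Suc n" and \<beta>: "\<beta> \<in> mi_exact m"
      have eq: "(\<lambda>x. D \<beta> x - poly_jet (mi_less (Suc n)) c \<beta> x) = (\<lambda>x. D' \<beta> x - poly_jet (mi_less n) c1 \<beta> x)"
        by (simp add: split D'_def algebra_simps)
      show "sqint ?B (\<lambda>x. D \<beta> x - poly_jet (mi_less (Suc n)) c \<beta> x)
        \<le> (C * N * K + K) * \<delta> ^ (2 * (Suc n - m)) * (\<Sum>\<alpha>\<in>mi_exact (Suc n). sqint ?B (D \<alpha>))"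
      proof (cases "m = n")
        case True
        \<comment> \<open>The polynomial from the induction hypothesis has degree below
          \<open>n\<close> and does not disturb the derivatives of order \<open>n\<close>.\<close>
        have "poly_jet (mi_less n) c1 \<beta> x = 0" for x
          by (rule poly_jet_order_less) (use \<beta> True in \<open>auto simp: mi_less_def mi_exact_def\<close>)
        then have "sqint ?B (\<lambda>x. D \<beta> x - poly_jet (mi_less (Suc n)) c \<beta> x) \<le> K * \<delta>\<^sup>2 * \<Sigma>"
          unfolding eq using D'n[of \<beta>] \<beta> True by simp
        also have "\<dots> \<le> (C * N * K + K) * \<delta>\<^sup>2 * \<Sigma>"
          using C K \<Sigma>0 by (intro mult_right_mono) (auto simp: N_def)
        finally show ?thesis using True by (simp add: \<Sigma>_def)
      next
        case False
        then have mn: "m < n" using m by simp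
        have "sqint ?B (\<lambda>x. D \<beta> x - poly_jet (mi_less (Suc n)) c \<beta> x) \<le> C * \<delta> ^ (2 * (n - m)) * (\<Sum>\<alpha>\<in>mi_exact n. sqint ?B (D' \<alpha>))"
          unfolding eq by (rule c1[OF mn \<beta>])
        also have "\<dots> \<le> C * \<delta> ^ (2 * (n - m)) * (N * (K * \<delta>\<^sup>2 * \<Sigma>))"
          using C \<delta> by (intro mult_left_mono D'sum) auto
        \<comment> \<open>The Poincare factor \<open>\<delta>\<^sup>2\<close> supplies the two
          powers missing from the exponent of the induction hypothesis.\<close>
        also have "\<dots> = C * N * K * \<delta> ^ (2 * (Suc n - m)) * \<Sigma>"
          using mn by (simp add: Suc_diff_le power_add power2_eq_square)
        also have "\<dots> \<le> (C * N * K + K) * \<delta> ^ (2 * (Suc n - m)) * \<Sigma>"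
          using K \<Sigma>0 \<delta> by (intro mult_right_mono) auto
        finally show ?thesis by (simp add: \<Sigma>_def)
      qed
    qed
  qed
qed

section \<open>Polynomials of bounded degree and the approximation of Sobolev functions\<close>

lemma mon_in_poly_space:
  assumes "\<alpha> \<in> multi_indices k"
  shows "mon \<alpha> \<in> poly_space k"
proof -
  have "mon \<alpha> x = (\<Sum>\<alpha>'\<in>multi_indices k. (if \<alpha>' = \<alpha> then 1 / (\<Prod>b\<in>Basis. fact (\<alpha> b)) else 0) * (\<Prod>b\<in>Basis. (x \<bullet> b) ^ \<alpha>' b))" for x
  proof -
    have "(\<Sum>\<alpha>'\<in>multi_indices k. (if \<alpha>' = \<alpha> then 1 / (\<Prod>b\<in>Basis. fact (\<alpha> b)) else 0) * (\<Prod>b\<in>Basis. (x \<bullet> b) ^ \<alpha>' b))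
      = (\<Sum>\<alpha>'\<in>{\<alpha>}. (if \<alpha>' = \<alpha> then 1 / (\<Prod>b\<in>Basis. fact (\<alpha> b)) else 0) * (\<Prod>b\<in>Basis. (x \<bullet> b) ^ \<alpha>' b))"
      using assms by (intro sum.mono_neutral_right finite_multi_indices) auto
    then show ?thesis by (simp add: mon_def prod_dividef)
  qed
  then show ?thesis unfolding poly_space_def
    by (intro CollectI exI[of _ "\<lambda>\<alpha>'. if \<alpha>' = \<alpha> then 1 / (\<Prod>b\<in>Basis. fact (\<alpha> b)) else 0"] allI)
qed

lemma poly_space_lincomb:
  assumes "p \<in> poly_space k" "q \<in> poly_space k"
  shows "(\<lambda>x. a * p x + b * q x) \<in> poly_space k"
proof -
  obtain c d where "\<And>x. p x = (\<Sum>\<alpha>\<in>multi_indices k. c \<alpha> * (\<Prod>b\<in>Basis. (x \<bullet> b) ^ \<alpha> b))"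
    "\<And>x. q x = (\<Sum>\<alpha>\<in>multi_indices k. d \<alpha> * (\<Prod>b\<in>Basis. (x \<bullet> b) ^ \<alpha> b))"
    using assms by (auto simp: poly_space_def)
  then have "\<forall>x. a * p x + b * q x = (\<Sum>\<alpha>\<in>multi_indices k. (a * c \<alpha> + b * d \<alpha>) * (\<Prod>b\<in>Basis. (x \<bullet> b) ^ \<alpha> b))"
    by (simp add: sum_distrib_left sum.distrib[symmetric] algebra_simps)
  then show ?thesis unfolding poly_space_def by (intro CollectI exI)
qed

lemma poly_space_zero: "(\<lambda>x. 0) \<in> poly_space k"
  unfolding poly_space_def by (auto intro!: exI[of _ "\<lambda>_. 0"])

lemma poly_space_add: "p \<in> poly_space k \<Longrightarrow> q \<in> poly_space k \<Longrightarrow> (\<lambda>x. p x + q x) \<in> poly_space k"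
  using poly_space_lincomb[of p k q 1 1] by simp

lemma poly_space_diff: "p \<in> poly_space k \<Longrightarrow> q \<in> poly_space k \<Longrightarrow> (\<lambda>x. p x - q x) \<in> poly_space k"
  using poly_space_lincomb[of p k q 1 "-1"] by simp

lemma poly_space_cmult: "p \<in> poly_space k \<Longrightarrow> (\<lambda>x. a * p x) \<in> poly_space k"
  using poly_space_lincomb[of p k p a 0] by simp

lemma poly_space_sum: "(\<And>i. i \<in> I \<Longrightarrow> f i \<in> poly_space k) \<Longrightarrow> (\<lambda>x. \<Sum>i\<in>I. f i x) \<in> poly_space k"
  by (induction I rule: infinite_finite_induct) (auto intro: poly_space_add poly_space_zero)

text \<open>The weak derivatives of \<open>w\<close> form a jet of order \<open>Suc k\<close>. The
  jet estimate covers orders below \<open>Suc k\<close>, so it reaches the gradient for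
  \<open>k > 0\<close>. The gradient is given as a weak partial \<open>g\<close>, the form in which
  polynomials can be subtracted from it.\<close>

theorem bramble_hilbert:
  "\<exists>C\<ge>0. \<forall>z \<delta>. \<forall>w :: 'a::euclidean_space \<Rightarrow> real. \<delta> > 0 \<longrightarrow> w \<in> sobolev_space (Suc k) (ball z \<delta>) \<longrightarrow>
     (\<exists>p\<in>poly_space k. smooth p \<and>
        sqint (ball z \<delta>) (\<lambda>x. w x - p x) \<le> C * \<delta> ^ (2 * Suc k) * (sobolev_norm (Suc k) (ball z \<delta>) w)\<^sup>2 \<and>
        (k > 0 \<longrightarrow> (\<forall>b\<in>Basis. \<exists>g\<in>L2_space (ball z \<delta>). weak_partial (ball z \<delta>) b w g \<and>
          sqint (ball z \<delta>) (\<lambda>x. g x - partial_deriv b p x) \<le> C * \<delta> ^ (2 * k) * (sobolev_norm (Suc k) (ball z \<delta>) w)\<^sup>2)))"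
proof -
  obtain C where C: "C \<ge> 0" and BH: "\<And>z \<delta>. \<And>D :: ('a \<Rightarrow> nat) \<Rightarrow> 'a \<Rightarrow> real. \<delta> > 0 \<Longrightarrow> jet (Suc k) (ball z \<delta>) D \<Longrightarrow>
     \<exists>c. \<forall>m<Suc k. \<forall>\<beta>\<in>mi_exact m. sqint (ball z \<delta>) (\<lambda>x. D \<beta> x - poly_jet (mi_less (Suc k)) c \<beta> x)
        \<le> C * \<delta> ^ (2 * (Suc k - m)) * (\<Sum>\<alpha>\<in>mi_exact (Suc k). sqint (ball z \<delta>) (D \<alpha>))"
    using jet_bramble_hilbert by blast
  show ?thesis
  proof (intro exI[of _ C] conjI C allI impI)
    fix z :: 'a and \<delta> :: real and w :: "'a \<Rightarrow> real"
    assume \<delta>: "\<delta> > 0" and w: "w \<in> sobolev_space (Suc k) (ball z \<delta>)"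
    let ?B = "ball z \<delta>"
    define D where "D \<alpha> = weak_deriv \<alpha> ?B w" for \<alpha>
    note wd = sobolev_space_weak_deriv[OF open_ball w]
    have mi: "\<alpha> \<in> multi_indices (Suc k)" if "\<alpha> \<in> mi_exact m" "m \<le> Suc k" for \<alpha> :: "'a \<Rightarrow> nat" and m
      using that mi_exact_subset by blast
    have wp: "weak_partial ?B b (D \<alpha>) (D (\<alpha>(b := Suc (\<alpha> b))))"
      if "m < Suc k" "\<alpha> \<in> mi_exact m" "b \<in> Basis" for m \<alpha> b
      unfolding D_def 
      by (rule is_weak_deriv_imp_weak_partial[OF wd(1) wd(1) that(3)]) 
         (use that mi[OF that(2)] mi[OF mi_exact_Suc[OF that(2,3)]] in auto)
    have L2: "D \<alpha> \<in> L2_space ?B" if "m \<le> Suc k" "\<alpha> \<in> mi_exact m" for m \<alpha>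
      unfolding D_def by (rule wd(2)[OF mi[OF that(2,1)]])
    have "jet (Suc k) ?B D" unfolding jet_def using wp L2 by blast
    from BH[OF \<delta> this] obtain c where c: "\<And>m \<beta>. m < Suc k \<Longrightarrow> \<beta> \<in> mi_exact m \<Longrightarrow> sqint ?B (\<lambda>x. D \<beta> x - poly_jet (mi_less (Suc k)) c \<beta> x)
        \<le> C * \<delta> ^ (2 * (Suc k - m)) * (\<Sum>\<alpha>\<in>mi_exact (Suc k). sqint ?B (D \<alpha>))" by blast
    have "(\<Sum>\<alpha>\<in>mi_exact (Suc k). sqint ?B (D \<alpha>)) \<le> (\<Sum>\<alpha>\<in>multi_indices (Suc k). sqint ?B (D \<alpha>))"
      by (intro sum_mono2 finite_multi_indices mi_exact_subset sqint_nonneg) auto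
    also have "\<dots> = (sobolev_norm (Suc k) ?B w)\<^sup>2"
      by (simp add: sobolev_norm_def D_def sqint_def[symmetric] sum_nonneg sqint_nonneg)
    finally have le: "(\<Sum>\<alpha>\<in>mi_exact (Suc k). sqint ?B (D \<alpha>)) \<le> (sobolev_norm (Suc k) ?B w)\<^sup>2" .
    have c': "sqint ?B (\<lambda>x. D \<beta> x - poly_jet (mi_less (Suc k)) c \<beta> x) \<le> C * \<delta> ^ (2 * (Suc k - m)) * (sobolev_norm (Suc k) ?B w)\<^sup>2"
      if "m < Suc k" "\<beta> \<in> mi_exact m" for m \<beta>
      by (rule order_trans[OF c[OF that] mult_left_mono[OF le]]) (use C \<delta> in auto)
    define p where "p = poly_jet (mi_less (Suc k)) c (\<lambda>_. 0)"
    have p: "p \<in> poly_space k"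
    proof -
      have "mi_less (Suc k) \<subseteq> (multi_indices k :: ('a \<Rightarrow> nat) set)"
        by (auto simp: mi_less_def mi_exact_def multi_indices_def)
      then show ?thesis unfolding p_def poly_jet_def[abs_def]
        by (intro poly_space_sum poly_space_cmult mon_in_poly_space) auto
    qed
    have z: "(\<lambda>_. 0) \<in> (mi_exact 0 :: ('a \<Rightarrow> nat) set)" by (simp add: mi_exact_def mi_order_0)
    have wL: "w \<in> L2_space ?B" using w by (simp add: sobolev_space_def)
    have w0: "is_weak_deriv (\<lambda>_. 0) ?B w w"
      using L2_imp_locally_integrable[OF wL] by (simp add: is_weak_deriv_def multi_deriv_0 mi_order_0)
    \<comment> \<open>The jet starts with the chosen weak derivative of order zero, which agrees
      with \<open>w\<close> up to a null set only.\<close>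
    have ae: "AE x in lebesgue. x \<in> ?B \<longrightarrow> w x = D (\<lambda>_. 0) x"
      unfolding D_def by (rule is_weak_deriv_unique[OF open_ball w0 wd(1)[OF mi[OF z]]]) simp
    show "\<exists>p\<in>poly_space k. smooth p \<and>
        sqint (ball z \<delta>) (\<lambda>x. w x - p x) \<le> C * \<delta> ^ (2 * Suc k) * (sobolev_norm (Suc k) (ball z \<delta>) w)\<^sup>2 \<and>
        (k > 0 \<longrightarrow> (\<forall>b\<in>Basis. \<exists>g\<in>L2_space (ball z \<delta>). weak_partial (ball z \<delta>) b w g \<and>
          sqint (ball z \<delta>) (\<lambda>x. g x - partial_deriv b p x) \<le> C * \<delta> ^ (2 * k) * (sobolev_norm (Suc k) (ball z \<delta>) w)\<^sup>2))"
    proof (intro bexI[OF _ p] conjI impI ballI)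
      show "smooth p" unfolding p_def by (rule smooth_poly_jet)
      have "sqint ?B (\<lambda>x. w x - p x) = sqint ?B (\<lambda>x. D (\<lambda>_. 0) x - p x)"
      proof (rule L2_space_AE_cong(2))
        show "(\<lambda>x. D (\<lambda>_. 0) x - p x) \<in> L2_space ?B"
          unfolding p_def
          by (intro L2_space_diff L2[OF _ z] continuous_imp_L2_space smooth_continuous smooth_poly_jet) auto
        show "AE x in lebesgue. x \<in> ?B \<longrightarrow> w x - p x = D (\<lambda>_. 0) x - p x"
          using ae by eventually_elim auto
      qed
      then show "sqint ?B (\<lambda>x. w x - p x) \<le> C * \<delta> ^ (2 * Suc k) * (sobolev_norm (Suc k) ?B w)\<^sup>2"
        using c'[OF _ z] by (simp add: p_def)
    next
      fix b :: 'a assume b: "b \<in> Basis" and k: "k > 0"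
      have e: "(\<lambda>_. 0)(b := Suc 0) \<in> mi_exact (Suc 0)" using mi_exact_Suc[OF z b] by simp
      have "weak_partial ?B b w (D ((\<lambda>_. 0)(b := Suc 0)))"
        unfolding D_def using is_weak_deriv_imp_weak_partial[OF w0 wd(1) b] mi[OF e] by simp
      moreover have "partial_deriv b p = poly_jet (mi_less (Suc k)) c ((\<lambda>_. 0)(b := Suc 0))"
        unfolding p_def by (simp add: partial_deriv_poly_jet[OF b finite_mi_less])
      ultimately show "\<exists>g\<in>L2_space (ball z \<delta>). weak_partial (ball z \<delta>) b w g \<and>
          sqint (ball z \<delta>) (\<lambda>x. g x - partial_deriv b p x) \<le> C * \<delta> ^ (2 * k) * (sobolev_norm (Suc k) (ball z \<delta>) w)\<^sup>2"
        using c'[OF _ e] L2[OF _ e] k by (intro bexI[of _ "D ((\<lambda>_. 0)(b := Suc 0))"]) auto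
    qed
  qed
qed


section \<open>Polynomials: norm equivalence and projection\<close>

text \<open>The monomials of \<open>poly_space\<close>. They suit multiplication by a coordinate, as
  \<open>mon\<close> suits differentiation.\<close>

definition raw_mon :: "('a::euclidean_space \<Rightarrow> nat) \<Rightarrow> 'a \<Rightarrow> real" where
  "raw_mon \<alpha> x = (\<Prod>b\<in>Basis. (x \<bullet> b) ^ \<alpha> b)"

lemma raw_mon_in_poly_space:
  assumes "\<alpha> \<in> multi_indices k"
  shows "raw_mon \<alpha> \<in> poly_space k"
proof -
  have "raw_mon \<alpha> = (\<lambda>x. (\<Prod>b\<in>Basis. fact (\<alpha> b)) * mon \<alpha> x)"
    by (rule ext) (simp add: raw_mon_def mon_def prod_dividef)
  then show ?thesis using poly_space_cmult[OF mon_in_poly_space[OF assms]] by simp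
qed

lemma poly_spaceE:
  assumes "p \<in> poly_space k"
  obtains c where "p = (\<lambda>x. \<Sum>\<alpha>\<in>multi_indices k. c \<alpha> * raw_mon \<alpha> x)"
  using assms unfolding poly_space_def raw_mon_def by blast

lemma raw_mon_Suc:
  assumes "b \<in> Basis"
  shows "raw_mon (\<alpha>(b := Suc (\<alpha> b))) x = (x \<bullet> b) * raw_mon \<alpha> x"
proof -
  have "(\<Prod>c\<in>Basis - {b}. (x \<bullet> c) ^ (\<alpha>(b := Suc (\<alpha> b))) c) = (\<Prod>c\<in>Basis - {b}. (x \<bullet> c) ^ \<alpha> c)"
    by (intro prod.cong) auto
  then show ?thesis
    unfolding raw_mon_def using assms by (subst (1 2) prod.remove[of Basis b]) auto
qed

text \<open>An induction principle for polynomials that tracks the degree: each multiplication by a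
  coordinate moves up one level. It serves affine substitution and the span of falling factorials;
  in the latter the passage upwards works only below level \<open>k\<close>, hence the condition
  \<open>j < k\<close>.\<close>

lemma poly_space_graded_induct:
  fixes W :: "nat \<Rightarrow> ('a::euclidean_space \<Rightarrow> real) set"
  assumes one: "(\<lambda>_. 1) \<in> W 0"
    and lin: "\<And>f g a b. f \<in> W k \<Longrightarrow> g \<in> W k \<Longrightarrow> (\<lambda>x. a * f x + b * g x) \<in> W k"
    and mult: "\<And>j f b. j < k \<Longrightarrow> f \<in> W j \<Longrightarrow> b \<in> Basis \<Longrightarrow> (\<lambda>x. (x \<bullet> b) * f x) \<in> W (Suc j)"
    and up: "\<And>j f. j < k \<Longrightarrow> f \<in> W j \<Longrightarrow> f \<in> W (Suc j)"
    and p: "p \<in> poly_space k"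
  shows "p \<in> W k"
proof -
  have mono: "f \<in> W k" if "f \<in> W j" "j \<le> k" for f j
    using that(2,1) by (induction rule: inc_induct) (use up in auto)
  \<comment> \<open>A monomial of order \<open>j\<close> arises from 1 by \<open>j\<close>
    multiplications, each of which lowers some positive exponent of what remains.\<close>
  have rm: "raw_mon \<alpha> \<in> W j" if "\<alpha> \<in> mi_exact j" "j \<le> k" for \<alpha> j
    using that
  proof (induction j arbitrary: \<alpha>)
    case 0
    then have "raw_mon \<alpha> = (\<lambda>_. 1)" by (auto simp: raw_mon_def mi_exact_def mi_order_def)
    then show ?case using one by simp
  next
    case (Suc j)
    then have "(\<Sum>b\<in>Basis. \<alpha> b) \<noteq> 0" by (simp add: mi_exact_def mi_order_def)
    then obtain b where b: "b \<in> Basis" "\<alpha> b \<noteq> 0" by (metis sum.neutral)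
    define \<beta> where "\<beta> = \<alpha>(b := \<alpha> b - 1)"
    have \<alpha>: "\<alpha> = \<beta>(b := Suc (\<beta> b))" using b by (auto simp: \<beta>_def)
    have "mi_order \<alpha> = Suc j" using Suc.prems by (simp add: mi_exact_def)
    then have "Suc (mi_order \<beta>) = Suc j" using mi_order_Suc[OF b(1), of \<beta>] \<alpha> by metis
    moreover have "\<forall>b. b \<notin> Basis \<longrightarrow> \<beta> b = 0" using Suc.prems b by (auto simp: \<beta>_def mi_exact_def)
    ultimately have "\<beta> \<in> mi_exact j" by (simp add: mi_exact_def)
    then have "raw_mon \<beta> \<in> W j" using Suc by simp
    then have "(\<lambda>x. (x \<bullet> b) * raw_mon \<beta> x) \<in> W (Suc j)" using Suc.prems b mult by simp
    then show ?case using raw_mon_Suc[OF b(1), of \<beta>] \<alpha> by (metis (no_types, lifting) ext)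
  qed
  obtain c where c: "p = (\<lambda>x. \<Sum>\<alpha>\<in>multi_indices k. c \<alpha> * raw_mon \<alpha> x)"
    using p by (rule poly_spaceE)
  have zero: "(\<lambda>_. 0) \<in> W k" using lin[OF mono[OF one] mono[OF one], of 0 0] by simp
  have "(\<lambda>x. \<Sum>\<alpha>\<in>A. c \<alpha> * raw_mon \<alpha> x) \<in> W k" if "A \<subseteq> multi_indices k" "finite A" for A
    using that(2,1)
  proof induction
    case (insert \<alpha> A)
    have "raw_mon \<alpha> \<in> W k"
      using insert.prems by (intro mono[OF rm[of \<alpha> "mi_order \<alpha>"]]) (auto simp: multi_indices_def mi_exact_def)
    then show ?case using lin[of "raw_mon \<alpha>" "\<lambda>x. \<Sum>\<alpha>\<in>A. c \<alpha> * raw_mon \<alpha> x" "c \<alpha>" 1] insert by simp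
  qed (use zero in simp)
  then show ?thesis unfolding c using finite_multi_indices by blast
qed

lemma poly_space_const: "(\<lambda>x. c) \<in> poly_space k"
proof -
  have "(\<lambda>_. 0) \<in> (multi_indices k :: ('a \<Rightarrow> nat) set)" by (simp add: multi_indices_def mi_order_0)
  from poly_space_cmult[OF raw_mon_in_poly_space[OF this], of c] show ?thesis by (simp add: raw_mon_def)
qed

lemma poly_space_Suc: "p \<in> poly_space k \<Longrightarrow> p \<in> poly_space (Suc k)"
proof (elim poly_spaceE)
  fix c assume p: "p = (\<lambda>x. \<Sum>\<alpha>\<in>multi_indices k. c \<alpha> * raw_mon \<alpha> x)"
  show ?thesis unfolding p
    by (intro poly_space_sum poly_space_cmult raw_mon_in_poly_space) (auto simp: multi_indices_def)
qed

lemma poly_space_coord_mult: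
  assumes "p \<in> poly_space k" "b \<in> Basis"
  shows "(\<lambda>x. (x \<bullet> b) * p x) \<in> poly_space (Suc k)"
proof -
  obtain c where p: "p = (\<lambda>x. \<Sum>\<alpha>\<in>multi_indices k. c \<alpha> * raw_mon \<alpha> x)"
    using assms(1) by (rule poly_spaceE)
  have "(\<lambda>x. (x \<bullet> b) * p x) = (\<lambda>x. \<Sum>\<alpha>\<in>multi_indices k. c \<alpha> * raw_mon (\<alpha>(b := Suc (\<alpha> b))) x)"
    by (simp add: p raw_mon_Suc[OF assms(2)] sum_distrib_left mult_ac)
  also have "\<dots> \<in> poly_space (Suc k)"
    by (intro poly_space_sum poly_space_cmult raw_mon_in_poly_space multi_indices_Suc assms(2))
  finally show ?thesis .
qed

lemma poly_space_affine_mult: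
  assumes "p \<in> poly_space k"
  shows "(\<lambda>x. (c + (\<Sum>b\<in>Basis. a b * (x \<bullet> b))) * p x) \<in> poly_space (Suc k)"
proof -
  have "(\<lambda>x. (c + (\<Sum>b\<in>Basis. a b * (x \<bullet> b))) * p x) = (\<lambda>x. c * p x + (\<Sum>b\<in>Basis. a b * ((x \<bullet> b) * p x)))"
    by (simp add: distrib_right sum_distrib_right mult.assoc)
  also have "\<dots> \<in> poly_space (Suc k)"
    by (intro poly_space_add poly_space_cmult poly_space_sum poly_space_Suc poly_space_coord_mult assms)
  finally show ?thesis .
qed

lemma poly_space_affine_subst:
  assumes "p \<in> poly_space k"
  shows "(\<lambda>x. p (t + r *\<^sub>R x)) \<in> poly_space k"
proof -
  have "p \<in> {f. (\<lambda>x. f (t + r *\<^sub>R x)) \<in> poly_space k}"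
  proof (rule poly_space_graded_induct[where W = "\<lambda>j. {f. (\<lambda>x. f (t + r *\<^sub>R x)) \<in> poly_space j}", OF _ _ _ _ assms])
    fix j f and b :: 'a assume f: "f \<in> {f. (\<lambda>x. f (t + r *\<^sub>R x)) \<in> poly_space j}" and b: "b \<in> Basis"
    have "(\<lambda>x. ((t + r *\<^sub>R x) \<bullet> b) * f (t + r *\<^sub>R x)) = 
      (\<lambda>x. (t \<bullet> b) * f (t + r *\<^sub>R x) + r * ((x \<bullet> b) * f (t + r *\<^sub>R x)))"
      by (simp add: inner_add_left algebra_simps)
    also have "\<dots> \<in> poly_space (Suc j)"
      using f b by (intro poly_space_add poly_space_cmult poly_space_Suc poly_space_coord_mult) auto
    finally show "(\<lambda>x. (x \<bullet> b) * f x) \<in> {f. (\<lambda>x. f (t + r *\<^sub>R x)) \<in> poly_space (Suc j)}" by simp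
  qed (auto intro: poly_space_const poly_space_lincomb poly_space_Suc)
  then show ?thesis by simp
qed

lemma smooth_poly_space: "p \<in> poly_space k \<Longrightarrow> smooth p"
  by (elim poly_spaceE) (auto simp: raw_mon_def intro!: smooth_sum smooth_cmult smooth_prod smooth_power smooth_inner)

lemma poly_space_poly_jet:
  assumes "p \<in> poly_space k"
  obtains c where "p = poly_jet (multi_indices k) c (\<lambda>_. 0)"
proof -
  obtain c where p: "p = (\<lambda>x. \<Sum>\<alpha>\<in>multi_indices k. c \<alpha> * raw_mon \<alpha> x)"
    using assms by (rule poly_spaceE)
  have "p = poly_jet (multi_indices k) (\<lambda>\<alpha>. c \<alpha> * (\<Prod>b\<in>Basis. fact (\<alpha> b))) (\<lambda>_. 0)"
    unfolding p poly_jet_def by (intro ext sum.cong) (auto simp: raw_mon_def mon_def prod_dividef)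
  then show ?thesis by (rule that)
qed

section \<open>Orthogonal projection and control of coefficients\<close>

definition l2ip :: "'a::euclidean_space set \<Rightarrow> ('a \<Rightarrow> real) \<Rightarrow> ('a \<Rightarrow> real) \<Rightarrow> real" where
  "l2ip U f g = (LINT x:U|lebesgue. f x * g x)"

lemma l2ip_commute: "l2ip U f g = l2ip U g f"
  by (simp add: l2ip_def mult.commute)

lemma l2ip_self: "l2ip U f f = sqint U f"
  by (simp add: l2ip_def sqint_def power2_eq_square)

lemma l2ip_diff_left:
  assumes "f \<in> L2_space U" "g \<in> L2_space U" "h \<in> L2_space U"
  shows "l2ip U (\<lambda>x. f x - g x) h = l2ip U f h - l2ip U g h"
  unfolding l2ip_def left_diff_distrib by (intro set_integral_diff(2) L2_mult_integrable assms)

lemma l2ip_cmult_left: "l2ip U (\<lambda>x. a * f x) h = a * l2ip U f h"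
  by (simp add: l2ip_def mult.assoc)

lemma l2ip_sum_left:
  assumes "\<And>i. i \<in> I \<Longrightarrow> f i \<in> L2_space U" "h \<in> L2_space U"
  shows "l2ip U (\<lambda>x. \<Sum>i\<in>I. c i * f i x) h = (\<Sum>i\<in>I. c i * l2ip U (f i) h)"
proof -
  have "l2ip U (\<lambda>x. \<Sum>i\<in>I. c i * f i x) h = (\<Sum>i\<in>I. l2ip U (\<lambda>x. c i * f i x) h)"
    unfolding l2ip_def sum_distrib_right by (intro set_integral_sum(2) L2_mult_integrable L2_space_cmult assms)
  then show ?thesis by (simp add: l2ip_cmult_left)
qed

lemma L2_space_lin_sum: "(\<And>i. i \<in> I \<Longrightarrow> f i \<in> L2_space U) \<Longrightarrow> (\<lambda>x. \<Sum>i\<in>I. c i * f i x) \<in> L2_space U"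
  by (intro L2_space_sum L2_space_cmult)

text \<open>One Gram--Schmidt step per function. The family may be linearly dependent.\<close>

lemma L2_projection_exists:
  assumes "finite I" "\<And>i. i \<in> I \<Longrightarrow> f i \<in> L2_space U" "w \<in> L2_space U"
  shows "\<exists>c. \<forall>j\<in>I. l2ip U (\<lambda>x. w x - (\<Sum>i\<in>I. c i * f i x)) (f j) = 0"
  using assms
proof (induction I arbitrary: w)
  case (insert j I)
  have fL: "f i \<in> L2_space U" if "i \<in> insert j I" for i using insert.prems that by blast
  obtain c where c: "\<And>i. i \<in> I \<Longrightarrow> l2ip U (\<lambda>x. f j x - (\<Sum>i\<in>I. c i * f i x)) (f i) = 0"
    using insert.IH[of "f j"] fL by blast
  obtain d where d: "\<And>i. i \<in> I \<Longrightarrow> l2ip U (\<lambda>x. w x - (\<Sum>i\<in>I. d i * f i x)) (f i) = 0"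
    using insert.IH[of w] fL insert.prems(2) by blast
  define f' where "f' x = f j x - (\<Sum>i\<in>I. c i * f i x)" for x
  define r where "r x = w x - (\<Sum>i\<in>I. d i * f i x)" for x
  have SL: "(\<lambda>x. \<Sum>i\<in>I. e i * f i x) \<in> L2_space U" for e using fL by (intro L2_space_lin_sum) auto
  have f'L: "f' \<in> L2_space U" unfolding f'_def by (intro L2_space_diff SL fL) auto
  have rL: "r \<in> L2_space U" unfolding r_def by (intro L2_space_diff SL insert.prems(2))
  \<comment> \<open>If \<open>f'\<close> has norm zero, the new function depends on the old ones in
    L2 and no correction is made; the residual is orthogonal to \<open>f'\<close> then by
    Cauchy--Schwarz.\<close>
  define t where "t = (if sqint U f' = 0 then 0 else l2ip U r f' / sqint U f')"
  define e where "e i = (if i = j then t else d i - t * c i)" for i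
  have res: "(\<lambda>x. w x - (\<Sum>i\<in>insert j I. e i * f i x)) = (\<lambda>x. r x - t * f' x)"
  proof
    fix x
    have "(\<Sum>i\<in>I. e i * f i x) = (\<Sum>i\<in>I. d i * f i x - t * (c i * f i x))"
      using insert.hyps by (intro sum.cong) (auto simp: e_def algebra_simps)
    then show "w x - (\<Sum>i\<in>insert j I. e i * f i x) = r x - t * f' x"
      using insert.hyps by (simp add: e_def r_def f'_def sum_subtractf sum_distrib_left algebra_simps)
  qed
  have tf'L: "(\<lambda>x. t * f' x) \<in> L2_space U" by (rule L2_space_cmult[OF f'L])
  have or: "l2ip U (\<lambda>x. r x - t * f' x) (f i) = 0" if "i \<in> I" for i
    using that c[OF that] d[OF that] fL unfolding f'_def[symmetric] r_def[symmetric]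
    by (simp add: l2ip_diff_left[OF rL tf'L] l2ip_cmult_left)
  have RL: "(\<lambda>x. r x - t * f' x) \<in> L2_space U" by (rule L2_space_diff[OF rL tf'L])
  \<comment> \<open>\<open>f j\<close> is \<open>f'\<close> plus a combination of the earlier
    functions, to which the new residual is already orthogonal.\<close>
  have orj: "l2ip U (\<lambda>x. r x - t * f' x) (f j) = 0"
  proof -
    have "l2ip U f' (\<lambda>x. r x - t * f' x) = l2ip U (f j) (\<lambda>x. r x - t * f' x) - (\<Sum>i\<in>I. c i * l2ip U (f i) (\<lambda>x. r x - t * f' x))"
      unfolding f'_def[abs_def]
      using fL RL[unfolded f'_def] by (subst l2ip_diff_left[OF _ SL]) (auto simp: l2ip_sum_left)
    also have "(\<Sum>i\<in>I. c i * l2ip U (f i) (\<lambda>x. r x - t * f' x)) = 0"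
      using or by (simp add: l2ip_commute[of U _ "\<lambda>x. r x - t * f' x"])
    finally have "l2ip U (\<lambda>x. r x - t * f' x) (f j) = l2ip U (\<lambda>x. r x - t * f' x) f'"
      by (simp add: l2ip_commute[of U _ "\<lambda>x. r x - t * f' x"])
    also have "\<dots> = l2ip U r f' - t * sqint U f'"
      by (simp add: l2ip_diff_left[OF rL tf'L f'L] l2ip_cmult_left l2ip_self)
    also have "\<dots> = 0"
    proof (cases "sqint U f' = 0")
      case True
      then have "(l2ip U r f')\<^sup>2 \<le> 0" using L2_Cauchy_Schwarz[OF rL f'L] by (simp add: l2ip_def)
      then show ?thesis using True by simp
    qed (simp add: t_def)
    finally show ?thesis .
  qed
  show ?case by (intro exI[of _ e] ballI) (use or orj in \<open>auto simp: res\<close>)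
qed simp

text \<open>Equivalence of norms without compactness. The part \<open>g\<close> of
  \<open>f i\<close> orthogonal to the other functions has positive norm by independence, and
  pairing a combination with \<open>g\<close> isolates its coefficient \<open>c i\<close>.\<close>

lemma L2_coefficient_bound:
  assumes fin: "finite I" and fL: "\<And>i. i \<in> I \<Longrightarrow> f i \<in> L2_space U"
    and indep: "\<And>c. sqint U (\<lambda>x. \<Sum>i\<in>I. c i * f i x) = 0 \<Longrightarrow> \<forall>i\<in>I. c i = 0"
  shows "\<exists>C\<ge>0. \<forall>c. \<forall>i\<in>I. (c i)\<^sup>2 \<le> C * sqint U (\<lambda>x. \<Sum>i\<in>I. c i * f i x)"
proof -
  have "\<exists>C\<ge>0. \<forall>c. (c i)\<^sup>2 \<le> C * sqint U (\<lambda>x. \<Sum>i\<in>I. c i * f i x)" if i: "i \<in> I" for i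
  proof -
    obtain d where d: "\<And>j. j \<in> I - {i} \<Longrightarrow> l2ip U (\<lambda>x. f i x - (\<Sum>j\<in>I - {i}. d j * f j x)) (f j) = 0"
      using L2_projection_exists[of "I - {i}" f U "f i"] fin fL i by blast
    define g where "g x = f i x - (\<Sum>j\<in>I - {i}. d j * f j x)" for x
    have SL: "(\<lambda>x. \<Sum>j\<in>I - {i}. d j * f j x) \<in> L2_space U" using fL by (intro L2_space_lin_sum) auto
    have gL: "g \<in> L2_space U" unfolding g_def by (intro L2_space_diff SL fL i)
    have g: "g = (\<lambda>x. \<Sum>j\<in>I. (if j = i then 1 else - d j) * f j x)"
      using fin i by (auto simp: g_def sum.remove[of I i] sum_negf[symmetric] intro!: ext sum.cong)
    have g0: "sqint U g \<noteq> 0"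
    proof
      assume "sqint U g = 0"
      then have "\<forall>j\<in>I. (if j = i then 1 else - d j) = 0" unfolding g by (rule indep)
      then show False using i by (auto dest: bspec[of _ _ i])
    qed
    then have gpos: "sqint U g > 0" using sqint_nonneg[of U g] by linarith
    have fg: "l2ip U (f j) g = 0" if "j \<in> I - {i}" for j
      using d[OF that] by (simp add: g_def[symmetric] l2ip_commute)
    have fig: "l2ip U (f i) g = sqint U g"
    proof -
      have "sqint U g = l2ip U (f i) g - (\<Sum>j\<in>I - {i}. d j * l2ip U (f j) g)"
        unfolding l2ip_self[symmetric] 
        using l2ip_diff_left[OF fL[OF i] SL gL] l2ip_sum_left[of "I - {i}" f U g d] fL gL unfolding g_def[symmetric] by auto
      then show ?thesis using fg by simp
    qed
    have "(c i)\<^sup>2 \<le> inverse (sqint U g) * sqint U (\<lambda>x. \<Sum>i\<in>I. c i * f i x)" for c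
    proof -
      let ?F = "\<lambda>x. \<Sum>i\<in>I. c i * f i x"
      have FL: "?F \<in> L2_space U" using fL by (intro L2_space_lin_sum)
      have "l2ip U ?F g = (\<Sum>j\<in>I. c j * l2ip U (f j) g)" using fL gL by (intro l2ip_sum_left)
      also have "\<dots> = c i * sqint U g" using fin i fg fig by (simp add: sum.remove[of I i])
      finally have "(c i * sqint U g)\<^sup>2 \<le> sqint U ?F * sqint U g"
        using L2_Cauchy_Schwarz[OF FL gL] by (simp add: l2ip_def)
      then have "((c i)\<^sup>2 * sqint U g) * sqint U g \<le> sqint U ?F * sqint U g"
        by (simp add: power2_eq_square mult_ac)
      then have "(c i)\<^sup>2 * sqint U g \<le> sqint U ?F" using gpos by simp
      then show ?thesis using gpos by (simp add: field_simps)
    qed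
    then show ?thesis using gpos by (intro exI[of _ "inverse (sqint U g)"]) auto
  qed
  then obtain C where C: "\<And>i. i \<in> I \<Longrightarrow> C i \<ge> 0" "\<And>i c. i \<in> I \<Longrightarrow> (c i)\<^sup>2 \<le> C i * sqint U (\<lambda>x. \<Sum>i\<in>I. c i * f i x)"
    by metis
  show ?thesis
  proof (intro exI[of _ "\<Sum>i\<in>I. C i"] conjI allI ballI)
    show "0 \<le> (\<Sum>i\<in>I. C i)" using C(1) by (rule sum_nonneg)
    fix c i assume i: "i \<in> I"
    have "C i \<le> (\<Sum>i\<in>I. C i)" using i C(1) fin by (intro member_le_sum) auto
    then show "(c i)\<^sup>2 \<le> (\<Sum>i\<in>I. C i) * sqint U (\<lambda>x. \<Sum>i\<in>I. c i * f i x)"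
      by (rule order_trans[OF C(2)[OF i] mult_right_mono[OF _ sqint_nonneg]])
  qed
qed

lemma sqint_zero_imp_zero:
  assumes c: "continuous_on UNIV p" and U: "open U" "bounded U" and z: "sqint U p = 0" and x: "x \<in> U"
  shows "p x = 0"
proof (rule ccontr)
  assume px: "p x \<noteq> 0"
  have UL: "U \<in> sets lebesgue" using U by simp
  have pL: "p \<in> L2_space U" by (rule continuous_imp_L2_space[OF c U(2) UL])
  have ae: "AE x in lebesgue. indicator U x *\<^sub>R (p x)\<^sup>2 = 0"
    using z L2_spaceD(2)[OF pL] unfolding sqint_def set_lebesgue_integral_def set_integrable_def
    by (subst (asm) integral_nonneg_eq_0_iff_AE) auto
  have op: "open (U \<inter> {x. p x \<noteq> 0})"
    using U(1) open_Collect_neq[OF c continuous_on_const, of 0] by auto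
  have "AE y in lebesgue. y \<notin> U \<inter> {x. p x \<noteq> 0}"
    using ae by eventually_elim (auto simp: indicator_def)
  then have "U \<inter> {x. p x \<noteq> 0} \<in> null_sets lebesgue"
    using op by (subst AE_iff_null_sets) auto
  then have "negligible (U \<inter> {x. p x \<noteq> 0})" by (simp add: negligible_iff_null_sets)
  then show False using open_not_negligible[OF op] x px by auto
qed

lemma mon_at_0: "mon \<alpha> 0 = (if \<forall>b\<in>Basis. \<alpha> b = 0 then 1 else 0)"
  by (auto simp: mon_def intro!: prod_zero)

text \<open>All derivatives vanish on the open set along with the polynomial, and the derivative of
  order \<open>\<alpha>\<close> at 0 is the coefficient \<open>c \<alpha>\<close>.\<close>

lemma poly_jet_zero_imp_coeff_zero:
  fixes c :: "('a::euclidean_space \<Rightarrow> nat) \<Rightarrow> real"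
  assumes z: "\<And>x. x \<in> U \<Longrightarrow> poly_jet (multi_indices k) c (\<lambda>_. 0) x = 0" and U: "open U" "0 \<in> U"
    and \<alpha>: "\<alpha> \<in> multi_indices k"
  shows "c \<alpha> = 0"
proof -
  have "\<forall>x\<in>U. poly_jet (multi_indices k) c \<beta> x = 0" if "\<beta> \<in> mi_exact m" for \<beta> m
    using that
  proof (induction m arbitrary: \<beta>)
    case 0
    then have "\<beta> = (\<lambda>_. 0)" by (auto simp: mi_exact_def mi_order_def)
    then show ?case using z by simp
  next
    case (Suc m)
    then have "(\<Sum>b\<in>Basis. \<beta> b) \<noteq> 0" by (simp add: mi_exact_def mi_order_def)
    then obtain b where b: "b \<in> Basis" "\<beta> b \<noteq> 0" by (metis sum.neutral)
    define \<beta>' where "\<beta>' = \<beta>(b := \<beta> b - 1)"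
    have \<beta>: "\<beta> = \<beta>'(b := Suc (\<beta>' b))" using b by (auto simp: \<beta>'_def)
    have "mi_order \<beta> = Suc m" using Suc.prems by (simp add: mi_exact_def)
    then have "Suc (mi_order \<beta>') = Suc m" using mi_order_Suc[OF b(1), of \<beta>'] \<beta> by metis
    moreover have "\<forall>b. b \<notin> Basis \<longrightarrow> \<beta>' b = 0" using Suc.prems b by (auto simp: \<beta>'_def mi_exact_def)
    ultimately have IH: "\<forall>x\<in>U. poly_jet (multi_indices k) c \<beta>' x = 0" using Suc.IH by (simp add: mi_exact_def)
    show ?case
    proof
      fix x assume x: "x \<in> U"
      have "((\<lambda>x. 0) has_derivative (\<lambda>h. 0)) (at x)" by simp
      then have "(poly_jet (multi_indices k) c \<beta>' has_derivative (\<lambda>h. 0)) (at x)"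
        by (rule has_derivative_transform_within_open[OF _ U(1) x]) (use IH in auto)
      then have "partial_deriv b (poly_jet (multi_indices k) c \<beta>') x = 0" by (rule partial_derivI)
      then show "poly_jet (multi_indices k) c \<beta> x = 0"
        using partial_deriv_poly_jet[OF b(1) finite_multi_indices, of k c \<beta>'] \<beta> by simp
    qed
  qed
  then have "poly_jet (multi_indices k) c \<alpha> 0 = 0" using \<alpha> U(2) by (auto simp: multi_indices_def mi_exact_def)
  moreover have "poly_jet (multi_indices k) c \<alpha> 0 = c \<alpha>"
  proof -
    have "c \<alpha>' * mon (\<lambda>b. \<alpha>' b - \<alpha> b) 0 = 0" if "\<alpha>' \<in> {\<alpha>' \<in> multi_indices k. \<forall>b. \<alpha> b \<le> \<alpha>' b} - {\<alpha>}" for \<alpha>'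
    proof -
      have le: "\<alpha> b \<le> \<alpha>' b" for b using that by auto
      have "\<alpha>' \<noteq> \<alpha>" using that by auto
      then obtain b where "\<alpha>' b \<noteq> \<alpha> b" by (meson ext)
      then have "\<alpha> b < \<alpha>' b" using le[of b] by simp
      moreover from this have "b \<in> Basis" using that by (auto simp: multi_indices_def)
      ultimately have "b \<in> Basis" "\<alpha>' b - \<alpha> b \<noteq> 0" by auto
      then have "\<not> (\<forall>b\<in>Basis. \<alpha>' b - \<alpha> b = 0)" by metis
      then have "mon (\<lambda>b. \<alpha>' b - \<alpha> b) 0 = 0" unfolding mon_at_0 by (rule if_not_P)
      then show ?thesis by simp
    qed
    then have "poly_jet (multi_indices k) c \<alpha> 0 = (\<Sum>\<alpha>'\<in>{\<alpha>}. c \<alpha>' * mon (\<lambda>b. \<alpha>' b - \<alpha> b) 0)"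
      unfolding poly_jet_def using \<alpha> finite_multi_indices[of k] by (intro sum.mono_neutral_right) auto
    then show ?thesis by (simp add: mon_at_0)
  qed
  ultimately show ?thesis by simp
qed

text \<open>The L2 norm on the unit ball controls the coefficients, and the monomials with their
  first derivatives are bounded on the larger ball by compactness; Cauchy--Schwarz for the finite
  sum combines the two.\<close>

lemma poly_space_unit_ball_bound:
  "\<exists>C\<ge>0. \<forall>p\<in>poly_space k. \<forall>x\<in>cball 0 R. (p x)\<^sup>2 \<le> C * sqint (ball (0::'a::euclidean_space) 1) p \<and>
     (\<forall>b\<in>Basis. (partial_deriv b p x)\<^sup>2 \<le> C * sqint (ball 0 1) p)"
proof -
  let ?A = "multi_indices k :: ('a \<Rightarrow> nat) set" and ?B = "ball (0::'a) 1"
  have mL: "mon \<alpha> \<in> L2_space ?B" for \<alpha>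
    by (rule continuous_imp_L2_space[OF smooth_continuous[OF smooth_mon]]) auto
  have pj: "poly_jet ?A c (\<lambda>_. 0) = (\<lambda>x. \<Sum>\<alpha>\<in>?A. c \<alpha> * mon \<alpha> x)" for c
    by (simp add: poly_jet_def fun_eq_iff)
  have ind: "\<forall>\<alpha>\<in>?A. c \<alpha> = 0" if "sqint ?B (\<lambda>x. \<Sum>\<alpha>\<in>?A. c \<alpha> * mon \<alpha> x) = 0" for c
  proof
    fix \<alpha> assume \<alpha>: "\<alpha> \<in> ?A"
    show "c \<alpha> = 0"
    proof (rule poly_jet_zero_imp_coeff_zero[OF _ open_ball _ \<alpha>, of 0 1])
      have "sqint ?B (poly_jet ?A c (\<lambda>_. 0)) = 0" using that unfolding pj .
      then show "poly_jet ?A c (\<lambda>_. 0) x = 0" if "x \<in> ?B" for x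
        by (rule sqint_zero_imp_zero[OF smooth_continuous[OF smooth_poly_jet] open_ball bounded_ball _ that])
    qed simp
  qed
  obtain C where C: "C \<ge> 0" and Cb: "\<And>c \<alpha>. \<alpha> \<in> ?A \<Longrightarrow> (c \<alpha>)\<^sup>2 \<le> C * sqint ?B (\<lambda>x. \<Sum>\<alpha>\<in>?A. c \<alpha> * mon \<alpha> x)"
  proof -
    have "\<exists>C\<ge>0. \<forall>c. \<forall>\<alpha>\<in>?A. (c \<alpha>)\<^sup>2 \<le> C * sqint ?B (\<lambda>x. \<Sum>\<alpha>\<in>?A. c \<alpha> * mon \<alpha> x)"
      by (rule L2_coefficient_bound[OF finite_multi_indices mL ind])
    then show ?thesis by (elim exE conjE) (rule that, auto)
  qed
  have bd: "\<exists>M. \<forall>x\<in>cball 0 R. (\<Sum>\<alpha>\<in>?A. (f \<alpha> x)\<^sup>2) \<le> M" if "\<And>\<alpha>. smooth (f \<alpha>)" for f :: "('a \<Rightarrow> nat) \<Rightarrow> 'a \<Rightarrow> real"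
  proof -
    have "continuous_on (cball 0 R) (\<lambda>x. \<Sum>\<alpha>\<in>?A. (f \<alpha> x)\<^sup>2)"
      by (rule continuous_on_subset[OF smooth_continuous[OF smooth_sum[OF smooth_power[OF that]]]]) simp
    then have "compact ((\<lambda>x. \<Sum>\<alpha>\<in>?A. (f \<alpha> x)\<^sup>2) ` cball 0 R)" by (intro compact_continuous_image) auto
    then obtain M where "\<forall>y\<in>(\<lambda>x. \<Sum>\<alpha>\<in>?A. (f \<alpha> x)\<^sup>2) ` cball 0 R. norm y \<le> M"
      by (auto dest!: compact_imp_bounded simp: bounded_iff)
    then show ?thesis by (intro exI[of _ M]) (auto dest!: abs_le_D1)
  qed
  obtain M where M: "\<And>x. x \<in> cball 0 R \<Longrightarrow> (\<Sum>\<alpha>\<in>?A. (mon \<alpha> x)\<^sup>2) \<le> M"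
    using bd[of mon] smooth_mon by blast
  have "\<exists>M. \<forall>x\<in>cball 0 R. (\<Sum>\<alpha>\<in>?A. (partial_deriv b (mon \<alpha>) x)\<^sup>2) \<le> M" for b
    using bd[of "\<lambda>\<alpha>. partial_deriv b (mon \<alpha>)"] smooth_deriv[OF smooth_mon] by blast
  then obtain M' where M': "\<And>b x. x \<in> cball 0 R \<Longrightarrow> (\<Sum>\<alpha>\<in>?A. (partial_deriv b (mon \<alpha>) x)\<^sup>2) \<le> M' b" by metis
  \<comment> \<open>One bound for the values and for the derivatives in all coordinate
    directions.\<close>
  define K where "K = \<bar>M\<bar> + (\<Sum>b\<in>Basis. \<bar>M' b\<bar>)"
  have K0: "0 \<le> K" by (auto simp: K_def intro!: add_nonneg_nonneg sum_nonneg)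
  have MK: "M \<le> K" "\<And>b. b \<in> Basis \<Longrightarrow> M' b \<le> K"
  proof -
    have "0 \<le> (\<Sum>b\<in>(Basis::'a set). \<bar>M' b\<bar>)" by (intro sum_nonneg) auto
    then show "M \<le> K" unfolding K_def by linarith
    show "M' b \<le> K" if "b \<in> Basis" for b
      using member_le_sum[of b Basis "\<lambda>b. \<bar>M' b\<bar>"] that by (auto simp: K_def)
  qed
  let ?N = "real (card ?A)"
  have key: "(\<Sum>\<alpha>\<in>?A. c \<alpha> * f \<alpha>)\<^sup>2 \<le> ?N * C * K * sqint ?B (\<lambda>x. \<Sum>\<alpha>\<in>?A. c \<alpha> * mon \<alpha> x)"
    if "(\<Sum>\<alpha>\<in>?A. (f \<alpha>)\<^sup>2) \<le> K" for c f
  proof -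
    let ?S = "sqint ?B (\<lambda>x. \<Sum>\<alpha>\<in>?A. c \<alpha> * mon \<alpha> x)"
    have "(\<Sum>\<alpha>\<in>?A. c \<alpha> * f \<alpha>)\<^sup>2 \<le> (\<Sum>\<alpha>\<in>?A. (c \<alpha>)\<^sup>2) * (\<Sum>\<alpha>\<in>?A. (f \<alpha>)\<^sup>2)"
      by (rule Cauchy_Schwarz_ineq_sum)
    also have "\<dots> \<le> (?N * (C * ?S)) * K"
    proof (rule mult_mono[OF _ that])
      show "(\<Sum>\<alpha>\<in>?A. (c \<alpha>)\<^sup>2) \<le> ?N * (C * ?S)" by (rule sum_bounded_above) (rule Cb)
      show "0 \<le> ?N * (C * ?S)" by (intro mult_nonneg_nonneg sqint_nonneg C) auto
    qed (auto intro: sum_nonneg)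
    finally show ?thesis by (simp add: mult_ac)
  qed
  show ?thesis
  proof (intro exI[of _ "?N * C * K"] conjI ballI)
    show "0 \<le> ?N * C * K" using C K0 by auto
    fix p :: "'a \<Rightarrow> real" and x assume p: "p \<in> poly_space k" and x: "x \<in> cball (0::'a) R"
    obtain c where c: "p = (\<lambda>x. \<Sum>\<alpha>\<in>?A. c \<alpha> * mon \<alpha> x)" 
      using poly_space_poly_jet[OF p] unfolding pj by metis
    show "(p x)\<^sup>2 \<le> ?N * C * K * sqint ?B p"
      unfolding c by (rule key[OF order_trans[OF M[OF x] MK(1)]])
    fix b :: 'a assume b: "b \<in> Basis"
    have "partial_deriv b p x = (\<Sum>\<alpha>\<in>?A. c \<alpha> * partial_deriv b (mon \<alpha>) x)"
      unfolding c by (rule partial_deriv_sum_cmult[OF smooth_mon])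
    then show "(partial_deriv b p x)\<^sup>2 \<le> ?N * C * K * sqint ?B p"
      unfolding c using key[OF order_trans[OF M'[OF x] MK(2)[OF b]], of c] by (simp add: c)
  qed
qed

lemma sqint_ball_scale:
  fixes x0 :: "'a::euclidean_space"
  assumes p: "smooth p" and r: "r > 0"
  shows "sqint (ball x0 r) p = r ^ DIM('a) * sqint (ball 0 1) (\<lambda>y. p (x0 + r *\<^sub>R y))"
proof -
  have m: "(\<lambda>x. indicator (ball x0 r) x *\<^sub>R (p x)\<^sup>2) \<in> borel_measurable lebesgue"
    using continuous_imp_measurable_lebesgue[OF smooth_continuous[OF p]] 
    by (intro borel_measurable_scaleR borel_measurable_indicator borel_measurable_power) auto
  have ind: "x0 + r *\<^sub>R y \<in> ball x0 r \<longleftrightarrow> y \<in> ball 0 1" for y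
    using r by (simp add: dist_norm)
  show ?thesis
    unfolding sqint_def set_lebesgue_integral_def
    by (subst integral_lebesgue_affine[OF m, of r x0]) (use r in \<open>auto simp: ind indicator_def of_bool_def simp del: mem_ball\<close>)
qed

lemma partial_deriv_affine:
  assumes "smooth p"
  shows "partial_deriv b (\<lambda>y. p (t + r *\<^sub>R y)) y = r * partial_deriv b p (t + r *\<^sub>R y)"
proof -
  have d: "(p has_derivative frechet_derivative p (at (t + r *\<^sub>R y))) (at (t + r *\<^sub>R y))"
    using smooth_deriv[OF assms] by (simp add: frechet_derivative_works[symmetric])
  then interpret linear "frechet_derivative p (at (t + r *\<^sub>R y))" by (rule has_derivative_linear)
  have "((\<lambda>y. t + r *\<^sub>R y) has_derivative (\<lambda>h. r *\<^sub>R h)) (at y)" by (auto intro!: derivative_eq_intros)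
  from has_derivative_compose[OF this d] show ?thesis
    by (subst partial_derivI) (auto simp: scale partial_deriv_def)
qed

text \<open>The substitution \<open>x = x0 + r *\<^sub>R y\<close> reduces to the unit ball. The
  squared norm contributes \<open>r ^ DIM('a)\<close>, and a derivative two more powers. The ratio
  \<open>R\<close> may exceed 1: extrapolation beyond the ball is included.\<close>

lemma poly_space_ball_bound:
  "\<exists>C\<ge>0. \<forall>p\<in>poly_space k. \<forall>x0 :: 'a::euclidean_space. \<forall>r>0. \<forall>x. dist x0 x \<le> R * r \<longrightarrow>
     (p x)\<^sup>2 \<le> C / r ^ DIM('a) * sqint (ball x0 r) p \<and>
     (\<forall>b\<in>Basis. (partial_deriv b p x)\<^sup>2 \<le> C / r ^ (DIM('a) + 2) * sqint (ball x0 r) p)"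
proof -
  obtain C where C: "C \<ge> 0" "\<And>p x. p \<in> poly_space k \<Longrightarrow> x \<in> cball 0 R \<Longrightarrow> (p x)\<^sup>2 \<le> C * sqint (ball (0::'a) 1) p \<and>
     (\<forall>b\<in>Basis. (partial_deriv b p x)\<^sup>2 \<le> C * sqint (ball 0 1) p)"
    using poly_space_unit_ball_bound by blast
  show ?thesis
  proof (intro exI[of _ C] conjI C(1) ballI allI impI)
    fix p :: "'a \<Rightarrow> real" and x0 :: 'a and r :: real and x 
    assume p: "p \<in> poly_space k" and r: "r > 0" and x: "dist x0 x \<le> R * r"
    define q where "q y = p (x0 + r *\<^sub>R y)" for y
    define y where "y = (1 / r) *\<^sub>R (x - x0)"
    have q: "q \<in> poly_space k" unfolding q_def by (rule poly_space_affine_subst[OF p])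
    have y: "y \<in> cball 0 R" "x0 + r *\<^sub>R y = x"
      using r x by (auto simp: y_def dist_norm norm_minus_commute divide_le_eq)
    have sq: "sqint (ball 0 1) q = sqint (ball x0 r) p / r ^ DIM('a)"
      using sqint_ball_scale[OF smooth_poly_space[OF p] r, of x0] r by (simp add: q_def[abs_def])
    note b = C(2)[OF q y(1)]
    show "(p x)\<^sup>2 \<le> C / r ^ DIM('a) * sqint (ball x0 r) p"
      using b y(2) by (simp add: sq q_def)
    fix a :: 'a assume a: "a \<in> Basis"
    have "partial_deriv a q y = r * partial_deriv a p x"
      unfolding q_def using partial_deriv_affine[OF smooth_poly_space[OF p]] y(2) by simp
    then have "r\<^sup>2 * (partial_deriv a p x)\<^sup>2 \<le> C * (sqint (ball x0 r) p / r ^ DIM('a))"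
      using b a by (auto simp: sq power_mult_distrib)
    then have "(partial_deriv a p x)\<^sup>2 \<le> C * (sqint (ball x0 r) p / r ^ DIM('a)) / r\<^sup>2"
      using r by (simp add: pos_le_divide_eq mult_ac)
    then show "(partial_deriv a p x)\<^sup>2 \<le> C / r ^ (DIM('a) + 2) * sqint (ball x0 r) p"
      by (simp add: power_add power2_eq_square mult_ac)
  qed
qed

lemma poly_space_L2: "p \<in> poly_space k \<Longrightarrow> bounded U \<Longrightarrow> U \<in> sets lebesgue \<Longrightarrow> p \<in> L2_space U"
  by (intro continuous_imp_L2_space smooth_continuous smooth_poly_space)

text \<open>The previous bound with \<open>R\<close> adapted to the point \<open>x\<close>; its
  dependence on \<open>x\<close> is harmless as it multiplies zero.\<close>

lemma poly_space_sqint_zero: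
  fixes x0 :: "'a::euclidean_space"
  assumes p: "p \<in> poly_space k" and z: "sqint (ball x0 r) p = 0" and r: "r > 0"
  shows "p x = 0"
proof -
  obtain C where C: "\<forall>p\<in>poly_space k. \<forall>y0 :: 'a. \<forall>s>0. \<forall>y. dist y0 y \<le> (dist x0 x / r) * s \<longrightarrow>
     (p y)\<^sup>2 \<le> C / s ^ DIM('a) * sqint (ball y0 s) p \<and>
     (\<forall>b\<in>Basis. (partial_deriv b p y)\<^sup>2 \<le> C / s ^ (DIM('a) + 2) * sqint (ball y0 s) p)"
    using poly_space_ball_bound[of k "dist x0 x / r", where 'a = 'a] by (elim exE conjE) (rule that)
  have "dist x0 x \<le> (dist x0 x / r) * r" using r by simp
  from C[rule_format, OF p r this] z show ?thesis by simp
qed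

text \<open>The projection onto the span of the monomials satisfies the description, and a ball
  inside \<open>T\<close> makes it unique, because a polynomial of norm zero on a ball vanishes. The
  inequality says that the projection is a contraction that reproduces \<open>p\<close>.\<close>

lemma L2_proj_props:
  assumes w: "w \<in> L2_space T" and T: "bounded T" "T \<in> sets lebesgue" and b: "ball x0 r \<subseteq> T" and r: "r > 0"
  shows "L2_proj k T w \<in> poly_space k"
    and "\<And>p. p \<in> poly_space k \<Longrightarrow> sqint T (\<lambda>x. L2_proj k T w x - p x) \<le> sqint T (\<lambda>x. w x - p x)"
proof -
  let ?P = "\<lambda>p. p \<in> poly_space k \<and> (\<forall>r\<in>poly_space k. (LINT x:T|lebesgue. (w x - p x) * r x) = 0)"
  have pL: "p \<in> L2_space T" if "p \<in> poly_space k" for p by (rule poly_space_L2[OF that T])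
  have "\<exists>c. \<forall>\<alpha>\<in>multi_indices k. l2ip T (\<lambda>x. w x - (\<Sum>\<alpha>\<in>multi_indices k. c \<alpha> * mon \<alpha> x)) (mon \<alpha>) = 0"
    by (rule L2_projection_exists[OF finite_multi_indices pL[OF mon_in_poly_space] w])
  then obtain c where c: "\<forall>\<alpha>\<in>multi_indices k. l2ip T (\<lambda>x. w x - (\<Sum>\<alpha>\<in>multi_indices k. c \<alpha> * mon \<alpha> x)) (mon \<alpha>) = 0"
    by (rule exE)
  define p where "p x = (\<Sum>\<alpha>\<in>multi_indices k. c \<alpha> * mon \<alpha> x)" for x
  have p: "p \<in> poly_space k" unfolding p_def by (intro poly_space_sum poly_space_cmult mon_in_poly_space)
  have Pp: "?P p"
  proof (intro conjI p ballI)
    fix q :: "'a \<Rightarrow> real" assume q: "q \<in> poly_space k"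
    have pj: "poly_jet (multi_indices k) d (\<lambda>_. 0) = (\<lambda>x. \<Sum>\<alpha>\<in>multi_indices k. d \<alpha> * mon \<alpha> x)" for d
      by (simp add: poly_jet_def fun_eq_iff)
    obtain d where d: "q = (\<lambda>x. \<Sum>\<alpha>\<in>multi_indices k. d \<alpha> * mon \<alpha> x)"
      using poly_space_poly_jet[OF q] unfolding pj by metis
    have L: "(\<lambda>x. w x - p x) \<in> L2_space T" by (rule L2_space_diff[OF w pL[OF p]])
    have "l2ip T q (\<lambda>x. w x - p x) = (\<Sum>\<alpha>\<in>multi_indices k. d \<alpha> * l2ip T (mon \<alpha>) (\<lambda>x. w x - p x))"
      unfolding d by (rule l2ip_sum_left[OF pL[OF mon_in_poly_space] L])
    also have "\<dots> = 0" using c by (simp add: p_def[symmetric] l2ip_commute[of T "mon _"])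
    finally show "(LINT x:T|lebesgue. (w x - p x) * q x) = 0" by (simp add: l2ip_def mult.commute)
  qed
  have uniq: "p' = p" if P': "?P p'" for p'
  proof
    fix x
    have dp: "(\<lambda>x. p' x - p x) \<in> poly_space k" using P' p by (intro poly_space_diff) auto
    have L: "(\<lambda>x. w x - p x) \<in> L2_space T" "(\<lambda>x. w x - p' x) \<in> L2_space T"
      using P' by (intro L2_space_diff[OF w pL] p, auto)+
    \<comment> \<open>The difference of two candidates is a polynomial orthogonal to all
      polynomials, in particular to itself.\<close>
    have "sqint T (\<lambda>x. p' x - p x) = l2ip T (\<lambda>x. (w x - p x) - (w x - p' x)) (\<lambda>x. p' x - p x)"
      by (simp add: l2ip_self[symmetric])
    also have "\<dots> = 0"
      unfolding l2ip_diff_left[OF L pL[OF dp]] using Pp P' dp by (simp add: l2ip_def)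
    finally have "sqint (ball x0 r) (\<lambda>x. p' x - p x) \<le> 0"
      using L2_space_subset(2)[OF pL[OF dp] b] by simp
    then have "sqint (ball x0 r) (\<lambda>x. p' x - p x) = 0" using sqint_nonneg by (metis antisym)
    from poly_space_sqint_zero[OF dp this r, of x] show "p' x = p x" by simp
  qed
  have eq: "L2_proj k T w = p" unfolding L2_proj_def by (rule the_equality[where P = ?P, OF Pp uniq])
  show "L2_proj k T w \<in> poly_space k" unfolding eq by (rule p)
  fix q :: "'a \<Rightarrow> real" assume q: "q \<in> poly_space k"
  have dp: "(\<lambda>x. p x - q x) \<in> poly_space k" using p q by (rule poly_space_diff)
  have L: "(\<lambda>x. w x - p x) \<in> L2_space T" "(\<lambda>x. w x - q x) \<in> L2_space T"
    by (intro L2_space_diff w pL p q)+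
  \<comment> \<open>Orthogonality of \<open>w - p\<close> to \<open>p - q\<close> lets
    \<open>w - q\<close> take the place of one factor; Cauchy--Schwarz and cancellation
    finish.\<close>
  have "sqint T (\<lambda>x. p x - q x) = l2ip T (\<lambda>x. (w x - q x) - (w x - p x)) (\<lambda>x. p x - q x)"
    by (simp add: l2ip_self[symmetric])
  also have "\<dots> = l2ip T (\<lambda>x. w x - q x) (\<lambda>x. p x - q x)"
    unfolding l2ip_diff_left[OF L(2,1) pL[OF dp]] using Pp dp by (simp add: l2ip_def)
  finally have "(sqint T (\<lambda>x. p x - q x))\<^sup>2 \<le> sqint T (\<lambda>x. w x - q x) * sqint T (\<lambda>x. p x - q x)"
    using L2_Cauchy_Schwarz[OF L(2) pL[OF dp]] by (simp add: l2ip_def)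
  then have "sqint T (\<lambda>x. p x - q x) * sqint T (\<lambda>x. p x - q x) \<le> sqint T (\<lambda>x. w x - q x) * sqint T (\<lambda>x. p x - q x)"
    by (simp add: power2_eq_square)
  then have "sqint T (\<lambda>x. p x - q x) \<le> sqint T (\<lambda>x. w x - q x)"
    using sqint_nonneg[of T "\<lambda>x. p x - q x"] sqint_nonneg[of T "\<lambda>x. w x - q x"]
    by (cases "sqint T (\<lambda>x. p x - q x) = 0") (auto simp: mult_le_cancel_right)
  then show "sqint T (\<lambda>x. L2_proj k T w x - q x) \<le> sqint T (\<lambda>x. w x - q x)" unfolding eq .
qed


section \<open>Lagrange elements on a simplex\<close>

abbreviation verts :: "'a::euclidean_space set \<Rightarrow> 'a set" where
  "verts T \<equiv> {v. v extreme_point_of T}"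

lemma full_simplex_verts:
  fixes T :: "'a::euclidean_space set"
  assumes "int DIM('a) simplex T"
  shows "finite (verts T)" "\<not> affine_dependent (verts T)" "card (verts T) = DIM('a) + 1"
    "T = convex hull (verts T)" "affine hull (verts T) = UNIV" "interior T \<noteq> {}" "compact T" "convex T"
proof -
  obtain C where C: "\<not> affine_dependent C" "int (card C) = int DIM('a) + 1" "T = convex hull C"
    using assms by (auto simp: simplex_def)
  have V: "verts T = C" using extreme_point_of_convex_hull_affine_independent[OF C(1)] C(3) by auto
  show "finite (verts T)" "\<not> affine_dependent (verts T)" "card (verts T) = DIM('a) + 1" "T = convex hull (verts T)"
    using C aff_independent_finite[OF C(1)] unfolding V by auto
  show ah: "affine hull (verts T) = UNIV"
    unfolding V by (rule affine_independent_span_gt[OF C(1)]) (use C(2) in simp)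
  show "compact T" "convex T"
    using C(3) aff_independent_finite[OF C(1)] by (auto simp: finite_imp_compact_convex_hull)
  have "C \<noteq> {}" using C(2) by auto
  then have "rel_interior T \<noteq> {}" using C(3) rel_interior_eq_empty[of T] by simp
  moreover have "affine hull T = UNIV" using ah V C(3) by (metis affine_hull_convex_hull)
  ultimately show "interior T \<noteq> {}" using rel_interior_interior by metis
qed

text \<open>Barycentric coordinates on the whole space, with no sign condition: the element
  polynomials are also evaluated outside their simplex. Affine independence of the vertices makes
  the choice unique on them.\<close>

definition bary :: "'a::euclidean_space set \<Rightarrow> 'a \<Rightarrow> 'a \<Rightarrow> real" where
  "bary T x = (SOME u. sum u (verts T) = 1 \<and> (\<Sum>v\<in>verts T. u v *\<^sub>R v) = x)"

lemma bary_props: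
  fixes T :: "'a::euclidean_space set"
  assumes "int DIM('a) simplex T"
  shows "(\<Sum>v\<in>verts T. bary T x v) = 1" "(\<Sum>v\<in>verts T. bary T x v *\<^sub>R v) = x"
proof -
  have "x \<in> affine hull (verts T)" using full_simplex_verts(5)[OF assms] by simp
  then have "\<exists>u. sum u (verts T) = 1 \<and> (\<Sum>v\<in>verts T. u v *\<^sub>R v) = x"
    unfolding affine_hull_finite[OF full_simplex_verts(1)[OF assms]] by simp
  from someI_ex[OF this] show "(\<Sum>v\<in>verts T. bary T x v) = 1" "(\<Sum>v\<in>verts T. bary T x v *\<^sub>R v) = x"
    by (simp_all add: bary_def)
qed

lemma bary_unique:
  fixes T :: "'a::euclidean_space set"
  assumes T: "int DIM('a) simplex T" and u: "sum u (verts T) = 1" "(\<Sum>v\<in>verts T. u v *\<^sub>R v) = x" and v: "v \<in> verts T"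
  shows "bary T x v = u v"
proof (rule ccontr)
  assume ne: "bary T x v \<noteq> u v"
  have "sum (\<lambda>v. bary T x v - u v) (verts T) = 0" "(\<Sum>v\<in>verts T. (bary T x v - u v) *\<^sub>R v) = 0"
    using bary_props[OF T, of x] u by (simp_all add: sum_subtractf scaleR_left_diff_distrib)
  then have "affine_dependent (verts T)"
    unfolding affine_dependent_explicit_finite[OF full_simplex_verts(1)[OF T]]
    using v ne by (intro exI[of _ "\<lambda>v. bary T x v - u v"]) auto
  then show False using full_simplex_verts(2)[OF T] by blast
qed

text \<open>The affine expression satisfies the two defining equations, so uniqueness applies. This
  is how the coordinates, and products of them, become polynomials.\<close>

lemma bary_affine:
  fixes T :: "'a::euclidean_space set"
  assumes T: "int DIM('a) simplex T" and v: "v \<in> verts T"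
  shows "bary T x v = bary T 0 v + (\<Sum>b\<in>Basis. (bary T b v - bary T 0 v) * (x \<bullet> b))"
proof (rule bary_unique[OF T _ _ v])
  let ?u = "\<lambda>v. bary T 0 v + (\<Sum>b\<in>Basis. (bary T b v - bary T 0 v) * (x \<bullet> b))"
  have "(\<Sum>v\<in>verts T. \<Sum>b\<in>Basis. (bary T b v - bary T 0 v) * (x \<bullet> b)) =
    (\<Sum>b\<in>Basis. (x \<bullet> b) * (\<Sum>v\<in>verts T. bary T b v - bary T 0 v))"
    by (subst sum.swap) (simp add: sum_distrib_left mult.commute)
  then show "sum ?u (verts T) = 1"
    by (simp add: sum.distrib sum_subtractf bary_props(1)[OF T])
  have "(\<Sum>v\<in>verts T. (\<Sum>b\<in>Basis. (bary T b v - bary T 0 v) * (x \<bullet> b)) *\<^sub>R v) =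
    (\<Sum>b\<in>Basis. (x \<bullet> b) *\<^sub>R (\<Sum>v\<in>verts T. (bary T b v - bary T 0 v) *\<^sub>R v))"
    unfolding scaleR_sum_left scaleR_sum_right by (subst sum.swap) (simp add: mult.commute)
  also have "\<dots> = (\<Sum>b\<in>Basis. (x \<bullet> b) *\<^sub>R b)"
    by (simp add: scaleR_left_diff_distrib sum_subtractf bary_props(2)[OF T])
  finally show "(\<Sum>v\<in>verts T. ?u v *\<^sub>R v) = x"
    by (simp add: scaleR_left_distrib sum.distrib bary_props(2)[OF T] euclidean_representation)
qed

lemma bary_in_simplex:
  fixes T :: "'a::euclidean_space set"
  assumes T: "int DIM('a) simplex T" and v: "v \<in> verts T" and x: "x \<in> T"
  shows "0 \<le> bary T x v" "bary T x v \<le> 1"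
proof -
  have fin: "finite (verts T)" by (rule full_simplex_verts(1)[OF T])
  obtain u where u: "\<forall>v\<in>verts T. 0 \<le> u v" "sum u (verts T) = 1" "(\<Sum>v\<in>verts T. u v *\<^sub>R v) = x"
    using x full_simplex_verts(4)[OF T] unfolding convex_hull_finite[OF fin] by blast
  have "u v \<le> sum u (verts T)" using u v fin by (intro member_le_sum) auto
  then show "0 \<le> bary T x v" "bary T x v \<le> 1" using bary_unique[OF T u(2,3) v] u v by auto
qed

text \<open>A point of a face is a convex combination of the vertices of that face by Krein--Milman,
  and these are vertices of \<open>T\<close>. So its coordinates at the remaining vertices are zero;
  \<open>u\<close> records them independently of the simplex.\<close>

lemma bary_face:
  fixes T :: "'a::euclidean_space set"
  assumes T: "int DIM('a) simplex T" and F: "F face_of T" and x: "x \<in> F"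
  obtains u where "\<forall>v. v \<notin> verts F \<longrightarrow> u v = 0" "\<forall>v\<in>verts T. bary T x v = u v" "sum u (verts F) = 1" "(\<Sum>v\<in>verts F. u v *\<^sub>R v) = x"
proof -
  have sub: "verts F \<subseteq> verts T" using extreme_point_of_face[OF F] by auto
  have fin: "finite (verts F)" using full_simplex_verts(1)[OF T] sub by (rule rev_finite_subset)
  have "compact F" "convex F" using F full_simplex_verts(7,8)[OF T] face_of_imp_compact face_of_imp_convex by blast+
  then have "x \<in> convex hull (verts F)" using Krein_Milman_Minkowski x by blast
  then obtain u where u: "sum u (verts F) = 1" "(\<Sum>v\<in>verts F. u v *\<^sub>R v) = x"
    unfolding convex_hull_finite[OF fin] by blast
  define u' where "u' v = (if v \<in> verts F then u v else 0)" for v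
  have u': "sum u' (verts F) = 1" "(\<Sum>v\<in>verts F. u' v *\<^sub>R v) = x"
  proof -
    have "sum u' (verts F) = sum u (verts F)" "(\<Sum>v\<in>verts F. u' v *\<^sub>R v) = (\<Sum>v\<in>verts F. u v *\<^sub>R v)"
      by (intro sum.cong; simp add: u'_def)+
    then show "sum u' (verts F) = 1" "(\<Sum>v\<in>verts F. u' v *\<^sub>R v) = x" using u by simp_all
  qed
  have "sum u' (verts T) = sum u' (verts F)" "(\<Sum>v\<in>verts T. u' v *\<^sub>R v) = (\<Sum>v\<in>verts F. u' v *\<^sub>R v)"
    by (intro sum.mono_neutral_right full_simplex_verts(1)[OF T] sub; simp add: u'_def)+
  then have "\<forall>v\<in>verts T. bary T x v = u' v" using bary_unique[OF T] u' by auto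
  then show ?thesis using that[of u'] u' by (auto simp: u'_def)
qed

section \<open>Falling factorials of the scaled barycentric coordinates and Lagrange
  functions\<close>

definition falling :: "nat \<Rightarrow> 'a::euclidean_space set \<Rightarrow> ('a \<Rightarrow> nat) \<Rightarrow> 'a \<Rightarrow> real" where
  "falling k T a x = (\<Prod>v\<in>verts T. \<Prod>l<a v. (real k * bary T x v - real l))"

text \<open>Vanishing off the vertices makes an index determined by its values there, so that for
  \<open>j = k\<close> indices and nodes correspond one to one when
  \<open>k \<ge> 1\<close>.\<close>

definition bary_indices :: "'a::euclidean_space set \<Rightarrow> nat \<Rightarrow> ('a \<Rightarrow> nat) set" where
  "bary_indices T j = {a. (\<forall>v. v \<notin> verts T \<longrightarrow> a v = 0) \<and> (\<Sum>v\<in>verts T. a v) = j}"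

definition bary_node :: "nat \<Rightarrow> 'a::euclidean_space set \<Rightarrow> ('a \<Rightarrow> nat) \<Rightarrow> 'a" where
  "bary_node k T m = (\<Sum>v\<in>verts T. (real (m v) / real k) *\<^sub>R v)"

text \<open>The Lagrange function of node \<open>i\<close>. At a node \<open>k\<close> times each
  barycentric coordinate is a natural number, so the floor recovers its index exactly. Being
  expressed by the point \<open>i\<close> instead of an index, the formula can be compared between
  neighbouring elements.\<close>

definition lag :: "nat \<Rightarrow> 'a::euclidean_space set \<Rightarrow> 'a \<Rightarrow> 'a \<Rightarrow> real" where
  "lag k T i x = (\<Prod>v\<in>verts T. \<Prod>l<nat \<lfloor>real k * bary T i v\<rfloor>.
     (real k * bary T x v - real l) / (real k * bary T i v - real l))"

lemma finite_bary_indices: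
  assumes "finite (verts T)"
  shows "finite (bary_indices T j)"
proof (rule finite_subset)
  show "bary_indices T j \<subseteq> {f. \<forall>x. (x \<in> verts T \<longrightarrow> f x \<in> {..j}) \<and> (x \<notin> verts T \<longrightarrow> f x = 0)}"
  proof clarify
    fix a x assume a: "a \<in> bary_indices T j"
    have "a x \<le> sum a (verts T)" if "x \<in> verts T" using that assms by (intro member_le_sum) auto
    then show "(x \<in> verts T \<longrightarrow> a x \<in> {..j}) \<and> (x \<notin> verts T \<longrightarrow> a x = 0)" using a by (auto simp: bary_indices_def)
  qed
  show "finite {f. \<forall>x. (x \<in> verts T \<longrightarrow> f x \<in> {..j}) \<and> (x \<notin> verts T \<longrightarrow> f x = 0)}"
    using assms by (intro finite_set_of_finite_funs) auto
qed

lemma falling_Suc: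
  assumes "finite (verts T)" "w \<in> verts T"
  shows "falling k T (a(w := Suc (a w))) x = (real k * bary T x w - real (a w)) * falling k T a x"
proof -
  have "(\<Prod>v\<in>verts T - {w}. \<Prod>l<(a(w := Suc (a w))) v. (real k * bary T x v - real l)) =
    (\<Prod>v\<in>verts T - {w}. \<Prod>l<a v. (real k * bary T x v - real l))"
    by (intro prod.cong) auto
  then show ?thesis unfolding falling_def prod.remove[OF assms] by (simp add: lessThan_Suc mult_ac)
qed

lemma bary_indices_Suc:
  assumes "finite (verts T)" "w \<in> verts T" "a \<in> bary_indices T j"
  shows "a(w := Suc (a w)) \<in> bary_indices T (Suc j)"
proof -
  have "(\<Sum>v\<in>verts T - {w}. (a(w := Suc (a w))) v) = (\<Sum>v\<in>verts T - {w}. a v)" by (intro sum.cong) auto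
  then have "(\<Sum>v\<in>verts T. (a(w := Suc (a w))) v) = Suc (\<Sum>v\<in>verts T. a v)"
    unfolding sum.remove[OF assms(1,2)] by simp
  then show ?thesis using assms by (auto simp: bary_indices_def)
qed

text \<open>The scaled barycentric coordinates \<open>k \<lambda>\<^sub>v\<close> add up to \<open>k\<close>, so a falling factorial of degree \<open>j < k\<close> in
  them is \<open>1 / (k - j)\<close> times the sum of its successors of degree \<open>j + 1\<close>. Hence the falling factorials of
  degree exactly \<open>k\<close>, which are multiples of the Lagrange basis, span all polynomials of degree at most \<open>k\<close>.\<close>

definition falling_span :: "nat \<Rightarrow> 'a::euclidean_space set \<Rightarrow> nat \<Rightarrow> ('a \<Rightarrow> real) set" where
  "falling_span k T j = {f. \<exists>c. f = (\<lambda>x. \<Sum>a\<in>bary_indices T j. c a * falling k T a x)}"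

lemma falling_span_lincomb:
  assumes "f \<in> falling_span k T j" "g \<in> falling_span k T j"
  shows "(\<lambda>x. a * f x + b * g x) \<in> falling_span k T j"
proof -
  obtain c d where "f = (\<lambda>x. \<Sum>a\<in>bary_indices T j. c a * falling k T a x)"
    "g = (\<lambda>x. \<Sum>a\<in>bary_indices T j. d a * falling k T a x)"
    using assms by (auto simp: falling_span_def)
  then have "(\<lambda>x. a * f x + b * g x) = (\<lambda>x. \<Sum>e\<in>bary_indices T j. (a * c e + b * d e) * falling k T e x)"
    by (simp add: sum_distrib_left sum.distrib[symmetric] algebra_simps)
  then show ?thesis unfolding falling_span_def by (intro CollectI exI)
qed

lemma falling_span_sum:
  assumes "\<And>i. i \<in> I \<Longrightarrow> f i \<in> falling_span k T j"
  shows "(\<lambda>x. \<Sum>i\<in>I. c i * f i x) \<in> falling_span k T j"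
  using assms
proof (induction I rule: infinite_finite_induct)
  case (insert i I)
  then show ?case using falling_span_lincomb[of "f i" k T j "\<lambda>x. \<Sum>i\<in>I. c i * f i x" "c i" 1] by simp
qed (auto simp: falling_span_def intro!: exI[of _ "\<lambda>_. 0"])

lemma falling_in_span:
  assumes "finite (verts T)" "a \<in> bary_indices T j"
  shows "falling k T a \<in> falling_span k T j"
proof -
  have "falling k T a x = (\<Sum>e\<in>bary_indices T j. (if e = a then 1 else 0) * falling k T e x)" for x
    using assms(2) finite_bary_indices[OF assms(1)] by (simp add: if_distrib[of "\<lambda>r. r * _"] cong: if_cong)
  then show ?thesis unfolding falling_span_def by (intro CollectI exI[of _ "\<lambda>e. if e = a then 1 else 0"] ext)
qed

lemma falling_span_up:
  fixes T :: "'a::euclidean_space set"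
  assumes T: "int DIM('a) simplex T" and j: "j < k" and f: "f \<in> falling_span k T j"
  shows "f \<in> falling_span k T (Suc j)"
proof -
  note fin = full_simplex_verts(1)[OF T]
  obtain c where c: "f = (\<lambda>x. \<Sum>a\<in>bary_indices T j. c a * falling k T a x)" using f by (auto simp: falling_span_def)
  have "falling k T a \<in> falling_span k T (Suc j)" if a: "a \<in> bary_indices T j" for a
  proof -
    have "(\<Sum>v\<in>verts T. falling k T (a(v := Suc (a v))) x) = (real k - real j) * falling k T a x" for x
    proof -
      have "(\<Sum>v\<in>verts T. falling k T (a(v := Suc (a v))) x) = (\<Sum>v\<in>verts T. (real k * bary T x v - real (a v)) * falling k T a x)"
        by (intro sum.cong falling_Suc fin) auto
      also have "\<dots> = (real k * (\<Sum>v\<in>verts T. bary T x v) - real (\<Sum>v\<in>verts T. a v)) * falling k T a x"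
        by (simp add: sum_distrib_right[symmetric] sum_subtractf sum_distrib_left)
      finally show ?thesis using a by (simp add: bary_props(1)[OF T] bary_indices_def del: of_nat_sum)
    qed
    then have "falling k T a = (\<lambda>x. \<Sum>v\<in>verts T. (1 / (real k - real j)) * falling k T (a(v := Suc (a v))) x)"
      using j by (intro ext) (simp add: sum_divide_distrib[symmetric])
    then show ?thesis
      using falling_span_sum[of "verts T" "\<lambda>v. falling k T (a(v := Suc (a v)))" k T "Suc j" "\<lambda>_. 1 / (real k - real j)"]
        falling_in_span[OF fin bary_indices_Suc[OF fin _ a]] by auto
  qed
  then show ?thesis unfolding c by (rule falling_span_sum)
qed

text \<open>The coordinate \<open>x \<bullet> b\<close> is a combination of the barycentric
  coordinates, and \<open>k\<close> times one of these, applied to a falling factorial, is its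
  successor plus \<open>a v\<close> times itself. The second summand has degree \<open>j\<close> and
  is lifted by \<open>falling_span_up\<close>.\<close>

lemma falling_span_mult:
  fixes T :: "'a::euclidean_space set"
  assumes T: "int DIM('a) simplex T" and j: "j < k" and f: "f \<in> falling_span k T j"
  shows "(\<lambda>x. (x \<bullet> b) * f x) \<in> falling_span k T (Suc j)"
proof -
  note fin = full_simplex_verts(1)[OF T]
  obtain c where c: "f = (\<lambda>x. \<Sum>a\<in>bary_indices T j. c a * falling k T a x)" using f by (auto simp: falling_span_def)
  have 1: "(\<lambda>x. 1 * falling k T (a(v := Suc (a v))) x + real (a v) * falling k T a x) \<in> falling_span k T (Suc j)"
    if a: "a \<in> bary_indices T j" and v: "v \<in> verts T" for a v
    by (intro falling_span_lincomb falling_in_span fin bary_indices_Suc a v falling_span_up[OF T j])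
  have 2: "(\<lambda>x. (x \<bullet> b) * falling k T a x) \<in> falling_span k T (Suc j)" if a: "a \<in> bary_indices T j" for a
  proof -
    have "(x \<bullet> b) * falling k T a x =
      (\<Sum>v\<in>verts T. ((v \<bullet> b) / real k) * (1 * falling k T (a(v := Suc (a v))) x + real (a v) * falling k T a x))" for x
    proof -
      have "x \<bullet> b = (\<Sum>v\<in>verts T. bary T x v * (v \<bullet> b))"
        by (subst bary_props(2)[OF T, of x, symmetric]) (simp add: inner_sum_left)
      then have "(x \<bullet> b) * falling k T a x = (\<Sum>v\<in>verts T. bary T x v * (v \<bullet> b) * falling k T a x)"
        by (simp add: sum_distrib_right)
      also have "\<dots> = (\<Sum>v\<in>verts T. ((v \<bullet> b) / real k) * (1 * falling k T (a(v := Suc (a v))) x + real (a v) * falling k T a x))"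
        using j by (intro sum.cong refl) (simp add: falling_Suc[OF fin] field_simps)
      finally show ?thesis .
    qed
    then have eq: "(\<lambda>x. (x \<bullet> b) * falling k T a x) = (\<lambda>x. \<Sum>v\<in>verts T. ((v \<bullet> b) / real k) * (1 * falling k T (a(v := Suc (a v))) x + real (a v) * falling k T a x))"
      by (rule ext)
    show ?thesis unfolding eq by (rule falling_span_sum[OF 1[OF a]])
  qed
  have "(\<lambda>x. (x \<bullet> b) * f x) = (\<lambda>x. \<Sum>a\<in>bary_indices T j. c a * ((x \<bullet> b) * falling k T a x))"
    by (simp add: c sum_distrib_left mult_ac)
  also have "\<dots> \<in> falling_span k T (Suc j)" by (rule falling_span_sum[OF 2])
  finally show ?thesis .
qed

lemma poly_space_falling_span:
  fixes T :: "'a::euclidean_space set"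
  assumes T: "int DIM('a) simplex T" and p: "p \<in> poly_space k"
  shows "p \<in> falling_span k T k"
proof (rule poly_space_graded_induct[OF _ _ _ _ p, where W = "falling_span k T"])
  have "(\<lambda>_. 0) \<in> bary_indices T 0" by (simp add: bary_indices_def)
  from falling_in_span[OF full_simplex_verts(1)[OF T] this, of k] show "(\<lambda>_. 1) \<in> falling_span k T 0"
    by (simp add: falling_def[abs_def])
qed (auto intro: falling_span_lincomb falling_span_mult[OF T] falling_span_up[OF T])

lemma bary_bary_node:
  fixes T :: "'a::euclidean_space set"
  assumes T: "int DIM('a) simplex T" and k: "k \<ge> 1" and m: "sum m (verts T) = k" and v: "v \<in> verts T"
  shows "real k * bary T (bary_node k T m) v = real (m v)"
proof -
  have "(\<Sum>v\<in>verts T. real (m v) / real k) = real (sum m (verts T)) / real k"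
    by (simp add: sum_divide_distrib[symmetric])
  then have "(\<Sum>v\<in>verts T. real (m v) / real k) = 1" using m k by simp
  then show ?thesis using bary_unique[OF T _ bary_node_def[symmetric] v] k by simp
qed

lemma lagrange_nodes_eq:
  "lagrange_nodes k T = bary_node k T ` bary_indices T k"
proof
  show "bary_node k T ` bary_indices T k \<subseteq> lagrange_nodes k T"
    by (auto simp: lagrange_nodes_def bary_node_def bary_indices_def)
  show "lagrange_nodes k T \<subseteq> bary_node k T ` bary_indices T k"
  proof
    fix x assume "x \<in> lagrange_nodes k T"
    then obtain m where m: "x = bary_node k T m" "sum m (verts T) = k" by (auto simp: lagrange_nodes_def bary_node_def)
    define m' where "m' v = (if v \<in> verts T then m v else 0)" for v
    have "x = bary_node k T m'" unfolding m bary_node_def m'_def by (intro sum.cong) auto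
    moreover have "sum m' (verts T) = k" 
      unfolding m(2)[symmetric] by (intro sum.cong) (auto simp: m'_def)
    ultimately show "x \<in> bary_node k T ` bary_indices T k" by (auto simp: bary_indices_def m'_def)
  qed
qed

lemma lagrange_node_bary:
  fixes T :: "'a::euclidean_space set"
  assumes T: "int DIM('a) simplex T" and k: "k \<ge> 1" and i: "i \<in> lagrange_nodes k T"
  obtains m where "m \<in> bary_indices T k" "\<And>v. v \<in> verts T \<Longrightarrow> real k * bary T i v = real (m v)" "i = bary_node k T m"
proof -
  obtain m where m: "m \<in> bary_indices T k" "i = bary_node k T m" using i unfolding lagrange_nodes_eq by blast
  then have "real k * bary T i v = real (m v)" if "v \<in> verts T" for v
    using bary_bary_node[OF T k _ that] by (simp add: bary_indices_def)
  then show ?thesis using that m by blast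
qed

lemma lagrange_nodes_subset:
  fixes T :: "'a::euclidean_space set"
  assumes T: "int DIM('a) simplex T" and k: "k \<ge> 1"
  shows "lagrange_nodes k T \<subseteq> T"
proof
  fix i assume "i \<in> lagrange_nodes k T"
  then obtain m where m: "m \<in> bary_indices T k" "\<And>v. v \<in> verts T \<Longrightarrow> real k * bary T i v = real (m v)"
    using lagrange_node_bary[OF T k] by metis
  have "0 \<le> bary T i v" if "v \<in> verts T" for v
  proof -
    have "0 \<le> real k * bary T i v" using m(2)[OF that] by simp
    then show ?thesis using k by (simp add: zero_le_mult_iff)
  qed
  then have "i \<in> convex hull (verts T)"
    unfolding convex_hull_finite[OF full_simplex_verts(1)[OF T]] using bary_props[OF T, of i] by blast
  then show "i \<in> T" using full_simplex_verts(4)[OF T] by simp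
qed

lemma finite_lagrange_nodes:
  fixes T :: "'a::euclidean_space set"
  assumes T: "int DIM('a) simplex T"
  shows "finite (lagrange_nodes k T)" "card (lagrange_nodes k T) \<le> (k + 1) ^ (DIM('a) + 1)"
proof -
  note fin = full_simplex_verts(1)[OF T]
  have "lagrange_nodes k T \<subseteq> bary_node k T ` (verts T \<rightarrow>\<^sub>E {..k})"
  proof
    fix x assume "x \<in> lagrange_nodes k T"
    then obtain m where m: "m \<in> bary_indices T k" "x = bary_node k T m" unfolding lagrange_nodes_eq by blast
    have "m v \<le> k" if "v \<in> verts T" for v
      using m(1) that fin member_le_sum[of v "verts T" m] by (auto simp: bary_indices_def)
    then have "restrict m (verts T) \<in> verts T \<rightarrow>\<^sub>E {..k}" by auto
    moreover have "x = bary_node k T (restrict m (verts T))" unfolding m bary_node_def by (intro sum.cong) auto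
    ultimately show "x \<in> bary_node k T ` (verts T \<rightarrow>\<^sub>E {..k})" by blast
  qed
  moreover have f: "finite (verts T \<rightarrow>\<^sub>E {..k})" using fin by (intro finite_PiE) auto
  ultimately have "card (lagrange_nodes k T) \<le> card (bary_node k T ` (verts T \<rightarrow>\<^sub>E {..k}))"
    "finite (lagrange_nodes k T)" by (auto intro: card_mono finite_subset)
  moreover have "card (bary_node k T ` (verts T \<rightarrow>\<^sub>E {..k})) \<le> (k + 1) ^ (DIM('a) + 1)"
    using card_image_le[OF f, of "bary_node k T"] full_simplex_verts(3)[OF T] fin by (simp add: card_PiE)
  ultimately show "finite (lagrange_nodes k T)" "card (lagrange_nodes k T) \<le> (k + 1) ^ (DIM('a) + 1)" by auto
qed

lemma lag_eq_falling:
  fixes T :: "'a::euclidean_space set"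
  assumes T: "int DIM('a) simplex T" and m: "\<And>v. v \<in> verts T \<Longrightarrow> real k * bary T i v = real (m v)"
  shows "lag k T i x = falling k T m x / falling k T m i"
proof -
  have "lag k T i x = (\<Prod>v\<in>verts T. (\<Prod>l<m v. (real k * bary T x v - real l)) / (\<Prod>l<m v. (real k * bary T i v - real l)))"
    unfolding lag_def by (intro prod.cong refl) (simp add: m prod_dividef)
  then show ?thesis by (simp add: falling_def prod_dividef)
qed

text \<open>At the node with index \<open>m\<close> the factors are the numbers
  \<open>m v - l\<close> with \<open>l < a v\<close>, so a zero occurs exactly if
  \<open>m v < a v\<close> for some vertex. Both indices sum to \<open>k\<close>, hence two
  different ones always have such a vertex.\<close>

lemma falling_at_node:
  fixes T :: "'a::euclidean_space set"
  assumes T: "int DIM('a) simplex T" and m: "\<And>v. v \<in> verts T \<Longrightarrow> real k * bary T i v = real (m v)"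
    and mk: "m \<in> bary_indices T k" and a: "a \<in> bary_indices T k"
  shows "falling k T a i = 0 \<longleftrightarrow> a \<noteq> m"
proof -
  note fin = full_simplex_verts(1)[OF T]
  have eq: "falling k T a i = (\<Prod>v\<in>verts T. \<Prod>l<a v. (real (m v) - real l))"
    unfolding falling_def by (intro prod.cong refl) (simp add: m)
  show ?thesis
  proof
    assume "falling k T a i = 0"
    then obtain v l where "v \<in> verts T" "l < a v" "m v = l" unfolding eq using fin by auto
    then show "a \<noteq> m" by auto
  next
    assume ne: "a \<noteq> m"
    have "\<exists>v\<in>verts T. m v < a v"
    proof (rule ccontr)
      assume "\<not> (\<exists>v\<in>verts T. m v < a v)"
      then have le: "\<And>v. v \<in> verts T \<Longrightarrow> a v \<le> m v" by (auto simp: not_less)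
      have "(\<Sum>v\<in>verts T. m v - a v) = 0"
        using le a mk by (subst sum_subtractf_nat) (auto simp: bary_indices_def)
      then have "\<forall>v\<in>verts T. m v - a v = 0" using fin by (simp only: sum_eq_0_iff)
      then have "m v = a v" if "v \<in> verts T" for v using le[OF that] that by force
      moreover have "m v = a v" if "v \<notin> verts T" for v using a mk that by (simp add: bary_indices_def)
      ultimately have "a = m" by (metis ext)
      with ne show False by simp
    qed
    then show "falling k T a i = 0" unfolding eq using fin by (auto intro!: prod_zero bexI)
  qed
qed

lemma lag_node:
  fixes T :: "'a::euclidean_space set"
  assumes T: "int DIM('a) simplex T" and k: "k \<ge> 1" and ij: "i \<in> lagrange_nodes k T" "j \<in> lagrange_nodes k T"
  shows "lag k T i j = (if i = j then 1 else 0)"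
proof -
  obtain m where m: "m \<in> bary_indices T k" "\<And>v. v \<in> verts T \<Longrightarrow> real k * bary T i v = real (m v)" "i = bary_node k T m"
    using lagrange_node_bary[OF T k ij(1)] by metis
  obtain n where n: "n \<in> bary_indices T k" "\<And>v. v \<in> verts T \<Longrightarrow> real k * bary T j v = real (n v)" "j = bary_node k T n"
    using lagrange_node_bary[OF T k ij(2)] by metis
  have "falling k T m i \<noteq> 0" using falling_at_node[OF T m(2) m(1) m(1)] by simp
  moreover have "falling k T m j = 0 \<longleftrightarrow> i \<noteq> j"
  proof -
    have "m = n \<longleftrightarrow> i = j"
    proof
      assume "i = j"
      have "m v = n v" for v 
      proof (cases "v \<in> verts T")
        case True
        then have "real (m v) = real (n v)" using m(2) n(2) \<open>i = j\<close> by metis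
        then show ?thesis by simp
      next
        case False
        then show ?thesis using m(1) n(1) by (simp add: bary_indices_def)
      qed
      then show "m = n" by auto
    qed (use m n in simp)
    then show ?thesis using falling_at_node[OF T n(2) n(1) m(1)] by simp
  qed
  ultimately show ?thesis using lag_eq_falling[OF T m(2)] by auto
qed

text \<open>Expanded in falling factorials of degree \<open>k\<close>, a polynomial is diagonal at
  the nodes: its value there determines the coefficient of the same index. So spanning alone yields
  unisolvence, with no count of dimensions.\<close>

lemma lagrange_interpolation:
  fixes T :: "'a::euclidean_space set"
  assumes T: "int DIM('a) simplex T" and k: "k \<ge> 1" and p: "p \<in> poly_space k"
  shows "p x = (\<Sum>i\<in>lagrange_nodes k T. p i * lag k T i x)"
proof -
  obtain c where c: "p = (\<lambda>x. \<Sum>a\<in>bary_indices T k. c a * falling k T a x)"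
    using poly_space_falling_span[OF T p] by (auto simp: falling_span_def)
  have fb: "finite (bary_indices T k)" by (rule finite_bary_indices[OF full_simplex_verts(1)[OF T]])
  have mb: "real k * bary T (bary_node k T m) v = real (m v)" if "m \<in> bary_indices T k" "v \<in> verts T" for m v
    using bary_bary_node[OF T k _ that(2), of m] that(1) by (simp add: bary_indices_def)
  have inj: "inj_on (bary_node k T) (bary_indices T k)"
  proof (rule inj_onI)
    fix m n assume mn: "m \<in> bary_indices T k" "n \<in> bary_indices T k" "bary_node k T m = bary_node k T n"
    have "m v = n v" for v
    proof (cases "v \<in> verts T")
      case True
      then have "real (m v) = real (n v)" using mb[OF mn(1) True] mb[OF mn(2) True] mn(3) by metis
      then show ?thesis by simp
    next
      case False
      then show ?thesis using mn(1,2) by (simp add: bary_indices_def)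
    qed
    then show "m = n" by auto
  qed
  have pn: "p (bary_node k T m) = c m * falling k T m (bary_node k T m)" if m: "m \<in> bary_indices T k" for m
  proof -
    have "p (bary_node k T m) = (\<Sum>a\<in>{m}. c a * falling k T a (bary_node k T m))"
      unfolding c using falling_at_node[OF T mb[OF m] m] m fb by (intro sum.mono_neutral_right) auto
    then show ?thesis by simp
  qed
  have "(\<Sum>i\<in>lagrange_nodes k T. p i * lag k T i x) = (\<Sum>m\<in>bary_indices T k. p (bary_node k T m) * lag k T (bary_node k T m) x)"
    unfolding lagrange_nodes_eq by (simp add: sum.reindex[OF inj])
  also have "\<dots> = (\<Sum>m\<in>bary_indices T k. c m * falling k T m x)"
  proof (intro sum.cong refl)
    fix m assume m: "m \<in> bary_indices T k"
    have "falling k T m (bary_node k T m) \<noteq> 0" using falling_at_node[OF T mb[OF m] m m] by simp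
    moreover have "lag k T (bary_node k T m) x = falling k T m x / falling k T m (bary_node k T m)"
      by (rule lag_eq_falling[OF T mb[OF m]])
    ultimately show "p (bary_node k T m) * lag k T (bary_node k T m) x = c m * falling k T m x"
      by (simp add: pn[OF m])
  qed
  finally show ?thesis unfolding c by simp
qed

lemma falling_in_poly_space:
  fixes T :: "'a::euclidean_space set"
  assumes T: "int DIM('a) simplex T"
  shows "a \<in> bary_indices T j \<Longrightarrow> falling k T a \<in> poly_space j"
proof (induction j arbitrary: a)
  case 0
  then have "falling k T a = (\<lambda>_. 1)" 
    using full_simplex_verts(1)[OF T] by (auto simp: bary_indices_def falling_def)
  then show ?case by (simp add: poly_space_const)
next
  case (Suc j)
  note fin = full_simplex_verts(1)[OF T]
  have "(\<Sum>v\<in>verts T. a v) \<noteq> 0" using Suc.prems by (simp add: bary_indices_def)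
  then obtain v where v: "v \<in> verts T" "a v \<noteq> 0" by (metis (no_types, lifting) sum.neutral)
  define a' where "a' = a(v := a v - 1)"
  have a: "a = a'(v := Suc (a' v))" using v by (auto simp: a'_def)
  have "(\<Sum>v\<in>verts T. a v) = Suc (\<Sum>v\<in>verts T. a' v)"
  proof -
    have "(\<Sum>w\<in>verts T - {v}. a w) = (\<Sum>w\<in>verts T - {v}. a' w)" by (intro sum.cong) (auto simp: a'_def)
    then show ?thesis unfolding sum.remove[OF fin v(1)] using v by (simp add: a'_def)
  qed
  then have "a' \<in> bary_indices T j" using Suc.prems v by (auto simp: bary_indices_def a'_def)
  then have IH: "falling k T a' \<in> poly_space j" by (rule Suc.IH)
  have "falling k T a x = (real k * bary T x v - real (a' v)) * falling k T a' x" for x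
    by (subst a) (rule falling_Suc[OF fin v(1)])
  also have "(real k * bary T x v - real (a' v)) = ((real k * bary T 0 v - real (a' v)) + (\<Sum>b\<in>Basis. (real k * (bary T b v - bary T 0 v)) * (x \<bullet> b)))" for x
    by (subst bary_affine[OF T v(1)]) (simp add: algebra_simps sum_distrib_left)
  finally have eq: "falling k T a = (\<lambda>x. ((real k * bary T 0 v - real (a' v)) + (\<Sum>b\<in>Basis. (real k * (bary T b v - bary T 0 v)) * (x \<bullet> b))) * falling k T a' x)"
    by (rule ext)
  show ?case unfolding eq by (rule poly_space_affine_mult[OF IH])
qed

lemma lag_in_poly_space:
  fixes T :: "'a::euclidean_space set"
  assumes T: "int DIM('a) simplex T" and k: "k \<ge> 1" and i: "i \<in> lagrange_nodes k T"
  shows "lag k T i \<in> poly_space k"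
proof -
  obtain m where m: "m \<in> bary_indices T k" "\<And>v. v \<in> verts T \<Longrightarrow> real k * bary T i v = real (m v)"
    using lagrange_node_bary[OF T k i] by metis
  have "lag k T i x = falling k T m x / falling k T m i" for x by (rule lag_eq_falling[OF T m(2)])
  then have "lag k T i = (\<lambda>x. inverse (falling k T m i) * falling k T m x)"
    by (intro ext) (simp add: divide_inverse)
  then show ?thesis using poly_space_cmult[OF falling_in_poly_space[OF T m(1)]] by simp
qed

text \<open>The product has \<open>k\<close> factors in all. On the simplex each numerator lies
  between \<open>-k\<close> and \<open>k\<close>, and each denominator is an integer that is at
  least 1. The shape of the simplex does not enter.\<close>

lemma lag_bound:
  fixes T :: "'a::euclidean_space set"
  assumes T: "int DIM('a) simplex T" and k: "k \<ge> 1" and i: "i \<in> lagrange_nodes k T" and x: "x \<in> T"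
  shows "\<bar>lag k T i x\<bar> \<le> real k ^ k"
proof -
  obtain m where m: "m \<in> bary_indices T k" "\<And>v. v \<in> verts T \<Longrightarrow> real k * bary T i v = real (m v)"
    using lagrange_node_bary[OF T k i] by metis
  note fin = full_simplex_verts(1)[OF T]
  have "lag k T i x = (\<Prod>v\<in>verts T. \<Prod>l<m v. (real k * bary T x v - real l) / (real (m v) - real l))"
    unfolding lag_def by (rule prod.cong[OF refl]) (simp add: m(2))
  then have "\<bar>lag k T i x\<bar> = (\<Prod>v\<in>verts T. \<Prod>l<m v. \<bar>(real k * bary T x v - real l) / (real (m v) - real l)\<bar>)"
    by (simp only: abs_prod)
  also have "\<dots> \<le> (\<Prod>v\<in>verts T. \<Prod>l<m v. real k)"
  proof (intro prod_mono conjI prod_nonneg ballI)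
    fix v l assume v: "v \<in> verts T" and l: "l \<in> {..<m v}"
    have mk: "m v \<le> k" using m(1) v fin member_le_sum[of v "verts T" m] by (auto simp: bary_indices_def)
    have "real k * bary T x v \<le> real k * 1" "0 \<le> real k * bary T x v"
      using bary_in_simplex[OF T v x] by (intro mult_left_mono mult_nonneg_nonneg; simp)+
    moreover have "real l < real (m v)" "real (m v) \<le> real k" using l mk by auto
    ultimately have "\<bar>real k * bary T x v - real l\<bar> \<le> real k" by linarith
    moreover have d1: "1 \<le> real (m v) - real l" using l by auto
    ultimately have "\<bar>real k * bary T x v - real l\<bar> \<le> real k * (real (m v) - real l)"
      using mult_left_mono[of 1 "real (m v) - real l" "real k"] by simp
    then show "\<bar>(real k * bary T x v - real l) / (real (m v) - real l)\<bar> \<le> real k"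
      using d1 by (simp add: divide_le_eq)
  qed auto
  also have "\<dots> = real k ^ (\<Sum>v\<in>verts T. m v)" by (simp add: power_sum)
  also have "(\<Sum>v\<in>verts T. m v) = k" using m(1) by (simp add: bary_indices_def)
  finally show ?thesis .
qed

text \<open>Conformity. On the common face both systems of barycentric coordinates are those of the
  face and vanish at all other vertices. If the node lies in \<open>T'\<close>, the two products
  reduce to the same one over the vertices of the face; otherwise the index is positive at a vertex
  off the face, and the factor with \<open>l = 0\<close> vanishes there.\<close>

lemma lag_common_face:
  fixes T T' :: "'a::euclidean_space set"
  assumes T: "int DIM('a) simplex T" and T': "int DIM('a) simplex T'" and k: "k \<ge> 1"
    and F: "T \<inter> T' face_of T" "T \<inter> T' face_of T'" and i: "i \<in> lagrange_nodes k T" and x: "x \<in> T" "x \<in> T'"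
  shows "i \<in> T' \<Longrightarrow> i \<in> lagrange_nodes k T'" "i \<in> T' \<Longrightarrow> lag k T i x = lag k T' i x"
    "i \<notin> T' \<Longrightarrow> lag k T i x = 0"
proof -
  let ?F = "T \<inter> T'"
  have sub: "verts ?F \<subseteq> verts T" "verts ?F \<subseteq> verts T'"
    using extreme_point_of_face[OF F(1)] extreme_point_of_face[OF F(2)] by auto
  note fin = full_simplex_verts(1)[OF T] and fin' = full_simplex_verts(1)[OF T']
  have bx: "\<forall>v. v \<in> verts T \<and> v \<notin> verts ?F \<longrightarrow> bary T y v = 0" "\<forall>v. v \<in> verts T' \<and> v \<notin> verts ?F \<longrightarrow> bary T' y v = 0"
    "\<forall>v\<in>verts ?F. bary T y v = bary T' y v" if y: "y \<in> T" "y \<in> T'" for y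
  proof -
    have yF: "y \<in> ?F" using y by simp
    obtain u where u: "\<forall>v. v \<notin> verts ?F \<longrightarrow> u v = 0" "\<forall>v\<in>verts T. bary T y v = u v" 
      "sum u (verts ?F) = 1" "(\<Sum>v\<in>verts ?F. u v *\<^sub>R v) = y"
      by (rule bary_face[OF T F(1) yF])
    have "sum u (verts T') = sum u (verts ?F)" "(\<Sum>v\<in>verts T'. u v *\<^sub>R v) = (\<Sum>v\<in>verts ?F. u v *\<^sub>R v)"
      using fin' sub u(1) by (auto intro!: sum.mono_neutral_right)
    then have u': "\<forall>v\<in>verts T'. bary T' y v = u v" using bary_unique[OF T'] u by auto
    show "\<forall>v. v \<in> verts T \<and> v \<notin> verts ?F \<longrightarrow> bary T y v = 0" "\<forall>v. v \<in> verts T' \<and> v \<notin> verts ?F \<longrightarrow> bary T' y v = 0"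
      using u u' by auto
    show "\<forall>v\<in>verts ?F. bary T y v = bary T' y v"
    proof
      fix v assume "v \<in> verts ?F"
      with sub have "v \<in> verts T" "v \<in> verts T'" by blast+
      then show "bary T y v = bary T' y v" using u(2) u' by metis
    qed
  qed
  obtain m where m: "m \<in> bary_indices T k" "\<And>v. v \<in> verts T \<Longrightarrow> real k * bary T i v = real (m v)" "i = bary_node k T m"
    using lagrange_node_bary[OF T k i] by metis
  have iT: "i \<in> T" using lagrange_nodes_subset[OF T k] i by blast
  {
    assume iT': "i \<in> T'"
    note bi = bx[OF iT iT']
    have m0: "m v = 0" if "v \<notin> verts ?F" for v
    proof (cases "v \<in> verts T")
      case True
      then have "real (m v) = 0" using bi(1) m(2)[OF True] that by auto
      then show ?thesis by simp
    next
      case False then show ?thesis using m(1) by (auto simp: bary_indices_def)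
    qed
    have s: "sum m (verts T') = sum m (verts ?F)" "sum m (verts T) = sum m (verts ?F)"
      "(\<Sum>v\<in>verts T'. (real (m v) / real k) *\<^sub>R v) = (\<Sum>v\<in>verts ?F. (real (m v) / real k) *\<^sub>R v)"
      "(\<Sum>v\<in>verts T. (real (m v) / real k) *\<^sub>R v) = (\<Sum>v\<in>verts ?F. (real (m v) / real k) *\<^sub>R v)"
      by (intro sum.mono_neutral_right fin fin' sub; simp add: m0)+
    have "sum m (verts T') = k" using s m(1) by (simp add: bary_indices_def)
    moreover have "i = bary_node k T' m" using m(3) s by (simp add: bary_node_def)
    ultimately show "i \<in> lagrange_nodes k T'" unfolding lagrange_nodes_def bary_node_def by blast
    have red: "lag k S i x = (\<Prod>v\<in>verts ?F. \<Prod>l<nat \<lfloor>real k * bary S i v\<rfloor>. (real k * bary S x v - real l) / (real k * bary S i v - real l))"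
      if "finite (verts S)" "verts ?F \<subseteq> verts S" "\<forall>v. v \<in> verts S \<and> v \<notin> verts ?F \<longrightarrow> bary S i v = 0" for S
      unfolding lag_def using that by (intro prod.mono_neutral_right) auto
    show "lag k T i x = lag k T' i x"
      unfolding red[OF fin sub(1) bi(1)] red[OF fin' sub(2) bi(2)]
      using bi(3) bx(3)[OF x] by (intro prod.cong) auto
  }
  {
    assume iT': "i \<notin> T'"
    \<comment> \<open>If all the weight of the node were on the vertices of the common face, the
      node would belong to the face and so to \<open>T'\<close>.\<close>
    have "\<exists>v\<in>verts T. v \<notin> verts ?F \<and> m v \<noteq> 0"
    proof (rule ccontr)
      assume "\<not> (\<exists>v\<in>verts T. v \<notin> verts ?F \<and> m v \<noteq> 0)"
      then have z: "bary T i v = 0" if "v \<in> verts T" "v \<notin> verts ?F" for v using m(2)[OF that(1)] that k by auto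
      have "sum (bary T i) (verts ?F) = sum (bary T i) (verts T)" "(\<Sum>v\<in>verts ?F. bary T i v *\<^sub>R v) = (\<Sum>v\<in>verts T. bary T i v *\<^sub>R v)"
        by (intro sum.mono_neutral_left fin sub; simp add: z)+
      then have "sum (bary T i) (verts ?F) = 1" "(\<Sum>v\<in>verts ?F. bary T i v *\<^sub>R v) = i" using bary_props[OF T, of i] by simp_all
      moreover have "\<forall>v\<in>verts ?F. 0 \<le> bary T i v" using bary_in_simplex(1)[OF T _ iT] sub by blast
      ultimately have "i \<in> convex hull (verts ?F)"
        unfolding convex_hull_finite[OF finite_subset[OF sub(1) fin]] by blast
      also have "convex hull (verts ?F) \<subseteq> T'"
      proof (rule hull_minimal)
        show "verts ?F \<subseteq> T'" by (auto simp: extreme_point_of_def)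
        show "convex T'" by (rule full_simplex_verts(8)[OF T'])
      qed
      finally show False using iT' by simp
    qed
    then obtain v where v: "v \<in> verts T" "v \<notin> verts ?F" "m v \<noteq> 0" by blast
    have "bary T x v = 0" using bx(1)[OF x] v by blast
    then have "(\<Prod>l<nat \<lfloor>real k * bary T i v\<rfloor>. (real k * bary T x v - real l) / (real k * bary T i v - real l)) = 0"
      using v(3) by (intro prod_zero bexI[of _ 0]) (auto simp: m(2)[OF v(1)])
    then show "lag k T i x = 0" unfolding lag_def using fin v(1) by (intro prod_zero) auto
  }
qed


section \<open>The finite element space\<close>

text \<open>Cauchy--Schwarz over at most \<open>(k + 1) ^ (DIM('a) + 1)\<close> nodes, with
  \<open>lag_bound\<close> for each summand. The constant is free of geometry.\<close>

lemma node_sum_bound: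
  fixes T :: "'a::euclidean_space set"
  assumes T: "int DIM('a) simplex T" and k: "k \<ge> 1" and x: "x \<in> T" and A: "0 \<le> A"
    and a: "\<And>i. i \<in> lagrange_nodes k T \<Longrightarrow> (a i)\<^sup>2 \<le> A"
  shows "(\<Sum>i\<in>lagrange_nodes k T. a i * lag k T i x)\<^sup>2 \<le> (real (k + 1) ^ (DIM('a) + 1) * real k ^ k)\<^sup>2 * A"
proof -
  let ?N = "lagrange_nodes k T" and ?K = "real k ^ k"
  have c: "real (card ?N) \<le> real (k + 1) ^ (DIM('a) + 1)"
    using finite_lagrange_nodes(2)[OF T, of k] by (metis of_nat_le_iff of_nat_power)
  have t: "(a i * lag k T i x)\<^sup>2 \<le> A * ?K\<^sup>2" if "i \<in> ?N" for i
  proof -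
    have "(lag k T i x)\<^sup>2 \<le> ?K\<^sup>2"
      using power_mono[OF lag_bound[OF T k that x], of 2] by simp
    then have "(a i)\<^sup>2 * (lag k T i x)\<^sup>2 \<le> A * ?K\<^sup>2"
      by (rule mult_mono[OF a[OF that] _ A]) simp
    then show ?thesis by (simp add: power_mult_distrib)
  qed
  have "(\<Sum>i\<in>?N. a i * lag k T i x)\<^sup>2 = (\<Sum>i\<in>?N. 1 * (a i * lag k T i x))\<^sup>2" by simp
  also have "\<dots> \<le> (\<Sum>i\<in>?N. 1\<^sup>2) * (\<Sum>i\<in>?N. (a i * lag k T i x)\<^sup>2)"
    by (rule Cauchy_Schwarz_ineq_sum)
  also have "\<dots> \<le> real (card ?N) * (real (card ?N) * (A * ?K\<^sup>2))"
    using sum_bounded_above[of ?N "\<lambda>i. (a i * lag k T i x)\<^sup>2", OF t] by (simp add: mult_left_mono)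
  also have "\<dots> = (real (card ?N))\<^sup>2 * (A * ?K\<^sup>2)" by (simp add: power2_eq_square)
  also have "\<dots> \<le> (real (k + 1) ^ (DIM('a) + 1))\<^sup>2 * (A * ?K\<^sup>2)"
    using c A by (intro mult_right_mono power_mono) auto
  finally show ?thesis by (simp add: power_mult_distrib mult_ac)
qed

locale fe_mesh =
  fixes k :: nat and \<T> :: "'a::euclidean_space set set" and \<Omega> :: "'a set"
  assumes k: "k \<ge> 1" and tri: "triangulation \<T>" and full: "\<And>T. T \<in> \<T> \<Longrightarrow> int DIM('a) simplex T"
begin

text \<open>The nodal function on the whole mesh, glued from the Lagrange functions of the elements
  having \<open>i\<close> as a node. The choice of the element is arbitrary; agreement on common
  faces shows that it does not matter.\<close>

definition hat :: "'a \<Rightarrow> 'a \<Rightarrow> real" where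
  "hat i x = (if \<exists>T\<in>\<T>. x \<in> T \<and> i \<in> lagrange_nodes k T
     then lag k (SOME T. T \<in> \<T> \<and> x \<in> T \<and> i \<in> lagrange_nodes k T) i x else 0)"

lemma faces: "T \<in> \<T> \<Longrightarrow> T' \<in> \<T> \<Longrightarrow> T \<inter> T' face_of T" "T \<in> \<T> \<Longrightarrow> T' \<in> \<T> \<Longrightarrow> T \<inter> T' face_of T'"
proof -
  assume T: "T \<in> \<T>" "T' \<in> \<T>"
  then show "T \<inter> T' face_of T" using tri by (auto simp: triangulation_def)
  have "T' \<inter> T face_of T'" using tri T by (auto simp: triangulation_def)
  then show "T \<inter> T' face_of T'" by (simp add: Int_commute)
qed

lemma nodes_subset: "T \<in> \<T> \<Longrightarrow> lagrange_nodes k T \<subseteq> T"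
  by (rule lagrange_nodes_subset[OF full k])

lemma hat_eq:
  assumes T: "T \<in> \<T>" and x: "x \<in> T"
  shows "hat i x = (if i \<in> lagrange_nodes k T then lag k T i x else 0)"
proof (cases "\<exists>T\<in>\<T>. x \<in> T \<and> i \<in> lagrange_nodes k T")
  case True
  define S where "S = (SOME T. T \<in> \<T> \<and> x \<in> T \<and> i \<in> lagrange_nodes k T)"
  have "\<exists>T. T \<in> \<T> \<and> x \<in> T \<and> i \<in> lagrange_nodes k T" using True by blast
  then have S: "S \<in> \<T>" "x \<in> S" "i \<in> lagrange_nodes k S" unfolding S_def by (metis (mono_tags, lifting) someI_ex)+
  have h: "hat i x = lag k S i x" using True by (simp add: hat_def S_def)
  note L = lag_common_face[OF full[OF S(1)] full[OF T] k faces[OF S(1) T] S(3,2) x]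
  show ?thesis
  proof (cases "i \<in> T")
    case True
    then show ?thesis using L h by simp
  next
    case False
    then have "i \<notin> lagrange_nodes k T" using nodes_subset[OF T] by blast
    then show ?thesis using L(3)[OF False] h by simp
  qed
next
  case False
  then have "i \<notin> lagrange_nodes k T" using T x by blast
  moreover have "hat i x = 0" unfolding hat_def using False by (rule if_not_P)
  ultimately show ?thesis by simp
qed

lemma hat_in_fe_space0: "hat i \<in> fe_space0 k \<T>"
proof -
  have p: "\<exists>p\<in>poly_space k. \<forall>x\<in>T. hat i x = p x" if T: "T \<in> \<T>" for T
  proof (cases "i \<in> lagrange_nodes k T")
    case True
    then show ?thesis using hat_eq[OF T] by (intro bexI[OF _ lag_in_poly_space[OF full[OF T] k True]]) simp
  next
    case False
    then show ?thesis using hat_eq[OF T] by (intro bexI[OF _ poly_space_zero]) simp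
  qed
  have "continuous_on (\<Union>T\<in>\<T>. T) (hat i)"
  proof (rule continuous_on_closed_Union)
    show "finite \<T>" using tri by (simp add: triangulation_def)
    fix T assume T: "T \<in> \<T>"
    show "closed T" using full_simplex_verts(7)[OF full[OF T]] by (rule compact_imp_closed)
    obtain p where p: "p \<in> poly_space k" "\<forall>x\<in>T. hat i x = p x" using p[OF T] by blast
    have "continuous_on T p" using smooth_continuous[OF smooth_poly_space[OF p(1)]] continuous_on_subset by blast
    then show "continuous_on T (hat i)" using p(2) by (subst continuous_on_cong[OF refl, of T _ p]) auto
  qed
  then show ?thesis using p by (simp add: fe_space0_def)
qed

lemma active_subset: "T \<in> active_mesh \<T> \<Omega> \<Longrightarrow> T \<in> \<T>"
  by (simp add: active_mesh_def)

lemma poly_eq_if_nodes_eq: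
  assumes "T \<in> \<T>" "p \<in> poly_space k" "q \<in> poly_space k" "\<And>i. i \<in> lagrange_nodes k T \<Longrightarrow> p i = q i"
  shows "p = q"
proof
  fix x
  show "p x = q x"
    unfolding lagrange_interpolation[OF full[OF assms(1)] k assms(2), of x] lagrange_interpolation[OF full[OF assms(1)] k assms(3), of x]
    by (rule sum.cong) (simp_all add: assms(4))
qed

text \<open>The function \<open>hat i\<close>, cut off outside the active elements, satisfies the
  description. Any other candidate is a polynomial of degree at most \<open>k\<close> on each active
  element with the same nodal values, hence equal to it there, and zero elsewhere by the convention
  of \<open>fe_space\<close>.\<close>

lemma fe_basis_eq:
  assumes i: "i \<in> fe_nodes k \<T> \<Omega>"
  shows "fe_basis k \<T> \<Omega> i = (\<lambda>x. if x \<in> \<Union>(active_mesh \<T> \<Omega>) then hat i x else 0)"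
  unfolding fe_basis_def
proof (rule the_equality, intro conjI ballI)
  show "(\<lambda>x. if x \<in> \<Union>(active_mesh \<T> \<Omega>) then hat i x else 0) \<in> fe_space k \<T> \<Omega>"
    unfolding fe_space_def using hat_in_fe_space0 by blast
  fix j assume "j \<in> fe_nodes k \<T> \<Omega>"
  then obtain T where T: "T \<in> active_mesh \<T> \<Omega>" "j \<in> lagrange_nodes k T" by (auto simp: fe_nodes_def)
  have TT: "T \<in> \<T>" by (rule active_subset[OF T(1)])
  have jT: "j \<in> T" using nodes_subset[OF TT] T(2) by blast
  have "hat i j = (if j = i then 1 else 0)"
    using hat_eq[OF TT jT, of i] lag_node[OF full[OF TT] k _ T(2), of i] T(2) by auto
  then show "(if j \<in> \<Union>(active_mesh \<T> \<Omega>) then hat i j else 0) = (if j = i then 1 else 0)"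
    using T(1) jT by auto
next
  fix \<phi> assume \<phi>: "\<phi> \<in> fe_space k \<T> \<Omega> \<and> (\<forall>j\<in>fe_nodes k \<T> \<Omega>. \<phi> j = (if j = i then 1 else 0))"
  then obtain v where v: "v \<in> fe_space0 k \<T>" "\<phi> = (\<lambda>x. if x \<in> \<Union>(active_mesh \<T> \<Omega>) then v x else 0)"
    by (auto simp: fe_space_def)
  show "\<phi> = (\<lambda>x. if x \<in> \<Union>(active_mesh \<T> \<Omega>) then hat i x else 0)"
  proof
    fix x
    show "\<phi> x = (if x \<in> \<Union>(active_mesh \<T> \<Omega>) then hat i x else 0)"
    proof (cases "x \<in> \<Union>(active_mesh \<T> \<Omega>)")
      case True
      then obtain T where T: "T \<in> active_mesh \<T> \<Omega>" "x \<in> T" by blast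
      have TT: "T \<in> \<T>" by (rule active_subset[OF T(1)])
      obtain p where p: "p \<in> poly_space k" "\<forall>x\<in>T. v x = p x" using v(1) TT by (auto simp: fe_space0_def)
      obtain q where q: "q \<in> poly_space k" "\<forall>x\<in>T. hat i x = q x" using hat_in_fe_space0[of i] TT by (auto simp: fe_space0_def)
      have "p j = q j" if j: "j \<in> lagrange_nodes k T" for j
      proof -
        have jT: "j \<in> T" using nodes_subset[OF TT] j by blast
        have "j \<in> fe_nodes k \<T> \<Omega>" using j T(1) by (auto simp: fe_nodes_def)
        then have "\<phi> j = (if j = i then 1 else 0)" using \<phi> by blast
        moreover have "\<phi> j = v j" using T(1) jT by (auto simp: v(2))
        moreover have "hat i j = (if j = i then 1 else 0)"
          using hat_eq[OF TT jT, of i] lag_node[OF full[OF TT] k _ j, of i] j by auto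
        ultimately show ?thesis using p(2) q(2) jT by auto
      qed
      then have "p = q" by (rule poly_eq_if_nodes_eq[OF TT p(1) q(1)])
      then show ?thesis using p(2) q(2) T v(2) True by simp
    next
      case False
      then show ?thesis unfolding v(2) by simp
    qed
  qed
qed

lemma fe_basis_on:
  assumes "i \<in> fe_nodes k \<T> \<Omega>" "T \<in> active_mesh \<T> \<Omega>" "x \<in> T"
  shows "fe_basis k \<T> \<Omega> i x = (if i \<in> lagrange_nodes k T then lag k T i x else 0)"
  using hat_eq[OF active_subset[OF assms(2)] assms(3), of i] assms(2,3) by (auto simp: fe_basis_eq[OF assms(1)])

text \<open>The choices of elements are stated through supports, the estimates use nodes. If
  \<open>i\<close> is not a node of \<open>T\<close>, its basis function vanishes on
  \<open>T\<close>, and then the nonempty interior of \<open>T\<close> misses the support.\<close>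

lemma node_of_supp:
  assumes i: "i \<in> fe_nodes k \<T> \<Omega>" and T: "T \<in> active_mesh \<T> \<Omega>" and s: "T \<subseteq> fe_supp k \<T> \<Omega> i"
  shows "i \<in> lagrange_nodes k T"
proof (rule ccontr)
  assume n: "i \<notin> lagrange_nodes k T"
  have "interior T \<inter> {x. fe_basis k \<T> \<Omega> i x \<noteq> 0} = {}"
    using fe_basis_on[OF i T] n interior_subset[of T] by auto
  then have "interior T \<inter> closure {x. fe_basis k \<T> \<Omega> i x \<noteq> 0} = {}"
    by (simp add: open_Int_closure_eq_empty)
  moreover have "interior T \<subseteq> closure {x. fe_basis k \<T> \<Omega> i x \<noteq> 0}"
    using s interior_subset[of T] by (auto simp: fe_supp_def)
  moreover have "interior T \<noteq> {}" by (rule full_simplex_verts(6)[OF full[OF active_subset[OF T]]])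
  ultimately show False by blast
qed

lemma finite_fe_nodes: "finite (fe_nodes k \<T> \<Omega>)"
proof -
  have "finite (active_mesh \<T> \<Omega>)" using tri by (simp add: triangulation_def active_mesh_def)
  then show ?thesis unfolding fe_nodes_def
    using finite_lagrange_nodes(1)[OF full[OF active_subset]] by blast
qed

lemma nodes_in_fe_nodes: "T \<in> active_mesh \<T> \<Omega> \<Longrightarrow> lagrange_nodes k T \<subseteq> fe_nodes k \<T> \<Omega>"
  by (auto simp: fe_nodes_def)

lemma fe_sum_on:
  assumes T: "T \<in> active_mesh \<T> \<Omega>" and x: "x \<in> T"
  shows "(\<Sum>i\<in>fe_nodes k \<T> \<Omega>. c i * fe_basis k \<T> \<Omega> i x) = (\<Sum>i\<in>lagrange_nodes k T. c i * lag k T i x)"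
proof -
  have "(\<Sum>i\<in>fe_nodes k \<T> \<Omega>. c i * fe_basis k \<T> \<Omega> i x) = (\<Sum>i\<in>lagrange_nodes k T. c i * fe_basis k \<T> \<Omega> i x)"
    by (rule sum.mono_neutral_right[OF finite_fe_nodes nodes_in_fe_nodes[OF T]]) (simp add: fe_basis_on[OF _ T x])
  also have "\<dots> = (\<Sum>i\<in>lagrange_nodes k T. c i * lag k T i x)"
    using nodes_in_fe_nodes[OF T] by (intro sum.cong refl) (auto simp: fe_basis_on[OF _ T x])
  finally show ?thesis .
qed

text \<open>The degree of freedom is evaluation at the node, of the polynomial with which
  \<open>f\<close> agrees on \<open>T\<close>. Existence of the expansion is Lagrange interpolation;
  evaluating any expansion at \<open>i\<close> gives uniqueness.\<close>

lemma elem_dof_eq: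
  assumes T: "T \<in> active_mesh \<T> \<Omega>" and i: "i \<in> lagrange_nodes k T" and p: "p \<in> poly_space k" "\<And>x. x \<in> T \<Longrightarrow> f x = p x"
  shows "elem_dof k \<T> \<Omega> i T f = p i"
  unfolding elem_dof_def
proof (rule the_equality)
  have TT: "T \<in> \<T>" by (rule active_subset[OF T])
  have b: "(\<Sum>j\<in>lagrange_nodes k T. a j * fe_basis k \<T> \<Omega> j x) = (\<Sum>j\<in>lagrange_nodes k T. a j * lag k T j x)" if "x \<in> T" for a x
    using nodes_in_fe_nodes[OF T] that by (intro sum.cong refl) (auto simp: fe_basis_on[OF _ T])
  show "\<exists>a. a i = p i \<and> (\<forall>x\<in>T. f x = (\<Sum>j\<in>lagrange_nodes k T. a j * fe_basis k \<T> \<Omega> j x))"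
    by (intro exI[of _ p] conjI refl ballI) (simp add: b p(2) lagrange_interpolation[OF full[OF TT] k p(1), symmetric])
  fix c assume "\<exists>a. a i = c \<and> (\<forall>x\<in>T. f x = (\<Sum>j\<in>lagrange_nodes k T. a j * fe_basis k \<T> \<Omega> j x))"
  then obtain a where a: "a i = c" "\<forall>x\<in>T. f x = (\<Sum>j\<in>lagrange_nodes k T. a j * fe_basis k \<T> \<Omega> j x)" by blast
  have iT: "i \<in> T" using nodes_subset[OF TT] i by blast
  have "p i = (\<Sum>j\<in>lagrange_nodes k T. a j * lag k T j i)" using a(2) iT p(2)[OF iT] b[OF iT] by simp
  also have "\<dots> = (\<Sum>j\<in>lagrange_nodes k T. if j = i then a i else 0)"
    by (intro sum.cong refl) (simp add: lag_node[OF full[OF TT] k _ i])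
  also have "\<dots> = a i" using i finite_lagrange_nodes(1)[OF full[OF TT]] by simp
  finally show "c = p i" using a(1) by simp
qed

lemma poly_ext_eq:
  assumes T: "T \<in> \<T>" and p: "p \<in> poly_space k" "\<And>x. x \<in> T \<Longrightarrow> f x = p x"
  shows "poly_ext k T f = p"
  unfolding poly_ext_def
proof (rule the_equality)
  show "p \<in> poly_space k \<and> (\<forall>x\<in>T. p x = f x)" using p by simp
  fix q assume q: "q \<in> poly_space k \<and> (\<forall>x\<in>T. q x = f x)"
  show "q = p"
    by (rule poly_eq_if_nodes_eq[OF T]) (use q p nodes_subset[OF T] in auto)
qed

text \<open>The restriction to \<open>T\<close> of the finite element function with coefficients
  \<open>c\<close>, as a polynomial on the whole space; it is thereby its own canonical
  extension.\<close>

definition nodal_poly :: "('a \<Rightarrow> real) \<Rightarrow> 'a set \<Rightarrow> 'a \<Rightarrow> real" where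
  "nodal_poly c T x = (\<Sum>i\<in>lagrange_nodes k T. c i * lag k T i x)"

lemma nodal_poly_in_poly_space: "T \<in> \<T> \<Longrightarrow> nodal_poly c T \<in> poly_space k"
  unfolding nodal_poly_def[abs_def]
  by (intro poly_space_sum poly_space_cmult lag_in_poly_space[OF full k])

text \<open>Reproduction of polynomials in the form in which it is used: only the differences of
  nodal values enter the error.\<close>

lemma nodal_poly_diff:
  assumes "T \<in> \<T>" "p \<in> poly_space k"
  shows "nodal_poly c T x - p x = (\<Sum>i\<in>lagrange_nodes k T. (c i - p i) * lag k T i x)"
  unfolding nodal_poly_def lagrange_interpolation[OF full[OF assms(1)] k assms(2), of x]
  by (simp add: sum_subtractf left_diff_distrib)

end

text \<open>Consecutive elements share a point of their common facet, and each element of the path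
  contributes at most its diameter.\<close>

lemma dist_le_path:
  assumes "Ts \<noteq> []" "successively face_neighbors Ts" "\<And>T. T \<in> set Ts \<Longrightarrow> bounded T \<and> diameter T \<le> h"
    "x \<in> hd Ts" "y \<in> last Ts"
  shows "dist x y \<le> real (length Ts) * h"
  using assms
proof (induction Ts arbitrary: x)
  case (Cons T Ts)
  have d: "dist x w \<le> h" if "w \<in> T" for w
    using diameter_bounded_bound[of T x w] Cons.prems(3)[of T] Cons.prems(4) that by auto
  show ?case
  proof (cases Ts)
    case Nil
    then show ?thesis using d Cons.prems by simp
  next
    case (Cons T' Ts')
    then have fn: "face_neighbors T T'" using Cons.prems(2) by simp
    then obtain F where F: "F facet_of T" "F facet_of T'" by (auto simp: face_neighbors_def)
    then obtain w where "w \<in> F" by (auto simp: facet_of_def)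
    then have w: "w \<in> T" "w \<in> T'" using F by (auto simp: facet_of_def dest: face_of_imp_subset)
    have "dist w y \<le> real (length Ts) * h"
      by (rule Cons.IH) (use Cons Cons.prems w in auto)
    then show ?thesis using d[OF w(1)] dist_triangle[of x y w] by (simp add: algebra_simps)
  qed
qed simp


section \<open>The interpolation operator\<close>

lemma measure_ball_lebesgue:
  fixes x :: "'a::euclidean_space"
  assumes "0 \<le> r"
  shows "measure lebesgue (ball x r) = unit_ball_vol (real DIM('a)) * r ^ DIM('a)"
  using content_ball[OF assms, of x] by simp

text \<open>Extrapolation and an inverse estimate from a pointwise bound on a ball. The volume of
  the ball cancels the power of \<open>r\<close> in \<open>poly_space_ball_bound\<close> and leaves
  the volume of the unit ball in the constant.\<close>

lemma poly_sup_extension: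
  "\<exists>C\<ge>0. \<forall>q\<in>poly_space k. \<forall>x0 :: 'a::euclidean_space. \<forall>r>0. \<forall>A\<ge>0. (\<forall>x\<in>ball x0 r. (q x)\<^sup>2 \<le> A) \<longrightarrow>
     (\<forall>y. dist x0 y \<le> R * r \<longrightarrow> (q y)\<^sup>2 \<le> C * A \<and> (\<forall>b\<in>Basis. (partial_deriv b q y)\<^sup>2 \<le> C * A / r\<^sup>2))"
proof -
  obtain C where C: "C \<ge> 0" and bd: "\<forall>p\<in>poly_space k. \<forall>x0 :: 'a. \<forall>r>0. \<forall>x. dist x0 x \<le> R * r \<longrightarrow>
     (p x)\<^sup>2 \<le> C / r ^ DIM('a) * sqint (ball x0 r) p \<and>
     (\<forall>b\<in>Basis. (partial_deriv b p x)\<^sup>2 \<le> C / r ^ (DIM('a) + 2) * sqint (ball x0 r) p)"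
    using poly_space_ball_bound[of k R, where 'a = 'a] by (elim exE conjE) (rule that)
  let ?\<omega> = "unit_ball_vol (real DIM('a))"
  show ?thesis
  proof (intro exI[of _ "C * ?\<omega>"] conjI ballI allI impI)
    show "0 \<le> C * ?\<omega>" using C by simp
    fix q and x0 :: 'a and r A :: real and y
    assume q: "q \<in> poly_space k" and r: "0 < r" and A: "0 \<le> A" and le: "\<forall>x\<in>ball x0 r. (q x)\<^sup>2 \<le> A" and y: "dist x0 y \<le> R * r"
    have "sqint (ball x0 r) q \<le> (sqrt A)\<^sup>2 * measure lebesgue (ball x0 r)"
    proof (rule bounded_imp_L2_space(2))
      show "q \<in> borel_measurable lebesgue"
        by (rule continuous_imp_measurable_lebesgue[OF smooth_continuous[OF smooth_poly_space[OF q]]])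
      show "ball x0 r \<in> lmeasurable" by (rule lmeasurable_ball)
      show "\<bar>q x\<bar> \<le> sqrt A" if "x \<in> ball x0 r" for x
        using le that by (intro real_le_rsqrt) auto
    qed
    then have s: "sqint (ball x0 r) q \<le> A * (?\<omega> * r ^ DIM('a))"
      by (simp only: measure_ball_lebesgue[OF less_imp_le[OF r]] real_sqrt_pow2[OF A])
    have 1: "C / r ^ DIM('a) * sqint (ball x0 r) q \<le> C * ?\<omega> * A"
    proof -
      have "C / r ^ DIM('a) * sqint (ball x0 r) q \<le> C / r ^ DIM('a) * (A * (?\<omega> * r ^ DIM('a)))"
        using C r by (intro mult_left_mono[OF s]) auto
      then show ?thesis using r by (simp add: mult_ac)
    qed
    show "(q y)\<^sup>2 \<le> C * ?\<omega> * A" using bd[rule_format, OF q r y] 1 by linarith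
    fix b :: 'a assume b: "b \<in> Basis"
    have "(partial_deriv b q y)\<^sup>2 \<le> C / r ^ (DIM('a) + 2) * sqint (ball x0 r) q"
      using bd[rule_format, OF q r y] b by blast
    also have "\<dots> = (C / r ^ DIM('a) * sqint (ball x0 r) q) / r\<^sup>2" by (simp add: power_add power2_eq_square mult_ac)
    also have "\<dots> \<le> C * ?\<omega> * A / r\<^sup>2" by (rule divide_right_mono[OF 1]) simp
    finally show "(partial_deriv b q y)\<^sup>2 \<le> C * ?\<omega> * A / r\<^sup>2" .
  qed
qed

context fe_mesh
begin

text \<open>Each degree of freedom is the value at the node \<open>j\<close> of the projection taken
  on \<open>elem' j\<close>, so on one element only its own nodes survive.\<close>

lemma pi_interp_on:
  assumes vc: "valid_choices k \<gamma> \<T> \<Omega> elem elem'"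
    and Q: "\<And>j. j \<in> fe_nodes k \<T> \<Omega> \<Longrightarrow> L2_proj k (elem' j) (E v) \<in> poly_space k"
    and T: "T \<in> active_mesh \<T> \<Omega>" and x: "x \<in> T"
  shows "pi_interp k \<T> \<Omega> E elem' v x = nodal_poly (\<lambda>j. L2_proj k (elem' j) (E v) j) T x"
proof -
  have e: "elem_dof k \<T> \<Omega> j (elem' j) (L2_proj k (elem' j) (E v)) = L2_proj k (elem' j) (E v) j"
    if j: "j \<in> fe_nodes k \<T> \<Omega>" for j
  proof (rule elem_dof_eq[OF _ _ Q[OF j]])
    show "elem' j \<in> active_mesh \<T> \<Omega>" using vc j by (auto simp: valid_choices_def)
    then show "j \<in> lagrange_nodes k (elem' j)" using vc j by (intro node_of_supp) (auto simp: valid_choices_def)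
  qed simp
  have "pi_interp k \<T> \<Omega> E elem' v x = (\<Sum>j\<in>fe_nodes k \<T> \<Omega>. L2_proj k (elem' j) (E v) j * fe_basis k \<T> \<Omega> j x)"
    unfolding pi_interp_def by (intro sum.cong refl) (simp add: e)
  then show ?thesis by (simp add: fe_sum_on[OF T x] nodal_poly_def)
qed

text \<open>For a small node the coefficient is the value at \<open>i\<close> of the polynomial
  living on \<open>S (elem i)\<close>, a possibly distant element; for the other nodes the
  polynomial comes from an element that contains \<open>i\<close>. The input is needed in polynomial
  form on active elements only.\<close>

lemma Pi_tilde_on:
  assumes vc: "valid_choices k \<gamma> \<T> \<Omega> elem elem'"
    and S: "S \<in> small_elements \<gamma> \<T> \<Omega> \<rightarrow> large_elements \<gamma> \<T> \<Omega>"
    and v: "\<And>T x. T \<in> active_mesh \<T> \<Omega> \<Longrightarrow> x \<in> T \<Longrightarrow> v x = nodal_poly c T x"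
    and T: "T \<in> active_mesh \<T> \<Omega>" and x: "x \<in> T"
  shows "Pi_tilde k \<gamma> \<T> \<Omega> S elem v x =
    nodal_poly (\<lambda>i. if i \<in> small_nodes k \<gamma> \<T> \<Omega> then nodal_poly c (S (elem i)) i else nodal_poly c (elem i) i) T x"
    (is "_ = nodal_poly ?c T x")
proof -
  have small: "elem_dof k \<T> \<Omega> i (elem i) (poly_ext k (S (elem i)) v) = ?c i" if i: "i \<in> small_nodes k \<gamma> \<T> \<Omega>" for i
  proof -
    have e: "elem i \<in> active_mesh \<T> \<Omega>" "elem i \<subseteq> fe_supp k \<T> \<Omega> i" using vc i by (auto simp: valid_choices_def)
    have inn: "i \<in> fe_nodes k \<T> \<Omega>" using i by (simp add: small_nodes_def)
    \<comment> \<open>A large \<open>elem i\<close> inside the support would contradict that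
      \<open>i\<close> is a small node; hence \<open>S\<close> may be applied to it.\<close>
    have "elem i \<in> small_elements \<gamma> \<T> \<Omega>" using e i by (auto simp: small_elements_def small_nodes_def)
    then have Sl: "S (elem i) \<in> active_mesh \<T> \<Omega>" using S by (auto simp: large_elements_def)
    note ST = active_subset[OF Sl]
    have "poly_ext k (S (elem i)) v = nodal_poly c (S (elem i))"
      by (rule poly_ext_eq[OF ST nodal_poly_in_poly_space[OF ST] v[OF Sl]])
    then have "elem_dof k \<T> \<Omega> i (elem i) (poly_ext k (S (elem i)) v) = nodal_poly c (S (elem i)) i"
      by (intro elem_dof_eq[OF e(1) node_of_supp[OF inn e] nodal_poly_in_poly_space[OF ST]]) simp
    then show ?thesis using i by simp
  qed
  have large: "elem_dof k \<T> \<Omega> i (elem i) v = ?c i" if i: "i \<in> large_nodes k \<gamma> \<T> \<Omega>" for i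
  proof -
    have e: "elem i \<in> active_mesh \<T> \<Omega>" "elem i \<subseteq> fe_supp k \<T> \<Omega> i" using vc i by (auto simp: valid_choices_def large_elements_def)
    have inn: "i \<in> fe_nodes k \<T> \<Omega>" "i \<notin> small_nodes k \<gamma> \<T> \<Omega>" using i by (auto simp: large_nodes_def)
    have "elem_dof k \<T> \<Omega> i (elem i) v = nodal_poly c (elem i) i"
      by (intro elem_dof_eq[OF e(1) node_of_supp[OF inn(1) e] nodal_poly_in_poly_space[OF active_subset[OF e(1)]]] v e)
    then show ?thesis using inn by simp
  qed
  have sub: "small_nodes k \<gamma> \<T> \<Omega> \<subseteq> fe_nodes k \<T> \<Omega>" by (auto simp: small_nodes_def)
  have "Pi_tilde k \<gamma> \<T> \<Omega> S elem v x = (\<Sum>i\<in>small_nodes k \<gamma> \<T> \<Omega>. ?c i * fe_basis k \<T> \<Omega> i x) + (\<Sum>i\<in>large_nodes k \<gamma> \<T> \<Omega>. ?c i * fe_basis k \<T> \<Omega> i x)"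
    unfolding Pi_tilde_def by (intro arg_cong2[of _ _ _ _ "(+)"] sum.cong refl) (simp_all only: small large)
  also have "\<dots> = (\<Sum>i\<in>fe_nodes k \<T> \<Omega>. ?c i * fe_basis k \<T> \<Omega> i x)"
    unfolding large_nodes_def sum.subset_diff[OF sub finite_fe_nodes] by (rule add.commute)
  finally show ?thesis by (simp only: fe_sum_on[OF T x] nodal_poly_def)
qed

end

text \<open>Stability of the operator, stated as a distance to an arbitrary polynomial
  \<open>p\<close>, which it reproduces. The squared error passes through four estimates: nodal
  values of the projections (\<open>A\<close>), the intermediate interpolant on an element
  (\<open>M * A\<close>), extrapolation to a node of \<open>T\<close> (\<open>C2 * (M * A)\<close>),
  and summation on \<open>T\<close> (another factor \<open>M\<close>).\<close>

theorem Pi_interp_local_bound: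
  assumes k: "k \<ge> 1" and \<rho>: "\<rho> > 0"
  shows "\<exists>C\<ge>0. \<forall>(\<T> :: 'a::euclidean_space set set) \<Omega> h S elem elem' E v p T z.
    fe_mesh k \<T> \<longrightarrow> h > 0 \<longrightarrow> (\<forall>T\<in>\<T>. diameter T \<le> h \<and> (\<exists>x. ball x (\<rho> * h) \<subseteq> T)) \<longrightarrow>
    S \<in> small_elements \<gamma> \<T> \<Omega> \<rightarrow> large_elements \<gamma> \<T> \<Omega> \<longrightarrow> path_assumption N \<gamma> \<T> \<Omega> S \<longrightarrow>
    valid_choices k \<gamma> \<T> \<Omega> elem elem' \<longrightarrow> T \<in> active_mesh \<T> \<Omega> \<longrightarrow> z \<in> T \<longrightarrow> p \<in> poly_space k \<longrightarrow> E v \<in> L2_space UNIV \<longrightarrow>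
    (\<exists>q\<in>poly_space k. \<forall>x\<in>T. Pi_interp k \<gamma> \<T> \<Omega> E S elem elem' v x = q x \<and>
      (q x - p x)\<^sup>2 \<le> C / h ^ DIM('a) * sqint (ball z (real (N + 10) * h)) (\<lambda>x. E v x - p x) \<and>
      (\<forall>b\<in>Basis. (partial_deriv b (\<lambda>x. q x - p x) x)\<^sup>2 \<le> C / h ^ (DIM('a) + 2) * sqint (ball z (real (N + 10) * h)) (\<lambda>x. E v x - p x)))"
proof -
  \<comment> \<open>Polynomials are evaluated at distance at most \<open>h\<close> or
    \<open>N * h\<close> from the centre of the ball that controls them, and its radius is
    \<open>\<rho> * h\<close>. Using \<open>N + 10\<close> covers both cases for every
    \<open>N\<close>.\<close>
  define R where "R = real (N + 10) / \<rho>"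
  have R: "real N / \<rho> \<le> R" "1 / \<rho> \<le> R" using \<rho> by (auto simp: R_def divide_right_mono)
  obtain C1 where C1: "C1 \<ge> 0" and bd1: "\<forall>p\<in>poly_space k. \<forall>x0 :: 'a. \<forall>r>0. \<forall>x. dist x0 x \<le> R * r \<longrightarrow>
     (p x)\<^sup>2 \<le> C1 / r ^ DIM('a) * sqint (ball x0 r) p \<and>
     (\<forall>b\<in>Basis. (partial_deriv b p x)\<^sup>2 \<le> C1 / r ^ (DIM('a) + 2) * sqint (ball x0 r) p)"
    using poly_space_ball_bound[of k R, where 'a = 'a] by (elim exE conjE) (rule that)
  obtain C2 where C2: "C2 \<ge> 0" and bd2: "\<forall>q\<in>poly_space k. \<forall>x0 :: 'a. \<forall>r>0. \<forall>A\<ge>0. (\<forall>x\<in>ball x0 r. (q x)\<^sup>2 \<le> A) \<longrightarrow>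
     (\<forall>y. dist x0 y \<le> R * r \<longrightarrow> (q y)\<^sup>2 \<le> C2 * A \<and> (\<forall>b\<in>Basis. (partial_deriv b q y)\<^sup>2 \<le> C2 * A / r\<^sup>2))"
    using poly_sup_extension[of k R, where 'a = 'a] by (elim exE conjE) (rule that)
  define M where "M = (real (k + 1) ^ (DIM('a) + 1) * real k ^ k)\<^sup>2"
  have M: "0 \<le> M" by (simp add: M_def)
  \<comment> \<open>The product of the four constants; the power of \<open>\<rho>\<close> comes from
    expressing the radius \<open>r\<close> by \<open>h\<close>.\<close>
  define L where "L = M * (C2 * (M * C1)) / \<rho> ^ DIM('a)"
  have L: "0 \<le> L" using M C1 C2 \<rho> by (simp add: L_def)
  show ?thesis
  \<comment> \<open>The second summand is the constant for the derivatives, where \<open>C2\<close>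
    and the two powers of \<open>\<rho>\<close> come from the inverse estimate on
    \<open>T\<close>.\<close>
  proof (intro exI[of _ "L + C2 * L / \<rho>\<^sup>2"] conjI allI impI)
    show "0 \<le> L + C2 * L / \<rho>\<^sup>2" using L C2 by simp
    fix \<T> :: "'a set set" and \<Omega> :: "'a set" and h :: real and S :: "'a set \<Rightarrow> 'a set" and elem elem' :: "'a \<Rightarrow> 'a set"
      and E :: "('a \<Rightarrow> real) \<Rightarrow> 'a \<Rightarrow> real" and v p :: "'a \<Rightarrow> real" and T :: "'a set" and z :: 'a
    assume mesh: "fe_mesh k \<T>" and h: "h > 0" and geo: "\<forall>T\<in>\<T>. diameter T \<le> h \<and> (\<exists>x. ball x (\<rho> * h) \<subseteq> T)"
      and S: "S \<in> small_elements \<gamma> \<T> \<Omega> \<rightarrow> large_elements \<gamma> \<T> \<Omega>" and path: "path_assumption N \<gamma> \<T> \<Omega> S"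
      and vc: "valid_choices k \<gamma> \<T> \<Omega> elem elem'" and T: "T \<in> active_mesh \<T> \<Omega>" and z: "z \<in> T"
      and p: "p \<in> poly_space k" and w: "E v \<in> L2_space UNIV"
    interpret fe_mesh k \<T> \<Omega> by (rule mesh)
    let ?d = "DIM('a)" and ?B = "ball z (real (N + 10) * h)" and ?w = "E v"
    define \<epsilon> where "\<epsilon> = sqint ?B (\<lambda>x. ?w x - p x)"
    have \<epsilon>: "0 \<le> \<epsilon>" by (simp add: \<epsilon>_def sqint_nonneg)
    define r where "r = \<rho> * h"
    have r: "r > 0" using \<rho> h by (simp add: r_def)
    have BT: "compact X" "bounded X" "X \<in> sets lebesgue" if "X \<in> \<T>" for X
      using full_simplex_verts(7)[OF full[OF that]] by (auto simp: compact_imp_bounded borel_compact)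
    have dist1: "dist x y \<le> h" if "X \<in> \<T>" "x \<in> X" "y \<in> X" for X x y
      using diameter_bounded_bound[OF BT(2)[OF that(1)] that(2,3)] geo that(1) by force
    define ctr where "ctr X = (SOME x. ball x r \<subseteq> X)" for X :: "'a set"
    have ctr: "ball (ctr X) r \<subseteq> X" if "X \<in> \<T>" for X
      unfolding ctr_def using geo that unfolding r_def[symmetric] by (metis (mono_tags, lifting) someI_ex)
    have ctr_in: "ctr X \<in> X" if "X \<in> \<T>" for X using ctr[OF that] r by auto
    have wL: "?w \<in> L2_space X" if "X \<in> \<T>" for X
      by (rule L2_space_subset(1)[OF w]) (use BT[OF that] in auto)
    define Q where "Q j = L2_proj k (elem' j) ?w" for j
    have e': "elem' j \<in> active_mesh \<T> \<Omega>" "elem' j \<in> \<T>" "j \<in> lagrange_nodes k (elem' j)" "j \<in> elem' j" if j: "j \<in> fe_nodes k \<T> \<Omega>" for j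
    proof -
      show 1: "elem' j \<in> active_mesh \<T> \<Omega>" using vc j by (auto simp: valid_choices_def)
      then show 2: "elem' j \<in> \<T>" by (rule active_subset)
      show 3: "j \<in> lagrange_nodes k (elem' j)" using vc j 1 by (intro node_of_supp) (auto simp: valid_choices_def)
      show "j \<in> elem' j" using nodes_subset[OF 2] 3 by blast
    qed
    have Q: "Q j \<in> poly_space k" if j: "j \<in> fe_nodes k \<T> \<Omega>" for j
      unfolding Q_def by (rule L2_proj_props(1)[OF wL[OF e'(2)[OF j]] BT(2,3)[OF e'(2)[OF j]] ctr[OF e'(2)[OF j]] r])
    define A where "A = C1 / r ^ ?d * \<epsilon>"
    have A: "0 \<le> A" using C1 r \<epsilon> by (simp add: A_def)
    \<comment> \<open>The projection error relative to \<open>p\<close> on \<open>elem' j\<close>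
      does not exceed that of the extended function, and the value at the node is controlled from
      the ball inscribed in that element.\<close>
    have Qb: "(Q j j - p j)\<^sup>2 \<le> A" if j: "j \<in> fe_nodes k \<T> \<Omega>" and sub: "elem' j \<subseteq> ?B" for j
    proof -
      let ?X = "elem' j"
      note X = e'(2)[OF j]
      have dp: "(\<lambda>x. Q j x - p x) \<in> poly_space k" by (rule poly_space_diff[OF Q[OF j] p])
      have "dist (ctr ?X) j \<le> R * r"
      proof -
        have "dist (ctr ?X) j \<le> h" by (rule dist1[OF X ctr_in[OF X] e'(4)[OF j]])
        also have "h = 1 / \<rho> * r" using \<rho> by (simp add: r_def)
        also have "\<dots> \<le> R * r" using R(2) r by (intro mult_right_mono) auto
        finally show ?thesis .
      qed
      then have "(Q j j - p j)\<^sup>2 \<le> C1 / r ^ ?d * sqint (ball (ctr ?X) r) (\<lambda>x. Q j x - p x)"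
        using bd1[rule_format, OF dp r] by blast
      also have "\<dots> \<le> C1 / r ^ ?d * \<epsilon>"
      proof (rule mult_left_mono)
        have "sqint (ball (ctr ?X) r) (\<lambda>x. Q j x - p x) \<le> sqint ?X (\<lambda>x. Q j x - p x)"
          by (rule L2_space_subset(2)[OF poly_space_L2[OF dp BT(2,3)[OF X]] ctr[OF X]]) auto
        also have "\<dots> \<le> sqint ?X (\<lambda>x. ?w x - p x)"
          unfolding Q_def by (rule L2_proj_props(2)[OF wL[OF X] BT(2,3)[OF X] ctr[OF X] r p])
        also have "\<dots> \<le> \<epsilon>"
          unfolding \<epsilon>_def
        proof (rule L2_space_subset(2)[OF _ sub BT(3)[OF X]])
          show "(\<lambda>x. ?w x - p x) \<in> L2_space ?B"
            by (intro L2_space_diff L2_space_subset(1)[OF w] poly_space_L2[OF p]) auto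
        qed
        finally show "sqint (ball (ctr ?X) r) (\<lambda>x. Q j x - p x) \<le> \<epsilon>" .
      qed (use C1 r in auto)
      finally show ?thesis by (simp add: A_def)
    qed
    define cQ where "cQ j = Q j j" for j
    have pi_on: "pi_interp k \<T> \<Omega> E elem' v x = nodal_poly cQ X x" if "X \<in> active_mesh \<T> \<Omega>" "x \<in> X" for X x
      unfolding cQ_def Q_def
      by (rule pi_interp_on[where E = E and v = v, OF vc _ that]) (rule Q[unfolded Q_def])
    \<comment> \<open>A nodal value on \<open>X\<close> comes from an element \<open>elem' j\<close>
      that reaches at most \<open>h\<close> beyond \<open>X\<close>, so the radius
      \<open>(N + 10) * h\<close> leaves room.\<close>
    have near: "(nodal_poly cQ X x - p x)\<^sup>2 \<le> M * A"
      if X: "X \<in> active_mesh \<T> \<Omega>" and nX: "\<And>y. y \<in> X \<Longrightarrow> dist z y \<le> real (N + 2) * h" and x: "x \<in> X" for X x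
    proof -
      note XT = active_subset[OF X]
      show ?thesis
        unfolding nodal_poly_diff[OF XT p] M_def
      proof (rule node_sum_bound[OF full[OF XT] k x A])
        fix j assume jX: "j \<in> lagrange_nodes k X"
        have j: "j \<in> fe_nodes k \<T> \<Omega>" using nodes_in_fe_nodes[OF X] jX by blast
        have jX': "j \<in> X" using nodes_subset[OF XT] jX by blast
        have "elem' j \<subseteq> ?B"
        proof
          fix y assume y: "y \<in> elem' j"
          have "dist z y \<le> dist z j + dist j y" by (rule dist_triangle)
          also have "\<dots> \<le> real (N + 2) * h + h"
            using nX[OF jX'] dist1[OF e'(2)[OF j] e'(4)[OF j] y] by linarith
          also have "\<dots> < real (N + 10) * h" using h by (simp add: algebra_simps)
          finally show "y \<in> ?B" by simp
        qed
        then show "(cQ j - p j)\<^sup>2 \<le> A" unfolding cQ_def by (rule Qb[OF j])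
      qed
    qed
    define c where "c i = (if i \<in> small_nodes k \<gamma> \<T> \<Omega> then nodal_poly cQ (S (elem i)) i else nodal_poly cQ (elem i) i)" for i
    have Pi_on: "Pi_interp k \<gamma> \<T> \<Omega> E S elem elem' v x = nodal_poly c T x" if x: "x \<in> T" for x
      unfolding Pi_interp_def c_def by (rule Pi_tilde_on[OF vc S pi_on T x])
    have cb: "(c i - p i)\<^sup>2 \<le> C2 * (M * A)" if i: "i \<in> lagrange_nodes k T" for i
    proof -
      note TT = active_subset[OF T]
      have iT: "i \<in> T" using nodes_subset[OF TT] i by blast
      have inn: "i \<in> fe_nodes k \<T> \<Omega>" using nodes_in_fe_nodes[OF T] i by blast
      have zi: "dist z i \<le> h" by (rule dist1[OF TT z iT])
      \<comment> \<open>Both kinds of nodes in one form: the coefficient is the value at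
        \<open>i\<close> of the polynomial on some \<open>X\<close> whose centre is within
        \<open>R * r\<close>. For a small node \<open>X\<close> is \<open>S (elem i)\<close>,
        reached along the path of at most \<open>N\<close> elements, and need not contain
        \<open>i\<close>.\<close>
      have "\<exists>X\<in>active_mesh \<T> \<Omega>. c i = nodal_poly cQ X i \<and> (\<forall>y\<in>X. dist z y \<le> real (N + 2) * h) \<and> dist (ctr X) i \<le> R * r"
      proof (cases "i \<in> small_nodes k \<gamma> \<T> \<Omega>")
        case True
        have e: "elem i \<in> active_mesh \<T> \<Omega>" "elem i \<subseteq> fe_supp k \<T> \<Omega> i" using vc True by (auto simp: valid_choices_def)
        have es: "elem i \<in> small_elements \<gamma> \<T> \<Omega>" using e True by (auto simp: small_elements_def small_nodes_def)
        then have Sl: "S (elem i) \<in> active_mesh \<T> \<Omega>" using S by (auto simp: large_elements_def)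
        have ie: "i \<in> elem i" using nodes_subset[OF active_subset[OF e(1)]] node_of_supp[OF inn e] by blast
        obtain Ts where Ts: "Ts \<noteq> []" "set Ts \<subseteq> active_mesh \<T> \<Omega>" "hd Ts = elem i" "last Ts = S (elem i)"
          "length Ts \<le> N" "successively face_neighbors Ts"
          using path es unfolding path_assumption_def by blast
        have d: "dist i y \<le> real N * h" if y: "y \<in> S (elem i)" for y
        proof -
          have "dist i y \<le> real (length Ts) * h"
            by (rule dist_le_path[OF Ts(1,6)]) (use Ts BT(2) geo active_subset ie y in auto)
          also have "\<dots> \<le> real N * h" using Ts(5) h by (intro mult_right_mono) auto
          finally show ?thesis .
        qed
        have "dist (ctr (S (elem i))) i \<le> real N * h"
          using d[OF ctr_in[OF active_subset[OF Sl]]] by (simp add: dist_commute)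
        also have "\<dots> = real N / \<rho> * r" using \<rho> by (simp add: r_def)
        also have "\<dots> \<le> R * r" using R(1) r by (intro mult_right_mono) auto
        finally have "dist (ctr (S (elem i))) i \<le> R * r" .
        moreover have "dist z y \<le> real (N + 2) * h" if "y \<in> S (elem i)" for y
          using zi d[OF that] dist_triangle[of z y i] h by (simp add: algebra_simps)
        ultimately show ?thesis using True Sl by (intro bexI[OF _ Sl]) (auto simp: c_def)
      next
        case False
        then have "i \<in> large_nodes k \<gamma> \<T> \<Omega>" using inn by (simp add: large_nodes_def)
        then have e: "elem i \<in> active_mesh \<T> \<Omega>" "elem i \<subseteq> fe_supp k \<T> \<Omega> i" using vc by (auto simp: valid_choices_def large_elements_def)
        note eT = active_subset[OF e(1)]
        have ie: "i \<in> elem i" using nodes_subset[OF eT] node_of_supp[OF inn e] by blast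
        have "dist (ctr (elem i)) i \<le> h" by (rule dist1[OF eT ctr_in[OF eT] ie])
        also have "h = 1 / \<rho> * r" using \<rho> by (simp add: r_def)
        also have "\<dots> \<le> R * r" using R(2) r by (intro mult_right_mono) auto
        finally have "dist (ctr (elem i)) i \<le> R * r" .
        moreover have "dist z y \<le> real (N + 2) * h" if "y \<in> elem i" for y
        proof -
          have "0 \<le> real N * h" using h by simp
          then show ?thesis using zi dist1[OF eT ie that] dist_triangle[of z y i] by (simp add: algebra_simps)
        qed
        ultimately show ?thesis using False by (intro bexI[OF _ e(1)]) (auto simp: c_def)
      qed
      then obtain X where X: "X \<in> active_mesh \<T> \<Omega>" "c i = nodal_poly cQ X i" "\<And>y. y \<in> X \<Longrightarrow> dist z y \<le> real (N + 2) * h"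
        "dist (ctr X) i \<le> R * r" by blast
      have dp: "(\<lambda>x. nodal_poly cQ X x - p x) \<in> poly_space k"
        by (rule poly_space_diff[OF nodal_poly_in_poly_space[OF active_subset[OF X(1)]] p])
      have "\<forall>x\<in>ball (ctr X) r. (nodal_poly cQ X x - p x)\<^sup>2 \<le> M * A"
        using near[OF X(1,3)] ctr[OF active_subset[OF X(1)]] by blast
      then have "(nodal_poly cQ X i - p i)\<^sup>2 \<le> C2 * (M * A)"
        using bd2[rule_format, OF dp r _ _ X(4), of "M * A"] M A by auto
      then show ?thesis by (simp add: X(2))
    qed
    note TT = active_subset[OF T]
    have dp: "(\<lambda>x. nodal_poly c T x - p x) \<in> poly_space k"
      by (rule poly_space_diff[OF nodal_poly_in_poly_space[OF TT] p])
    have CMA: "0 \<le> C2 * (M * A)" using C2 M A by simp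
    have b1: "(nodal_poly c T x - p x)\<^sup>2 \<le> M * (C2 * (M * A))" if x: "x \<in> T" for x
      unfolding nodal_poly_diff[OF TT p] M_def[symmetric]
      by (subst M_def, rule node_sum_bound[OF full[OF TT] k x CMA cb])
    \<comment> \<open>The inverse estimate, applied to the ball inscribed in \<open>T\<close> with
      the pointwise bound \<open>b1\<close>.\<close>
    have b2: "(partial_deriv b (\<lambda>x. nodal_poly c T x - p x) x)\<^sup>2 \<le> C2 * (M * (C2 * (M * A))) / r\<^sup>2"
      if x: "x \<in> T" and b: "b \<in> Basis" for x b
    proof -
      have "dist (ctr T) x \<le> R * r"
      proof -
        have "dist (ctr T) x \<le> h" by (rule dist1[OF TT ctr_in[OF TT] x])
        also have "h = 1 / \<rho> * r" using \<rho> by (simp add: r_def)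
        also have "\<dots> \<le> R * r" using R(2) r by (intro mult_right_mono) auto
        finally show ?thesis .
      qed
      moreover have "0 \<le> M * (C2 * (M * A))" using M CMA by simp
      moreover have "\<forall>x\<in>ball (ctr T) r. (nodal_poly c T x - p x)\<^sup>2 \<le> M * (C2 * (M * A))"
        using b1 ctr[OF TT] by blast
      ultimately show ?thesis using bd2[rule_format, OF dp r] b by blast
    qed
    have e1: "M * (C2 * (M * A)) = L / h ^ ?d * \<epsilon>"
      by (simp add: A_def L_def r_def power_mult_distrib mult_ac)
    have e2: "C2 * (M * (C2 * (M * A))) / r\<^sup>2 = C2 * L / \<rho>\<^sup>2 / h ^ (?d + 2) * \<epsilon>"
      unfolding e1 by (simp add: r_def power_mult_distrib power_add power2_eq_square mult_ac)
    have L2: "0 \<le> C2 * L / \<rho>\<^sup>2" using L C2 by simp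
    show "\<exists>q\<in>poly_space k. \<forall>x\<in>T. Pi_interp k \<gamma> \<T> \<Omega> E S elem elem' v x = q x \<and>
      (q x - p x)\<^sup>2 \<le> (L + C2 * L / \<rho>\<^sup>2) / h ^ DIM('a) * sqint (ball z (real (N + 10) * h)) (\<lambda>x. E v x - p x) \<and>
      (\<forall>b\<in>Basis. (partial_deriv b (\<lambda>x. q x - p x) x)\<^sup>2 \<le> (L + C2 * L / \<rho>\<^sup>2) / h ^ (DIM('a) + 2) * sqint (ball z (real (N + 10) * h)) (\<lambda>x. E v x - p x))"
      unfolding \<epsilon>_def[symmetric]
    proof (intro bexI[OF _ nodal_poly_in_poly_space[OF TT, of c]] ballI conjI)
      fix x assume x: "x \<in> T"
      show "Pi_interp k \<gamma> \<T> \<Omega> E S elem elem' v x = nodal_poly c T x" by (rule Pi_on[OF x])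
      have "L / h ^ ?d * \<epsilon> \<le> (L + C2 * L / \<rho>\<^sup>2) / h ^ ?d * \<epsilon>"
        using L2 h \<epsilon> by (intro mult_right_mono divide_right_mono) auto
      then show "(nodal_poly c T x - p x)\<^sup>2 \<le> (L + C2 * L / \<rho>\<^sup>2) / h ^ ?d * \<epsilon>" using b1[OF x] e1 by linarith
      fix b :: 'a assume b: "b \<in> Basis"
      have "C2 * L / \<rho>\<^sup>2 / h ^ (?d + 2) * \<epsilon> \<le> (L + C2 * L / \<rho>\<^sup>2) / h ^ (?d + 2) * \<epsilon>"
        using L h \<epsilon> by (intro mult_right_mono divide_right_mono) auto
      then show "(partial_deriv b (\<lambda>x. nodal_poly c T x - p x) x)\<^sup>2 \<le> (L + C2 * L / \<rho>\<^sup>2) / h ^ (?d + 2) * \<epsilon>"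
        using b2[OF x b] e2 by linarith
    qed
  qed
qed


section \<open>The interpolation error\<close>

lemma is_weak_deriv_0:
  assumes "f \<in> L2_space U"
  shows "is_weak_deriv (\<lambda>_. 0) U f f"
  using L2_imp_locally_integrable[OF assms] by (simp add: is_weak_deriv_def multi_deriv_0 mi_order_0)

lemma is_weak_deriv_unit:
  assumes "f \<in> L2_space U" "g \<in> L2_space U" "weak_partial U b f g" "b \<in> Basis"
  shows "is_weak_deriv ((\<lambda>_. 0)(b := Suc 0)) U f g"
proof -
  have o: "mi_order ((\<lambda>_. 0)(b := Suc 0)) = Suc 0"
    using mi_order_Suc[OF assms(4), of "\<lambda>_. 0"] by (simp add: mi_order_0)
  have m: "multi_deriv ((\<lambda>_. 0)(b := Suc 0)) \<phi> = partial_deriv b \<phi>" if "\<phi> \<in> test_functions U" for \<phi>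
    using multi_deriv_Suc[OF test_functions_C_diff[OF that] assms(4), of "\<lambda>_. 0"] by (simp add: multi_deriv_0)
  show ?thesis
    using L2_imp_locally_integrable[OF assms(1)] L2_imp_locally_integrable[OF assms(2)] assms(3)
    unfolding is_weak_deriv_def weak_partial_def by (simp add: o m)
qed

lemma sqint_weak_deriv:
  assumes "open U" "is_weak_deriv \<alpha> U f g" "g \<in> L2_space U"
  shows "sqint U (weak_deriv \<alpha> U f) = sqint U g"
proof -
  have "is_weak_deriv \<alpha> U f (weak_deriv \<alpha> U f)"
    unfolding weak_deriv_def using assms(2) by (metis someI)
  then show ?thesis
    by (rule L2_space_AE_cong(2)[OF assms(3) is_weak_deriv_unique[OF assms(1) _ assms(2)]])
qed

lemma multi_indices_0: "multi_indices 0 = {\<lambda>_. 0 :: nat}"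
  by (auto simp: multi_indices_def mi_order_def)

lemma multi_indices_1:
  "multi_indices 1 = insert (\<lambda>_. 0) ((\<lambda>b. (\<lambda>_. 0)(b := Suc 0)) ` (Basis :: 'a::euclidean_space set))"
proof
  have z: "(\<lambda>_. 0) \<in> (mi_exact 0 :: ('a \<Rightarrow> nat) set)" by (simp add: mi_exact_def mi_order_0)
  have e: "(\<lambda>_. 0)(b := Suc 0) \<in> mi_exact (Suc 0)" if "b \<in> Basis" for b :: 'a
    using mi_exact_Suc[OF z that] by simp
  show "insert (\<lambda>_. 0) ((\<lambda>b. (\<lambda>_. 0)(b := Suc 0)) ` (Basis :: 'a set)) \<subseteq> multi_indices 1"
    using e mi_exact_subset[of "Suc 0" 1] by (auto simp: multi_indices_def mi_order_0)
  show "multi_indices 1 \<subseteq> insert (\<lambda>_. 0) ((\<lambda>b. (\<lambda>_. 0)(b := Suc 0)) ` (Basis :: 'a set))"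
  proof
    fix \<alpha> :: "'a \<Rightarrow> nat" assume \<alpha>: "\<alpha> \<in> multi_indices 1"
    show "\<alpha> \<in> insert (\<lambda>_. 0) ((\<lambda>b. (\<lambda>_. 0)(b := Suc 0)) ` Basis)"
    proof (cases "\<alpha> = (\<lambda>_. 0)")
      case False
      then obtain b where nb: "\<alpha> b \<noteq> 0" by (meson ext)
      then have b: "b \<in> Basis" using \<alpha> by (auto simp: multi_indices_def)
      have "\<alpha> b \<le> mi_order \<alpha>" unfolding mi_order_def using b by (intro member_le_sum) auto
      then have "\<alpha> \<in> mi_exact (Suc 0)" using \<alpha> nb by (auto simp: multi_indices_def mi_exact_def)
      then have "\<alpha> = (\<lambda>_. 0)(b := Suc 0)"
        by (rule mi_le_exact_imp_eq[OF _ e[OF b]]) (use nb in auto)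
      then show ?thesis using b by blast
    qed simp
  qed
qed

lemma sobolev_0:
  assumes "f \<in> L2_space U" "open U"
  shows "f \<in> sobolev_space 0 U" "sobolev_norm 0 U f = sqrt (sqint U f)"
proof -
  note w = is_weak_deriv_0[OF assms(1)]
  show "f \<in> sobolev_space 0 U"
    using assms(1) w by (auto simp: sobolev_space_def multi_indices_0)
  show "sobolev_norm 0 U f = sqrt (sqint U f)"
    unfolding sobolev_norm_def sqint_def[symmetric] multi_indices_0
    using sqint_weak_deriv[OF assms(2) w assms(1)] by simp
qed

text \<open>The norm is defined by chosen weak derivatives; by uniqueness up to null sets any
  square-integrable weak gradient computes it.\<close>

lemma sobolev_1:
  fixes U :: "'a::euclidean_space set"
  assumes f: "f \<in> L2_space U" and U: "open U" and G: "\<And>b. b \<in> Basis \<Longrightarrow> G b \<in> L2_space U"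
    and w: "\<And>b. b \<in> Basis \<Longrightarrow> weak_partial U b f (G b)"
  shows "f \<in> sobolev_space 1 U" "sobolev_norm 1 U f = sqrt (sqint U f + (\<Sum>b\<in>Basis. sqint U (G b)))"
proof -
  note w0 = is_weak_deriv_0[OF f]
  have w1: "is_weak_deriv ((\<lambda>_. 0)(b := Suc 0)) U f (G b)" if "b \<in> Basis" for b
    by (rule is_weak_deriv_unit[OF f G[OF that] w[OF that] that])
  show "f \<in> sobolev_space 1 U"
    using f w0 w1 G unfolding sobolev_space_def multi_indices_1 by blast
  have inj: "inj_on (\<lambda>b. (\<lambda>_. 0 :: nat)(b := Suc 0)) (Basis :: 'a set)"
  proof (rule inj_onI)
    fix a b :: 'a assume "(\<lambda>_. 0 :: nat)(a := Suc 0) = (\<lambda>_. 0)(b := Suc 0)"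
    from fun_cong[OF this, of a] show "a = b" by (auto split: if_splits)
  qed
  have n0: "(\<lambda>_. 0) \<notin> (\<lambda>b. (\<lambda>_. 0 :: nat)(b := Suc 0)) ` (Basis :: 'a set)"
  proof
    assume "(\<lambda>_. 0) \<in> (\<lambda>b. (\<lambda>_. 0 :: nat)(b := Suc 0)) ` (Basis :: 'a set)"
    then obtain b :: 'a where "(\<lambda>_. 0) = (\<lambda>_. 0 :: nat)(b := Suc 0)" by blast
    from fun_cong[OF this, of b] show False by simp
  qed
  have "(\<Sum>\<alpha>\<in>multi_indices 1. sqint U (weak_deriv \<alpha> U f)) = sqint U f + (\<Sum>b\<in>Basis. sqint U (G b))"
    unfolding multi_indices_1 using n0
    by (simp add: sum.reindex[OF inj] sqint_weak_deriv[OF U w0 f] sqint_weak_deriv[OF U w1 G])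
  then show "sobolev_norm 1 U f = sqrt (sqint U f + (\<Sum>b\<in>Basis. sqint U (G b)))"
    by (simp add: sobolev_norm_def sqint_def[symmetric])
qed

lemma weak_partial_subset:
  assumes w: "weak_partial U b u g" and VU: "V \<subseteq> U" and b: "b \<in> Basis"
  shows "weak_partial V b u g"
  unfolding weak_partial_def
proof
  fix \<phi> assume \<phi>: "\<phi> \<in> test_functions V"
  have "(LINT x:U|lebesgue. u x * partial_deriv b \<phi> x) = (LINT x:V|lebesgue. u x * partial_deriv b \<phi> x)"
    by (rule set_integral_supported[OF VU]) (use test_functions_zero[OF partial_deriv_test_functions[OF \<phi> b]] in auto)
  moreover have "(LINT x:U|lebesgue. g x * \<phi> x) = (LINT x:V|lebesgue. g x * \<phi> x)"
    by (rule set_integral_supported[OF VU]) (use test_functions_zero[OF \<phi>] in auto)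
  ultimately show "(LINT x:V|lebesgue. u x * partial_deriv b \<phi> x) = - (LINT x:V|lebesgue. g x * \<phi> x)"
    using w test_functions_mono[OF \<phi> VU] by (simp add: weak_partial_def)
qed

lemma weak_partial_cong_on:
  assumes "weak_partial U b u g" "\<And>x. x \<in> U \<Longrightarrow> u' x = u x"
  shows "weak_partial U b u' g"
proof -
  have "(LINT x:U|lebesgue. u' x * \<psi> x) = (LINT x:U|lebesgue. u x * \<psi> x)" for \<psi>
    unfolding set_lebesgue_integral_def using assms(2)
    by (intro Bochner_Integration.integral_cong) (auto simp: indicator_def)
  then show ?thesis using assms(1) by (simp add: weak_partial_def)
qed

lemma sqint_bounded:
  assumes f: "f \<in> borel_measurable lebesgue" and U: "U \<in> lmeasurable" and A: "0 \<le> A" and le: "\<And>x. x \<in> U \<Longrightarrow> (f x)\<^sup>2 \<le> A"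
  shows "sqint U f \<le> A * measure lebesgue U"
proof -
  have "sqint U f \<le> (sqrt A)\<^sup>2 * measure lebesgue U"
    by (rule bounded_imp_L2_space(2)[OF f U]) (use le in \<open>auto intro: real_le_rsqrt\<close>)
  then show ?thesis using A by simp
qed

text \<open>The two regularity constants combine to a lower bound of the inradius by a multiple of
  \<open>h\<close>, which is all that the estimates use besides the upper bound of the
  diameter.\<close>

lemma quasiuniform_meshes_geometry:
  fixes \<T>\<^sub>0 :: "real \<Rightarrow> 'a::euclidean_space set set"
  assumes "quasiuniform_meshes \<Omega>\<^sub>0 h\<^sub>0 \<T>\<^sub>0" and k: "k \<ge> 1"
  shows "\<exists>\<rho>>0. \<forall>h\<in>{0<..h\<^sub>0}. fe_mesh k (\<T>\<^sub>0 h) \<and> (\<forall>T\<in>\<T>\<^sub>0 h. diameter T \<le> h \<and> (\<exists>x. ball x (\<rho> * h) \<subseteq> T))"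
proof -
  obtain \<kappa> q where m: "\<And>h. h \<in> {0<..h\<^sub>0} \<Longrightarrow> triangulation (\<T>\<^sub>0 h) \<and> (\<forall>T\<in>\<T>\<^sub>0 h. int DIM('a) simplex T)"
    and g: "\<And>h T. h \<in> {0<..h\<^sub>0} \<Longrightarrow> T \<in> \<T>\<^sub>0 h \<Longrightarrow> diameter T \<le> h \<and> h \<le> q * diameter T \<and> diameter T \<le> \<kappa> * inradius T"
    using assms unfolding quasiuniform_meshes_def by blast
  \<comment> \<open>The maximum provides positivity, as no sign is prescribed for the constants of
    the mesh family.\<close>
  define L where "L = max 1 (q * \<kappa>)"
  have L: "L \<ge> 1" by (simp add: L_def)
  show ?thesis
  proof (intro exI[of _ "1 / (2 * L)"] conjI ballI)
    show "0 < 1 / (2 * L)" using L by simp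
    fix h assume h: "h \<in> {0<..h\<^sub>0}"
    show "fe_mesh k (\<T>\<^sub>0 h)" using m[OF h] k by (auto simp: fe_mesh_def)
    fix T assume T: "T \<in> \<T>\<^sub>0 h"
    show "diameter T \<le> h" using g[OF h T] by blast
    have full: "int DIM('a) simplex T" using m[OF h] T by blast
    have bT: "bounded T" using full_simplex_verts(7)[OF full] by (rule compact_imp_bounded)
    obtain x0 where x0: "x0 \<in> T" using full_simplex_verts(6)[OF full] interior_subset by blast
    let ?R = "{r. \<exists>x. cball x r \<subseteq> T}"
    have bdd: "bdd_above ?R"
    proof (rule bdd_aboveI)
      fix r assume "r \<in> ?R"
      then obtain x where "cball x r \<subseteq> T" by blast
      then have "diameter (cball x r) \<le> diameter T" by (rule diameter_subset[OF _ bT])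
      then show "r \<le> max 0 (diameter T)" by (auto split: if_splits)
    qed
    have "0 \<in> ?R" using x0 by (auto intro!: exI[of _ x0])
    then have i0: "0 \<le> inradius T" unfolding inradius_def by (rule cSup_upper[OF _ bdd])
    have h0: "0 < h" using h by simp
    have d0: "0 \<le> diameter T" using bT by (rule diameter_ge_0)
    have "0 < q * diameter T" using g[OF h T] h0 by linarith
    then have q: "0 < q" using d0 by (simp add: zero_less_mult_iff)
    have "h \<le> q * diameter T" using g[OF h T] by blast
    also have "\<dots> \<le> q * (\<kappa> * inradius T)" using g[OF h T] q by (intro mult_left_mono) auto
    also have "\<dots> \<le> L * inradius T" using i0 by (simp add: mult.assoc[symmetric] L_def mult_right_mono)
    finally have "h \<le> L * inradius T" .
    \<comment> \<open>The inradius is a supremum; staying strictly below it by a factor 2 yields an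
      actual ball.\<close>
    moreover have "h / (2 * L) < h / L" using h0 L by (simp add: field_simps)
    ultimately have "h / (2 * L) < inradius T" using L by (simp add: field_simps)
    obtain r x where "h / (2 * L) < r" "cball x r \<subseteq> T"
    proof -
      have ne: "?R \<noteq> {}" using \<open>0 \<in> ?R\<close> by blast
      show ?thesis using that \<open>h / (2 * L) < inradius T\<close> unfolding inradius_def less_cSup_iff[OF ne bdd] by blast
    qed
    then have "ball x (1 / (2 * L) * h) \<subseteq> T" by (auto simp: subset_iff)
    then show "\<exists>x. ball x (1 / (2 * L) * h) \<subseteq> T" ..
  qed
qed

lemma node_patch_subset_ball:
  assumes mesh: "fe_mesh k \<T>" and geo: "\<And>T. T \<in> \<T> \<Longrightarrow> bounded T \<and> diameter T \<le> h"
    and T: "T \<in> \<T>" and d: "\<And>y. y \<in> T \<Longrightarrow> dist z y \<le> a" and a: "a + h < \<delta>"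
  shows "\<Union>(node_patch k \<T> \<Omega> T) \<subseteq> ball z \<delta>"
proof
  interpret fe_mesh k \<T> \<Omega> by (rule mesh)
  fix y assume "y \<in> \<Union>(node_patch k \<T> \<Omega> T)"
  then obtain X where X: "X \<in> active_mesh \<T> \<Omega>" "lagrange_nodes k X \<inter> lagrange_nodes k T \<noteq> {}" "y \<in> X"
    by (auto simp: node_patch_def)
  note XT = active_subset[OF X(1)]
  obtain i where i: "i \<in> X" "i \<in> T" using X(2) nodes_subset[OF XT] nodes_subset[OF T] by blast
  have "dist z y \<le> dist z i + dist i y" by (rule dist_triangle)
  also have "\<dots> \<le> a + h"
    using d[OF i(2)] diameter_bounded_bound[of X i y] geo[OF XT] i(1) X(3) by fastforce
  finally show "y \<in> ball z \<delta>" using a by simp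
qed

text \<open>On \<open>U\<close> the error is split as \<open>(w - p) - (q - p)\<close>. The part
  \<open>w - p\<close> is a Bramble--Hilbert error; the pointwise bound for \<open>q - p\<close> is
  integrated over \<open>U\<close>, whose volume compensates the negative power of \<open>h\<close>.
  In \<open>K\<close> the summand 2 stems from the one part, the term with \<open>CL\<close> from
  the other.\<close>

lemma interpolation_error_bounds:
  fixes w P :: "'a::euclidean_space \<Rightarrow> real"
  assumes k: "k \<ge> 1" and h: "h > 0" and UB: "U \<subseteq> ball z (\<Lambda> * h)" and U: "open U" and Us: "U \<subseteq> ball z (2 * h)" and \<Lambda>: "\<Lambda> \<ge> 1"
    and w: "w \<in> L2_space (ball z (\<Lambda> * h))" and p: "p \<in> poly_space k" and q: "q \<in> poly_space k" 
    and CB: "CB \<ge> 0" and CL: "CL \<ge> 0"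
    and P: "\<And>x. x \<in> U \<Longrightarrow> P x = q x"
    and wp: "sqint (ball z (\<Lambda> * h)) (\<lambda>x. w x - p x) \<le> CB * (\<Lambda> * h) ^ (2 * Suc k) * W\<^sup>2"
    and g: "\<And>b. b \<in> Basis \<Longrightarrow> g b \<in> L2_space (ball z (\<Lambda> * h))" "\<And>b. b \<in> Basis \<Longrightarrow> weak_partial (ball z (\<Lambda> * h)) b w (g b)"
      "\<And>b. b \<in> Basis \<Longrightarrow> sqint (ball z (\<Lambda> * h)) (\<lambda>x. g b x - partial_deriv b p x) \<le> CB * (\<Lambda> * h) ^ (2 * k) * W\<^sup>2"
    and qp: "\<And>x. x \<in> U \<Longrightarrow> (q x - p x)\<^sup>2 \<le> CL / h ^ DIM('a) * sqint (ball z (\<Lambda> * h)) (\<lambda>x. w x - p x)"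
      "\<And>x b. x \<in> U \<Longrightarrow> b \<in> Basis \<Longrightarrow> (partial_deriv b (\<lambda>x. q x - p x) x)\<^sup>2 \<le> CL / h ^ (DIM('a) + 2) * sqint (ball z (\<Lambda> * h)) (\<lambda>x. w x - p x)"
    and K: "K = (2 + 2 * CL * unit_ball_vol (real DIM('a)) * 2 ^ DIM('a)) * CB * \<Lambda> ^ (2 * k + 2)"
  shows "(\<lambda>x. w x - P x) \<in> L2_space U" "sqint U (\<lambda>x. w x - P x) \<le> K * h ^ (2 * k + 2) * W\<^sup>2"
    "\<exists>G. \<forall>b\<in>Basis. G b \<in> L2_space U \<and> weak_partial U b (\<lambda>x. w x - P x) (G b) \<and> sqint U (G b) \<le> K * h ^ (2 * k) * W\<^sup>2"
proof -
  let ?B = "ball z (\<Lambda> * h)" and ?\<omega> = "unit_ball_vol (real DIM('a))"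
  define \<epsilon> where "\<epsilon> = sqint ?B (\<lambda>x. w x - p x)"
  have \<epsilon>0: "0 \<le> \<epsilon>" by (simp add: \<epsilon>_def sqint_nonneg)
  have \<epsilon>: "\<epsilon> \<le> CB * \<Lambda> ^ (2 * k + 2) * h ^ (2 * k + 2) * W\<^sup>2"
    using wp unfolding \<epsilon>_def[symmetric] by (simp add: power_mult_distrib mult_ac)
  have UL: "U \<in> sets lebesgue" "bounded U" using U UB bounded_subset[OF bounded_ball] by auto
  have Ul: "U \<in> lmeasurable" using UL bounded_set_imp_lmeasurable by blast
  \<comment> \<open>The volume is taken from the ball of radius \<open>2 * h\<close>, which gives
    the factor \<open>2 ^ DIM('a)\<close> in \<open>K\<close>, independent of
    \<open>\<Lambda>\<close>.\<close>
  have mU: "measure lebesgue U \<le> ?\<omega> * 2 ^ DIM('a) * h ^ DIM('a)"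
  proof -
    have "measure lebesgue U \<le> measure lebesgue (ball z (2 * h))"
      by (rule measure_mono_fmeasurable[OF Us UL(1) lmeasurable_ball])
    also have "\<dots> = ?\<omega> * 2 ^ DIM('a) * h ^ DIM('a)"
      using h by (subst measure_ball_lebesgue) (auto simp: power_mult_distrib)
    finally show ?thesis .
  qed
  have wU: "w \<in> L2_space U" by (rule L2_space_subset(1)[OF w UB UL(1)])
  have pL: "f \<in> L2_space U" "f \<in> L2_space ?B" "f \<in> borel_measurable lebesgue" if "smooth f" for f
    using continuous_imp_L2_space[OF smooth_continuous[OF that]] continuous_imp_measurable_lebesgue[OF smooth_continuous[OF that]] UL by auto
  note sp = smooth_poly_space[OF p] and sq = smooth_poly_space[OF q]
  note sd = smooth_diff[OF sq sp]
  have spd: "smooth (partial_deriv b f)" if "smooth f" for b f using smooth_deriv[OF that] by blast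
  have wpU: "sqint U (\<lambda>x. w x - p x) \<le> \<epsilon>"
    unfolding \<epsilon>_def by (rule L2_space_subset(2)[OF L2_space_diff[OF w pL(2)[OF sp]] UB UL(1)])
  have s1: "sqint U (\<lambda>x. q x - p x) \<le> CL * ?\<omega> * 2 ^ DIM('a) * \<epsilon>"
  proof -
    have "sqint U (\<lambda>x. q x - p x) \<le> CL / h ^ DIM('a) * \<epsilon> * measure lebesgue U"
      by (rule sqint_bounded[OF pL(3)[OF sd] Ul]) (use qp(1) CL h \<epsilon>0 in \<open>auto simp: \<epsilon>_def\<close>)
    also have "\<dots> \<le> CL / h ^ DIM('a) * \<epsilon> * (?\<omega> * 2 ^ DIM('a) * h ^ DIM('a))"
      using CL h \<epsilon>0 by (intro mult_left_mono[OF mU]) auto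
    also have "\<dots> = CL * ?\<omega> * 2 ^ DIM('a) * \<epsilon>" using h by (simp add: mult_ac)
    finally show ?thesis .
  qed
  have s2: "sqint U (partial_deriv b (\<lambda>x. q x - p x)) \<le> CL * ?\<omega> * 2 ^ DIM('a) * (\<epsilon> / h\<^sup>2)" if b: "b \<in> Basis" for b
  proof -
    have "sqint U (partial_deriv b (\<lambda>x. q x - p x)) \<le> CL / h ^ (DIM('a) + 2) * \<epsilon> * measure lebesgue U"
      by (rule sqint_bounded[OF pL(3)[OF spd[OF sd]] Ul]) (use qp(2)[OF _ b] CL h \<epsilon>0 in \<open>auto simp: \<epsilon>_def\<close>)
    also have "\<dots> \<le> CL / h ^ (DIM('a) + 2) * \<epsilon> * (?\<omega> * 2 ^ DIM('a) * h ^ DIM('a))"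
      using CL h \<epsilon>0 by (intro mult_left_mono[OF mU]) auto
    also have "\<dots> = CL * ?\<omega> * 2 ^ DIM('a) * (\<epsilon> / h\<^sup>2)" using h by (simp add: power_add power2_eq_square mult_ac)
    finally show ?thesis .
  qed
  let ?c = "2 + 2 * CL * ?\<omega> * 2 ^ DIM('a)"
  have c0: "0 \<le> CL * ?\<omega> * 2 ^ DIM('a)" using CL by simp
  have fL: "(\<lambda>x. w x - q x) \<in> L2_space U" by (rule L2_space_diff[OF wU pL(1)[OF sq]])
  have feq: "w x - P x = w x - q x" if "x \<in> U" for x using P[OF that] by simp
  show "(\<lambda>x. w x - P x) \<in> L2_space U" by (rule L2_space_cong_on(1)[OF fL feq])
  have "sqint U (\<lambda>x. w x - P x) = sqint U (\<lambda>x. w x - q x)" by (rule L2_space_cong_on(2)[OF fL feq])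
  also have "\<dots> = sqint U (\<lambda>x. (w x - p x) - (q x - p x))" by simp
  also have "\<dots> \<le> 2 * sqint U (\<lambda>x. w x - p x) + 2 * sqint U (\<lambda>x. q x - p x)"
    by (rule sqint_diff_le[OF L2_space_diff[OF wU pL(1)[OF sp]] pL(1)[OF sd]])
  also have "\<dots> \<le> ?c * \<epsilon>" using wpU s1 by (simp add: algebra_simps)
  also have "\<dots> \<le> ?c * (CB * \<Lambda> ^ (2 * k + 2) * h ^ (2 * k + 2) * W\<^sup>2)"
    using c0 by (intro mult_left_mono[OF \<epsilon>]) auto
  also have "\<dots> = K * h ^ (2 * k + 2) * W\<^sup>2" by (simp add: K mult_ac)
  finally show "sqint U (\<lambda>x. w x - P x) \<le> K * h ^ (2 * k + 2) * W\<^sup>2" .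
  have "partial_deriv b (\<lambda>x. q x - p x) x = partial_deriv b q x - partial_deriv b p x" for b x
  proof (rule partial_deriv_line)
    show "(\<lambda>x. q x - p x) differentiable at x" using smooth_deriv[OF sd] by blast
    show "((\<lambda>s. q (x + s *\<^sub>R b) - p (x + s *\<^sub>R b)) has_real_derivative partial_deriv b q x - partial_deriv b p x) (at 0)"
      using has_real_derivative_line[of q x 0 b] has_real_derivative_line[of p x 0 b] smooth_deriv[OF sq] smooth_deriv[OF sp]
      by (intro DERIV_diff) auto
  qed
  note pd = this
  \<comment> \<open>The weak gradient of the error: \<open>?P\<close> coincides with
    \<open>q\<close> on \<open>U\<close>, so its derivative there is that of
    \<open>q\<close>.\<close>
  have G: "(\<lambda>x. g b x - partial_deriv b q x) \<in> L2_space U \<and> weak_partial U b (\<lambda>x. w x - P x) (\<lambda>x. g b x - partial_deriv b q x) \<and>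
      sqint U (\<lambda>x. g b x - partial_deriv b q x) \<le> K * h ^ (2 * k) * W\<^sup>2" if b: "b \<in> Basis" for b
  proof (intro conjI)
    have gU: "g b \<in> L2_space U" by (rule L2_space_subset(1)[OF g(1)[OF b] UB UL(1)])
    note Lpq = pL(1)[OF spd[OF sq]] and Lpp = pL(1)[OF spd[OF sp]]
    show "(\<lambda>x. g b x - partial_deriv b q x) \<in> L2_space U" by (rule L2_space_diff[OF gU Lpq])
    show "weak_partial U b (\<lambda>x. w x - P x) (\<lambda>x. g b x - partial_deriv b q x)"
    proof (rule weak_partial_cong_on[OF _ feq])
      show "weak_partial U b (\<lambda>x. w x - q x) (\<lambda>x. g b x - partial_deriv b q x)"
        by (rule weak_partial_diff[OF weak_partial_subset[OF g(2)[OF b] UB b] weak_partial_smooth[OF sq b UL(2,1)] b UL(2,1) wU gU pL(1)[OF sq] Lpq])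
    qed
    have gp: "sqint U (\<lambda>x. g b x - partial_deriv b p x) \<le> CB * \<Lambda> ^ (2 * k + 2) * h ^ (2 * k) * W\<^sup>2"
    proof -
      have "sqint U (\<lambda>x. g b x - partial_deriv b p x) \<le> sqint ?B (\<lambda>x. g b x - partial_deriv b p x)"
        by (rule L2_space_subset(2)[OF L2_space_diff[OF g(1)[OF b] pL(2)[OF spd[OF sp]]] UB UL(1)])
      also have "\<dots> \<le> CB * (\<Lambda> * h) ^ (2 * k) * W\<^sup>2" by (rule g(3)[OF b])
      also have "\<dots> = CB * \<Lambda> ^ (2 * k) * (h ^ (2 * k) * W\<^sup>2)" by (simp add: power_mult_distrib mult_ac)
      \<comment> \<open>Two extra powers of \<open>\<Lambda> \<ge> 1\<close> let the gradient share
        the constant \<open>K\<close> with the function itself.\<close>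
      also have "\<dots> \<le> CB * \<Lambda> ^ (2 * k + 2) * (h ^ (2 * k) * W\<^sup>2)"
        using CB h \<Lambda> by (intro mult_right_mono mult_left_mono power_increasing) auto
      finally show ?thesis by (simp add: mult_ac)
    qed
    have eh: "\<epsilon> / h\<^sup>2 \<le> CB * \<Lambda> ^ (2 * k + 2) * h ^ (2 * k) * W\<^sup>2"
    proof -
      have "\<epsilon> / h\<^sup>2 \<le> CB * \<Lambda> ^ (2 * k + 2) * h ^ (2 * k + 2) * W\<^sup>2 / h\<^sup>2" by (rule divide_right_mono[OF \<epsilon>]) simp
      then show ?thesis using h by (simp add: power_add power2_eq_square)
    qed
    have "sqint U (\<lambda>x. g b x - partial_deriv b q x) = sqint U (\<lambda>x. (g b x - partial_deriv b p x) - partial_deriv b (\<lambda>x. q x - p x) x)"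
      by (simp add: pd)
    also have "\<dots> \<le> 2 * sqint U (\<lambda>x. g b x - partial_deriv b p x) + 2 * sqint U (partial_deriv b (\<lambda>x. q x - p x))"
      by (rule sqint_diff_le[OF L2_space_diff[OF gU Lpp] pL(1)[OF spd[OF sd]]])
    also have "\<dots> \<le> 2 * (CB * \<Lambda> ^ (2 * k + 2) * h ^ (2 * k) * W\<^sup>2) + 2 * (CL * ?\<omega> * 2 ^ DIM('a) * (CB * \<Lambda> ^ (2 * k + 2) * h ^ (2 * k) * W\<^sup>2))"
      using gp order_trans[OF s2[OF b] mult_left_mono[OF eh c0]] by linarith
    also have "\<dots> = K * h ^ (2 * k) * W\<^sup>2" by (simp add: K algebra_simps)
    finally show "sqint U (\<lambda>x. g b x - partial_deriv b q x) \<le> K * h ^ (2 * k) * W\<^sup>2" .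
  qed
  show "\<exists>G. \<forall>b\<in>Basis. G b \<in> L2_space U \<and> weak_partial U b (\<lambda>x. w x - P x) (G b) \<and> sqint U (G b) \<le> K * h ^ (2 * k) * W\<^sup>2"
    using G by (intro exI[of _ "\<lambda>b x. g b x - partial_deriv b q x"]) blast
qed

text \<open>The order of the quantifiers expresses uniformity: the constants precede the domain, the
  extension operator, \<open>h\<close> and all choices of elements. The ball is centred at a point
  of \<open>T\<close> and has radius exactly \<open>\<Lambda> * h\<close>, so
  \<open>c\<^sub>1\<close> and \<open>c\<^sub>2\<close> are both \<open>\<Lambda>\<close>.\<close>

theorem lemma3p6:
  fixes \<Omega>\<^sub>0 :: "'a::euclidean_space set" and \<T>\<^sub>0 :: "real \<Rightarrow> 'a set set"
    and h\<^sub>0 \<gamma> :: real and k N :: nat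
  assumes "k \<ge> 1" and "h\<^sub>0 > 0" and "0 < \<gamma>" and "\<gamma> \<le> 1"
    and "closed_domain \<Omega>\<^sub>0" and "quasiuniform_meshes \<Omega>\<^sub>0 h\<^sub>0 \<T>\<^sub>0"
  shows "\<exists>C c\<^sub>1 c\<^sub>2 :: real. C > 0 \<and> c\<^sub>1 > 0 \<and> c\<^sub>2 > 0 \<and>
    (\<forall>\<Omega> E. closed_domain \<Omega> \<and> \<Omega> \<subseteq> \<Omega>\<^sub>0 \<and> universal_extension \<Omega> E \<longrightarrow>
      (\<forall>h\<in>{0<..h\<^sub>0}. \<forall>S elem elem'.
        S \<in> small_elements \<gamma> (\<T>\<^sub>0 h) \<Omega> \<rightarrow> large_elements \<gamma> (\<T>\<^sub>0 h) \<Omega> \<and>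
        path_assumption N \<gamma> (\<T>\<^sub>0 h) \<Omega> S \<and>
        valid_choices k \<gamma> (\<T>\<^sub>0 h) \<Omega> elem elem' \<longrightarrow>
        (\<forall>T\<in>active_mesh (\<T>\<^sub>0 h) \<Omega>. \<exists>z \<delta>.
          c\<^sub>1 * h \<le> \<delta> \<and> \<delta> \<le> c\<^sub>2 * h \<and>
          \<Union>(node_patch k (\<T>\<^sub>0 h) \<Omega> T) \<subseteq> ball z \<delta> \<and>
          (T \<in> small_elements \<gamma> (\<T>\<^sub>0 h) \<Omega> \<longrightarrow> \<Union>(node_patch k (\<T>\<^sub>0 h) \<Omega> (S T)) \<subseteq> ball z \<delta>) \<and>
          (\<forall>v\<in>sobolev_space (k + 1) (interior \<Omega>). \<forall>m\<in>{0, 1}.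
            (\<lambda>x. E v x - Pi_interp k \<gamma> (\<T>\<^sub>0 h) \<Omega> E S elem elem' v x) \<in> sobolev_space m (interior T) \<and>
            sobolev_norm m (interior T)
              (\<lambda>x. E v x - Pi_interp k \<gamma> (\<T>\<^sub>0 h) \<Omega> E S elem elem' v x)
            \<le> C * h ^ (k + 1 - m) * sobolev_norm (k + 1) (ball z \<delta>) (E v)))))"
proof -
  note k = assms(1)
  obtain \<rho> where \<rho>: "\<rho> > 0" and geo: "\<And>h. h \<in> {0<..h\<^sub>0} \<Longrightarrow> fe_mesh k (\<T>\<^sub>0 h) \<and> (\<forall>T\<in>\<T>\<^sub>0 h. diameter T \<le> h \<and> (\<exists>x. ball x (\<rho> * h) \<subseteq> T))"
    using quasiuniform_meshes_geometry[OF assms(6,1)] by blast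
  obtain CL where CL: "CL \<ge> 0" and local: "\<And>(\<T> :: 'a set set) \<Omega> h S elem elem' E v p T z.
    fe_mesh k \<T> \<Longrightarrow> h > 0 \<Longrightarrow> (\<forall>T\<in>\<T>. diameter T \<le> h \<and> (\<exists>x. ball x (\<rho> * h) \<subseteq> T)) \<Longrightarrow>
    S \<in> small_elements \<gamma> \<T> \<Omega> \<rightarrow> large_elements \<gamma> \<T> \<Omega> \<Longrightarrow> path_assumption N \<gamma> \<T> \<Omega> S \<Longrightarrow>
    valid_choices k \<gamma> \<T> \<Omega> elem elem' \<Longrightarrow> T \<in> active_mesh \<T> \<Omega> \<Longrightarrow> z \<in> T \<Longrightarrow> p \<in> poly_space k \<Longrightarrow> E v \<in> L2_space UNIV \<Longrightarrow>
    (\<exists>q\<in>poly_space k. \<forall>x\<in>T. Pi_interp k \<gamma> \<T> \<Omega> E S elem elem' v x = q x \<and>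
      (q x - p x)\<^sup>2 \<le> CL / h ^ DIM('a) * sqint (ball z (real (N + 10) * h)) (\<lambda>x. E v x - p x) \<and>
      (\<forall>b\<in>Basis. (partial_deriv b (\<lambda>x. q x - p x) x)\<^sup>2 \<le> CL / h ^ (DIM('a) + 2) * sqint (ball z (real (N + 10) * h)) (\<lambda>x. E v x - p x)))"
    using Pi_interp_local_bound[OF k \<rho>, of \<gamma> N, where 'a = 'a] by (elim exE conjE) (rule that, assumption, simp)
  obtain CB where CB: "CB \<ge> 0" and BH: "\<forall>z \<delta>. \<forall>w :: 'a \<Rightarrow> real. \<delta> > 0 \<longrightarrow> w \<in> sobolev_space (Suc k) (ball z \<delta>) \<longrightarrow>
     (\<exists>p\<in>poly_space k. smooth p \<and>
        sqint (ball z \<delta>) (\<lambda>x. w x - p x) \<le> CB * \<delta> ^ (2 * Suc k) * (sobolev_norm (Suc k) (ball z \<delta>) w)\<^sup>2 \<and>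
        (k > 0 \<longrightarrow> (\<forall>b\<in>Basis. \<exists>g\<in>L2_space (ball z \<delta>). weak_partial (ball z \<delta>) b w g \<and>
          sqint (ball z \<delta>) (\<lambda>x. g x - partial_deriv b p x) \<le> CB * \<delta> ^ (2 * k) * (sobolev_norm (Suc k) (ball z \<delta>) w)\<^sup>2)))"
    using bramble_hilbert[of k, where 'a = 'a] by (elim exE conjE) (rule that)
  \<comment> \<open>A path of at most \<open>N\<close> elements, the neighbours of its end and the
    elements on which the projections are taken all fit into this multiple of
    \<open>h\<close>.\<close>
  define \<Lambda> where "\<Lambda> = real (N + 10)"
  have \<Lambda>: "\<Lambda> \<ge> 10" by (simp add: \<Lambda>_def)
  define K where "K = (2 + 2 * CL * unit_ball_vol (real DIM('a)) * 2 ^ DIM('a)) * CB * \<Lambda> ^ (2 * k + 2)"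
  have K: "0 \<le> K" using CL CB \<Lambda> by (simp add: K_def)
  \<comment> \<open>The summands serve, in order, the case \<open>m = 0\<close>, the L2 part of the
    norm for \<open>m = 1\<close>, where two powers of \<open>h\<close> are traded for
    \<open>h\<^sub>0\<^sup>2\<close>, and the partial derivatives.\<close>
  define D where "D = K * (1 + h\<^sub>0\<^sup>2 + real DIM('a))"
  have D: "0 \<le> D" "K \<le> D" "K * (h\<^sub>0\<^sup>2 + real DIM('a)) \<le> D" using K by (auto simp: D_def algebra_simps)
  \<comment> \<open>Adding 1 makes the constant strictly positive even if \<open>D\<close> is
    zero.\<close>
  define C where "C = sqrt D + 1"
  have C: "C > 0" "sqrt D \<le> C" using D by (auto simp: C_def add_nonneg_pos)
  show ?thesis
  proof (rule exI[of _ C], rule exI[of _ \<Lambda>], rule exI[of _ \<Lambda>], intro conjI allI ballI impI)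
    show "C > 0" "\<Lambda> > 0" "\<Lambda> > 0" using C \<Lambda> by auto
    fix \<Omega> E h S elem elem' T
    assume \<Omega>E: "closed_domain \<Omega> \<and> \<Omega> \<subseteq> \<Omega>\<^sub>0 \<and> universal_extension \<Omega> E" and hh: "h \<in> {0<..h\<^sub>0}"
      and hyp: "S \<in> small_elements \<gamma> (\<T>\<^sub>0 h) \<Omega> \<rightarrow> large_elements \<gamma> (\<T>\<^sub>0 h) \<Omega> \<and>
        path_assumption N \<gamma> (\<T>\<^sub>0 h) \<Omega> S \<and> valid_choices k \<gamma> (\<T>\<^sub>0 h) \<Omega> elem elem'"
      and T: "T \<in> active_mesh (\<T>\<^sub>0 h) \<Omega>"
    have h: "h > 0" "h \<le> h\<^sub>0" using hh by auto
    have mesh: "fe_mesh k (\<T>\<^sub>0 h)" using geo[OF hh] by blast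
    interpret fe_mesh k "\<T>\<^sub>0 h" \<Omega> by (rule mesh)
    have bd: "bounded X \<and> diameter X \<le> h" if "X \<in> \<T>\<^sub>0 h" for X
      using geo[OF hh] that full_simplex_verts(7)[OF full[OF that]] by (auto simp: compact_imp_bounded)
    note TT = active_subset[OF T]
    obtain z where z: "z \<in> T" using full_simplex_verts(6)[OF full[OF TT]] interior_subset by blast
    have dT: "dist z y \<le> h" if "y \<in> T" for y
      using diameter_bounded_bound[of T z y] bd[OF TT] z that by force
    have "0 \<le> real N * h" using h by simp
    moreover have "\<Lambda> * h = real N * h + 10 * h" by (simp add: \<Lambda>_def distrib_right)
    ultimately have NL: "real N * h + h < \<Lambda> * h" "h + h < \<Lambda> * h" using h(1) by linarith+
    let ?\<delta> = "\<Lambda> * h"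
    show "\<exists>z \<delta>. \<Lambda> * h \<le> \<delta> \<and> \<delta> \<le> \<Lambda> * h \<and>
          \<Union>(node_patch k (\<T>\<^sub>0 h) \<Omega> T) \<subseteq> ball z \<delta> \<and>
          (T \<in> small_elements \<gamma> (\<T>\<^sub>0 h) \<Omega> \<longrightarrow> \<Union>(node_patch k (\<T>\<^sub>0 h) \<Omega> (S T)) \<subseteq> ball z \<delta>) \<and>
          (\<forall>v\<in>sobolev_space (k + 1) (interior \<Omega>). \<forall>m\<in>{0, 1}.
            (\<lambda>x. E v x - Pi_interp k \<gamma> (\<T>\<^sub>0 h) \<Omega> E S elem elem' v x) \<in> sobolev_space m (interior T) \<and>
            sobolev_norm m (interior T)
              (\<lambda>x. E v x - Pi_interp k \<gamma> (\<T>\<^sub>0 h) \<Omega> E S elem elem' v x)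
            \<le> C * h ^ (k + 1 - m) * sobolev_norm (k + 1) (ball z \<delta>) (E v))"
    proof (intro exI[of _ z] exI[of _ ?\<delta>] conjI[OF order_refl] conjI impI)
      show "\<Union>(node_patch k (\<T>\<^sub>0 h) \<Omega> T) \<subseteq> ball z ?\<delta>"
        by (rule node_patch_subset_ball[OF mesh bd TT dT NL(2)])
    next
      assume sm: "T \<in> small_elements \<gamma> (\<T>\<^sub>0 h) \<Omega>"
      then have ST: "S T \<in> \<T>\<^sub>0 h" using hyp by (auto simp: large_elements_def active_mesh_def)
      obtain Ts where Ts: "Ts \<noteq> []" "set Ts \<subseteq> active_mesh (\<T>\<^sub>0 h) \<Omega>" "hd Ts = T" "last Ts = S T"
        "length Ts \<le> N" "successively face_neighbors Ts"
        using hyp sm unfolding path_assumption_def by blast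
      have d: "dist z y \<le> real N * h" if y: "y \<in> S T" for y
      proof -
        have "dist z y \<le> real (length Ts) * h"
          by (rule dist_le_path[OF Ts(1,6)]) (use Ts bd active_subset z y in auto)
        also have "\<dots> \<le> real N * h" using Ts(5) h by (intro mult_right_mono) auto
        finally show ?thesis .
      qed
      show "\<Union>(node_patch k (\<T>\<^sub>0 h) \<Omega> (S T)) \<subseteq> ball z ?\<delta>"
        by (rule node_patch_subset_ball[OF mesh bd ST d NL(1)])
    next
      show "\<forall>v\<in>sobolev_space (k + 1) (interior \<Omega>). \<forall>m\<in>{0, 1}.
            (\<lambda>x. E v x - Pi_interp k \<gamma> (\<T>\<^sub>0 h) \<Omega> E S elem elem' v x) \<in> sobolev_space m (interior T) \<and>
            sobolev_norm m (interior T)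
              (\<lambda>x. E v x - Pi_interp k \<gamma> (\<T>\<^sub>0 h) \<Omega> E S elem elem' v x)
            \<le> C * h ^ (k + 1 - m) * sobolev_norm (k + 1) (ball z ?\<delta>) (E v)"
      proof
        fix v assume v: "v \<in> sobolev_space (k + 1) (interior \<Omega>)"
        let ?B = "ball z ?\<delta>" and ?P = "Pi_interp k \<gamma> (\<T>\<^sub>0 h) \<Omega> E S elem elem' v"
        define W where "W = sobolev_norm (k + 1) ?B (E v)"
        have W0: "0 \<le> W" unfolding W_def sobolev_norm_def sqint_def[symmetric]
          by (intro real_sqrt_ge_zero sum_nonneg sqint_nonneg)
        \<comment> \<open>The universal extension property at the integer order
          \<open>k + 1\<close>, where \<open>Hs_space\<close> is the ordinary Sobolev space.\<close>
        have "E v \<in> Hs_space (real (k + 1)) UNIV"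
          using \<Omega>E v unfolding universal_extension_def Hs_space_of_nat[symmetric] by (meson of_nat_0_le_iff)
        then have Ev: "E v \<in> sobolev_space (k + 1) UNIV" unfolding Hs_space_of_nat .
        then have EL: "E v \<in> L2_space UNIV" by (simp add: sobolev_space_def)
        have EB: "E v \<in> sobolev_space (Suc k) ?B" using sobolev_space_subset[OF Ev subset_UNIV open_ball] by simp
        have wL: "E v \<in> L2_space ?B" by (rule L2_space_subset(1)[OF EL]) auto
        have \<delta>: "?\<delta> > 0" using h \<Lambda> by simp
        obtain p where p: "p \<in> poly_space k" "sqint ?B (\<lambda>x. E v x - p x) \<le> CB * ?\<delta> ^ (2 * Suc k) * W\<^sup>2"
          and "\<forall>b\<in>Basis. \<exists>g\<in>L2_space ?B. weak_partial ?B b (E v) g \<and>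
          sqint ?B (\<lambda>x. g x - partial_deriv b p x) \<le> CB * ?\<delta> ^ (2 * k) * W\<^sup>2"
          using BH[rule_format, OF \<delta> EB] k unfolding W_def by auto
        then obtain g where g: "\<And>b. b \<in> Basis \<Longrightarrow> g b \<in> L2_space ?B" "\<And>b. b \<in> Basis \<Longrightarrow> weak_partial ?B b (E v) (g b)"
          "\<And>b. b \<in> Basis \<Longrightarrow> sqint ?B (\<lambda>x. g b x - partial_deriv b p x) \<le> CB * ?\<delta> ^ (2 * k) * W\<^sup>2"
          by metis
        obtain q where q: "q \<in> poly_space k" "\<And>x. x \<in> T \<Longrightarrow> ?P x = q x"
          "\<And>x. x \<in> T \<Longrightarrow> (q x - p x)\<^sup>2 \<le> CL / h ^ DIM('a) * sqint ?B (\<lambda>x. E v x - p x)"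
          "\<And>x b. x \<in> T \<Longrightarrow> b \<in> Basis \<Longrightarrow> (partial_deriv b (\<lambda>x. q x - p x) x)\<^sup>2 \<le> CL / h ^ (DIM('a) + 2) * sqint ?B (\<lambda>x. E v x - p x)"
          using local[where E = E and v = v and S = S and elem = elem and elem' = elem', OF mesh h(1) _ _ _ _ T z p(1) EL]
            hyp geo[OF hh] unfolding \<Lambda>_def by blast
        let ?U = "interior T"
        have TB: "T \<subseteq> ball z (2 * h)"
        proof
          fix y assume "y \<in> T"
          then show "y \<in> ball z (2 * h)" using dT[of y] h by simp
        qed
        also have "\<dots> \<subseteq> ?B" using h \<Lambda> by (intro subset_ball mult_right_mono) auto
        finally have UB: "?U \<subseteq> ?B" using interior_subset[of T] by blast
        have U2: "?U \<subseteq> ball z (2 * h)" using TB interior_subset[of T] by blast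
        have U: "x \<in> T" if "x \<in> ?U" for x using that interior_subset[of T] by blast
        have \<Lambda>1: "1 \<le> \<Lambda>" using \<Lambda> by simp
        note err = interpolation_error_bounds[OF k h(1) UB open_interior U2 \<Lambda>1 wL p(1) q(1) CB CL q(2)[OF U] p(2) g q(3)[OF U] q(4)[OF U] K_def]
        obtain G where G: "\<And>b. b \<in> Basis \<Longrightarrow> G b \<in> L2_space ?U" "\<And>b. b \<in> Basis \<Longrightarrow> weak_partial ?U b (\<lambda>x. E v x - ?P x) (G b)"
          "\<And>b. b \<in> Basis \<Longrightarrow> sqint ?U (G b) \<le> K * h ^ (2 * k) * W\<^sup>2"
          using err(3) by blast
        note s0 = sobolev_0[OF err(1) open_interior] and s1 = sobolev_1[OF err(1) open_interior G(1,2)]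
        have root: "sqrt X \<le> C * h ^ j * W" if "X \<le> D * h ^ (2 * j) * W\<^sup>2" for X j
        proof -
          have "sqrt X \<le> sqrt (D * (h ^ j * W)\<^sup>2)"
            using that by (intro real_sqrt_le_mono) (simp add: power_mult_distrib power_mult[symmetric] mult.commute[of j] mult.assoc)
          also have "\<dots> = sqrt D * (h ^ j * W)" using h W0 by (simp add: real_sqrt_mult)
          also have "\<dots> \<le> C * (h ^ j * W)" using C h W0 by (intro mult_right_mono) auto
          finally show ?thesis by (simp add: mult.assoc)
        qed
        have "sqint ?U (\<lambda>x. E v x - ?P x) \<le> D * h ^ (2 * (k + 1)) * W\<^sup>2"
        proof -
          have "K * h ^ (2 * k + 2) * W\<^sup>2 \<le> D * h ^ (2 * k + 2) * W\<^sup>2"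
            using D h by (intro mult_right_mono) auto
          then show ?thesis using err(2) by simp
        qed
        from root[OF this] have n0: "sobolev_norm 0 ?U (\<lambda>x. E v x - ?P x) \<le> C * h ^ (k + 1 - 0) * W"
          by (simp only: s0(2) diff_zero)
        have "sqint ?U (\<lambda>x. E v x - ?P x) + (\<Sum>b\<in>Basis. sqint ?U (G b)) \<le> D * h ^ (2 * k) * W\<^sup>2"
        proof -
          have hk: "h\<^sup>2 \<le> h\<^sub>0\<^sup>2" using h by (intro power_mono) auto
          have "sqint ?U (\<lambda>x. E v x - ?P x) \<le> K * h ^ (2 * k + 2) * W\<^sup>2" by (rule err(2))
          also have "\<dots> = K * h ^ (2 * k) * W\<^sup>2 * h\<^sup>2" by (simp add: power_add power2_eq_square mult_ac)
          also have "\<dots> \<le> K * h ^ (2 * k) * W\<^sup>2 * h\<^sub>0\<^sup>2" using K h by (intro mult_left_mono[OF hk]) auto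
          finally have a: "sqint ?U (\<lambda>x. E v x - ?P x) \<le> K * h ^ (2 * k) * W\<^sup>2 * h\<^sub>0\<^sup>2" .
          have b: "(\<Sum>b\<in>Basis. sqint ?U (G b)) \<le> real DIM('a) * (K * h ^ (2 * k) * W\<^sup>2)"
            using sum_bounded_above[of Basis "\<lambda>b. sqint ?U (G b)", OF G(3)] by simp
          have "sqint ?U (\<lambda>x. E v x - ?P x) + (\<Sum>b\<in>Basis. sqint ?U (G b)) \<le> K * (h\<^sub>0\<^sup>2 + real DIM('a)) * (h ^ (2 * k) * W\<^sup>2)"
            using a b by (simp add: algebra_simps)
          also have "\<dots> \<le> D * (h ^ (2 * k) * W\<^sup>2)" using D h by (intro mult_right_mono) auto
          finally show ?thesis by (simp add: mult.assoc)
        qed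
        from root[OF this] have n1: "sobolev_norm 1 ?U (\<lambda>x. E v x - ?P x) \<le> C * h ^ (k + 1 - 1) * W"
          by (simp only: s1(2) add_diff_cancel_right')
        show "\<forall>m\<in>{0, 1}. (\<lambda>x. E v x - ?P x) \<in> sobolev_space m ?U \<and>
            sobolev_norm m ?U (\<lambda>x. E v x - ?P x) \<le> C * h ^ (k + 1 - m) * sobolev_norm (k + 1) ?B (E v)"
          using s0(1) s1(1) n0 n1 unfolding W_def[symmetric] by blast
      qed
    qed
  qed
qed

end
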